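(* Let $\mathsf A$ be a graded $k(q)$-algebra, let $\mathcal A$ be a $k[q^{\pm1}]$-form of $\mathsf A$ which has a semiclassical limit $A=\mathcal A/(q-1)\mathcal A$, and let $\mathsf x_1,\dots,\mathsf x_n\in\mathcal A$ be a homogeneous generating set for $\mathsf A$ such that $A$ is a polynomial algebra on the images $\overline{\mathsf x_1},\dots,\overline{\mathsf x_n}$. Suppose the elements $\mathsf x_1^{a_1}\cdots\mathsf x_n^{a_n}$ with $a_i\ge 0$ form a basis of $\mathsf A$ over $k(q)$. Let $\mathcal A'$ be the $k[q^{\pm1}]$-subalgebra of $\mathsf A^e=\mathsf A\otimes_{k(q)}\mathsf A^{\mathrm{op}}$ generated by $\mathsf x_i\otimes 1$ and $\tilde\Omega(\mathsf x_i)=\dfrac{\mathsf x_i\otimes1-1\otimes\mathsf x_i}{q-1}$ for $1\le i\le n$. Then $\mathsf A^e$ is a $q$-deformation of the Poisson enveloping algebra $P(A)$ via the $k[q^{\pm1}]$-form $\mathcal A'$.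
   Context: $k$ is a field of characteristic zero and $q$ is transcendental over $k$. "Graded" means $\mathbb Z_{\ge0}$-graded. $k[q^{\pm1}]$-form and $q$-deformation: a $k[q^{\pm1}]$-subalgebra $\mathcal R$ of a $k(q)$-algebra $\mathsf R$ is a $k[q^{\pm1}]$-form of $\mathsf R$ if the natural map $\mathcal R\otimes_{k[q^{\pm1}]}k(q)\to\mathsf R$ is an isomorphism. $\mathsf R$ is a $q$-deformation of a $k$-algebra $R$ via the $k[q^{\pm1}]$-form $\mathcal R$ if $\mathcal R/(q-1)\mathcal R\cong R$ as $k$-algebras. Semiclassical limit: if $\mathcal A$ is a $k[q^{\pm1}]$-algebra that is torsion-free as a $k[q^{\pm1}]$-module and $A=\mathcal A/(q-1)\mathcal A$ is commutative, then $A$ is a Poisson algebra with $\{\bar a,\bar b\}=\overline{\beta(a,b)}$, where $\beta(a,b)\in\mathcal A$ is the unique element with $ab-ba=(q-1)\beta(a,b)$ and the bar denotes the image in $A$. Then $A$ with this bracket is called the semiclassical limit of $\mathcal A$. Poisson enveloping algebra: for a Poisson algebra $A=k[x_1,\dots,x_n]$ (here $x_i=\overline{\mathsf x_i}$), $P(A)$ is the $k$-algebra generated by $y_i,\Omega(y_i)$, $1\le i\le n$, with relations $y_iy_j=y_jy_i$; $\Omega(y_i)y_j-y_j\Omega(y_i)=\iota_A(\{x_i,x_j\})$ for all $i,j$; and $\Omega(y_i)\Omega(y_j)-\Omega(y_j)\Omega(y_i)=\sum_l\iota_A\!\left(\frac{\partial\{x_i,x_j\}}{\partial x_l}\right)\Omega(y_l)$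 for $i<j$, where $\iota_A:A\to P(A)$ is the algebra map $x_i\mapsto y_i$. It is isomorphic to the Poisson enveloping algebra of $A$. *)

theory Defs
  imports
    "HOL-Algebra.Algebra"
    "HOL-Algebra.Algebraic_Closure_Type"
    "HOL-Computational_Algebra.Polynomial"
    "HOL-Computational_Algebra.Fraction_Field"
    "HOL-Library.Poly_Mapping"
begin

text \<open>The field \<open>k\<close> is a type \<open>'k\<close> of class \<^class>\<open>field_char_0\<close>, the field \<open>k(q)\<close> is the type
  \<open>'k poly fract\<close>, and the Laurent polynomials are the subring of fractions \<open>p / q\<^sup>m\<close>.\<close>

abbreviation base_field :: "'k::field_char_0 ring" where
  "base_field \<equiv> ring_of_type_algebra"

abbreviation ratfun_field :: "'k::field_char_0 poly fract ring" where
  "ratfun_field \<equiv> ring_of_type_algebra"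

definition const :: "'k::field_char_0 \<Rightarrow> 'k poly fract" where
  "const c = Fract [:c:] 1"

definition qq :: "'k::field_char_0 poly fract" where
  "qq = Fract [:0, 1:] 1"

definition laurent_ring :: "'k::field_char_0 poly fract ring" where
  "laurent_ring = ratfun_field \<lparr> carrier := {Fract p 1 / qq ^ m | p m. True} \<rparr>"

definition ratfun_alg :: "('k::field_char_0 poly fract, 'k poly fract) module" where
  "ratfun_alg = \<lparr> carrier = UNIV, monoid.mult = (*), one = 1, ring.zero = 0, add = (+), module.smult = (*) \<rparr>"

text \<open>The locale \<^locale>\<open>algebra\<close> of the library is restricted to commutative algebras.\<close>

locale assoc_algebra = module R M + ring M for R and M (structure) +
  assumes smult_mult_left:
      "\<lbrakk>c \<in> carrier R; x \<in> carrier M; y \<in> carrier M\<rbrakk> \<Longrightarrow> (c \<odot> x) \<otimes> y = c \<odot> (x \<otimes> y)"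
    and smult_mult_right:
      "\<lbrakk>c \<in> carrier R; x \<in> carrier M; y \<in> carrier M\<rbrakk> \<Longrightarrow> x \<otimes> (c \<odot> y) = c \<odot> (x \<otimes> y)"

definition is_subalgebra :: "'s ring \<Rightarrow> 'a set \<Rightarrow> ('s, 'a) module \<Rightarrow> bool" where
  "is_subalgebra R S A \<longleftrightarrow> subring S A \<and> (\<forall>c\<in>carrier R. \<forall>x\<in>S. c \<odot>\<^bsub>A\<^esub> x \<in> S)"

definition generated_subalgebra :: "'s ring \<Rightarrow> ('s, 'a) module \<Rightarrow> 'a set \<Rightarrow> 'a set" where
  "generated_subalgebra R A W = \<Inter>{S. is_subalgebra R S A \<and> W \<subseteq> S}"

definition alg_iso ::
    "'s ring \<Rightarrow> ('s, 'a) module \<Rightarrow> ('s, 'b) module \<Rightarrow> ('a \<Rightarrow> 'b) set" where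
  "alg_iso R A B = {h \<in> ring_iso A B. \<forall>c\<in>carrier R. \<forall>x\<in>carrier A. h (c \<odot>\<^bsub>A\<^esub> x) = c \<odot>\<^bsub>B\<^esub> h x}"

definition opposite :: "('s, 'a) module \<Rightarrow> ('s, 'a) module" where
  "opposite A = A \<lparr> monoid.mult := (\<lambda>x y. y \<otimes>\<^bsub>A\<^esub> x) \<rparr>"

definition restrict_scalars :: "('r \<Rightarrow> 's) \<Rightarrow> ('s, 'a) module \<Rightarrow> ('r, 'a) module" where
  "restrict_scalars f A =
    \<lparr> carrier = carrier A, monoid.mult = monoid.mult A, one = \<one>\<^bsub>A\<^esub>, ring.zero = \<zero>\<^bsub>A\<^esub>, add = add A,
      module.smult = (\<lambda>c. module.smult A (f c)) \<rparr>"

definition quot_alg :: "('s, 'a) module \<Rightarrow> 'a set \<Rightarrow> ('s, 'a set) module" where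
  "quot_alg A I =
    \<lparr> carrier = carrier (A Quot I), monoid.mult = monoid.mult (A Quot I), one = \<one>\<^bsub>A Quot I\<^esub>,
      ring.zero = \<zero>\<^bsub>A Quot I\<^esub>, add = add (A Quot I),
      module.smult = (\<lambda>c W. \<Union>x\<in>W. I +>\<^bsub>A\<^esub> (c \<odot>\<^bsub>A\<^esub> x)) \<rparr>"

definition is_grading :: "'s ring \<Rightarrow> ('s, 'a) module \<Rightarrow> (nat \<Rightarrow> 'a set) \<Rightarrow> bool" where
  "is_grading R A G \<longleftrightarrow>
    (\<forall>d. submodule (G d) R A) \<and>
    (\<forall>v\<in>carrier A. \<exists>!c. (\<forall>d. c d \<in> G d) \<and> finite {d. c d \<noteq> \<zero>\<^bsub>A\<^esub>} \<and>
       v = (\<Oplus>\<^bsub>A\<^esub>d\<in>{d. c d \<noteq> \<zero>\<^bsub>A\<^esub>}. c d)) \<and>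
    \<one>\<^bsub>A\<^esub> \<in> G 0 \<and>
    (\<forall>d e. \<forall>x\<in>G d. \<forall>y\<in>G e. x \<otimes>\<^bsub>A\<^esub> y \<in> G (d + e))"

definition lincomb :: "('s::zero, 'a) module \<Rightarrow> ('i \<Rightarrow> 'a) \<Rightarrow> ('i \<Rightarrow>\<^sub>0 's) \<Rightarrow> 'a" where
  "lincomb V b c = (\<Oplus>\<^bsub>V\<^esub>i\<in>Poly_Mapping.keys c. Poly_Mapping.lookup c i \<odot>\<^bsub>V\<^esub> b i)"

definition is_basis :: "('s::zero, 'a) module \<Rightarrow> 'i set \<Rightarrow> ('i \<Rightarrow> 'a) \<Rightarrow> bool" where
  "is_basis V I b \<longleftrightarrow>
    b ` I \<subseteq> carrier V \<and>
    (\<forall>c. Poly_Mapping.keys c \<subseteq> I \<and> lincomb V b c = \<zero>\<^bsub>V\<^esub> \<longrightarrow> c = 0) \<and>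
    (\<forall>v\<in>carrier V. \<exists>c. Poly_Mapping.keys c \<subseteq> I \<and> v = lincomb V b c)"

text \<open>The tensor product \<open>M \<otimes>\<^sub>R N\<close> is the free abelian group on \<open>M \<times> N\<close> modulo the subgroup
  generated by the usual relations. The free abelian group carries the product
  \<open>(a, b)(c, d) = (ac, bd)\<close>, for which this subgroup is a two-sided ideal, so the quotient is
  a ring. Scalars act on the right factor, hence \<open>M \<otimes>\<^sub>R N\<close> is also an algebra over a ring
  extending \<open>R\<close> if \<open>N\<close> is; this gives extension of scalars.\<close>

definition free_pairs ::
    "('s, 'a) module \<Rightarrow> ('s, 'b) module \<Rightarrow> ('s, 'a \<times> 'b \<Rightarrow>\<^sub>0 int) module" where
  "free_pairs M N =
    \<lparr> carrier = {f. Poly_Mapping.keys f \<subseteq> carrier M \<times> carrier N},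
      monoid.mult = (\<lambda>f g. frag_extend (\<lambda>(a, b).
                 frag_extend (\<lambda>(c, d). frag_of (a \<otimes>\<^bsub>M\<^esub> c, b \<otimes>\<^bsub>N\<^esub> d)) g) f),
      one = frag_of (\<one>\<^bsub>M\<^esub>, \<one>\<^bsub>N\<^esub>), ring.zero = 0, add = (+),
      module.smult = (\<lambda>r. frag_extend (\<lambda>(a, b). frag_of (a, r \<odot>\<^bsub>N\<^esub> b))) \<rparr>"

definition tensor_relations ::
    "'s ring \<Rightarrow> ('s, 'a) module \<Rightarrow> ('s, 'b) module \<Rightarrow> ('a \<times> 'b \<Rightarrow>\<^sub>0 int) set" where
  "tensor_relations R M N =
    {frag_of (a \<oplus>\<^bsub>M\<^esub> a', b) - frag_of (a, b) - frag_of (a', b) | a a' b.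
        a \<in> carrier M \<and> a' \<in> carrier M \<and> b \<in> carrier N} \<union>
    {frag_of (a, b \<oplus>\<^bsub>N\<^esub> b') - frag_of (a, b) - frag_of (a, b') | a b b'.
        a \<in> carrier M \<and> b \<in> carrier N \<and> b' \<in> carrier N} \<union>
    {frag_of (r \<odot>\<^bsub>M\<^esub> a, b) - frag_of (a, r \<odot>\<^bsub>N\<^esub> b) | r a b.
        r \<in> carrier R \<and> a \<in> carrier M \<and> b \<in> carrier N}"

definition tensor_kernel ::
    "'s ring \<Rightarrow> ('s, 'a) module \<Rightarrow> ('s, 'b) module \<Rightarrow> ('a \<times> 'b \<Rightarrow>\<^sub>0 int) set" where
  "tensor_kernel R M N = generate (add_monoid (free_pairs M N)) (tensor_relations R M N)"

definition tensor_alg ::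
    "'s ring \<Rightarrow> ('s, 'a) module \<Rightarrow> ('s, 'b) module \<Rightarrow> ('s, ('a \<times> 'b \<Rightarrow>\<^sub>0 int) set) module" where
  "tensor_alg R M N = quot_alg (free_pairs M N) (tensor_kernel R M N)"

definition pure_tensor ::
    "'s ring \<Rightarrow> ('s, 'a) module \<Rightarrow> ('s, 'b) module \<Rightarrow> 'a \<Rightarrow> 'b \<Rightarrow> ('a \<times> 'b \<Rightarrow>\<^sub>0 int) set" where
  "pure_tensor R M N a b = tensor_kernel R M N +>\<^bsub>free_pairs M N\<^esub> frag_of (a, b)"

text \<open>The natural map of a form is determined by \<open>r \<otimes> c \<mapsto> c r\<close>.\<close>

definition is_form :: "('k::field_char_0 poly fract, 'a) module \<Rightarrow> 'a set \<Rightarrow> bool" where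
  "is_form A S \<longleftrightarrow>
    is_subalgebra laurent_ring S A \<and>
    (\<exists>h \<in> alg_iso ratfun_field (tensor_alg laurent_ring (A \<lparr> carrier := S \<rparr>) ratfun_alg) A.
       \<forall>r\<in>S. \<forall>c. h (pure_tensor laurent_ring (A \<lparr> carrier := S \<rparr>) ratfun_alg r c) = c \<odot>\<^bsub>A\<^esub> r)"

definition q_minus_1_ideal :: "('k::field_char_0 poly fract, 'a) module \<Rightarrow> 'a set \<Rightarrow> 'a set" where
  "q_minus_1_ideal A S = (\<lambda>s. (qq - 1) \<odot>\<^bsub>A\<^esub> s) ` S"

text \<open>\<open>S / (q - 1) S\<close> as a \<open>k\<close>-algebra.\<close>

definition specialization ::
    "('k::field_char_0 poly fract, 'a) module \<Rightarrow> 'a set \<Rightarrow> ('k, 'a set) module" where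
  "specialization A S =
    restrict_scalars const (quot_alg (A \<lparr> carrier := S \<rparr>) (q_minus_1_ideal A S))"

definition spec_image ::
    "('k::field_char_0 poly fract, 'a) module \<Rightarrow> 'a set \<Rightarrow> 'a \<Rightarrow> 'a set" where
  "spec_image A S a = q_minus_1_ideal A S +>\<^bsub>A\<^esub> a"

definition q_deformation ::
    "('k::field_char_0 poly fract, 'a) module \<Rightarrow> 'a set \<Rightarrow> ('k, 'b) module \<Rightarrow> bool" where
  "q_deformation A S B \<longleftrightarrow>
    is_form A S \<and> alg_iso base_field (specialization A S) B \<noteq> {}"

definition has_semiclassical_limit ::
    "('k::field_char_0 poly fract, 'a) module \<Rightarrow> 'a set \<Rightarrow> bool" where
  "has_semiclassical_limit A S \<longleftrightarrow>
    (\<forall>c\<in>carrier laurent_ring. \<forall>s\<in>S. c \<odot>\<^bsub>A\<^esub> s = \<zero>\<^bsub>A\<^esub> \<longrightarrow> c = 0 \<or> s = \<zero>\<^bsub>A\<^esub>) \<and>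
    cring (specialization A S)"

definition commutator_quotient ::
    "('k::field_char_0 poly fract, 'a) module \<Rightarrow> 'a set \<Rightarrow> 'a \<Rightarrow> 'a \<Rightarrow> 'a" where
  "commutator_quotient A S a b =
    (THE c. c \<in> S \<and> (a \<otimes>\<^bsub>A\<^esub> b) \<ominus>\<^bsub>A\<^esub> (b \<otimes>\<^bsub>A\<^esub> a) = (qq - 1) \<odot>\<^bsub>A\<^esub> c)"

text \<open>If \<open>S / (q - 1) S\<close> is commutative and \<open>S\<close> is torsion-free, all members of the union are
  the same coset (compare \<^const>\<open>rcoset_mult\<close>).\<close>

definition semiclassical_bracket ::
    "('k::field_char_0 poly fract, 'a) module \<Rightarrow> 'a set \<Rightarrow> 'a set \<Rightarrow> 'a set \<Rightarrow> 'a set" where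
  "semiclassical_bracket A S U V =
    (\<Union>a\<in>U. \<Union>b\<in>V. spec_image A S (commutator_quotient A S a b))"

definition exponents :: "nat \<Rightarrow> (nat \<Rightarrow>\<^sub>0 nat) set" where
  "exponents n = {m. Poly_Mapping.keys m \<subseteq> {..<n}}"

definition ordered_monomial ::
    "('s, 'a) module \<Rightarrow> nat \<Rightarrow> (nat \<Rightarrow> 'a) \<Rightarrow> (nat \<Rightarrow>\<^sub>0 nat) \<Rightarrow> 'a" where
  "ordered_monomial A n x m =
    foldr (\<lambda>i y. (x i [^]\<^bsub>A\<^esub> Poly_Mapping.lookup m i) \<otimes>\<^bsub>A\<^esub> y) [0..<n] \<one>\<^bsub>A\<^esub>"

text \<open>The algebra of a submonoid \<open>W\<close>; multiplication of \<^type>\<open>poly_mapping\<close> is convolution.\<close>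

definition monoid_alg :: "'m::monoid_add set \<Rightarrow> ('k::field_char_0, 'm \<Rightarrow>\<^sub>0 'k) module" where
  "monoid_alg W =
    \<lparr> carrier = {f. Poly_Mapping.keys f \<subseteq> W}, monoid.mult = (*), one = 1, ring.zero = 0, add = (+),
      module.smult = (\<lambda>c f. Poly_Mapping.single 0 c * f) \<rparr>"

abbreviation mpoly_alg :: "nat \<Rightarrow> ('k::field_char_0, (nat \<Rightarrow>\<^sub>0 nat) \<Rightarrow>\<^sub>0 'k) module" where
  "mpoly_alg n \<equiv> monoid_alg (exponents n)"

definition mpoly_eval ::
    "nat \<Rightarrow> ('k::field_char_0, 'a) module \<Rightarrow> (nat \<Rightarrow> 'a) \<Rightarrow> ((nat \<Rightarrow>\<^sub>0 nat) \<Rightarrow>\<^sub>0 'k) \<Rightarrow> 'a" where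
  "mpoly_eval n A x p = lincomb A (ordered_monomial A n x) p"

definition mpoly_deriv ::
    "nat \<Rightarrow> ((nat \<Rightarrow>\<^sub>0 nat) \<Rightarrow>\<^sub>0 'k::field_char_0) \<Rightarrow> ((nat \<Rightarrow>\<^sub>0 nat) \<Rightarrow>\<^sub>0 'k)" where
  "mpoly_deriv l p =
    (\<Sum>m\<in>Poly_Mapping.keys p. Poly_Mapping.single (m - Poly_Mapping.single l 1)
       (Poly_Mapping.lookup p m * of_nat (Poly_Mapping.lookup m l)))"

definition is_polynomial_algebra_on ::
    "nat \<Rightarrow> ('k::field_char_0, 'a) module \<Rightarrow> (nat \<Rightarrow> 'a) \<Rightarrow> bool" where
  "is_polynomial_algebra_on n A x \<longleftrightarrow> mpoly_eval n A x \<in> alg_iso base_field (mpoly_alg n) A"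

definition mpoly_repr ::
    "nat \<Rightarrow> ('k::field_char_0, 'a) module \<Rightarrow> (nat \<Rightarrow> 'a) \<Rightarrow> 'a \<Rightarrow> ((nat \<Rightarrow>\<^sub>0 nat) \<Rightarrow>\<^sub>0 'k)" where
  "mpoly_repr n A x a = (THE p. p \<in> carrier (mpoly_alg n) \<and> mpoly_eval n A x p = a)"

datatype 'g word = Word (letters: "'g list")

instantiation word :: (type) monoid_add
begin
definition zero_word where "zero_word = Word []"
definition plus_word where "plus_word u v = Word (letters u @ letters v)"
instance by standard (simp_all add: zero_word_def plus_word_def)
end

abbreviation free_alg :: "'g set \<Rightarrow> ('k::field_char_0, 'g word \<Rightarrow>\<^sub>0 'k) module" where
  "free_alg W \<equiv> monoid_alg {w. set (letters w) \<subseteq> W}"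

definition gen_elem :: "'g \<Rightarrow> 'g word \<Rightarrow>\<^sub>0 'k::field_char_0" where
  "gen_elem g = Poly_Mapping.single (Word [g]) 1"

datatype env_gen = Y nat | Omega nat

definition env_free_alg :: "nat \<Rightarrow> ('k::field_char_0, env_gen word \<Rightarrow>\<^sub>0 'k) module" where
  "env_free_alg n = free_alg (Y ` {..<n} \<union> Omega ` {..<n})"

text \<open>A lift of \<open>\<iota>\<^sub>A\<close> to the free algebra, on elements of \<open>A\<close> written as polynomials in the
  generators. The order of the factors in the monomials is immaterial because the
  \<open>y\<^sub>i\<close> commute in the quotient.\<close>

definition iota_lift ::
    "nat \<Rightarrow> ((nat \<Rightarrow>\<^sub>0 nat) \<Rightarrow>\<^sub>0 'k::field_char_0) \<Rightarrow> (env_gen word \<Rightarrow>\<^sub>0 'k)" where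
  "iota_lift n p = mpoly_eval n (env_free_alg n) (\<lambda>i. gen_elem (Y i)) p"

definition poisson_env_relations ::
    "nat \<Rightarrow> ('k::field_char_0, 'a) module \<Rightarrow> ('a \<Rightarrow> 'a \<Rightarrow> 'a) \<Rightarrow> (nat \<Rightarrow> 'a) \<Rightarrow>
      (env_gen word \<Rightarrow>\<^sub>0 'k) set" where
  "poisson_env_relations n A br x =
    (let y = (\<lambda>i. gen_elem (Y i)); \<Omega> = (\<lambda>i. gen_elem (Omega i));
         p = (\<lambda>i j. mpoly_repr n A x (br (x i) (x j)))
     in {y i * y j - y j * y i | i j. i < n \<and> j < n} \<union>
        {\<Omega> i * y j - y j * \<Omega> i - iota_lift n (p i j) | i j. i < n \<and> j < n} \<union>
        {\<Omega> i * \<Omega> j - \<Omega> j * \<Omega> i - (\<Sum>l<n. iota_lift n (mpoly_deriv l (p i j)) * \<Omega> l) | i j.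
           i < j \<and> j < n})"

definition poisson_env ::
    "nat \<Rightarrow> ('k::field_char_0, 'a) module \<Rightarrow> ('a \<Rightarrow> 'a \<Rightarrow> 'a) \<Rightarrow> (nat \<Rightarrow> 'a) \<Rightarrow>
      ('k, (env_gen word \<Rightarrow>\<^sub>0 'k) set) module" where
  "poisson_env n A br x =
    quot_alg (env_free_alg n) (genideal (env_free_alg n) (poisson_env_relations n A br x))"

definition env_alg ::
    "('k::field_char_0 poly fract, 'a) module \<Rightarrow>
      ('k poly fract, ('a \<times> 'a \<Rightarrow>\<^sub>0 int) set) module" where
  "env_alg A = tensor_alg ratfun_field A (opposite A)"

abbreviation env_tensor ::
    "('k::field_char_0 poly fract, 'a) module \<Rightarrow> 'a \<Rightarrow> 'a \<Rightarrow> ('a \<times> 'a \<Rightarrow>\<^sub>0 int) set" where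
  "env_tensor A \<equiv> pure_tensor ratfun_field A (opposite A)"

definition Omega_tilde ::
    "('k::field_char_0 poly fract, 'a) module \<Rightarrow> 'a \<Rightarrow> ('a \<times> 'a \<Rightarrow>\<^sub>0 int) set" where
  "Omega_tilde A a =
    (1 / (qq - 1)) \<odot>\<^bsub>env_alg A\<^esub> (env_tensor A a \<one>\<^bsub>A\<^esub> \<ominus>\<^bsub>env_alg A\<^esub> env_tensor A \<one>\<^bsub>A\<^esub> a)"

definition env_form ::
    "('k::field_char_0 poly fract, 'a) module \<Rightarrow> nat \<Rightarrow> (nat \<Rightarrow> 'a) \<Rightarrow> ('a \<times> 'a \<Rightarrow>\<^sub>0 int) set set" where
  "env_form A n x =
    generated_subalgebra laurent_ring (env_alg A)
      ((\<lambda>i. env_tensor A (x i) \<one>\<^bsub>A\<^esub>) ` {..<n} \<union> (\<lambda>i. Omega_tilde A (x i)) ` {..<n})"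

end

theory Submission
  imports Defs "HOL-Library.Product_Plus"
begin

text \<open>Write \<open>h = q - 1\<close>, \<open>X\<^sub>i = x\<^sub>i \<otimes> 1\<close> and \<open>\<Omega>\<^sub>i = (x\<^sub>i \<otimes> 1 - 1 \<otimes> x\<^sub>i) / h\<close>. The defining relations of
  \<open>P(A)\<close> hold in \<open>\<A>' / h \<A>'\<close> because \<open>a \<mapsto> (a \<otimes> 1 - 1 \<otimes> a) / h\<close> is a derivation modulo \<open>h\<close>, which
  gives a surjection \<open>P(A) \<rightarrow> \<A>' / h \<A>'\<close>. Sorting the \<open>\<Omega>\<^sub>i\<close> shows that \<open>P(A)\<close> is spanned by the
  \<open>y\<^sup>a \<Omega>\<^sup>b\<close>, so it remains to see that the \<open>X\<^sup>a \<Omega>\<^sup>b\<close> are linearly independent modulo \<open>h \<A>'\<close>.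

  Let \<open>E\<close> be the image of \<open>\<A> \<otimes> \<A>\<close> in the enveloping algebra. Then \<open>E / h E\<close> is a polynomial ring in
  the \<open>X\<^sub>i\<close> and \<open>U\<^sub>i = h \<Omega>\<^sub>i\<close>. Let \<open>W N\<close> be the span of the products of elements of \<open>E\<close> with
  at most \<open>N\<close> factors \<open>\<Omega>\<^sub>i\<close>; the union of the \<open>W N\<close> contains \<open>\<A>'\<close>. Modulo \<open>W (N - 1)\<close>, every element
  of \<open>W N\<close> is a combination of the \<open>h\<^bsup>|d| - N\<^esup> X\<^sup>a \<Omega>\<^sup>d\<close> with \<open>|d| \<ge> N\<close>, and its coefficients can be
  read off in \<open>E / h E\<close> after multiplication by \<open>h\<^sup>N\<close>. If \<open>\<Sum> c\<^sub>a\<^sub>b X\<^sup>a \<Omega>\<^sup>b = h g\<close> with \<open>g \<in> W M\<close>, this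
  lowers \<open>M\<close> until it exceeds the top degree in \<open>\<Omega>\<close> by one, where the top coefficients are
  forced to vanish.\<close>

section \<open>Additive spans and filtrations\<close>

text \<open>\<open>S\<close> need not be the Laurent span of the ordered monomials: it may also
  contain fractions whose denominator does not vanish at \<open>q = 1\<close>. The generated
  subalgebra A' then need not contain \<open>E\<close>, so two rings occur. Independence is shown
  modulo \<open>h\<close> in the union of the \<open>W N\<close>, which suffices because A' lies in
  it; the relations have to be verified modulo \<open>h A'\<close>, with the quotients by
  \<open>h\<close> exhibited inside A'. Multipliers \<open>u\<close> congruent to 1 modulo
  \<open>h\<close>, which carry \<open>S\<close> into the Laurent span, serve both purposes.

  The degree in the \<open>Omega_i\<close> is not compatible with \<open>h\<close>, as
  \<open>h * Omega_i\<close> has degree 0. Hence an equation \<open>sum = h * g\<close> does not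
  bound the degree of \<open>g\<close> at the outset, and a plain comparison of leading terms fails.

  Cosets of formal sums are awkward to calculate with, so the ring computations take place in a type
  of linear endomorphisms, where left and right multiplications represent the enveloping algebra
  faithfully. Both tensor products, the one defining the enveloping algebra and the one defining a
  form, are analysed through this representation.\<close>

abbreviation lookup :: "('a \<Rightarrow>\<^sub>0 'b::zero) \<Rightarrow> 'a \<Rightarrow> 'b" where "lookup \<equiv> Poly_Mapping.lookup"
abbreviation keys :: "('a \<Rightarrow>\<^sub>0 'b::zero) \<Rightarrow> 'a set" where "keys \<equiv> Poly_Mapping.keys"
abbreviation single :: "'a \<Rightarrow> 'b \<Rightarrow> ('a \<Rightarrow>\<^sub>0 'b::zero)" where "single \<equiv> Poly_Mapping.single"

text \<open>Congruences are written \<open>a - b \<in> J\<close> throughout. Plain additive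
  subgroups are used because the steps of a filtration are not ideals.\<close>

definition add_subgroup :: "'r::ab_group_add set \<Rightarrow> bool" where
  "add_subgroup J \<longleftrightarrow> 0 \<in> J \<and> (\<forall>a\<in>J. \<forall>b\<in>J. a - b \<in> J)"

lemma add_subgroupD:
  assumes "add_subgroup J"
  shows "0 \<in> J" "\<And>a b. a \<in> J \<Longrightarrow> b \<in> J \<Longrightarrow> a - b \<in> J" "\<And>a. a \<in> J \<Longrightarrow> - a \<in> J"
    "\<And>a b. a \<in> J \<Longrightarrow> b \<in> J \<Longrightarrow> a + b \<in> J"
proof -
  show z: "0 \<in> J" and d: "\<And>a b. a \<in> J \<Longrightarrow> b \<in> J \<Longrightarrow> a - b \<in> J"
    using assms unfolding add_subgroup_def by auto
  show m: "- a \<in> J" if "a \<in> J" for a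
    using d[OF z that] by simp
  show "a + b \<in> J" if "a \<in> J" "b \<in> J" for a b
    using d[OF that(1) m[OF that(2)]] by simp
qed

lemma add_subgroup_sum:
  "add_subgroup J \<Longrightarrow> (\<And>i. i \<in> I \<Longrightarrow> f i \<in> J) \<Longrightarrow> sum f I \<in> J"
  by (induction I rule: infinite_finite_induct) (auto simp: add_subgroupD)

lemma add_subgroup_cancel:
  assumes "add_subgroup J" "a - b \<in> J"
  shows "a \<in> J \<longleftrightarrow> b \<in> J"
  using add_subgroupD(2)[OF assms(1) _ assms(2), of a] add_subgroupD(4)[OF assms(1) assms(2), of b] by auto

lemma add_subgroup_trans:
  assumes "add_subgroup J" "a - b \<in> J" "b - c \<in> J"
  shows "a - c \<in> J"
  using add_subgroupD(4)[OF assms] by simp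

lemma add_subgroup_vimage:
  "add_subgroup J \<Longrightarrow> (\<And>a b. f (a - b) = f a - f b) \<Longrightarrow> add_subgroup {a. f a \<in> J}"
  unfolding add_subgroup_def by (metis (lifting) diff_self mem_Collect_eq)

lemma add_subgroup_image:
  fixes f :: "'a::ab_group_add \<Rightarrow> 'b::ab_group_add"
  assumes "add_subgroup J" "\<And>a b. f (a - b) = f a - f b"
  shows "add_subgroup (f ` J)"
  unfolding add_subgroup_def
proof (intro conjI ballI)
  show "0 \<in> f ` J"
    using assms(2)[of 0 0] add_subgroupD(1)[OF assms(1)] by (auto intro: image_eqI[of _ _ 0])
next
  fix a b assume "a \<in> f ` J" "b \<in> f ` J"
  then show "a - b \<in> f ` J"
    using assms(2) add_subgroupD(2)[OF assms(1)] by (auto simp: image_iff) metis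
qed

text \<open>Coefficients are part of the generators, so that one notion of span serves for scalars
  from \<open>k\<close>, Laurent polynomials and elements of \<open>E\<close>. Closure under
  differences yields sums and negatives.\<close>

inductive_set addspan :: "'r::ab_group_add set \<Rightarrow> 'r set" for G where
  addspan_zero: "0 \<in> addspan G"
| addspan_gen: "g \<in> G \<Longrightarrow> g \<in> addspan G"
| addspan_diff: "a \<in> addspan G \<Longrightarrow> b \<in> addspan G \<Longrightarrow> a - b \<in> addspan G"

lemma add_subgroup_addspan: "add_subgroup (addspan G)"
  unfolding add_subgroup_def by (auto intro: addspan.intros)

lemma addspan_subset: "add_subgroup J \<Longrightarrow> G \<subseteq> J \<Longrightarrow> addspan G \<subseteq> J"
proof
  fix a assume *: "add_subgroup J" "G \<subseteq> J" "a \<in> addspan G"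
  from *(3) show "a \<in> J"
    by (induction) (use * in \<open>auto simp: add_subgroupD\<close>)
qed

lemma addspan_mono: "G \<subseteq> H \<Longrightarrow> addspan G \<subseteq> addspan H"
  by (rule addspan_subset[OF add_subgroup_addspan]) (auto intro: addspan_gen)

lemma addspan_map:
  assumes "a \<in> addspan G" "add_subgroup J" "\<And>a b. f (a - b) = f a - f b" "\<And>g. g \<in> G \<Longrightarrow> f g \<in> J"
  shows "f a \<in> J"
  using addspan_subset[OF add_subgroup_vimage[OF assms(2,3)], of G] assms(1,4) by auto

lemma addspan_mult_left:
  fixes c :: "'r::ring"
  assumes "a \<in> addspan G" "add_subgroup J" "\<And>g. g \<in> G \<Longrightarrow> c * g \<in> J"
  shows "c * a \<in> J"
  by (rule addspan_map[OF assms(1,2)]) (auto simp: assms(3) right_diff_distrib)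

lemma addspan_mult_right:
  fixes c :: "'r::ring"
  assumes "a \<in> addspan G" "add_subgroup J" "\<And>g. g \<in> G \<Longrightarrow> g * c \<in> J"
  shows "a * c \<in> J"
  by (rule addspan_map[OF assms(1,2)]) (auto simp: assms(3) left_diff_distrib)

lemma addspan_mult:
  fixes a b :: "'r::ring"
  assumes "a \<in> addspan G" "b \<in> addspan H" "add_subgroup J" "\<And>g k. g \<in> G \<Longrightarrow> k \<in> H \<Longrightarrow> g * k \<in> J"
  shows "a * b \<in> J"
  by (meson addspan_mult_left addspan_mult_right assms)

text \<open>Bubble sort: a rearrangement is a chain of adjacent swaps, each of which changes
  \<open>F\<close> by an element of \<open>J\<close>. The swap hypothesis is restricted to words
  with multiset \<open>M\<close>, since \<open>J\<close> may depend on the length of the word and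
  the letters must stay in range.\<close>

lemma swap_imp_perm_cong:
  fixes F :: "'a list \<Rightarrow> 'r::ab_group_add"
  assumes J: "add_subgroup J"
    and swap: "\<And>u v i j. mset (u @ i # j # v) = M \<Longrightarrow> F (u @ i # j # v) - F (u @ j # i # v) \<in> J"
    and "mset is = M" "mset js = M"
  shows "F is - F js \<in> J"
proof -
  \<comment> \<open>Carries the letter \<open>i\<close> leftwards across the whole block
    \<open>a\<close>.\<close>
  have move: "F (u @ a @ i # b) - F (u @ i # a @ b) \<in> J" if "mset (u @ a @ i # b) = M" for u a i b
    using that
  proof (induction a arbitrary: b rule: rev_induct)
    case Nil
    then show ?case using add_subgroupD(1)[OF J] by simp
  next
    case (snoc x a)
    have "F ((u @ a) @ x # i # b) - F ((u @ a) @ i # x # b) \<in> J"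
      by (rule swap) (use snoc.prems in auto)
    moreover have "F (u @ a @ i # (x # b)) - F (u @ i # a @ (x # b)) \<in> J"
      by (rule snoc.IH) (use snoc.prems in auto)
    ultimately show ?case
      using add_subgroup_trans[OF J] by simp
  qed
  have "F (u @ is) - F (u @ js) \<in> J" if "mset is = mset js" "mset (u @ is) = M" for u "is" js
    using that
  proof (induction "is" arbitrary: u js)
    case Nil
    then show ?case using add_subgroupD(1)[OF J] by simp
  next
    case (Cons i "is")
    have "i \<in> set js" using Cons.prems(1) by (metis list.set_intros(1) set_mset_mset)
    then obtain a b where js: "js = a @ i # b" by (meson split_list)
    have "F ((u @ [i]) @ is) - F ((u @ [i]) @ (a @ b)) \<in> J"
      by (rule Cons.IH) (use Cons.prems js in auto)
    moreover have "F (u @ a @ i # b) - F (u @ i # a @ b) \<in> J"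
      by (rule move) (use Cons.prems js in auto)
    ultimately have "F (u @ i # is) - F (u @ i # a @ b) \<in> J"
       "F (u @ i # a @ b) - F (u @ a @ i # b) \<in> J"
      using add_subgroupD(3)[OF J] by fastforce+
    then show ?case unfolding js by (rule add_subgroup_trans[OF J])
  qed
  from this[of "is" js "[]"] show ?thesis using assms(3,4) by simp
qed

section \<open>Exponent vectors and sorted words\<close>

definition mlist :: "nat \<Rightarrow> (nat \<Rightarrow>\<^sub>0 nat) \<Rightarrow> nat list" where
  "mlist n m = concat (map (\<lambda>i. replicate (lookup m i) i) [0..<n])"

text \<open>Inverse of \<open>mlist\<close> up to sorting: \<open>mlist\<close> lists the letters of
  an exponent vector in increasing order and cuts it off at \<open>n\<close>, while
  \<open>expo\<close> accepts an arbitrary word.\<close>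

definition expo :: "nat list \<Rightarrow> (nat \<Rightarrow>\<^sub>0 nat)" where
  "expo is = (\<Sum>i\<leftarrow>is. single i 1)"

lemma expo_simps [simp]: "expo [] = 0" "expo (i # is) = single i 1 + expo is"
  by (auto simp: expo_def)

lemma mlist_Suc: "mlist (Suc n) m = mlist n m @ replicate (lookup m n) n"
  by (simp add: mlist_def)

lemma count_mlist: "count (mset (mlist n m)) i = (if i < n then lookup m i else 0)"
  by (induction n) (auto simp: mlist_Suc, simp add: mlist_def)

lemma set_mlist: "set (mlist n m) \<subseteq> {..<n}"
  by (auto simp: mlist_def)

lemma mlist_0 [simp]: "mlist n 0 = []"
  by (induction n) (auto simp: mlist_Suc, simp add: mlist_def)

lemma mset_mlist_add: "mset (mlist n (a + b)) = mset (mlist n a) + mset (mlist n b)"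
  by (rule multiset_eqI) (simp add: count_mlist lookup_add)

lemma length_mlist_add: "length (mlist n (a + b)) = length (mlist n a) + length (mlist n b)"
  by (metis mset_mlist_add size_mset size_union)

lemma mset_mlist_single: "i < n \<Longrightarrow> mset (mlist n (single i 1)) = {#i#}"
  by (rule multiset_eqI) (auto simp: count_mlist lookup_single when_def)

lemma mset_mlist_expo: "set is \<subseteq> {..<n} \<Longrightarrow> mset (mlist n (expo is)) = mset is"
  by (induction "is") (auto simp: mset_mlist_add mset_mlist_single[simplified])

lemma exponents_add: "a \<in> exponents n \<Longrightarrow> b \<in> exponents n \<Longrightarrow> a + b \<in> exponents n"
  using keys_add[of a b] by (auto simp: exponents_def)

lemma exponents_0 [simp]: "0 \<in> exponents n"
  by (simp add: exponents_def)

lemma exponents_single: "i < n \<Longrightarrow> single i k \<in> exponents n"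
  by (simp add: exponents_def)

lemma expo_exponents: "set is \<subseteq> {..<n} \<Longrightarrow> expo is \<in> exponents n"
  by (induction "is") (auto intro: exponents_add exponents_single)

lemma lookup_expo: "lookup (expo is) i = count (mset is) i"
  by (induction "is") (auto simp: lookup_add lookup_single when_def)

lemma exponents_eqI:
  assumes "a \<in> exponents n" "b \<in> exponents n" "mset (mlist n a) = mset (mlist n b)"
  shows "a = b"
proof (rule poly_mapping_eqI)
  fix i
  have "lookup a i = 0 \<and> lookup b i = 0" if "\<not> i < n"
    using assms(1,2) that by (auto simp: exponents_def in_keys_iff)
  then show "lookup a i = lookup b i"
    using assms(3) count_mlist[of n a i] count_mlist[of n b i] by (auto split: if_splits)
qed

lemma expo_mlist: "m \<in> exponents n \<Longrightarrow> expo (mlist n m) = m"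
  by (rule exponents_eqI[of _ n]) (simp_all add: mset_mlist_expo set_mlist expo_exponents)

abbreviation pl :: "(nat \<Rightarrow> 'r::monoid_mult) \<Rightarrow> nat list \<Rightarrow> 'r" where
  "pl f is \<equiv> prod_list (map f is)"

section \<open>Linear combinations with central coefficients\<close>

definition lin_comb :: "('k::zero \<Rightarrow> 'r::ring_1) \<Rightarrow> ('p \<Rightarrow> 'r) \<Rightarrow> ('p \<Rightarrow>\<^sub>0 'k) \<Rightarrow> 'r" where
  "lin_comb \<kappa> F c = (\<Sum>p\<in>keys c. \<kappa> (lookup c p) * F p)"

lemma lin_comb_superset:
  assumes "finite I" "keys c \<subseteq> I" "\<kappa> 0 = 0"
  shows "lin_comb \<kappa> F c = (\<Sum>p\<in>I. \<kappa> (lookup c p) * F p)"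
  unfolding lin_comb_def using assms
  by (intro sum.mono_neutral_left) (auto simp: in_keys_iff)

text \<open>An algebra structure on a type of class \<open>ring_1\<close>, given by a ring
  homomorphism into the centre. Instances are the constants from \<open>k\<close>, the scalars from
  \<open>k(q)\<close>, \<open>single 0\<close> in a monoid algebra, and
  \<open>of_int\<close>.\<close>

locale central_hom =
  fixes \<kappa> :: "'k::comm_ring_1 \<Rightarrow> 'r::ring_1"
  assumes kappa_add: "\<kappa> (a + b) = \<kappa> a + \<kappa> b"
    and kappa_mult: "\<kappa> (a * b) = \<kappa> a * \<kappa> b"
    and kappa_one [simp]: "\<kappa> 1 = 1"
    and kappa_central: "\<kappa> a * r = r * \<kappa> a"
begin

lemma kappa_zero [simp]: "\<kappa> 0 = 0"
  using kappa_add[of 0 0] by simp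

lemma kappa_minus: "\<kappa> (- a) = - \<kappa> a"
  using kappa_add[of a "- a"] by (simp add: add_eq_0_iff2 neg_eq_iff_add_eq_0)

lemma kappa_diff: "\<kappa> (a - b) = \<kappa> a - \<kappa> b"
  using kappa_add[of a "- b"] by (simp add: kappa_minus)

lemma lin_comb_0 [simp]: "lin_comb \<kappa> F 0 = 0"
  by (simp add: lin_comb_def)

lemma lin_comb_single [simp]: "lin_comb \<kappa> F (single p c) = \<kappa> c * F p"
  by (simp add: lin_comb_def)

lemma lin_comb_diff: "lin_comb \<kappa> F (c - d) = lin_comb \<kappa> F c - lin_comb \<kappa> F d"
proof -
  let ?I = "keys c \<union> keys d"
  have "keys (c - d) \<subseteq> ?I" by (rule keys_diff)
  then show ?thesis
    by (simp add: lin_comb_superset[of ?I] lookup_minus kappa_diff left_diff_distrib sum_subtractf)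
qed

lemma lin_comb_add: "lin_comb \<kappa> F (c + d) = lin_comb \<kappa> F c + lin_comb \<kappa> F d"
  using lin_comb_diff[of F "c + d" d] by simp

text \<open>Induction over the span, merging repeated generators into one finitely supported
  coefficient function. This turns membership in a span into a normal form modulo
  \<open>J\<close>.\<close>

lemma span_repr:
  assumes "w \<in> addspan ({\<kappa> c * F p |c p. p \<in> P} \<union> J)" "add_subgroup J"
  shows "\<exists>c. keys c \<subseteq> P \<and> w - lin_comb \<kappa> F c \<in> J"
  using assms(1)
proof induction
  case addspan_zero
  show ?case using add_subgroupD(1)[OF assms(2)] by (intro exI[of _ 0]) auto
next
  case (addspan_gen g)
  then show ?case
  proof
    assume "g \<in> {\<kappa> c * F p |c p. p \<in> P}"
    then obtain c p where "g = \<kappa> c * F p" "p \<in> P" by auto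
    then show ?thesis using add_subgroupD(1)[OF assms(2)]
      by (intro exI[of _ "single p c"]) auto
  next
    assume "g \<in> J"
    then show ?thesis by (intro exI[of _ 0]) auto
  qed
next
  case (addspan_diff a b)
  then obtain c d where "keys c \<subseteq> P" "a - lin_comb \<kappa> F c \<in> J"
    "keys d \<subseteq> P" "b - lin_comb \<kappa> F d \<in> J" by auto
  moreover from this have "(a - lin_comb \<kappa> F c) - (b - lin_comb \<kappa> F d) \<in> J"
    using add_subgroupD(2)[OF assms(2)] by blast
  ultimately show ?case
    using keys_diff[of c d]
    by (intro exI[of _ "c - d"]) (auto simp: lin_comb_diff algebra_simps)
qed

lemma lin_comb_in:
  assumes "add_subgroup J" "\<And>p c. p \<in> keys d \<Longrightarrow> \<kappa> c * F p \<in> J"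
  shows "lin_comb \<kappa> F d \<in> J"
  unfolding lin_comb_def by (rule add_subgroup_sum[OF assms(1)]) (use assms(2) in auto)

lemma lin_comb_cong_mod:
  assumes "add_subgroup J" "\<And>p c. p \<in> keys d \<Longrightarrow> \<kappa> c * (F p - H p) \<in> J"
  shows "lin_comb \<kappa> F d - lin_comb \<kappa> H d \<in> J"
proof -
  have "lin_comb \<kappa> F d - lin_comb \<kappa> H d = lin_comb \<kappa> (\<lambda>p. F p - H p) d"
    by (simp add: lin_comb_def sum_subtractf right_diff_distrib)
  then show ?thesis using lin_comb_in[OF assms] by simp
qed

end

section \<open>Filtration by the length of words in \<open>om\<close>\<close>

definition filt_set :: "'r::ring_1 set \<Rightarrow> (nat \<Rightarrow> 'r) \<Rightarrow> nat \<Rightarrow> nat \<Rightarrow> 'r set" where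
  "filt_set E om n N = addspan {e * pl om is |e is. e \<in> E \<and> set is \<subseteq> {..<n} \<and> length is \<le> N}"

text \<open>Used twice: in the endomorphism ring with \<open>E\<close> and the images of the
  \<open>Omega_i\<close>, and in the free algebra with the preimage \<open>Ef\<close> of the
  \<open>y\<close>-part and the generators \<open>fo\<close>. Coefficients from \<open>E\<close> may
  be kept on the left because moving a letter past one leaves only a correction in
  \<open>E\<close>.\<close>

locale prefiltration =
  fixes E :: "'r::ring_1 set" and om :: "nat \<Rightarrow> 'r" and n :: nat
  assumes E_sub: "add_subgroup E"
    and E_one: "1 \<in> E"
    and E_mult: "a \<in> E \<Longrightarrow> b \<in> E \<Longrightarrow> a * b \<in> E"
    and om_E_comm: "i < n \<Longrightarrow> e \<in> E \<Longrightarrow> om i * e - e * om i \<in> E"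
begin

abbreviation "W \<equiv> filt_set E om n"

text \<open>\<open>W (N - 1)\<close>, with the convention that only 0 lies below degree 0.\<close>

definition V where "V N = (case N of 0 \<Rightarrow> {0} | Suc M \<Rightarrow> W M)"

lemma W_sub: "add_subgroup (W N)"
  unfolding filt_set_def by (rule add_subgroup_addspan)

lemma V_sub: "add_subgroup (V N)"
  by (cases N) (auto simp: V_def W_sub, simp add: add_subgroup_def)

lemma W_gen: "e \<in> E \<Longrightarrow> set is \<subseteq> {..<n} \<Longrightarrow> length is \<le> N \<Longrightarrow> e * pl om is \<in> W N"
  unfolding filt_set_def by (rule addspan_gen) auto

lemma W_pl: "set is \<subseteq> {..<n} \<Longrightarrow> length is \<le> N \<Longrightarrow> pl om is \<in> W N"
  using W_gen[OF E_one] by simp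

lemma W_mono: "N \<le> M \<Longrightarrow> W N \<subseteq> W M"
  unfolding filt_set_def by (rule addspan_mono) force

lemma E_W: "E \<subseteq> W N"
  using W_gen[of _ "[]"] by auto

lemma W_0: "W 0 = E"
proof
  show "W 0 \<subseteq> E" unfolding filt_set_def by (rule addspan_subset[OF E_sub]) auto
qed (rule E_W)

lemma E_W_mult: "e \<in> E \<Longrightarrow> w \<in> W N \<Longrightarrow> e * w \<in> W N"
  by (rule addspan_mult_left[of w, OF _ W_sub])
    (auto simp: filt_set_def mult.assoc[symmetric] intro!: W_gen[unfolded filt_set_def] E_mult)

text \<open>From \<open>om i * e = e * om i + (om i * e - e * om i)\<close>: the first term
  lengthens the word by one letter, the second keeps its length.\<close>

lemma om_W_mult: assumes "i < n" "w \<in> W N" shows "om i * w \<in> W (Suc N)"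
proof (rule addspan_mult_left[OF assms(2)[unfolded filt_set_def] W_sub])
  fix g assume "g \<in> {e * pl om is |e is. e \<in> E \<and> set is \<subseteq> {..<n} \<and> length is \<le> N}"
  then obtain e "is" where g: "g = e * pl om is" "e \<in> E" "set is \<subseteq> {..<n}" "length is \<le> N" by auto
  have "om i * g = e * pl om (i # is) + (om i * e - e * om i) * pl om is"
    by (simp add: g algebra_simps)
  also have "\<dots> \<in> W (Suc N)"
    by (intro add_subgroupD(4)[OF W_sub] W_gen) (use g assms om_E_comm in auto)
  finally show "om i * g \<in> W (Suc N)" .
qed

lemma pl_om_W_mult: "set is \<subseteq> {..<n} \<Longrightarrow> w \<in> W N \<Longrightarrow> pl om is * w \<in> W (length is + N)"
  by (induction "is") (auto simp: mult.assoc om_W_mult)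

lemma W_mult: assumes "v \<in> W M" "w \<in> W N" shows "v * w \<in> W (M + N)"
proof (rule addspan_mult_right[OF assms(1)[unfolded filt_set_def] W_sub])
  fix g assume "g \<in> {e * pl om is |e is. e \<in> E \<and> set is \<subseteq> {..<n} \<and> length is \<le> M}"
  then obtain e "is" where g: "g = e * pl om is" "e \<in> E" "set is \<subseteq> {..<n}" "length is \<le> M" by auto
  have "pl om is * w \<in> W (M + N)"
    using pl_om_W_mult[OF g(3) assms(2)] W_mono[of "length is + N" "M + N"] g(4) by auto
  then show "g * w \<in> W (M + N)"
    using E_W_mult[OF g(2)] by (simp add: g(1) mult.assoc)
qed

lemma E_V_mult: "e \<in> E \<Longrightarrow> w \<in> V N \<Longrightarrow> e * w \<in> V N"
  using E_W_mult by (auto simp: V_def split: nat.splits)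

end

text \<open>The commutator of two letters has degree 1 instead of 2, so letters commute up to
  shorter words (\<open>om_perm\<close>), and words of top length may be sorted
  (\<open>W_top\<close>).\<close>

locale filtration = prefiltration +
  assumes om_om_comm: "i < n \<Longrightarrow> j < n \<Longrightarrow> om i * om j - om j * om i \<in> filt_set E om n 1"
begin

lemma om_perm:
  assumes "mset is = mset js" "set is \<subseteq> {..<n}"
  shows "pl om is - pl om js \<in> V (length is)"
proof (rule swap_imp_perm_cong[OF V_sub, where M = "mset is"])
  fix u v i j assume m: "mset (u @ i # j # v) = mset is"
  then have *: "set (u @ i # j # v) \<subseteq> {..<n}" and l: "length is = Suc (length u + 1 + length v)"
    using assms(2) by (metis set_mset_mset) (use arg_cong[OF m, of size] in auto)
  have "pl om u * (om i * om j - om j * om i) * pl om v \<in> W (length u + 1 + length v)"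
    by (intro W_mult om_om_comm W_pl) (use * in auto)
  then show "pl om (u @ i # j # v) - pl om (u @ j # i # v) \<in> V (length is)"
    by (simp add: l V_def algebra_simps)
qed (use assms in auto)

lemma W_top:
  assumes "w \<in> W N"
  shows "w \<in> addspan ({e * pl om (mlist n d) |e d. e \<in> E \<and> d \<in> exponents n \<and> length (mlist n d) = N} \<union> V N)"
    (is "w \<in> addspan ?G")
proof -
  have "W N \<subseteq> addspan ?G"
    unfolding filt_set_def
  proof (intro addspan_subset[OF add_subgroup_addspan] subsetI)
    fix g assume "g \<in> {e * pl om is |e is. e \<in> E \<and> set is \<subseteq> {..<n} \<and> length is \<le> N}"
    then obtain e "is" where g: "g = e * pl om is" "e \<in> E" "set is \<subseteq> {..<n}" "length is \<le> N" by auto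
    show "g \<in> addspan ?G"
    proof (cases "length is = N")
      case True
      let ?m = "mlist n (expo is)"
      have "pl om is - pl om ?m \<in> V N"
        using om_perm[of "is" ?m] mset_mlist_expo[OF g(3)] g(3) True by auto
      then have 1: "e * (pl om is - pl om ?m) \<in> addspan ?G"
        using E_V_mult[OF g(2)] by (intro addspan_gen) auto
      have 2: "e * pl om ?m \<in> addspan ?G"
        using g True expo_exponents[OF g(3)] mset_mlist_expo[OF g(3)]
        by (intro addspan_gen) (auto dest: mset_eq_length)
      show ?thesis
        using add_subgroupD(4)[OF add_subgroup_addspan 1 2] by (simp add: g(1) algebra_simps)
    next
      case False
      then obtain M where "N = Suc M" "length is \<le> M" using g(4) by (cases N) auto
      then show ?thesis using W_gen[OF g(2,3)] by (intro addspan_gen) (auto simp: V_def g(1))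
    qed
  qed
  then show ?thesis using assms by blast
qed

end

section \<open>Independence modulo \<open>h\<close>\<close>

lemma add_subgroup_sign:
  fixes x :: "'r::ring_1"
  shows "add_subgroup J \<Longrightarrow> x \<in> J \<Longrightarrow> (- 1) ^ k * x \<in> J"
  by (cases "even k") (auto simp: add_subgroupD)

lemma pl_mult_ideal:
  fixes F :: "nat \<Rightarrow> 'r::ring_1"
  assumes "\<And>i x. i < n \<Longrightarrow> x \<in> J \<Longrightarrow> F i * x \<in> J" "set is \<subseteq> {..<n}" "x \<in> J"
  shows "pl F is * x \<in> J"
  using assms(2) by (induction "is") (auto simp: mult.assoc assms)

text \<open>\<open>xl\<close> and \<open>xr\<close> stand for left and right multiplication by the
  generators. The last three assumptions say that \<open>E / h E\<close> is commutative with
  \<open>k\<close>-basis the products of a left and a right monomial. Right words are reversed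
  because right multiplication reverses products. Scalars from \<open>k\<close> suffice: modulo
  \<open>h\<close> a Laurent coefficient becomes its value at \<open>q = 1\<close>.\<close>

locale deformation = central_hom \<kappa> + filtration E om n
  for \<kappa> :: "'k::field \<Rightarrow> 'r::ring_1" and E :: "'r set" and om n +
  fixes h :: 'r and xl xr :: "nat \<Rightarrow> 'r"
  assumes h_central: "h * r = r * h"
    and h_E: "h \<in> E"
    and kappa_E: "\<kappa> c \<in> E"
    and X_E: "i < n \<Longrightarrow> xl i \<in> E" and X'_E: "i < n \<Longrightarrow> xr i \<in> E"
    and h_om: "i < n \<Longrightarrow> h * om i = xl i - xr i"
    and E_comm: "a \<in> E \<Longrightarrow> b \<in> E \<Longrightarrow> a * b - b * a \<in> (\<lambda>e. h * e) ` E"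
    and E_span: "E \<subseteq> addspan ({\<kappa> c * (pl xl (mlist n a) * pl xr (rev (mlist n b))) |c a b.
        a \<in> exponents n \<and> b \<in> exponents n} \<union> (\<lambda>e. h * e) ` E)"
    and E_indep: "keys f \<subseteq> exponents n \<times> exponents n \<Longrightarrow>
        lin_comb \<kappa> (\<lambda>(a, b). pl xl (mlist n a) * pl xr (rev (mlist n b))) f \<in> (\<lambda>e. h * e) ` E \<Longrightarrow> f = 0"
begin

abbreviation "hE \<equiv> (\<lambda>e. h * e) ` E"
abbreviation "U i \<equiv> xl i - xr i"
abbreviation "dgr m \<equiv> length (mlist n m)"
abbreviation "pX m \<equiv> pl xl (mlist n m)"
abbreviation "pU m \<equiv> pl U (mlist n m)"
abbreviation "pO m \<equiv> pl om (mlist n m)"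

lemma hE_sub: "add_subgroup hE"
  by (rule add_subgroup_image[OF E_sub]) (simp add: right_diff_distrib)

lemma h_left: "r * (h * s) = h * (r * s)"
  by (metis h_central mult.assoc)

lemma hpow_left: "r * (h ^ j * s) = h ^ j * (r * s)"
  by (induction j arbitrary: s) (auto simp: h_left mult.assoc)

lemma kappa_left: "r * (\<kappa> c * s) = \<kappa> c * (r * s)"
  by (metis kappa_central mult.assoc)

lemma hE_left: "a \<in> E \<Longrightarrow> x \<in> hE \<Longrightarrow> a * x \<in> hE"
  by (auto simp: h_left E_mult)

lemma hE_right: "a \<in> E \<Longrightarrow> x \<in> hE \<Longrightarrow> x * a \<in> hE"
  by (auto simp: mult.assoc E_mult)

lemma U_E: "i < n \<Longrightarrow> U i \<in> E"
  using add_subgroupD(2)[OF E_sub X_E X'_E] .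

lemma pl_E: "(\<And>i. i < n \<Longrightarrow> F i \<in> E) \<Longrightarrow> set is \<subseteq> {..<n} \<Longrightarrow> pl F is \<in> E"
  using pl_mult_ideal[of n E F "is" 1] E_mult E_one by auto

lemma perm_hE:
  assumes F: "\<And>i. i < n \<Longrightarrow> F i \<in> E" and "mset is = mset js" "set is \<subseteq> {..<n}"
  shows "pl F is - pl F js \<in> hE"
proof (rule swap_imp_perm_cong[OF hE_sub, where M = "mset is"])
  fix u v i j assume "mset (u @ i # j # v) = mset is"
  then have *: "set (u @ i # j # v) \<subseteq> {..<n}"
    using assms(3) by (metis set_mset_mset)
  have "pl F u * ((F i * F j - F j * F i) * pl F v) \<in> hE"
    by (intro hE_left hE_right E_comm pl_E F) (use * in auto)
  then show "pl F (u @ i # j # v) - pl F (u @ j # i # v) \<in> hE"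
    by (simp add: algebra_simps)
qed (use assms in auto)

lemma mset_mlist_Cons: "i < n \<Longrightarrow> mset (mlist n (single i 1 + m)) = mset (i # mlist n m)"
  by (simp add: mset_mlist_add mset_mlist_single[simplified])

lemma pl_Cons_hE:
  assumes "\<And>i. i < n \<Longrightarrow> F i \<in> E" "i < n"
  shows "F i * pl F (mlist n m) - pl F (mlist n (single i 1 + m)) \<in> hE"
  using perm_hE[of F "i # mlist n m" "mlist n (single i 1 + m)"] assms set_mlist[of n m]
    mset_mlist_Cons[OF assms(2)] by auto

lemma pX_E: "pX a \<in> E"
  by (rule pl_E[OF X_E set_mlist])

lemma pU_E: "pU a \<in> E"
  by (rule pl_E[OF U_E set_mlist])

lemma pX'_E: "pl xr (rev (mlist n a)) \<in> E"
  by (rule pl_E[OF X'_E]) (use set_mlist in auto)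

lemma single_add_exponents: "i < n \<Longrightarrow> m \<in> exponents n \<Longrightarrow> single i 1 + m \<in> exponents n"
  by (intro exponents_add exponents_single) auto

section \<open>Change of basis in \<open>E / h E\<close> from right monomials to monomials in the
  \<open>U i\<close>\<close>

definition "Z = addspan ({\<kappa> c * (pX a * pU b) |c a b. a \<in> exponents n \<and> b \<in> exponents n} \<union> hE)"

lemma Z_sub: "add_subgroup Z"
  unfolding Z_def by (rule add_subgroup_addspan)

lemma Z_gen: "a \<in> exponents n \<Longrightarrow> b \<in> exponents n \<Longrightarrow> \<kappa> c * (pX a * pU b) \<in> Z"
  unfolding Z_def by (rule addspan_gen) auto

lemma hE_Z: "hE \<subseteq> Z"
  unfolding Z_def by (auto intro: addspan_gen)

lemma kappa_hE: "x \<in> hE \<Longrightarrow> \<kappa> c * x \<in> hE"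
  using hE_left[OF kappa_E] .

lemma X_Z: assumes i: "i < n" and z: "z \<in> Z" shows "xl i * z \<in> Z"
proof (rule addspan_mult_left[OF z[unfolded Z_def] Z_sub], elim UnE)
  fix g assume "g \<in> {\<kappa> c * (pX a * pU b) |c a b. a \<in> exponents n \<and> b \<in> exponents n}"
  then obtain c a b where g: "g = \<kappa> c * (pX a * pU b)" "a \<in> exponents n" "b \<in> exponents n" by auto
  have "\<kappa> c * ((xl i * pX a - pX (single i 1 + a)) * pU b) \<in> hE"
    by (intro kappa_hE hE_right pU_E pl_Cons_hE X_E i)
  then have "xl i * g - \<kappa> c * (pX (single i 1 + a) * pU b) \<in> Z"
    using hE_Z by (auto simp: g kappa_left algebra_simps)
  then show "xl i * g \<in> Z"
    using add_subgroup_cancel[OF Z_sub] Z_gen[OF single_add_exponents[OF i g(2)] g(3)] by blast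
qed (use hE_left[OF X_E[OF i]] hE_Z in auto)

lemma U_Z: assumes i: "i < n" and z: "z \<in> Z" shows "U i * z \<in> Z"
proof (rule addspan_mult_left[OF z[unfolded Z_def] Z_sub], elim UnE)
  fix g assume "g \<in> {\<kappa> c * (pX a * pU b) |c a b. a \<in> exponents n \<and> b \<in> exponents n}"
  then obtain c a b where g: "g = \<kappa> c * (pX a * pU b)" "a \<in> exponents n" "b \<in> exponents n" by auto
  have "\<kappa> c * (pX a * (U i * pU b - pU (single i 1 + b))) \<in> hE"
    by (intro kappa_hE hE_left pX_E pl_Cons_hE U_E i)
  moreover have "\<kappa> c * ((U i * pX a - pX a * U i) * pU b) \<in> hE"
    by (intro kappa_hE hE_right pU_E E_comm U_E pX_E i)
  ultimately have "\<kappa> c * ((U i * pX a - pX a * U i) * pU b) + \<kappa> c * (pX a * (U i * pU b - pU (single i 1 + b))) \<in> hE"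
    using add_subgroupD(4)[OF hE_sub] by blast
  moreover have eq: "\<kappa> c * ((u * pX a - pX a * u) * pU b) + \<kappa> c * (pX a * (u * pU b - pU (single i 1 + b)))
      = u * g - \<kappa> c * (pX a * pU (single i 1 + b))" for u
    by (simp add: g kappa_left algebra_simps)
  ultimately have "U i * g - \<kappa> c * (pX a * pU (single i 1 + b)) \<in> Z"
    unfolding eq using hE_Z by blast
  then show "U i * g \<in> Z"
    using add_subgroup_cancel[OF Z_sub] Z_gen[OF g(2) single_add_exponents[OF i g(3)]] by blast
qed (use hE_left[OF U_E[OF i]] hE_Z in auto)

lemma X'_Z: assumes i: "i < n" and z: "z \<in> Z" shows "xr i * z \<in> Z"
  using add_subgroupD(2)[OF Z_sub X_Z[OF assms] U_Z[OF assms]] by (simp add: algebra_simps)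

text \<open>\<open>Z\<close> is closed under left multiplication by
  \<open>xr i = xl i - U i\<close>, so the right monomial is built up letter by letter in front of
  \<open>pX a\<close>; commutativity modulo \<open>h\<close> then moves it behind.\<close>

lemma E_Z: "E \<subseteq> Z"
proof -
  have "\<kappa> c * (pX a * pl xr (rev (mlist n b))) \<in> Z" if "a \<in> exponents n" "b \<in> exponents n" for a b c
  proof -
    have "\<kappa> c * pX a \<in> Z" using Z_gen[OF that(1) exponents_0, of c] by simp
    then have "pl xr (rev (mlist n b)) * (\<kappa> c * pX a) \<in> Z"
      by (intro pl_mult_ideal[of n Z]) (use X'_Z set_mlist in auto)
    moreover have "\<kappa> c * (pX a * pl xr (rev (mlist n b)) - pl xr (rev (mlist n b)) * pX a) \<in> hE"
      by (intro kappa_hE E_comm pX_E pX'_E)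
    then have "\<kappa> c * (pX a * pl xr (rev (mlist n b))) - pl xr (rev (mlist n b)) * (\<kappa> c * pX a) \<in> Z"
      using hE_Z by (auto simp: kappa_left algebra_simps)
    ultimately show ?thesis using add_subgroup_cancel[OF Z_sub] by blast
  qed
  then have "addspan ({\<kappa> c * (pX a * pl xr (rev (mlist n b))) |c a b.
        a \<in> exponents n \<and> b \<in> exponents n} \<union> hE) \<subseteq> Z"
    using hE_Z by (intro addspan_subset[OF Z_sub]) auto
  then show ?thesis using E_span by blast
qed

text \<open>Modulo \<open>h E\<close>, the product \<open>U\<^sup>b\<close> of the \<open>U\<^sub>i = xl\<^sub>i - xr\<^sub>i\<close> has leading term
  \<open>\<plusminus> xr\<^sup>b\<close> with respect to the degree in \<open>xr\<close>.\<close>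

definition "D N = addspan ({\<kappa> c * (case p of (a, b) \<Rightarrow> pX a * pl xr (rev (mlist n b))) |c p.
    p \<in> {(a, b). a \<in> exponents n \<and> b \<in> exponents n \<and> dgr b < N}} \<union> hE)"

lemma D_sub: "add_subgroup (D N)"
  unfolding D_def by (rule add_subgroup_addspan)

lemma D_gen: "a \<in> exponents n \<Longrightarrow> b \<in> exponents n \<Longrightarrow> dgr b < N \<Longrightarrow>
    \<kappa> c * (pX a * pl xr (rev (mlist n b))) \<in> D N"
  unfolding D_def by (rule addspan_gen) auto

lemma hE_D: "hE \<subseteq> D N"
  unfolding D_def by (auto intro: addspan_gen)

lemma D_mono: "N \<le> M \<Longrightarrow> D N \<subseteq> D M"
  unfolding D_def by (rule addspan_mono) force

lemma X_D: assumes i: "i < n" and z: "z \<in> D N" shows "xl i * z \<in> D N"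
proof (rule addspan_mult_left[OF z[unfolded D_def] D_sub], elim UnE)
  fix g assume "g \<in> {\<kappa> c * (case p of (a, b) \<Rightarrow> pX a * pl xr (rev (mlist n b))) |c p.
    p \<in> {(a, b). a \<in> exponents n \<and> b \<in> exponents n \<and> dgr b < N}}"
  then obtain c a b where g: "g = \<kappa> c * (pX a * pl xr (rev (mlist n b)))" "a \<in> exponents n" "b \<in> exponents n"
    "dgr b < N" by auto
  have "\<kappa> c * ((xl i * pX a - pX (single i 1 + a)) * pl xr (rev (mlist n b))) \<in> hE"
    by (intro kappa_hE hE_right pX'_E pl_Cons_hE X_E i)
  then have "xl i * g - \<kappa> c * (pX (single i 1 + a) * pl xr (rev (mlist n b))) \<in> D N"
    using hE_D by (auto simp: g kappa_left algebra_simps)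
  then show "xl i * g \<in> D N"
    using add_subgroup_cancel[OF D_sub] D_gen[OF single_add_exponents[OF i g(2)] g(3,4)] by blast
qed (use hE_left[OF X_E[OF i]] hE_D in auto)

lemma X'_D: assumes i: "i < n" and z: "z \<in> D N" shows "xr i * z \<in> D (Suc N)"
proof (rule addspan_mult_left[OF z[unfolded D_def] D_sub], elim UnE)
  fix g assume "g \<in> {\<kappa> c * (case p of (a, b) \<Rightarrow> pX a * pl xr (rev (mlist n b))) |c p.
    p \<in> {(a, b). a \<in> exponents n \<and> b \<in> exponents n \<and> dgr b < N}}"
  then obtain c a b where g: "g = \<kappa> c * (pX a * pl xr (rev (mlist n b)))" "a \<in> exponents n" "b \<in> exponents n"
    "dgr b < N" by auto
  let ?x = "pl xr (rev (mlist n b))" and ?y = "pl xr (rev (mlist n (single i 1 + b)))"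
  have "pl xr (i # rev (mlist n b)) - ?y \<in> hE"
    by (rule perm_hE) (use i set_mlist[of n b] mset_mlist_Cons[OF i, of b] X'_E in auto)
  then have "\<kappa> c * (pX a * (xr i * ?x - ?y)) \<in> hE"
    by (intro kappa_hE hE_left pX_E) auto
  moreover have "\<kappa> c * ((xr i * pX a - pX a * xr i) * ?x) \<in> hE"
    by (intro kappa_hE hE_right pX'_E E_comm X'_E pX_E i)
  ultimately have "\<kappa> c * ((xr i * pX a - pX a * xr i) * ?x) + \<kappa> c * (pX a * (xr i * ?x - ?y)) \<in> D (Suc N)"
    using add_subgroupD(4)[OF hE_sub] hE_D by blast
  then have "xr i * g - \<kappa> c * (pX a * ?y) \<in> D (Suc N)"
    by (simp add: g kappa_left algebra_simps)
  moreover have "\<kappa> c * (pX a * ?y) \<in> D (Suc N)"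
    using mset_mlist_Cons[OF i, of b, THEN arg_cong[of _ _ size]] g(4)
    by (intro D_gen g(2) single_add_exponents[OF i g(3)]) auto
  ultimately show "xr i * g \<in> D (Suc N)"
    using add_subgroup_cancel[OF D_sub] by blast
qed (use hE_left[OF X'_E[OF i]] hE_D in auto)

lemma pX'_D: assumes "set is \<subseteq> {..<n}" "length is < N" shows "pl xr is \<in> D N"
proof -
  have "\<kappa> 1 * (pX 0 * pl xr (rev (mlist n 0))) \<in> D 1" by (rule D_gen) auto
  then have "1 \<in> D (Suc 0)" by simp
  then have "pl xr is \<in> D (Suc (length is))"
    using assms(1) by (induction "is") (auto simp: X'_D)
  then show ?thesis using D_mono[of "Suc (length is)" N] assms(2) by auto
qed

text \<open>Write \<open>pl U is\<close> as \<open>d\<close> plus the signed word in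
  \<open>xr\<close> and multiply by \<open>xl i - xr i\<close>: only the product of
  \<open>xr i\<close> with the signed word reaches the new top degree. Degrees in \<open>D N\<close>
  are strictly below \<open>N\<close>.\<close>

lemma pU_leading: "set is \<subseteq> {..<n} \<Longrightarrow> pl U is - (- 1) ^ length is * pl xr is \<in> D (length is)"
proof (induction "is")
  case Nil
  then show ?case using add_subgroupD(1)[OF D_sub] by simp
next
  case (Cons i "is")
  let ?N = "length is" and ?s = "(- 1) ^ length is :: 'r"
  define d where "d = pl U is - ?s * pl xr is"
  have i: "i < n" and d: "d \<in> D ?N" using Cons by (auto simp: d_def)
  have s: "?s * a \<in> D N" if "a \<in> D N" for a N
    using that add_subgroupD(3)[OF D_sub] by (cases "even ?N") auto
  have "?s * pl xr is \<in> D (Suc ?N)"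
    by (intro s pX'_D) (use Cons.prems in auto)
  then have "xl i * (d + ?s * pl xr is) \<in> D (Suc ?N)"
    using d D_mono[of ?N "Suc ?N"] by (intro X_D i add_subgroupD(4)[OF D_sub]) auto
  then have "xl i * (d + ?s * pl xr is) - xr i * d \<in> D (Suc ?N)"
    using X'_D[OF i d] add_subgroupD(2)[OF D_sub] by blast
  moreover have "xr i * (?s * pl xr is) = ?s * (xr i * pl xr is)"
    by (cases "even ?N") auto
  ultimately show ?case
    by (simp add: d_def algebra_simps)
qed

lemma pX_D: "a \<in> exponents n \<Longrightarrow> z \<in> D N \<Longrightarrow> pX a * z \<in> D N"
  by (rule pl_mult_ideal[of n]) (auto simp: X_D set_mlist)

lemma kappa_D: "z \<in> D N \<Longrightarrow> \<kappa> c * z \<in> D N"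
proof (rule addspan_mult_left[where a=z and G = "_ \<union> hE", OF _ D_sub])
  assume "z \<in> D N"
  then show "z \<in> addspan ({\<kappa> c * (case p of (a, b) \<Rightarrow> pX a * pl xr (rev (mlist n b))) |c p.
    p \<in> {(a, b). a \<in> exponents n \<and> b \<in> exponents n \<and> dgr b < N}} \<union> hE)" unfolding D_def .
next
  fix g assume "g \<in> {\<kappa> c * (case p of (a, b) \<Rightarrow> pX a * pl xr (rev (mlist n b))) |c p.
    p \<in> {(a, b). a \<in> exponents n \<and> b \<in> exponents n \<and> dgr b < N}} \<union> hE"
  then show "\<kappa> c * g \<in> D N"
  proof
    assume "g \<in> hE"
    then show ?thesis using kappa_hE hE_D by blast
  next
    assume "g \<in> {\<kappa> c * (case p of (a, b) \<Rightarrow> pX a * pl xr (rev (mlist n b))) |c p.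
      p \<in> {(a, b). a \<in> exponents n \<and> b \<in> exponents n \<and> dgr b < N}}"
    then obtain c' a b where g: "g = \<kappa> c' * (pX a * pl xr (rev (mlist n b)))"
      "a \<in> exponents n" "b \<in> exponents n" "dgr b < N" by auto
    have "\<kappa> c * g = \<kappa> (c * c') * (pX a * pl xr (rev (mlist n b)))"
      by (simp add: g(1) kappa_mult mult.assoc)
    then show ?thesis using D_gen[OF g(2-4)] by simp
  qed
qed

text \<open>A nonzero relation is truncated to its top degree \<open>N\<close> in the
  \<open>U i\<close>. Modulo \<open>D N\<close> these terms become, up to sign, products of left and
  right monomials, whose independence is assumed.\<close>

lemma pX_pU_indep:
  assumes c: "keys c \<subseteq> exponents n \<times> exponents n"
    and "lin_comb \<kappa> (\<lambda>(a, b). pX a * pU b) c \<in> hE"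
  shows "c = 0"
proof (rule ccontr)
  assume "c \<noteq> 0"
  define N where "N = Max ((\<lambda>(a, b). dgr b) ` keys c)"
  have fin: "finite ((\<lambda>(a, b). dgr b) ` keys c)" by simp
  have "(\<lambda>(a, b). dgr b) ` keys c \<noteq> {}" using \<open>c \<noteq> 0\<close> by simp
  from Max_in[OF fin this] obtain a0 b0 where ab0: "(a0, b0) \<in> keys c" "dgr b0 = N"
    by (auto simp: N_def)
  have le: "dgr b \<le> N" if "(a, b) \<in> keys c" for a b
    unfolding N_def by (rule Max_ge[OF fin]) (use that in force)
  define P where "P = (\<lambda>(a, b). pX a * pl xr (rev (mlist n b)))"
  \<comment> \<open>Leading term of \<open>pX a * pU b\<close> in degree \<open>N\<close>; products
    of lower degree lie in \<open>D N\<close> and are replaced by 0.\<close>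
  define Q where "Q = (\<lambda>(a, b). if dgr b = N then (- 1) ^ N * P (a, b) else 0)"
  have "lin_comb \<kappa> (\<lambda>(a, b). pX a * pU b) c - lin_comb \<kappa> Q c \<in> D N"
  proof (rule lin_comb_cong_mod[OF D_sub])
    fix p k assume p: "p \<in> keys c"
    obtain a b where ab: "p = (a, b)" by force
    have ex: "a \<in> exponents n" "b \<in> exponents n" using c p ab by auto
    have 1: "pU b - (- 1) ^ dgr b * pl xr (mlist n b) \<in> D (dgr b)"
      by (rule pU_leading[OF set_mlist])
    have "pX a * pU b - Q (a, b) \<in> D N"
    proof (cases "dgr b = N")
      case True
      have "pl xr (mlist n b) - pl xr (rev (mlist n b)) \<in> hE"
        by (rule perm_hE[OF X'_E]) (auto simp: set_mlist)
      then have "(- 1) ^ dgr b * (pl xr (mlist n b) - pl xr (rev (mlist n b))) \<in> hE"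
        by (rule add_subgroup_sign[OF hE_sub])
      then have "pU b - (- 1) ^ N * pl xr (rev (mlist n b)) \<in> D N"
        using add_subgroup_trans[OF D_sub, of "pU b" "(- 1) ^ N * pl xr (mlist n b)" N] 1 True hE_D
        by (auto simp: right_diff_distrib)
      from pX_D[OF ex(1) this] have "pX a * (pU b - (- 1) ^ N * pl xr (rev (mlist n b))) \<in> D N" .
      moreover have "pX a * ((- 1) ^ N * pl xr (rev (mlist n b))) = (- 1) ^ N * (pX a * pl xr (rev (mlist n b)))"
        by (cases "even N") auto
      ultimately show ?thesis by (simp add: Q_def P_def True right_diff_distrib)
    next
      case False
      then have "dgr b < N" using le p ab by force
      then have "(- 1) ^ dgr b * pl xr (mlist n b) \<in> D N"
        using pX'_D[OF set_mlist, where N = N] add_subgroupD(3)[OF D_sub] by (cases "even (dgr b)") auto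
      moreover have "D (dgr b) \<subseteq> D N" using D_mono \<open>dgr b < N\<close> by simp
      ultimately have "pU b \<in> D N" using 1 add_subgroup_cancel[OF D_sub] by blast
      then show ?thesis using pX_D[OF ex(1)] False by (simp add: Q_def)
    qed
    then show "\<kappa> k * ((case p of (a, b) \<Rightarrow> pX a * pU b) - Q p) \<in> D N"
      using kappa_D by (simp add: ab)
  qed
  then have "lin_comb \<kappa> Q c \<in> D N"
    using assms(2) hE_D add_subgroup_cancel[OF D_sub] by blast
  \<comment> \<open>The remainder is rewritten in the assumed basis with exponents of degree below
    \<open>N\<close>, so it cannot cancel the coefficient at \<open>(a0, b0)\<close>.\<close>
  then obtain d where d: "keys d \<subseteq> {(a, b). a \<in> exponents n \<and> b \<in> exponents n \<and> dgr b < N}"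
    "lin_comb \<kappa> Q c - lin_comb \<kappa> P d \<in> hE"
    using span_repr[OF _ hE_sub] unfolding D_def P_def by blast
  \<comment> \<open>Top-degree coefficients of \<open>c\<close>, with the sign of the leading term
    absorbed.\<close>
  define c' where "c' = (\<Sum>p\<in>keys c. single p (if dgr (snd p) = N then (- 1) ^ N * lookup c p else 0))"
  have l: "lookup c' p = (if dgr (snd p) = N then (- 1) ^ N * lookup c p else 0)" for p
    by (auto simp: c'_def lookup_sum lookup_single when_def in_keys_iff intro!: sum.neutral)
  have kc': "keys c' \<subseteq> keys c"
    by (auto simp: in_keys_iff l split: if_splits)
  have "lin_comb \<kappa> P c' = lin_comb \<kappa> Q c"
    unfolding lin_comb_superset[where \<kappa> = \<kappa>, OF finite_keys[of c] kc' kappa_zero] unfolding lin_comb_def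
    by (rule sum.cong) (cases "even N"; auto simp: l Q_def kappa_minus)+
  with d(2) have "lin_comb \<kappa> P (c' - d) \<in> hE" by (simp add: lin_comb_diff)
  moreover have "keys (c' - d) \<subseteq> exponents n \<times> exponents n"
    using keys_diff[of c' d] kc' c d(1) by blast
  ultimately have "c' - d = 0" unfolding P_def by (intro E_indep)
  then have "lookup c' (a0, b0) = lookup d (a0, b0)" by simp
  moreover have "(a0, b0) \<notin> keys d" using d(1) ab0 by auto
  ultimately have "(- 1) ^ N * lookup c (a0, b0) = 0" using ab0 by (simp add: l in_keys_iff)
  then show False using ab0 by (cases "even N") (auto simp: in_keys_iff)
qed

text \<open>The ring \<open>C = \<Union>\<^sub>N W N\<close> is a noncommutative Rees ring: \<open>h\<^sup>N W N \<subseteq> E\<close>,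
  and by \<open>W_repr\<close> an element of \<open>W N\<close> is determined modulo \<open>W (N - 1)\<close> by the part of degree
  at least \<open>N\<close> in the \<open>U\<^sub>i = h \<Omega>\<^sub>i\<close> of its image under \<open>h\<^sup>N\<close> modulo \<open>h E\<close>.\<close>

definition "Vh M = (case M of 0 \<Rightarrow> hE | Suc N \<Rightarrow> W N)"

lemma Vh_sub: "add_subgroup (Vh M)"
  by (auto simp: Vh_def hE_sub W_sub split: nat.splits)

text \<open>One factor \<open>h\<close> turns the first letter into \<open>h * om i = U i\<close>,
  an element of \<open>E\<close>, and so shortens the word by one.\<close>

lemma h_W: assumes "w \<in> W (Suc N)" shows "h * w \<in> W N"
proof (rule addspan_mult_left[OF assms[unfolded filt_set_def] W_sub])
  fix g assume "g \<in> {e * pl om is |e is. e \<in> E \<and> set is \<subseteq> {..<n} \<and> length is \<le> Suc N}"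
  then obtain e "is" where g: "g = e * pl om is" "e \<in> E" "set is \<subseteq> {..<n}" "length is \<le> Suc N" by auto
  show "h * g \<in> W N"
  proof (cases "is")
    case Nil
    then show ?thesis using g E_mult[OF h_E g(2)] E_W by auto
  next
    case (Cons i js)
    then have "h * g = e * ((h * om i) * pl om js)"
      by (simp add: g(1) mult.assoc h_left[of e])
    also have "\<dots> = e * (U i * pl om js)"
      using h_om[of i] g(3) Cons by simp
    also have "\<dots> \<in> W N"
      using W_gen[OF E_mult[OF g(2) U_E], of i js N] g Cons by (simp add: mult.assoc)
    finally show ?thesis .
  qed
qed

lemma hpow_W: "w \<in> W (j + N) \<Longrightarrow> h ^ j * w \<in> W N"
proof (induction j arbitrary: w)
  case (Suc j)
  have "h ^ j * (h * w) \<in> W N" by (rule Suc.IH) (use Suc.prems h_W in auto)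
  then show ?case by (simp add: mult.assoc[symmetric] power_commutes)
qed auto

lemma pU_eq: "set is \<subseteq> {..<n} \<Longrightarrow> pl U is = h ^ length is * pl om is"
  by (induction "is") (auto simp: h_om[symmetric] mult.assoc hpow_left[of "om _"])

lemma hE_W: "N > 0 \<Longrightarrow> x \<in> hE \<Longrightarrow> w \<in> W N \<Longrightarrow> x * w \<in> W (N - 1)"
proof -
  assume "N > 0" "x \<in> hE" and w: "w \<in> W N"
  then obtain y M where "x = h * y" "y \<in> E" "N = Suc M" by (cases N) auto
  then show ?thesis using h_W[of "y * w" M] E_W_mult[of y w N] w
    by (simp add: mult.assoc)
qed

text \<open>In \<open>e * pO d\<close> replace \<open>e\<close> by products
  \<open>pX a * pU b\<close> modulo \<open>h E\<close>. The factor \<open>pU b\<close> is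
  \<open>h ^ dgr b\<close> times a word in \<open>om\<close>, which merges with \<open>pO d\<close>;
  the exponent of \<open>h\<close> is then \<open>dgr (b + d) - M\<close>. All errors drop below
  degree \<open>M\<close>; for \<open>M = 0\<close> they lie in \<open>hE\<close>, which is why
  \<open>Vh 0\<close> is not 0.\<close>

lemma W_repr:
  assumes "w \<in> W M"
  shows "\<exists>c. keys c \<subseteq> {(a, d). a \<in> exponents n \<and> d \<in> exponents n \<and> dgr d \<ge> M} \<and>
    w - lin_comb \<kappa> (\<lambda>(a, d). h ^ (dgr d - M) * (pX a * pO d)) c \<in> Vh M"
proof -
  define P where "P = {(a, d). a \<in> exponents n \<and> d \<in> exponents n \<and> dgr d \<ge> M}"
  define F where "F = (\<lambda>(a, d). h ^ (dgr d - M) * (pX a * pO d))"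
  let ?J = "addspan ({\<kappa> c * F p |c p. p \<in> P} \<union> Vh M)"
  have J: "add_subgroup ?J" by (rule add_subgroup_addspan)
  have V: "Vh M \<subseteq> ?J" by (auto intro: addspan_gen)
  have "e * pO d \<in> ?J" if e: "e \<in> E" and d: "d \<in> exponents n" "dgr d = M" for e d
  proof -
    have "e \<in> Z" using e E_Z by blast
    then show ?thesis unfolding Z_def
    proof (rule addspan_mult_right[OF _ J], elim UnE)
      fix g assume "g \<in> {\<kappa> c * (pX a * pU b) |c a b. a \<in> exponents n \<and> b \<in> exponents n}"
      then obtain c a b where g: "g = \<kappa> c * (pX a * pU b)" "a \<in> exponents n" "b \<in> exponents n" by auto
      let ?m = "mlist n b @ mlist n d"
      have "pl om ?m - pO (b + d) \<in> V (length ?m)"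
        by (rule om_perm) (use set_mlist in \<open>auto simp: mset_mlist_add\<close>)
      then have "\<kappa> c * (pX a * (pl om ?m - pO (b + d))) \<in> V (length ?m)"
        by (intro E_V_mult kappa_E pX_E)
      \<comment> \<open>Sorting costs an element of degree at most \<open>dgr b + M - 1\<close>, and
        \<open>h ^ dgr b\<close> brings it to degree at most \<open>M - 1\<close>. For
        \<open>M = 0\<close> only \<open>dgr b - 1\<close> factors are spent on reaching
        \<open>E\<close>; the remaining one puts the product into \<open>hE\<close>.\<close>
      moreover have "h ^ dgr b * v \<in> Vh M" if v: "v \<in> V (length ?m)" for v
      proof (cases "length ?m")
        case 0
        then show ?thesis using v add_subgroupD(1)[OF Vh_sub] by (simp add: V_def)
      next
        case (Suc k)
        then have v: "v \<in> W k" using v by (simp add: V_def)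
        show ?thesis
        proof (cases M)
          case 0
          then have b: "dgr b = Suc k" using Suc d by simp
          have "h ^ k * v \<in> E" using hpow_W[of v k 0] v by (simp add: W_0)
          then show ?thesis using 0 b by (simp add: Vh_def mult.assoc)
        next
          case (Suc N)
          then show ?thesis
            using hpow_W[of v "dgr b" N] v \<open>length ?m = Suc k\<close> d by (simp add: Vh_def)
        qed
      qed
      ultimately have "h ^ dgr b * (\<kappa> c * (pX a * (pl om ?m - pO (b + d)))) \<in> Vh M"
        by blast
      moreover have "h ^ dgr b * (\<kappa> c * (pX a * (pl om ?m - pO (b + d)))) = g * pO d - \<kappa> c * F (a, b + d)"
        using d by (simp add: g pU_eq set_mlist F_def length_mlist_add right_diff_distrib mult.assoc
            kappa_left[of "h ^ dgr b"] hpow_left[of "pX a"])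
      ultimately have *: "g * pO d - \<kappa> c * F (a, b + d) \<in> ?J" using V by auto
      have "\<kappa> c * F (a, b + d) \<in> ?J"
        using g d by (intro addspan_gen UnI1 CollectI exI[of _ c] exI[of _ "(a, b + d)"])
          (auto simp: P_def length_mlist_add exponents_add)
      then show "g * pO d \<in> ?J" using * add_subgroup_cancel[OF J] by blast
    next
      fix g assume g: "g \<in> hE"
      have "g * pO d \<in> Vh M"
      proof (cases M)
        case 0
        then show ?thesis using g d by (simp add: Vh_def)
      next
        case (Suc N)
        then show ?thesis
          using hE_W[OF _ g W_pl[OF set_mlist], of M d] d by (simp add: Vh_def)
      qed
      then show "g * pO d \<in> ?J" using V by blast
    qed
  qed
  moreover have "V M \<subseteq> Vh M"
    using add_subgroupD(1)[OF hE_sub] by (auto simp: V_def Vh_def split: nat.splits)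
  ultimately have "addspan ({e * pO d |e d. e \<in> E \<and> d \<in> exponents n \<and> dgr d = M} \<union> V M) \<subseteq> ?J"
    using V by (intro addspan_subset[OF J]) auto
  then have "w \<in> ?J" using W_top[OF assms] by blast
  from span_repr[OF this Vh_sub] show ?thesis unfolding P_def F_def by blast
qed

lemma pX_pO_indep:
  assumes c: "keys c \<subseteq> exponents n \<times> exponents n"
    and eq: "lin_comb \<kappa> (\<lambda>(a, b). pX a * pO b) c = h * g" and g: "g \<in> W M"
  shows "c = 0"
proof (rule ccontr)
  assume "c \<noteq> 0"
  define N where "N = Max ((\<lambda>(a, b). dgr b) ` keys c)"
  have fin: "finite ((\<lambda>(a, b). dgr b) ` keys c)" by simp
  have "(\<lambda>(a, b). dgr b) ` keys c \<noteq> {}" using \<open>c \<noteq> 0\<close> by simp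
  from Max_in[OF fin this] obtain a0 b0 where ab0: "(a0, b0) \<in> keys c" "dgr b0 = N"
    by (auto simp: N_def)
  have le: "dgr b \<le> N" if "(a, b) \<in> keys c" for a b
    unfolding N_def by (rule Max_ge[OF fin]) (use that in force)
  define P where "P = (\<lambda>(a, b). pX a * pU b)"
  have lc_h: "h ^ j * lin_comb \<kappa> F d = lin_comb \<kappa> (\<lambda>p. h ^ j * F p) d" for j d and F :: "_ \<times> _ \<Rightarrow> _"
    by (simp add: lin_comb_def sum_distrib_left kappa_left)
  have pUO: "h ^ k * (pX a * pO b) = h ^ (k - dgr b) * P (a, b)" if "dgr b \<le> k" for a b k
  proof -
    have "h ^ k = h ^ (k - dgr b) * h ^ dgr b"
      using that by (simp add: power_add[symmetric])
    then show ?thesis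
      by (simp add: P_def pU_eq set_mlist hpow_left[of "pX a"] mult.assoc)
  qed
  have hpow_hE: "h ^ j * x \<in> hE" if "x \<in> hE" for j x
    using that hE_left[OF h_E] by (induction j) (auto simp: mult.assoc)
  have P_E: "P p \<in> E" for p
    by (cases p) (auto simp: P_def intro!: E_mult pX_E pU_E)
  \<comment> \<open>Multiplying the normal form of \<open>g\<close> in degree \<open>M' + 1\<close>
    by \<open>h ^ (M' + 1)\<close> makes each exponent of \<open>h\<close> equal to
    \<open>dgr d\<close>, which turns \<open>pO d\<close> into \<open>pU d\<close>. The remainder in
    \<open>W M'\<close> lands in \<open>hE\<close>, since \<open>h ^ M'\<close> already brings it
    into \<open>E\<close>.\<close>
  have key: "\<exists>d. keys d \<subseteq> {(a, d). a \<in> exponents n \<and> d \<in> exponents n \<and> dgr d \<ge> Suc M'} \<and>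
      g - lin_comb \<kappa> (\<lambda>(a, d). h ^ (dgr d - Suc M') * (pX a * pO d)) d \<in> W M' \<and>
      h ^ M' * (h * g) - lin_comb \<kappa> P d \<in> hE" if "g \<in> W (Suc M')" for M'
  proof -
    obtain d where d: "keys d \<subseteq> {(a, d). a \<in> exponents n \<and> d \<in> exponents n \<and> dgr d \<ge> Suc M'}"
      "g - lin_comb \<kappa> (\<lambda>(a, d). h ^ (dgr d - Suc M') * (pX a * pO d)) d \<in> W M'"
      using W_repr[OF \<open>g \<in> W (Suc M')\<close>] by (auto simp: Vh_def)
    define w where "w = g - lin_comb \<kappa> (\<lambda>(a, d). h ^ (dgr d - Suc M') * (pX a * pO d)) d"
    have "h ^ M' * w \<in> E" using hpow_W[of w M' 0] d(2) by (simp add: w_def W_0)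
    then have "h * (h ^ M' * w) \<in> hE" by blast
    moreover have "h * (h ^ M' * w) = h ^ M' * (h * g) - h ^ Suc M' *
       lin_comb \<kappa> (\<lambda>(a, d). h ^ (dgr d - Suc M') * (pX a * pO d)) d"
      by (simp add: w_def algebra_simps h_left[of "h ^ M'"])
    moreover have "h ^ Suc M' * lin_comb \<kappa> (\<lambda>(a, d). h ^ (dgr d - Suc M') * (pX a * pO d)) d = lin_comb \<kappa> P d"
      unfolding lc_h unfolding lin_comb_def
    proof (rule sum.cong[OF refl])
      fix p assume "p \<in> keys d"
      then obtain a b where ab: "p = (a, b)" "dgr b \<ge> Suc M'" using d(1) by force
      have "h ^ Suc M' * (h ^ (dgr b - Suc M') * (pX a * pO b)) = h ^ dgr b * (pX a * pO b)"
        using ab(2) by (simp only: mult.assoc[symmetric] power_add[symmetric] le_add_diff_inverse)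
      also have "\<dots> = P (a, b)" using pUO[of b "dgr b" a] by simp
      finally show "\<kappa> (lookup d p) * (h ^ Suc M' * (case p of (a, d) \<Rightarrow> h ^ (dgr d - Suc M') * (pX a * pO d)))
          = \<kappa> (lookup d p) * P p" by (simp add: ab(1))
    qed
    ultimately show ?thesis using d by auto
  qed
  \<comment> \<open>The same multiple computed from the given combination: a term keeps the factor
    \<open>h ^ (k - dgr b)\<close>, so modulo \<open>h\<close> only the terms with
    \<open>dgr b = k\<close> survive.\<close>
  have hc: "h ^ k * (h * g) = lin_comb \<kappa> (\<lambda>p. h ^ (k - dgr (snd p)) * P p) c" if "N \<le> k" for k
    unfolding eq[symmetric] lc_h unfolding lin_comb_def
    by (rule sum.cong) (use le that pUO in force)+
  have "g \<in> W (Suc N)" if "g \<in> W M" for M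
    using that
  proof (induction M)
    case 0
    then show ?case using W_mono[of 0 "Suc N"] by blast
  next
    case (Suc M')
    show ?case
    proof (cases "M' \<le> N")
      case True
      then show ?thesis using W_mono[of "Suc M'" "Suc N"] Suc.prems by auto
    next
      case False
      from key[OF Suc.prems] obtain d where d: "keys d \<subseteq> {(a, d). a \<in> exponents n \<and> d \<in> exponents n \<and> dgr d \<ge> Suc M'}"
        "g - lin_comb \<kappa> (\<lambda>(a, d). h ^ (dgr d - Suc M') * (pX a * pO d)) d \<in> W M'"
        "h ^ M' * (h * g) - lin_comb \<kappa> P d \<in> hE" by blast
      \<comment> \<open>Every exponent \<open>M' - dgr b\<close> is positive, as \<open>M'\<close>
        exceeds the top degree \<open>N\<close>. Hence the leading coefficients \<open>d\<close> of
        \<open>g\<close> vanish and its degree drops.\<close>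
      have "h ^ M' * (h * g) \<in> hE"
        unfolding hc[OF less_imp_le[OF not_le_imp_less[OF False]]]
      proof (rule lin_comb_in[OF hE_sub])
        fix p x assume "p \<in> keys c"
        then have "dgr (snd p) < M'" using le[of "fst p" "snd p"] False by simp
        then obtain j where "M' - dgr (snd p) = Suc j" by (metis Suc_diff_Suc)
        then have "h ^ (M' - dgr (snd p)) * P p = h ^ j * (h * P p)"
          by (simp only: power_Suc2 mult.assoc)
        then have "h ^ (M' - dgr (snd p)) * P p \<in> hE"
          using hpow_hE[of "h * P p" j] P_E by auto
        then show "\<kappa> x * (h ^ (M' - dgr (snd p)) * P p) \<in> hE" by (rule kappa_hE)
      qed
      then have "lin_comb \<kappa> P d \<in> hE" using d(3) add_subgroup_cancel[OF hE_sub] by blast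
      then have "d = 0" unfolding P_def by (intro pX_pU_indep) (use d(1) in auto)
      then show ?thesis using d(2) Suc.IH by simp
    qed
  qed
  \<comment> \<open>Now with \<open>M' = N\<close>: the given combination contributes exactly its
    terms of degree \<open>N\<close>, while \<open>d\<close> has only degrees above
    \<open>N\<close>, so the two cannot agree.\<close>
  from key[OF this[OF g]] obtain d where d: "keys d \<subseteq> {(a, d). a \<in> exponents n \<and> d \<in> exponents n \<and> dgr d \<ge> Suc N}"
    "h ^ N * (h * g) - lin_comb \<kappa> P d \<in> hE" by blast
  define c' where "c' = (\<Sum>p\<in>keys c. single p (if dgr (snd p) = N then lookup c p else 0))"
  have l: "lookup c' p = (if dgr (snd p) = N then lookup c p else 0)" for p
    by (auto simp: c'_def lookup_sum lookup_single when_def in_keys_iff intro!: sum.neutral)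
  have kc': "keys c' \<subseteq> keys c"
    by (auto simp: in_keys_iff l split: if_splits)
  have "lin_comb \<kappa> P c' = lin_comb \<kappa> (\<lambda>p. if dgr (snd p) = N then P p else 0) c"
    unfolding lin_comb_superset[where \<kappa> = \<kappa>, OF finite_keys[of c] kc' kappa_zero] unfolding lin_comb_def
    by (rule sum.cong) (auto simp: l)
  moreover have "h ^ N * (h * g) - lin_comb \<kappa> (\<lambda>p. if dgr (snd p) = N then P p else 0) c \<in> hE"
    unfolding hc[OF order_refl]
  proof (rule lin_comb_cong_mod[OF hE_sub])
    fix p x assume p: "p \<in> keys c"
    show "\<kappa> x * (h ^ (N - dgr (snd p)) * P p - (if dgr (snd p) = N then P p else 0)) \<in> hE"
    proof (cases "dgr (snd p) = N")
      case True
      then show ?thesis using add_subgroupD(1)[OF hE_sub] by simp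
    next
      case False
      then have "dgr (snd p) < N" using le[of "fst p" "snd p"] p by simp
      then obtain j where "N - dgr (snd p) = Suc j" by (metis Suc_diff_Suc)
      then have "h ^ (N - dgr (snd p)) * P p = h ^ j * (h * P p)"
        by (simp only: power_Suc2 mult.assoc)
      then have "h ^ (N - dgr (snd p)) * P p \<in> hE"
        using hpow_hE[of "h * P p" j] P_E by auto
      then show ?thesis using kappa_hE False by simp
    qed
  qed
  ultimately have "lin_comb \<kappa> P c' - lin_comb \<kappa> P d \<in> hE"
    using add_subgroupD(2)[OF hE_sub d(2),
        of "h ^ N * (h * g) - lin_comb \<kappa> (\<lambda>p. if dgr (snd p) = N then P p else 0) c"] by simp
  then have "lin_comb \<kappa> P (c' - d) \<in> hE" by (simp add: lin_comb_diff)
  moreover have "keys (c' - d) \<subseteq> exponents n \<times> exponents n"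
    using keys_diff[of c' d] kc' c d(1) by blast
  ultimately have "c' - d = 0" unfolding P_def by (intro pX_pU_indep)
  then have "lookup c' (a0, b0) = lookup d (a0, b0)" by simp
  moreover have "(a0, b0) \<notin> keys d" using d(1) ab0 by auto
  ultimately show False using ab0 by (simp add: l in_keys_iff)
qed

end

section \<open>Laurent polynomials and coordinates\<close>

abbreviation laurent :: "'k::field_char_0 poly fract set" where
  "laurent \<equiv> carrier laurent_ring"

lemma qq_to_fract: "qq = to_fract [:0, 1:]" and const_to_fract: "const c = to_fract [:c:]"
  by (simp_all add: qq_def const_def to_fract_def)

lemma laurent_iff: "f \<in> laurent \<longleftrightarrow> (\<exists>p m. f = to_fract p / qq ^ m)"
  by (auto simp: laurent_ring_def to_fract_def)

lemma to_fract_power: "to_fract (p ^ m) = to_fract p ^ m"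
  by (induction m) auto

lemma qq_nonzero: "qq \<noteq> (0::'k::field_char_0 poly fract)"
  by (simp add: qq_to_fract)

lemma qq_power: "(qq::'k::field_char_0 poly fract) ^ m = to_fract ([:0, 1:] ^ m)"
  by (simp only: qq_to_fract to_fract_power)

lemma qq_minus_1: "(qq::'k::field_char_0 poly fract) - 1 = to_fract [:- 1, 1:]"
proof -
  have "[:- 1, 1:] = [:0, 1:] - (1 :: 'k poly)" by (simp add: one_pCons)
  then show ?thesis by (simp only: qq_to_fract to_fract_diff to_fract_1)
qed

lemma qq_minus_1_nonzero: "(qq::'k::field_char_0 poly fract) - 1 \<noteq> 0"
  unfolding qq_minus_1 by simp

interpretation const: central_hom "const :: 'k::field_char_0 \<Rightarrow> _"
  by unfold_locales
    (simp_all add: const_to_fract to_fract_add[symmetric] to_fract_mult[symmetric] mult.commute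
      one_pCons[symmetric] del: to_fract_add to_fract_mult)

lemma const_laurent: "const c \<in> laurent"
  unfolding laurent_iff by (intro exI[of _ "[:c:]"] exI[of _ 0]) (simp add: const_to_fract)

lemma laurent_one: "1 \<in> laurent" and laurent_zero: "0 \<in> laurent"
  using const_laurent[of 1] const_laurent[of 0] by auto

lemma qq_minus_1_laurent: "qq - 1 \<in> laurent"
  unfolding laurent_iff by (intro exI[of _ "[:- 1, 1:]"] exI[of _ 0]) (simp add: qq_minus_1)

lemma laurent_mult: assumes "a \<in> laurent" "b \<in> laurent" shows "a * b \<in> laurent"
proof -
  obtain p m r k where "a = to_fract p / qq ^ m" "b = to_fract r / qq ^ k"
    using assms unfolding laurent_iff by blast
  then show ?thesis
    unfolding laurent_iff by (intro exI[of _ "p * r"] exI[of _ "m + k"]) (simp add: power_add)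
qed

lemma laurent_diff: assumes "a \<in> laurent" "b \<in> laurent" shows "a - b \<in> laurent"
proof -
  obtain p m r k where "a = to_fract p / qq ^ m" "b = to_fract r / qq ^ k"
    using assms unfolding laurent_iff by blast
  then have "a - b = to_fract (p * [:0, 1:] ^ k - r * [:0, 1:] ^ m) / qq ^ (m + k)"
    by (simp add: power_add qq_nonzero qq_power[symmetric] diff_divide_distrib)
  then show ?thesis unfolding laurent_iff by blast
qed

lemma laurent_sub: "add_subgroup laurent"
  unfolding add_subgroup_def using laurent_zero laurent_diff by blast

lemmas laurent_add = add_subgroupD(4)[OF laurent_sub]
  and laurent_minus = add_subgroupD(3)[OF laurent_sub]

text \<open>The constant is the value of the numerator at 1. The denominator \<open>q ^ m\<close>
  takes the value 1 there, so the numerator minus \<open>c * q ^ m\<close> is divisible by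
  \<open>q - 1\<close>.\<close>

lemma laurent_decomp:
  assumes "l \<in> laurent"
  shows "\<exists>c. \<exists>l'\<in>laurent. l = const c + (qq - 1) * l'"
proof -
  obtain p m where l: "l = to_fract p / qq ^ m" using assms unfolding laurent_iff by blast
  define c where "c = poly p 1"
  have "poly (p - [:c:] * [:0, 1:] ^ m) 1 = 0" by (simp add: c_def)
  then obtain r where r: "p - [:c:] * [:0, 1:] ^ m = [:- 1, 1:] * r"
    unfolding poly_eq_0_iff_dvd by (elim dvdE)
  then have "p = [:c:] * [:0, 1:] ^ m + [:- 1, 1:] * r"
    by (metis add.commute diff_add_cancel)
  then have "to_fract p = to_fract ([:c:] * [:0, 1:] ^ m + [:- 1, 1:] * r)"
    by (rule arg_cong)
  also have "\<dots> = const c * qq ^ m + (qq - 1) * to_fract r"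
    unfolding qq_minus_1 qq_power const_to_fract by (simp only: to_fract_add to_fract_mult)
  finally have "l = const c + (qq - 1) * (to_fract r / qq ^ m)"
    by (simp add: l qq_nonzero divide_simps)
  moreover have "to_fract r / qq ^ m \<in> laurent" unfolding laurent_iff by blast
  ultimately show ?thesis by blast
qed

text \<open>Evaluation at \<open>q = 1\<close> after clearing \<open>q ^ m\<close>. Thus
  \<open>k\<close> embeds into the Laurent polynomials modulo \<open>q - 1\<close>.\<close>

lemma const_eq_mult:
  assumes "const c = (qq - 1) * l" "l \<in> laurent"
  shows "c = 0"
proof -
  obtain p m where l: "l = to_fract p / qq ^ m" using assms unfolding laurent_iff by blast
  have "const c * qq ^ m = (qq - 1) * to_fract p"
    using assms(1) by (simp add: l qq_nonzero divide_simps)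
  then have "to_fract ([:c:] * [:0, 1:] ^ m) = to_fract ([:- 1, 1:] * p)"
    unfolding qq_minus_1 qq_power const_to_fract by (simp only: to_fract_mult)
  then have "[:c:] * [:0, 1:] ^ m = [:- 1, 1:] * p" by (simp only: to_fract_eq_iff)
  then have "poly ([:c:] * [:0, 1:] ^ m) 1 = poly ([:- 1, 1:] * p) 1" by simp
  then show ?thesis by simp
qed

text \<open>Denominators are cleared by powers of \<open>q - 1\<close> and by elements congruent to \<open>1\<close>
  modulo \<open>q - 1\<close>.\<close>

definition unit1 :: "'k::field_char_0 poly fract set" where
  "unit1 = {1 + (qq - 1) * l | l. l \<in> laurent}"

lemma unit1_one: "1 \<in> unit1"
  unfolding unit1_def using laurent_zero by force

lemma unit1_laurent: "u \<in> unit1 \<Longrightarrow> u \<in> laurent"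
  by (auto simp: unit1_def intro!: laurent_add laurent_mult laurent_one qq_minus_1_laurent)

lemma unit1_mult: assumes "u \<in> unit1" "v \<in> unit1" shows "u * v \<in> unit1"
proof -
  obtain k l where "u = 1 + (qq - 1) * k" "v = 1 + (qq - 1) * l" "k \<in> laurent" "l \<in> laurent"
    using assms by (auto simp: unit1_def)
  then have "u * v = 1 + (qq - 1) * (k + l + (qq - 1) * (k * l))"
    "k + l + (qq - 1) * (k * l) \<in> laurent"
    by (simp only: distrib_left distrib_right mult_1 mult_1_right mult_ac add_ac)
      (intro laurent_add laurent_mult qq_minus_1_laurent \<open>k \<in> laurent\<close> \<open>l \<in> laurent\<close>)
  then show ?thesis unfolding unit1_def by blast
qed

text \<open>The power of \<open>q - 1\<close> is split off from the denominator, and the cofactor is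
  divided by its nonzero value at 1 to become congruent to 1.\<close>

lemma clear_denominator: "\<exists>j. \<exists>u\<in>unit1. (qq - 1) ^ j * u * f \<in> laurent"
proof (cases f)
  case (Fract a b)
  obtain b' where b': "b = [:- 1, 1:] ^ order 1 b * b'" "\<not> [:- 1, 1:] dvd b'"
    using order_decomp[OF Fract(2)] by blast
  define d where "d = poly b' 1"
  have d: "d \<noteq> 0" using b'(2) by (simp add: d_def poly_eq_0_iff_dvd)
  define u where "u = to_fract b' * const (1 / d)"
  have "poly (b' - [:d:]) 1 = 0" by (simp add: d_def)
  then obtain r where "b' - [:d:] = [:- 1, 1:] * r" unfolding poly_eq_0_iff_dvd by (elim dvdE)
  then have "b' = [:d:] + [:- 1, 1:] * r"
    by (metis add.commute diff_add_cancel)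
  then have "to_fract b' = to_fract ([:d:] + [:- 1, 1:] * r)" by (rule arg_cong)
  also have "\<dots> = const d + (qq - 1) * to_fract r"
    unfolding qq_minus_1 const_to_fract by (simp only: to_fract_add to_fract_mult)
  finally have "u = 1 + (qq - 1) * (to_fract r * const (1 / d))"
    using d by (simp add: u_def distrib_right const.kappa_mult[symmetric] mult.assoc)
  moreover have "to_fract r \<in> laurent"
    unfolding laurent_iff by (intro exI[of _ r] exI[of _ 0]) simp
  ultimately have u: "u \<in> unit1"
    unfolding unit1_def using laurent_mult[OF _ const_laurent] by blast
  have pw: "(qq - 1) ^ k = to_fract ([:- 1, 1:] ^ k)" for k
    by (simp only: qq_minus_1 to_fract_power)
  have "to_fract b = (qq - 1) ^ order 1 b * to_fract b'"
    by (subst b'(1)) (simp only: pw to_fract_mult)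
  then have "(qq - 1) ^ order 1 b * u * f = to_fract a * const (1 / d)"
    using Fract d qq_minus_1_nonzero
    by (simp only: u_def Fract_conv_to_fract) (auto simp: mult_ac)
  moreover have "to_fract a \<in> laurent"
    unfolding laurent_iff by (intro exI[of _ a] exI[of _ 0]) simp
  ultimately show ?thesis using u laurent_mult[OF _ const_laurent] by metis
qed

lemma clear_denominators:
  fixes c :: "'p \<Rightarrow>\<^sub>0 'k::field_char_0 poly fract"
  shows "\<exists>j. \<exists>u\<in>unit1. \<forall>p. (qq - 1) ^ j * u * lookup c p \<in> laurent"
proof -
  have "\<exists>j. \<exists>u\<in>unit1. \<forall>p\<in>P. (qq - 1) ^ j * u * lookup c p \<in> laurent" if "finite P" for P
    using that
  proof induction
    case empty
    then show ?case using unit1_one by blast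
  next
    case (insert x P)
    then obtain j u where u: "u \<in> unit1" "\<forall>p\<in>P. (qq - 1) ^ j * u * lookup c p \<in> laurent" by blast
    obtain k v where v: "v \<in> unit1" "(qq - 1) ^ k * v * lookup c x \<in> laurent"
      using clear_denominator by blast
    have pow: "(qq - 1 :: 'k poly fract) ^ i \<in> laurent" for i
      by (induction i) (auto intro: laurent_one laurent_mult qq_minus_1_laurent)
    have eq: "(qq - 1) ^ (j + k) * (u * v) * f = ((qq - 1) ^ k * v) * ((qq - 1) ^ j * u * f)"
      "(qq - 1) ^ (j + k) * (u * v) * f = ((qq - 1) ^ j * u) * ((qq - 1) ^ k * v * f)" for f :: "'k poly fract"
      by (simp_all add: power_add mult_ac)
    have "(qq - 1) ^ (j + k) * (u * v) * lookup c p \<in> laurent" if "p \<in> insert x P" for p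
    proof (cases "p = x")
      case True
      then show ?thesis unfolding eq(2)
        using laurent_mult[OF laurent_mult[OF pow unit1_laurent[OF u(1)]] v(2)] True by simp
    next
      case False
      then show ?thesis unfolding eq(1)
        using laurent_mult[OF laurent_mult[OF pow unit1_laurent[OF v(1)]] u(2)[rule_format]] that False by simp
    qed
    then show ?case using unit1_mult[OF u(1) v(1)] by blast
  qed
  from this[OF finite_keys[of c]] obtain j u where
    *: "u \<in> unit1" "\<And>p. p \<in> keys c \<Longrightarrow> (qq - 1) ^ j * u * lookup c p \<in> laurent" by blast
  have "(qq - 1) ^ j * u * lookup c p \<in> laurent" for p
    using *(2)[of p] laurent_zero by (cases "p \<in> keys c") (auto simp: in_keys_iff)
  then show ?thesis using *(1) by blast
qed

lemma carrier_of_type [simp]: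
  "carrier (ring_of_type_algebra :: 'b::comm_ring_1 ring) = UNIV"
  "add (ring_of_type_algebra :: 'b ring) = (+)"
  "monoid.mult (ring_of_type_algebra :: 'b ring) = (*)"
  "\<one>\<^bsub>(ring_of_type_algebra :: 'b ring)\<^esub> = 1"
  "\<zero>\<^bsub>(ring_of_type_algebra :: 'b ring)\<^esub> = 0"
  by (auto simp: ring_of_type_algebra_def)

text \<open>Scalar multiples of finitely supported functions are written as convolution products
  with \<open>single 0 k\<close>.\<close>

lemma lookup_scale: "lookup (single (0::'i::monoid_add) (k::'b::comm_ring_1) * c) i = k * lookup c i"
  by (simp add: mult_map_scale_conv_mult[symmetric] map.rep_eq when_def)

lemma keys_scale: "keys (single (0::'i::monoid_add) (k::'b::comm_ring_1) * c) \<subseteq> keys c"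
  by (auto simp: in_keys_iff lookup_scale)

section \<open>Linear combinations in modules given as records\<close>

locale module_over_type = module "ring_of_type_algebra :: 's::field ring" M for M :: "('s::field, 'a) module" (structure)
begin

lemma lincomb_superset:
  assumes "b ` I \<subseteq> carrier M" "finite I" "keys c \<subseteq> I"
  shows "lincomb M b c = (\<Oplus>i\<in>I. lookup c i \<odot>\<^bsub>M\<^esub> b i)"
  unfolding lincomb_def
proof (rule add.finprod_mono_neutral_cong_left[OF assms(2,3)])
  fix i assume "i \<in> I - keys c"
  then have "lookup c i = 0" "b i \<in> carrier M" using assms(1) by (auto simp: in_keys_iff)
  then show "lookup c i \<odot>\<^bsub>M\<^esub> b i = \<zero>\<^bsub>M\<^esub>" using smult_l_null by simp
qed (use assms in \<open>auto simp: subset_eq\<close>)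

lemma lincomb_closed:
  assumes "b ` keys c \<subseteq> carrier M" shows "lincomb M b c \<in> carrier M"
  unfolding lincomb_def by (rule M.finsum_closed) (use assms in auto)

lemma lincomb_0: "lincomb M b 0 = \<zero>\<^bsub>M\<^esub>"
  by (simp add: lincomb_def)

lemma lincomb_single:
  assumes "b p \<in> carrier M" shows "lincomb M b (single p k) = k \<odot>\<^bsub>M\<^esub> b p"
proof -
  have "lincomb M b (single p k) = (\<Oplus>i\<in>{p}. lookup (single p k) i \<odot>\<^bsub>M\<^esub> b i)"
    by (rule lincomb_superset) (use assms in auto)
  also have "\<dots> = k \<odot>\<^bsub>M\<^esub> b p" using assms by (subst M.finsum_insert) auto
  finally show ?thesis .
qed

lemma lincomb_add:
  assumes "b ` I \<subseteq> carrier M" "keys c \<subseteq> I" "keys d \<subseteq> I"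
  shows "lincomb M b (c + d) = lincomb M b c \<oplus>\<^bsub>M\<^esub> lincomb M b d"
proof -
  let ?J = "keys c \<union> keys d"
  have b: "b ` ?J \<subseteq> carrier M" using assms by auto
  have "keys (c + d) \<subseteq> ?J" by (rule keys_add)
  then have "lincomb M b (c + d) = (\<Oplus>i\<in>?J. (lookup c i \<odot>\<^bsub>M\<^esub> b i) \<oplus>\<^bsub>M\<^esub> (lookup d i \<odot>\<^bsub>M\<^esub> b i))"
    using b by (subst lincomb_superset[OF b]) (auto intro!: M.finsum_cong' simp: lookup_add smult_l_distr[simplified])
  also have "\<dots> = lincomb M b c \<oplus>\<^bsub>M\<^esub> lincomb M b d"
    using b by (subst M.finsum_addf) (auto simp: lincomb_superset[OF b])
  finally show ?thesis .
qed

lemma lincomb_scale: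
  assumes "b ` I \<subseteq> carrier M" "keys c \<subseteq> I"
  shows "lincomb M b (single (0::_::monoid_add) k * c) = k \<odot>\<^bsub>M\<^esub> lincomb M b c"
proof -
  have b: "b ` keys c \<subseteq> carrier M" using assms by auto
  have "lincomb M b (single 0 k * c) = (\<Oplus>i\<in>keys c. k \<odot>\<^bsub>M\<^esub> (lookup c i \<odot>\<^bsub>M\<^esub> b i))"
    using b by (subst lincomb_superset[OF b]) (auto intro!: M.finsum_cong' simp: lookup_scale keys_scale smult_assoc1[simplified])
  also have "\<dots> = k \<odot>\<^bsub>M\<^esub> lincomb M b c"
    using b unfolding lincomb_def by (intro finsum_smult_ldistr[symmetric]) auto
  finally show ?thesis .
qed

end

section \<open>Left and right multiplications\<close>

interpretation single0: central_hom "single (0::'i::comm_monoid_add) :: 'k::comm_ring_1 \<Rightarrow> _"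
  by unfold_locales (auto simp: single_add mult_single mult.commute)

abbreviation lin_ext :: "('j \<Rightarrow> ('i::comm_monoid_add \<Rightarrow>\<^sub>0 'k::comm_ring_1)) \<Rightarrow> ('j \<Rightarrow>\<^sub>0 'k) \<Rightarrow> ('i \<Rightarrow>\<^sub>0 'k)" where
  "lin_ext \<equiv> lin_comb (single 0)"

lemma lin_ext_sum: "lin_ext T (\<Sum>a\<in>I. f a) = (\<Sum>a\<in>I. lin_ext T (f a))"
  by (induction I rule: infinite_finite_induct) (auto simp: single0.lin_comb_add)

lemma lin_ext_scale:
  "lin_ext T (single (0::'j::comm_monoid_add) k * f) = single 0 k * lin_ext T f"
  unfolding lin_comb_superset[where \<kappa> = "single 0", OF finite_keys keys_scale single_zero]
  by (simp add: lin_comb_def lookup_scale sum_distrib_left mult.assoc[symmetric] mult_single)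

lemma lin_ext_lin_ext:
  fixes T :: "'j::comm_monoid_add \<Rightarrow> ('i::comm_monoid_add \<Rightarrow>\<^sub>0 'k::comm_ring_1)"
  shows "lin_ext T (lin_ext S f) = lin_ext (\<lambda>p. lin_ext T (S p)) f"
  by (simp add: lin_comb_def[of _ S f] lin_ext_sum lin_ext_scale)
    (simp add: lin_comb_def[of _ _ f])

lemma lin_ext_swap:
  fixes F :: "'j \<Rightarrow> 'p \<Rightarrow> ('i::comm_monoid_add \<Rightarrow>\<^sub>0 'k::comm_ring_1)"
  shows "lin_ext (\<lambda>w. lin_ext (F w) d) c = lin_ext (\<lambda>z. lin_ext (\<lambda>w. F w z) c) d"
proof -
  have "lin_ext (\<lambda>w. lin_ext (F w) d) c
      = (\<Sum>w\<in>keys c. \<Sum>z\<in>keys d. single 0 (lookup d z) * (single 0 (lookup c w) * F w z))"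
    by (simp add: lin_comb_def sum_distrib_left mult.left_commute)
  also have "\<dots> = (\<Sum>z\<in>keys d. \<Sum>w\<in>keys c. single 0 (lookup d z) * (single 0 (lookup c w) * F w z))"
    by (rule sum.swap)
  also have "\<dots> = lin_ext (\<lambda>z. lin_ext (\<lambda>w. F w z) c) d"
    by (simp add: lin_comb_def sum_distrib_left)
  finally show ?thesis .
qed

lemma lin_ext_single_id: "lin_ext (\<lambda>p. single p 1) f = (f :: _ \<Rightarrow>\<^sub>0 'k::comm_ring_1)"
  by (rule poly_mapping_eqI)
    (auto simp: lin_comb_def mult_single lookup_sum lookup_single when_def in_keys_iff)

text \<open>Endomorphisms of a free module are made a type of class \<open>ring_1\<close>, so that
  class-based rewriting and the locales above apply. The factor \<open>single 0 k\<close> scales by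
  \<open>k\<close>; for pairs of exponent vectors the index monoid is the componentwise one.\<close>

typedef (overloaded) ('i, 'k) endo =
  "{\<phi> :: ('i::comm_monoid_add \<Rightarrow>\<^sub>0 'k::comm_ring_1) \<Rightarrow> ('i \<Rightarrow>\<^sub>0 'k).
     (\<forall>f g. \<phi> (f + g) = \<phi> f + \<phi> g) \<and> (\<forall>k f. \<phi> (single 0 k * f) = single 0 k * \<phi> f)}"
  morphisms app Endo
  by (rule exI[of _ "\<lambda>f. f"]) auto

setup_lifting type_definition_endo

lemma app_add: "app \<phi> (f + g) = app \<phi> f + app \<phi> g"
  using app[of \<phi>] by auto

lemma endo_eqI: "(\<And>f. app \<phi> f = app \<psi> f) \<Longrightarrow> \<phi> = \<psi>"
  by (metis app_inject ext)

instantiation endo :: (comm_monoid_add, comm_ring_1) ring_1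
begin

lift_definition zero_endo :: "('a, 'b) endo" is "\<lambda>f. 0" by simp
lift_definition one_endo :: "('a, 'b) endo" is "\<lambda>f. f" by simp
lift_definition plus_endo :: "('a, 'b) endo \<Rightarrow> ('a, 'b) endo \<Rightarrow> ('a, 'b) endo" is "\<lambda>\<phi> \<psi> f. \<phi> f + \<psi> f"
  by (auto simp: algebra_simps)
lift_definition uminus_endo :: "('a, 'b) endo \<Rightarrow> ('a, 'b) endo" is "\<lambda>\<phi> f. - \<phi> f"
  by auto
lift_definition minus_endo :: "('a, 'b) endo \<Rightarrow> ('a, 'b) endo \<Rightarrow> ('a, 'b) endo" is "\<lambda>\<phi> \<psi> f. \<phi> f - \<psi> f"
  by (auto simp: algebra_simps)
lift_definition times_endo :: "('a, 'b) endo \<Rightarrow> ('a, 'b) endo \<Rightarrow> ('a, 'b) endo" is "\<lambda>\<phi> \<psi> f. \<phi> (\<psi> f)"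
  by auto

instance
proof
  fix a b c :: "('a, 'b) endo"
  note rep = zero_endo.rep_eq one_endo.rep_eq plus_endo.rep_eq uminus_endo.rep_eq minus_endo.rep_eq
    times_endo.rep_eq app_add
  show "(a + b) * c = a * c + b * c" "a * (b + c) = a * b + a * c"
    "a + b + c = a + (b + c)" "a + b = b + a" "0 + a = a" "- a + a = 0" "a - b = a + - b"
    "a * b * c = a * (b * c)" "1 * a = a" "a * 1 = a"
    by (rule endo_eqI, simp add: rep)+
  have "app (0 :: ('a, 'b) endo) (single 0 1) \<noteq> app 1 (single 0 1)"
    by (simp add: rep)
  then show "(0 :: ('a, 'b) endo) \<noteq> 1" by metis
qed

end

lemma app_simps [simp]:
  "app 0 f = 0" "app 1 f = f" "app (\<phi> + \<psi>) f = app \<phi> f + app \<psi> f" "app (- \<phi>) f = - app \<phi> f"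
  "app (\<phi> - \<psi>) f = app \<phi> f - app \<psi> f" "app (\<phi> * \<psi>) f = app \<phi> (app \<psi> f)"
  by (simp_all add: zero_endo.rep_eq one_endo.rep_eq plus_endo.rep_eq uminus_endo.rep_eq
      minus_endo.rep_eq times_endo.rep_eq)

lift_definition endo_scalar :: "'k::comm_ring_1 \<Rightarrow> ('i::comm_monoid_add, 'k) endo" is
  "\<lambda>k f. single 0 k * f"
  by (auto simp: algebra_simps)

interpretation endo_scalar: central_hom endo_scalar
proof
  fix a b :: "'k::comm_ring_1" and r :: "('i::comm_monoid_add, 'k) endo"
  show "endo_scalar (a + b) = (endo_scalar a + endo_scalar b :: ('i, 'k) endo)"
    by transfer (simp add: single_add distrib_right fun_eq_iff)
  show "endo_scalar (a * b) = (endo_scalar a * endo_scalar b :: ('i, 'k) endo)"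
    by transfer (simp add: mult.assoc[symmetric] mult_single)
  show "endo_scalar 1 = (1 :: ('i, 'k) endo)"
    by transfer simp
  show "endo_scalar a * r = r * endo_scalar a"
    by transfer auto
qed

lift_definition endo_of :: "('i \<Rightarrow> ('i \<Rightarrow>\<^sub>0 'k)) \<Rightarrow> ('i::comm_monoid_add, 'k::comm_ring_1) endo" is lin_ext
  by (auto simp: single0.lin_comb_add lin_ext_scale)

lemma app_endo_scalar: "app (endo_scalar k) f = single 0 k * f"
  by transfer simp

lemma app_endo_of: "app (endo_of T) f = lin_ext T f"
  by transfer simp

lemma app_sum: "app (\<Sum>a\<in>I. F a) f = (\<Sum>a\<in>I. app (F a) f)"
  by (induction I rule: infinite_finite_induct) auto

section \<open>Ordered monomials under homomorphisms and antihomomorphisms\<close>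

lemma foldr_power_mult_list:
  assumes "\<phi> \<one>\<^bsub>A\<^esub> = 1"
    and "\<And>a b. a \<in> carrier A \<Longrightarrow> b \<in> carrier A \<Longrightarrow> \<phi> (a \<otimes>\<^bsub>A\<^esub> b) = \<phi> a * (\<phi> b :: 'r::monoid_mult)"
    and "monoid A" "x ` set ks \<subseteq> carrier A"
  shows "foldr (\<lambda>i y. (x i [^]\<^bsub>A\<^esub> lookup m i) \<otimes>\<^bsub>A\<^esub> y) ks \<one>\<^bsub>A\<^esub> \<in> carrier A \<and>
    \<phi> (foldr (\<lambda>i y. (x i [^]\<^bsub>A\<^esub> lookup m i) \<otimes>\<^bsub>A\<^esub> y) ks \<one>\<^bsub>A\<^esub>)
      = prod_list (map (\<lambda>i. \<phi> (x i)) (concat (map (\<lambda>i. replicate (lookup m i) i) ks)))"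
proof -
  interpret A: monoid A by fact
  have pow: "\<phi> (a [^]\<^bsub>A\<^esub> k) = \<phi> a ^ k" if "a \<in> carrier A" for a and k :: nat
    using that by (induction k) (auto simp: assms power_Suc2 simp del: power_Suc)
  have rep: "map (\<lambda>i. \<phi> (x i)) (replicate k i) = replicate k (\<phi> (x i))" for k i
    by simp
  show ?thesis
    using assms(4) by (induction ks) (auto simp: assms(1,2) pow rep prod_list_replicate)
qed

lemma ordered_monomial_hom:
  assumes "\<phi> \<one>\<^bsub>A\<^esub> = 1"
    and "\<And>a b. a \<in> carrier A \<Longrightarrow> b \<in> carrier A \<Longrightarrow> \<phi> (a \<otimes>\<^bsub>A\<^esub> b) = \<phi> a * (\<phi> b :: 'r::monoid_mult)"
    and "monoid A" "x ` {..<n} \<subseteq> carrier A"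
  shows "\<phi> (ordered_monomial A n x m) = pl (\<lambda>i. \<phi> (x i)) (mlist n m)"
  unfolding ordered_monomial_def mlist_def
  using foldr_power_mult_list[of \<phi> A x "[0..<n]" m] assms by (auto simp: atLeast0LessThan)

text \<open>An antihomomorphism reverses the word; this is the origin of \<open>rev\<close> in the
  formulas for right multiplication.\<close>

lemma foldr_power_mult_list_rev:
  assumes "\<phi> \<one>\<^bsub>A\<^esub> = 1"
    and "\<And>a b. a \<in> carrier A \<Longrightarrow> b \<in> carrier A \<Longrightarrow> \<phi> (a \<otimes>\<^bsub>A\<^esub> b) = \<phi> b * (\<phi> a :: 'r::monoid_mult)"
    and "monoid A" "x ` set ks \<subseteq> carrier A"
  shows "\<phi> (foldr (\<lambda>i y. (x i [^]\<^bsub>A\<^esub> lookup m i) \<otimes>\<^bsub>A\<^esub> y) ks \<one>\<^bsub>A\<^esub>)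
      = prod_list (map (\<lambda>i. \<phi> (x i)) (rev (concat (map (\<lambda>i. replicate (lookup m i) i) ks))))"
proof -
  interpret A: monoid A by fact
  have pow: "\<phi> (a [^]\<^bsub>A\<^esub> k) = \<phi> a ^ k" if "a \<in> carrier A" for a and k :: nat
    using that by (induction k) (auto simp: assms)
  have rep: "map (\<lambda>i. \<phi> (x i)) (rev (replicate k i)) = replicate k (\<phi> (x i))" for k i
    by simp
  show ?thesis
    using assms(4)
  proof (induction ks)
    case (Cons i ks)
    \<comment> \<open>The multiplicative version is instantiated with the constant map 1 to extract
      its closure statement.\<close>
    then show ?case
      using foldr_power_mult_list[of "\<lambda>_. 1 :: nat" A x ks m] assms(3)
      by (auto simp: assms(1,2) pow rep prod_list_replicate)
  qed (simp add: assms(1))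
qed

lemma ordered_monomial_antihom:
  assumes "\<phi> \<one>\<^bsub>A\<^esub> = 1"
    and "\<And>a b. a \<in> carrier A \<Longrightarrow> b \<in> carrier A \<Longrightarrow> \<phi> (a \<otimes>\<^bsub>A\<^esub> b) = \<phi> b * (\<phi> a :: 'r::monoid_mult)"
    and "monoid A" "x ` {..<n} \<subseteq> carrier A"
  shows "\<phi> (ordered_monomial A n x m) = pl (\<lambda>i. \<phi> (x i)) (rev (mlist n m))"
  unfolding ordered_monomial_def mlist_def
  using foldr_power_mult_list_rev[of \<phi> A x "[0..<n]" m] assms by (auto simp: atLeast0LessThan)

lemma ordered_monomial_cong:
  "(\<And>i. i < n \<Longrightarrow> lookup a i = lookup b i) \<Longrightarrow> ordered_monomial A n x a = ordered_monomial A n x b"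
  unfolding ordered_monomial_def by (rule foldr_cong) auto

lemma ordered_monomial_closed:
  "monoid A \<Longrightarrow> x ` {..<n} \<subseteq> carrier A \<Longrightarrow> ordered_monomial A n x m \<in> carrier A"
  unfolding ordered_monomial_def
  using foldr_power_mult_list[of "\<lambda>_. 1 :: nat" A x "[0..<n]" m] by (auto simp: atLeast0LessThan)

section \<open>An algebra with a monomial basis and its multiplication operators\<close>

locale based_algebra = assoc_algebra "ring_of_type_algebra :: 's::field ring" A
  for A :: "('s::field, 'a) module" (structure) +
  fixes n :: nat and x :: "nat \<Rightarrow> 'a"
  assumes basis: "is_basis A (exponents n) (ordered_monomial A n x)"
begin

sublocale module_over_type A ..

abbreviation "xm \<equiv> ordered_monomial A n x"

lemma xm_closed: "m \<in> exponents n \<Longrightarrow> xm m \<in> carrier A"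
  using basis by (auto simp: is_basis_def)

lemma xm_carrier: "xm ` exponents n \<subseteq> carrier A"
  using xm_closed by auto

text \<open>Exponents from \<open>n\<close> on are ignored, so \<open>xm\<close> takes a value in
  the carrier for every exponent vector (\<open>xm_in\<close>). The representation relies on this,
  as its basis vectors run over the full index type.\<close>

lemma xm_low: "ordered_monomial A n x m = xm (expo (mlist n m))"
  by (rule ordered_monomial_cong) (simp add: lookup_expo count_mlist)

lemma low_exponents: "expo (mlist n m) \<in> exponents n"
  by (rule expo_exponents[OF set_mlist])

lemma xm_in: "xm m \<in> carrier A"
  using xm_closed[OF low_exponents] by (subst xm_low)

definition coords :: "'a \<Rightarrow> (nat \<Rightarrow>\<^sub>0 nat) \<Rightarrow>\<^sub>0 's" where
  "coords a = (THE c. keys c \<subseteq> exponents n \<and> a = lincomb A xm c)"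

lemma lincomb_inject:
  assumes "keys c \<subseteq> exponents n" "keys d \<subseteq> exponents n" "lincomb A xm c = lincomb A xm d"
  shows "c = d"
proof -
  have k: "keys (c - d) \<subseteq> exponents n" using keys_diff[of c d] assms(1,2) by auto
  have cl: "lincomb A xm e \<in> carrier A" for e
    using xm_in by (intro lincomb_closed) auto
  have "lincomb A xm ((c - d) + d) = lincomb A xm (c - d) \<oplus> lincomb A xm d"
    by (rule lincomb_add[OF xm_carrier k assms(2)])
  then have "lincomb A xm d = lincomb A xm (c - d) \<oplus> lincomb A xm d"
    using assms(3) by simp
  then have "lincomb A xm (c - d) = \<zero>"
    using cl by (metis M.add.l_cancel_one' M.a_comm)
  then have "c - d = 0" using basis k by (auto simp: is_basis_def)
  then show ?thesis by simp
qed

lemma coords: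
  assumes "a \<in> carrier A"
  shows "keys (coords a) \<subseteq> exponents n" "lincomb A xm (coords a) = a"
proof -
  have "\<exists>c. keys c \<subseteq> exponents n \<and> a = lincomb A xm c"
    using basis assms by (auto simp: is_basis_def)
  then have "\<exists>!c. keys c \<subseteq> exponents n \<and> a = lincomb A xm c"
    using lincomb_inject by metis
  from theI'[OF this] show "keys (coords a) \<subseteq> exponents n" "lincomb A xm (coords a) = a"
    unfolding coords_def by auto
qed

lemma coords_lincomb: "keys c \<subseteq> exponents n \<Longrightarrow> coords (lincomb A xm c) = c"
  using lincomb_inject coords lincomb_closed[of xm c] xm_in by (metis image_subsetI)

lemma coords_add: "a \<in> carrier A \<Longrightarrow> b \<in> carrier A \<Longrightarrow> coords (a \<oplus> b) = coords a + coords b"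
  using coords_lincomb[of "coords a + coords b"] lincomb_add[OF xm_carrier, of "coords a" "coords b"]
    coords keys_add[of "coords a" "coords b"] by force

lemma coords_smult: "a \<in> carrier A \<Longrightarrow> coords (k \<odot>\<^bsub>A\<^esub> a) = single 0 k * coords a"
  using coords_lincomb[of "single 0 k * coords a"] lincomb_scale[OF xm_carrier, of "coords a"]
    coords keys_scale[of k "coords a"] by force

lemma coords_xm: "m \<in> exponents n \<Longrightarrow> coords (xm m) = single m 1"
  using coords_lincomb[of "single m 1"] lincomb_single[of xm m 1] xm_in smult_one by simp

lemma coords_zero: "coords \<zero> = 0"
  using coords_lincomb[of 0] by (simp add: lincomb_0)

text \<open>Matrix form of a linear map, applied below to left and right multiplication by a fixed
  element.\<close>

lemma coords_map:
  assumes "\<And>w. w \<in> keys c \<Longrightarrow> f (xm w) \<in> carrier A" "f \<zero> = \<zero>"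
    "\<And>a b. a \<in> carrier A \<Longrightarrow> b \<in> carrier A \<Longrightarrow> f (a \<oplus> b) = f a \<oplus> f b"
    "\<And>k a. a \<in> carrier A \<Longrightarrow> f (k \<odot>\<^bsub>A\<^esub> a) = k \<odot>\<^bsub>A\<^esub> f a"
  shows "lin_ext (\<lambda>w. coords (f (xm w))) c = coords (f (lincomb A xm c))"
proof -
  have "lin_ext (\<lambda>w. coords (f (xm w))) c = (\<Sum>w\<in>keys c. single 0 (lookup c w) * coords (f (xm w)))"
    by (simp add: lin_comb_def)
  \<comment> \<open>Membership in the carrier is carried along, since additivity of
    \<open>coords\<close> is available only there.\<close>
  also have "\<dots> = coords (f (\<Oplus>w\<in>I. lookup c w \<odot>\<^bsub>A\<^esub> xm w)) \<and> f (\<Oplus>w\<in>I. lookup c w \<odot>\<^bsub>A\<^esub> xm w) \<in> carrier A"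
    if "I = keys c" for I
  proof -
    have "finite J \<Longrightarrow> J \<subseteq> keys c \<Longrightarrow> (\<Sum>w\<in>J. single 0 (lookup c w) * coords (f (xm w)))
      = coords (f (\<Oplus>w\<in>J. lookup c w \<odot>\<^bsub>A\<^esub> xm w)) \<and> f (\<Oplus>w\<in>J. lookup c w \<odot>\<^bsub>A\<^esub> xm w) \<in> carrier A" for J
    proof (induction J rule: finite_induct)
      case (insert w J)
      have "(\<Oplus>w\<in>insert w J. lookup c w \<odot>\<^bsub>A\<^esub> xm w) = (lookup c w \<odot>\<^bsub>A\<^esub> xm w) \<oplus> (\<Oplus>w\<in>J. lookup c w \<odot>\<^bsub>A\<^esub> xm w)"
        using insert.hyps xm_in by (intro M.finsum_insert) auto
      then have "f (\<Oplus>w\<in>insert w J. lookup c w \<odot>\<^bsub>A\<^esub> xm w) = (lookup c w \<odot>\<^bsub>A\<^esub> f (xm w)) \<oplus> f (\<Oplus>w\<in>J. lookup c w \<odot>\<^bsub>A\<^esub> xm w)"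
        using xm_in by (simp add: assms(3,4) M.finsum_closed)
      then show ?case using insert assms(1) by (simp add: coords_add coords_smult)
    qed (simp add: assms(2) coords_zero)
    from this[of I] show ?thesis using that by simp
  qed
  from this[OF refl] show ?thesis by (simp add: lincomb_def lin_comb_def)
qed

text \<open>The representation of \<open>A \<otimes> A\<^sup>o\<^sup>p\<close> by left and right multiplications on \<open>A \<otimes> A\<close>. For the
  index type \<^typ>\<open>nat \<Rightarrow>\<^sub>0 nat\<close> of the coordinates to be a basis, \<open>A\<close> is tensored with
  a polynomial ring: \<open>u\<close> stands for the monomial in the \<open>x\<^sub>i\<close> with exponents \<open>u\<^sub>i\<close>, \<open>i < n\<close>,
  times the monomial \<open>high u\<close> in new central variables.\<close>

definition high :: "(nat \<Rightarrow>\<^sub>0 nat) \<Rightarrow> (nat \<Rightarrow>\<^sub>0 nat)" where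
  "high u = u - expo (mlist n u)"

lemma low_high: "expo (mlist n u) + high u = u"
  by (rule poly_mapping_eqI) (auto simp: high_def lookup_add lookup_minus lookup_expo count_mlist)

lemma lookup_high: "lookup (high u) i = (if i < n then 0 else lookup u i)"
  by (auto simp: high_def lookup_minus lookup_expo count_mlist)

lemma high_add: "w \<in> exponents n \<Longrightarrow> high (w + high u) = high u"
  by (rule poly_mapping_eqI) (auto simp: lookup_high lookup_add exponents_def in_keys_iff)

lemma xm_add_high: "xm (w + high u) = xm w"
  by (rule ordered_monomial_cong) (simp add: lookup_add lookup_high)

lemma high_zero: "high 0 = 0"
  by (rule poly_mapping_eqI) (simp add: lookup_high)

definition ltab where
  "ltab a = (\<lambda>(u, v). lin_ext (\<lambda>w. single (w + high u, v) 1) (coords (a \<otimes> xm u)))"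

definition rtab where
  "rtab b = (\<lambda>(u, v). lin_ext (\<lambda>w. single (u, w + high v) 1) (coords (xm v \<otimes> b)))"

definition lmul :: "'a \<Rightarrow> ((nat \<Rightarrow>\<^sub>0 nat) \<times> (nat \<Rightarrow>\<^sub>0 nat), 's) endo" where
  "lmul a = endo_of (ltab a)"

definition rmul :: "'a \<Rightarrow> ((nat \<Rightarrow>\<^sub>0 nat) \<times> (nat \<Rightarrow>\<^sub>0 nat), 's) endo" where
  "rmul b = endo_of (rtab b)"

lemma lin_comb_cong_keys: "(\<And>p. p \<in> keys c \<Longrightarrow> F p = H p) \<Longrightarrow> lin_comb \<kappa> F c = lin_comb \<kappa> H c"
  by (simp add: lin_comb_def)

lemma endo_of_eqI: "(\<And>p. T p = S p) \<Longrightarrow> endo_of T = endo_of S"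
  by (metis ext)

lemma endo_of_mult: "endo_of T * endo_of S = endo_of (\<lambda>p. lin_ext T (S p))"
  by (rule endo_eqI) (simp add: app_endo_of lin_ext_lin_ext)

lemma endo_of_add: "endo_of T + endo_of S = endo_of (\<lambda>p. T p + S p)"
  by (rule endo_eqI) (simp add: app_endo_of lin_comb_def sum.distrib distrib_left)

lemma endo_of_scalar: "endo_scalar k * endo_of T = endo_of (\<lambda>p. single 0 k * T p)"
  by (rule endo_eqI) (simp add: app_endo_of app_endo_scalar lin_comb_def sum_distrib_left mult.left_commute)

lemma endo_of_one: "endo_of (\<lambda>p. single p 1) = 1"
  by (rule endo_eqI) (simp add: app_endo_of lin_ext_single_id)

lemma lmul_add: "a \<in> carrier A \<Longrightarrow> b \<in> carrier A \<Longrightarrow> lmul (a \<oplus> b) = lmul a + lmul b"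
  unfolding lmul_def endo_of_add
  by (rule endo_of_eqI) (auto simp: ltab_def xm_in l_distr coords_add single0.lin_comb_add)

lemma rmul_add: "a \<in> carrier A \<Longrightarrow> b \<in> carrier A \<Longrightarrow> rmul (a \<oplus> b) = rmul a + rmul b"
  unfolding rmul_def endo_of_add
  by (rule endo_of_eqI) (auto simp: rtab_def xm_in r_distr coords_add single0.lin_comb_add)

lemma lmul_smult: "a \<in> carrier A \<Longrightarrow> lmul (k \<odot>\<^bsub>A\<^esub> a) = endo_scalar k * lmul a"
  unfolding lmul_def endo_of_scalar
  by (rule endo_of_eqI) (auto simp: ltab_def xm_in smult_mult_left coords_smult lin_ext_scale)

lemma rmul_smult: "a \<in> carrier A \<Longrightarrow> rmul (k \<odot>\<^bsub>A\<^esub> a) = endo_scalar k * rmul a"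
  unfolding rmul_def endo_of_scalar
  by (rule endo_of_eqI) (auto simp: rtab_def xm_in smult_mult_right coords_smult lin_ext_scale)

lemma coords_xm_low: "coords (xm u) = single (expo (mlist n u)) 1"
  by (subst xm_low) (simp add: coords_xm low_exponents)

lemma lmul_one: "lmul \<one> = 1"
  unfolding lmul_def endo_of_one[symmetric]
  by (rule endo_of_eqI) (auto simp: ltab_def xm_in coords_xm_low low_high)

lemma rmul_one: "rmul \<one> = 1"
  unfolding rmul_def endo_of_one[symmetric]
  by (rule endo_of_eqI) (auto simp: rtab_def xm_in coords_xm_low low_high)

lemma lin_ext_coords_mult_left:
  assumes "a \<in> carrier A" "c \<in> carrier A"
  shows "lin_ext (\<lambda>w. coords (a \<otimes> xm w)) (coords c) = coords (a \<otimes> c)"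
  using coords_map[of "coords c" "\<lambda>y. a \<otimes> y"] assms xm_in coords(2)[OF assms(2)]
  by (simp add: r_distr smult_mult_right)

lemma lin_ext_coords_mult_right:
  assumes "b \<in> carrier A" "c \<in> carrier A"
  shows "lin_ext (\<lambda>w. coords (xm w \<otimes> b)) (coords c) = coords (c \<otimes> b)"
  using coords_map[of "coords c" "\<lambda>y. y \<otimes> b"] assms xm_in coords(2)[OF assms(2)]
  by (simp add: l_distr smult_mult_left)

text \<open>After the action of \<open>b\<close> the index is \<open>w + high u\<close> with
  \<open>w\<close> supported below \<open>n\<close>: its high part is again \<open>high u\<close>
  and its monomial is \<open>xm w\<close>. So the additional variables are inert, and the claim
  reduces to associativity in \<open>A\<close>.\<close>

lemma lmul_mult:
  assumes "a \<in> carrier A" "b \<in> carrier A"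
  shows "lmul (a \<otimes> b) = lmul a * lmul b"
  unfolding lmul_def endo_of_mult
proof (rule endo_of_eqI)
  fix p :: "(nat \<Rightarrow>\<^sub>0 nat) \<times> (nat \<Rightarrow>\<^sub>0 nat)"
  obtain u v where p: "p = (u, v)" by force
  have c: "b \<otimes> xm u \<in> carrier A" using assms xm_in by simp
  have "lin_ext (ltab a) (ltab b p)
      = lin_ext (\<lambda>w. lin_ext (\<lambda>w'. single (w' + high (w + high u), v) 1) (coords (a \<otimes> xm (w + high u))))
          (coords (b \<otimes> xm u))"
    by (simp add: p ltab_def[of b] lin_ext_lin_ext) (simp add: ltab_def)
  also have "\<dots> = lin_ext (\<lambda>w. lin_ext (\<lambda>w'. single (w' + high u, v) 1) (coords (a \<otimes> xm w))) (coords (b \<otimes> xm u))"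
    by (rule lin_comb_cong_keys) (use coords(1)[OF c] in \<open>auto simp: high_add xm_add_high subset_eq\<close>)
  also have "\<dots> = lin_ext (\<lambda>w'. single (w' + high u, v) 1) (coords (a \<otimes> (b \<otimes> xm u)))"
    by (simp add: lin_ext_lin_ext[symmetric] lin_ext_coords_mult_left assms c)
  finally show "ltab (a \<otimes> b) p = lin_ext (ltab a) (ltab b p)"
    by (simp add: p ltab_def m_assoc assms xm_in)
qed

text \<open>The reversed order makes \<open>rmul\<close> a representation of the opposite
  algebra.\<close>

lemma rmul_mult:
  assumes "a \<in> carrier A" "b \<in> carrier A"
  shows "rmul (a \<otimes> b) = rmul b * rmul a"
  unfolding rmul_def endo_of_mult
proof (rule endo_of_eqI)
  fix p :: "(nat \<Rightarrow>\<^sub>0 nat) \<times> (nat \<Rightarrow>\<^sub>0 nat)"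
  obtain u v where p: "p = (u, v)" by force
  have c: "xm v \<otimes> a \<in> carrier A" using assms xm_in by simp
  have "lin_ext (rtab b) (rtab a p)
      = lin_ext (\<lambda>w. lin_ext (\<lambda>w'. single (u, w' + high (w + high v)) 1) (coords (xm (w + high v) \<otimes> b)))
          (coords (xm v \<otimes> a))"
    by (simp add: p rtab_def[of a] lin_ext_lin_ext) (simp add: rtab_def)
  also have "\<dots> = lin_ext (\<lambda>w. lin_ext (\<lambda>w'. single (u, w' + high v) 1) (coords (xm w \<otimes> b))) (coords (xm v \<otimes> a))"
    by (rule lin_comb_cong_keys) (use coords(1)[OF c] in \<open>auto simp: high_add xm_add_high subset_eq\<close>)
  also have "\<dots> = lin_ext (\<lambda>w'. single (u, w' + high v) 1) (coords ((xm v \<otimes> a) \<otimes> b))"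
    by (simp add: lin_ext_lin_ext[symmetric] lin_ext_coords_mult_right assms c)
  finally show "rtab (a \<otimes> b) p = lin_ext (rtab b) (rtab a p)"
    by (simp add: p rtab_def m_assoc assms xm_in)
qed

lemma lmul_rmul_commute: "lmul a * rmul b = rmul b * lmul a"
  unfolding rmul_def lmul_def endo_of_mult
proof (rule endo_of_eqI)
  fix p :: "(nat \<Rightarrow>\<^sub>0 nat) \<times> (nat \<Rightarrow>\<^sub>0 nat)"
  obtain u v where p: "p = (u, v)" by force
  have "lin_ext (ltab a) (rtab b p)
      = lin_ext (\<lambda>w. lin_ext (\<lambda>z. single (z + high u, w + high v) 1) (coords (a \<otimes> xm u))) (coords (xm v \<otimes> b))"
    by (simp add: p rtab_def lin_ext_lin_ext) (simp add: ltab_def)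
  also have "\<dots> = lin_ext (\<lambda>z. lin_ext (\<lambda>w. single (z + high u, w + high v) 1) (coords (xm v \<otimes> b))) (coords (a \<otimes> xm u))"
    by (rule lin_ext_swap)
  also have "\<dots> = lin_ext (rtab b) (ltab a p)"
    by (simp add: p ltab_def lin_ext_lin_ext) (simp add: rtab_def)
  finally show "lin_ext (ltab a) (rtab b p) = lin_ext (rtab b) (ltab a p)" .
qed

lemma xm_0: "xm 0 = \<one>"
proof -
  have "foldr (\<lambda>i y. (x i [^] (0::nat)) \<otimes> y) ks \<one> = \<one>" for ks
    by (induction ks) auto
  then show ?thesis by (simp add: ordered_monomial_def)
qed

text \<open>Evaluation on the vector of \<open>1 \<otimes> 1\<close> returns the tensor itself in
  coordinates; this is the source of faithfulness.\<close>

lemma lmul_rmul_unit_vector: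
  assumes "a \<in> exponents n" "b \<in> exponents n"
  shows "app (lmul (xm a) * rmul (xm b)) (single (0, 0) 1) = single (a, b) 1"
proof -
  have "app (rmul (xm b)) (single (0, 0) 1) = single (0, b) 1"
    by (simp add: rmul_def app_endo_of rtab_def xm_0 xm_in coords_xm assms high_zero)
  moreover have "app (lmul (xm a)) (single (0, b) 1) = single (a, b) 1"
    by (simp add: lmul_def app_endo_of ltab_def xm_0 xm_in coords_xm assms high_zero)
  ultimately show ?thesis by simp
qed

lemma lmul_rmul_indep:
  assumes "keys c \<subseteq> exponents n \<times> exponents n"
    and "lin_comb endo_scalar (\<lambda>(a, b). lmul (xm a) * rmul (xm b)) c = 0"
  shows "c = 0"
proof -
  have "c = lin_ext (\<lambda>p. single p 1) c" by (rule lin_ext_single_id[symmetric])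
  also have "\<dots> = (\<Sum>p\<in>keys c. single 0 (lookup c p) * app (case p of (a, b) \<Rightarrow> lmul (xm a) * rmul (xm b)) (single (0, 0) 1))"
    unfolding lin_comb_def
  proof (rule sum.cong[OF refl])
    fix p assume "p \<in> keys c"
    then obtain a b where "p = (a, b)" "a \<in> exponents n" "b \<in> exponents n" using assms(1) by auto
    then show "single 0 (lookup c p) * single p 1
        = single 0 (lookup c p) * app (case p of (a, b) \<Rightarrow> lmul (xm a) * rmul (xm b)) (single (0, 0) 1)"
      using lmul_rmul_unit_vector by simp
  qed
  also have "\<dots> = app (lin_comb endo_scalar (\<lambda>(a, b). lmul (xm a) * rmul (xm b)) c) (single (0, 0) 1)"
    by (simp add: lin_comb_def app_sum app_endo_scalar del: single_zero split: prod.split)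
  finally show ?thesis using assms(2) by simp
qed

end

section \<open>Quotients and the semiclassical limit\<close>

text \<open>The properties of \<open>I\<close> under which the operations of \<open>quot_alg\<close>
  are well defined. \<open>M\<close> is just an abelian group with further operations, because the
  formal sums underlying a tensor product enter without their ring axioms. \<open>R\<close> is
  whichever ring of scalars is in force: Laurent polynomials, \<open>k(q)\<close> or
  \<open>k\<close>.\<close>

locale alg_congruence = abelian_subgroup I M
  for I and M :: "('s, 'a) module" (structure) +
  fixes R :: "'s ring"
  assumes mult_closed: "a \<in> carrier M \<Longrightarrow> b \<in> carrier M \<Longrightarrow> a \<otimes> b \<in> carrier M"
    and one_closed: "\<one> \<in> carrier M"
    and smult_closed: "c \<in> carrier R \<Longrightarrow> a \<in> carrier M \<Longrightarrow> c \<odot>\<^bsub>M\<^esub> a \<in> carrier M"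
    and mult_cong: "\<lbrakk>a \<in> carrier M; a' \<in> carrier M; b \<in> carrier M; b' \<in> carrier M;
      a \<ominus> a' \<in> I; b \<ominus> b' \<in> I\<rbrakk> \<Longrightarrow> a \<otimes> b \<ominus> a' \<otimes> b' \<in> I"
    and smult_cong: "\<lbrakk>c \<in> carrier R; a \<in> carrier M; a' \<in> carrier M; a \<ominus> a' \<in> I\<rbrakk>
      \<Longrightarrow> c \<odot>\<^bsub>M\<^esub> a \<ominus> c \<odot>\<^bsub>M\<^esub> a' \<in> I"
begin

lemma coset_eq_iff:
  assumes "a \<in> carrier M" "b \<in> carrier M"
  shows "I +> a = I +> b \<longleftrightarrow> a \<ominus> b \<in> I"
proof
  assume "I +> a = I +> b"
  then have "a \<in> I +> b" using a_rcos_self[OF assms(1)] by simp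
  then show "a \<ominus> b \<in> I" using a_rcos_module[OF assms(2,1)] by (simp add: minus_eq)
next
  assume "a \<ominus> b \<in> I"
  then have "a \<in> I +> b" using a_rcos_module[OF assms(2,1)] by (simp add: minus_eq)
  then show "I +> a = I +> b" using a_repr_independence'[OF _ assms(2)] by blast
qed

lemma mem_coset_iff:
  assumes "a \<in> carrier M"
  shows "b \<in> I +> a \<longleftrightarrow> b \<in> carrier M \<and> b \<ominus> a \<in> I"
  using a_rcos_module[OF assms, of b] a_elemrcos_carrier[OF assms, of b] by (auto simp: minus_eq)

lemma quot_carrier: "carrier (quot_alg M I) = (\<lambda>a. I +> a) ` carrier M"
  by (auto simp: quot_alg_def FactRing_def A_RCOSETS_def')

lemma quot_add:
  "a \<in> carrier M \<Longrightarrow> b \<in> carrier M \<Longrightarrow> (I +> a) \<oplus>\<^bsub>quot_alg M I\<^esub> (I +> b) = I +> (a \<oplus> b)"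
  by (simp add: quot_alg_def FactRing_def a_rcos_sum)

text \<open>Products and multiples in \<open>quot_alg\<close> are unions of cosets over all
  representatives; such a union collapses once its members agree.\<close>

lemma Union_cosets:
  assumes "S \<noteq> {}" "\<And>s. s \<in> S \<Longrightarrow> F s = c"
  shows "(\<Union>s\<in>S. F s) = c"
  using assms by auto

lemma quot_mult:
  assumes "a \<in> carrier M" "b \<in> carrier M"
  shows "(I +> a) \<otimes>\<^bsub>quot_alg M I\<^esub> (I +> b) = I +> (a \<otimes> b)"
proof -
  have "(\<Union>x\<in>I +> a. \<Union>y\<in>I +> b. I +> (x \<otimes> y)) = I +> (a \<otimes> b)"
  proof (intro Union_cosets)
    fix x y assume "x \<in> I +> a" "y \<in> I +> b"
    then have "x \<in> carrier M" "x \<ominus> a \<in> I" "y \<in> carrier M" "y \<ominus> b \<in> I"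
      using mem_coset_iff assms by auto
    then show "I +> (x \<otimes> y) = I +> (a \<otimes> b)"
      using assms by (subst coset_eq_iff) (auto intro: mult_closed mult_cong)
  qed (use a_rcos_self assms in auto)
  then show ?thesis by (simp add: quot_alg_def FactRing_def rcoset_mult_def)
qed

lemma quot_smult:
  assumes "c \<in> carrier R" "a \<in> carrier M"
  shows "c \<odot>\<^bsub>quot_alg M I\<^esub> (I +> a) = I +> (c \<odot>\<^bsub>M\<^esub> a)"
proof -
  have "(\<Union>x\<in>I +> a. I +> (c \<odot>\<^bsub>M\<^esub> x)) = I +> (c \<odot>\<^bsub>M\<^esub> a)"
  proof (intro Union_cosets)
    fix x assume "x \<in> I +> a"
    then have "x \<in> carrier M" "x \<ominus> a \<in> I"
      using mem_coset_iff assms by auto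
    then show "I +> (c \<odot>\<^bsub>M\<^esub> x) = I +> (c \<odot>\<^bsub>M\<^esub> a)"
      using assms by (subst coset_eq_iff) (auto intro: smult_closed smult_cong)
  qed (use a_rcos_self assms in auto)
  then show ?thesis by (simp add: quot_alg_def)
qed

lemma quot_one: "\<one>\<^bsub>quot_alg M I\<^esub> = I +> \<one>"
  by (simp add: quot_alg_def FactRing_def)

lemma quot_zero: "\<zero>\<^bsub>quot_alg M I\<^esub> = I +> \<zero>"
  using a_rcos_const zero_closed by (simp add: quot_alg_def FactRing_def)

text \<open>The target \<open>B\<close> is just a record, so that a subset of a ring type may serve.
  The kernel condition is stated for pairs, which gives well-definedness and injectivity at
  once.\<close>

lemma first_isomorphism:
  assumes hom: "\<And>a. a \<in> carrier M \<Longrightarrow> f a \<in> carrier B"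
      "\<And>a b. a \<in> carrier M \<Longrightarrow> b \<in> carrier M \<Longrightarrow> f (a \<otimes> b) = f a \<otimes>\<^bsub>B\<^esub> f b"
      "\<And>a b. a \<in> carrier M \<Longrightarrow> b \<in> carrier M \<Longrightarrow> f (a \<oplus> b) = f a \<oplus>\<^bsub>B\<^esub> f b"
      "f \<one> = \<one>\<^bsub>B\<^esub>"
      "\<And>c a. c \<in> carrier R \<Longrightarrow> a \<in> carrier M \<Longrightarrow> f (c \<odot>\<^bsub>M\<^esub> a) = c \<odot>\<^bsub>B\<^esub> f a"
    and ker: "\<And>a b. a \<in> carrier M \<Longrightarrow> b \<in> carrier M \<Longrightarrow> f a = f b \<longleftrightarrow> a \<ominus> b \<in> I"
    and surj: "carrier B \<subseteq> f ` carrier M"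
  shows "(\<lambda>W. the_elem (f ` W)) \<in> alg_iso R (quot_alg M I) B"
    and "\<And>a. a \<in> carrier M \<Longrightarrow> the_elem (f ` (I +> a)) = f a"
proof -
  show val: "the_elem (f ` (I +> a)) = f a" if a: "a \<in> carrier M" for a
  proof -
    have "f y = f a" if "y \<in> I +> a" for y
      using that ker a mem_coset_iff[OF a] by blast
    then have "f ` (I +> a) = {f a}" using a_rcos_self[OF a] by blast
    then show ?thesis by simp
  qed
  have "inj_on (\<lambda>W. the_elem (f ` W)) (carrier (quot_alg M I))"
  proof (rule inj_onI, unfold quot_carrier, elim imageE)
    fix W V a b
    assume *: "the_elem (f ` W) = the_elem (f ` V)" "W = I +> a" "V = I +> b" "a \<in> carrier M" "b \<in> carrier M"
    then have "f a = f b" by (simp add: val)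
    then show "W = V" using coset_eq_iff ker * by auto
  qed
  moreover have "(\<lambda>W. the_elem (f ` W)) ` carrier (quot_alg M I) = carrier B"
  proof -
    have "(\<lambda>W. the_elem (f ` W)) ` carrier (quot_alg M I) = f ` carrier M"
      unfolding quot_carrier image_image by (rule image_cong) (auto simp: val)
    also have "\<dots> = carrier B" using surj hom(1) by (auto intro!: equalityI)
    finally show ?thesis .
  qed
  ultimately show "(\<lambda>W. the_elem (f ` W)) \<in> alg_iso R (quot_alg M I) B"
    unfolding alg_iso_def ring_iso_def bij_betw_def mem_Collect_eq
  proof (intro conjI ring_hom_memI ballI)
    fix c W assume "c \<in> carrier R" "W \<in> carrier (quot_alg M I)"
    then show "the_elem (f ` (c \<odot>\<^bsub>quot_alg M I\<^esub> W)) = c \<odot>\<^bsub>B\<^esub> the_elem (f ` W)"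
      unfolding quot_carrier by (elim imageE) (simp add: val quot_smult hom smult_closed)
  next
    fix W V assume "W \<in> carrier (quot_alg M I)" "V \<in> carrier (quot_alg M I)"
    then show "the_elem (f ` (W \<otimes>\<^bsub>quot_alg M I\<^esub> V)) = the_elem (f ` W) \<otimes>\<^bsub>B\<^esub> the_elem (f ` V)"
      "the_elem (f ` (W \<oplus>\<^bsub>quot_alg M I\<^esub> V)) = the_elem (f ` W) \<oplus>\<^bsub>B\<^esub> the_elem (f ` V)"
      unfolding quot_carrier
      by (elim imageE, simp add: val quot_mult quot_add hom mult_closed a_closed)+
  next
    fix W assume "W \<in> carrier (quot_alg M I)"
    then show "the_elem (f ` W) \<in> carrier B"
      unfolding quot_carrier by (elim imageE) (simp add: val hom)
  qed (simp_all add: quot_one val one_closed hom)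
qed

end

text \<open>Group axioms are pulled back along an injection into a class-based group. The second
  conclusion identifies the subtraction of the record, which is otherwise hidden behind its defined
  inverse.\<close>

lemma abelian_group_of_inj:
  fixes v :: "'a \<Rightarrow> 'r::ab_group_add"
  assumes "inj_on v (carrier B)" "\<zero>\<^bsub>B\<^esub> \<in> carrier B" "v \<zero>\<^bsub>B\<^esub> = 0"
    and cl: "\<And>a b. a \<in> carrier B \<Longrightarrow> b \<in> carrier B \<Longrightarrow> a \<oplus>\<^bsub>B\<^esub> b \<in> carrier B"
    and add: "\<And>a b. a \<in> carrier B \<Longrightarrow> b \<in> carrier B \<Longrightarrow> v (a \<oplus>\<^bsub>B\<^esub> b) = v a + v b"
    and neg: "\<And>a. a \<in> carrier B \<Longrightarrow> - v a \<in> v ` carrier B"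
  shows "abelian_group B" "\<And>a b. a \<in> carrier B \<Longrightarrow> b \<in> carrier B \<Longrightarrow> v (a \<ominus>\<^bsub>B\<^esub> b) = v a - v b"
proof -
  show B: "abelian_group B"
  proof (rule abelian_groupI)
    fix a assume a: "a \<in> carrier B"
    then obtain b where "b \<in> carrier B" "v b = - v a" using neg by (metis imageE)
    then show "\<exists>y\<in>carrier B. y \<oplus>\<^bsub>B\<^esub> a = \<zero>\<^bsub>B\<^esub>"
      using a assms by (intro bexI[of _ b]) (auto intro!: inj_onD[OF assms(1)])
  qed (use assms in \<open>auto intro!: inj_onD[OF assms(1)] simp: add_ac\<close>)
  then interpret abelian_group B .
  show "v (a \<ominus>\<^bsub>B\<^esub> b) = v a - v b" if "a \<in> carrier B" "b \<in> carrier B" for a b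
  proof -
    have "v (a \<ominus>\<^bsub>B\<^esub> b) + v b = v ((a \<ominus>\<^bsub>B\<^esub> b) \<oplus>\<^bsub>B\<^esub> b)"
      using that by (simp add: add)
    also have "(a \<ominus>\<^bsub>B\<^esub> b) \<oplus>\<^bsub>B\<^esub> b = a"
      using that by (simp add: minus_eq a_assoc l_neg)
    finally show ?thesis by (simp add: eq_diff_eq)
  qed
qed

lemma ordered_monomial_carrier_update:
  "ordered_monomial (A\<lparr>carrier := S\<rparr>) n x m = ordered_monomial A n x m"
  by (simp add: ordered_monomial_def nat_pow_def)

lemma a_r_coset_carrier_update: "I +>\<^bsub>A\<lparr>carrier := S\<rparr>\<^esub> a = I +>\<^bsub>A\<^esub> a"
  by (simp add: a_r_coset_def r_coset_def)

text \<open>For a Laurent polynomial \<open>l\<close>, \<open>res l\<close> is its value at \<open>q = 1\<close>; for other elements of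
  \<open>k(q)\<close> the value is meaningless.\<close>

definition res :: "'k::field_char_0 poly fract \<Rightarrow> 'k" where
  "res l = (SOME c. \<exists>l'\<in>laurent. l = const c + (qq - 1) * l')"

definition quo :: "'k::field_char_0 poly fract \<Rightarrow> 'k poly fract" where
  "quo l = (l - const (res l)) / (qq - 1)"

lemma res_quo:
  assumes "l \<in> laurent"
  shows "l = const (res l) + (qq - 1) * quo l" "quo l \<in> laurent"
proof -
  have "\<exists>l'\<in>laurent. l = const (res l) + (qq - 1) * l'"
    unfolding res_def using laurent_decomp[OF assms] by (rule someI_ex)
  then obtain l' where l': "l' \<in> laurent" "l = const (res l) + (qq - 1) * l'" by blast
  have "l - const (res l) = (qq - 1) * l'" by (subst l'(2)) (rule add_diff_cancel_left')
  then have q: "quo l = l'"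
    unfolding quo_def by (simp only: nonzero_mult_div_cancel_left[OF qq_minus_1_nonzero])
  show "l = const (res l) + (qq - 1) * quo l" unfolding q by (rule l'(2))
  show "quo l \<in> laurent" unfolding q by (rule l'(1))
qed

lemma res_0: "res 0 = 0"
proof (rule const_eq_mult)
  show "const (res 0) = (qq - 1) * - quo 0"
    using res_quo(1)[OF laurent_zero, symmetric] by (simp only: mult_minus_right eq_neg_iff_add_eq_0)
  show "- quo 0 \<in> (laurent :: 'a poly fract set)"
    by (rule laurent_minus[OF res_quo(2)[OF laurent_zero]])
qed

lemma lookup_map_0: "f 0 = 0 \<Longrightarrow> lookup (Poly_Mapping.map f c) p = f (lookup c p)"
  by (simp add: map.rep_eq when_def)

lemma keys_map_subset: "keys (Poly_Mapping.map f c) \<subseteq> keys c"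
  by (auto simp: in_keys_iff map.rep_eq when_def)

section \<open>The semiclassical limit of \<open>S\<close>\<close>

locale quantization = based_algebra A n x
  for A :: "('k::field_char_0 poly fract, 'a) module" (structure) and n x +
  fixes S :: "'a set"
  assumes S_subalgebra: "is_subalgebra laurent_ring S A"
    and x_S: "i < n \<Longrightarrow> x i \<in> S"
    and spec_cring: "cring (specialization A S)"
    and spec_poly: "is_polynomial_algebra_on n (specialization A S) (\<lambda>i. spec_image A S (x i))"
begin

lemma S_closed:
  shows "S \<subseteq> carrier A" "\<zero> \<in> S" "\<one> \<in> S" "a \<in> S \<Longrightarrow> \<ominus> a \<in> S"
    "a \<in> S \<Longrightarrow> b \<in> S \<Longrightarrow> a \<otimes> b \<in> S" "a \<in> S \<Longrightarrow> b \<in> S \<Longrightarrow> a \<oplus> b \<in> S"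
    "c \<in> laurent \<Longrightarrow> a \<in> S \<Longrightarrow> c \<odot>\<^bsub>A\<^esub> a \<in> S"
  using S_subalgebra subringE[of S A] by (auto simp: is_subalgebra_def)

lemma S_carrier [simp]: "a \<in> S \<Longrightarrow> a \<in> carrier A"
  using S_closed(1) by blast

lemma smult_swap: "a \<in> carrier A \<Longrightarrow> c \<odot>\<^bsub>A\<^esub> (d \<odot>\<^bsub>A\<^esub> a) = d \<odot>\<^bsub>A\<^esub> (c \<odot>\<^bsub>A\<^esub> a)"
  using smult_assoc1[of c d a] smult_assoc1[of d c a] by (simp add: mult.commute)

lemma S_minus: "a \<in> S \<Longrightarrow> b \<in> S \<Longrightarrow> a \<ominus> b \<in> S"
  by (simp add: M.minus_eq S_closed)

abbreviation "AS \<equiv> A\<lparr>carrier := S\<rparr>"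
abbreviation "hS \<equiv> q_minus_1_ideal A S"

lemma AS_ring: "ring AS"
  using S_subalgebra subring_is_ring by (simp add: is_subalgebra_def)

lemma hS_iff: "a \<in> hS \<longleftrightarrow> (\<exists>s\<in>S. a = (qq - 1) \<odot>\<^bsub>A\<^esub> s)"
  by (auto simp: q_minus_1_ideal_def)

lemma hS_S: "hS \<subseteq> S"
  using S_closed(7)[OF qq_minus_1_laurent] by (auto simp: hS_iff)

lemma AS_uminus: "a \<in> S \<Longrightarrow> \<ominus>\<^bsub>AS\<^esub> a = \<ominus> a"
  using M.add.m_inv_consistent[of S a] S_subalgebra
  by (simp add: a_inv_def is_subalgebra_def subring_def)

lemma AS_minus: "a \<in> S \<Longrightarrow> b \<in> S \<Longrightarrow> a \<ominus>\<^bsub>AS\<^esub> b = a \<ominus> b"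
  by (simp add: a_minus_def AS_uminus)

lemma hS_sub: "additive_subgroup hS AS"
proof -
  interpret AS: ring AS by (rule AS_ring)
  show ?thesis
  proof (rule AS.add.subgroupI[THEN additive_subgroup.intro])
    show "hS \<subseteq> carrier AS" using hS_S by simp
    show "hS \<noteq> {}" using S_closed(2) by (auto simp: q_minus_1_ideal_def)
    fix a assume a: "a \<in> hS"
    then obtain s where s: "s \<in> S" "a = (qq - 1) \<odot>\<^bsub>A\<^esub> s" by (auto simp: hS_iff)
    have "\<ominus>\<^bsub>AS\<^esub> a = (qq - 1) \<odot>\<^bsub>A\<^esub> (\<ominus> s)"
    proof -
      have "\<ominus>\<^bsub>AS\<^esub> a = \<ominus> a" using AS_uminus a hS_S by blast
      also have "\<dots> = (qq - 1) \<odot>\<^bsub>A\<^esub> (\<ominus> s)"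
        using smult_r_minus[of "qq - 1" s] s S_closed(1) by auto
      finally show ?thesis .
    qed
    then show "\<ominus>\<^bsub>AS\<^esub> a \<in> hS" using s S_closed(4) by (auto simp: hS_iff)
    fix b assume "b \<in> hS"
    then obtain t where t: "t \<in> S" "b = (qq - 1) \<odot>\<^bsub>A\<^esub> t" by (auto simp: hS_iff)
    have "a \<oplus>\<^bsub>AS\<^esub> b = (qq - 1) \<odot>\<^bsub>A\<^esub> (s \<oplus> t)"
      using s t by (simp add: smult_r_distr)
    then show "a \<oplus>\<^bsub>AS\<^esub> b \<in> hS" using s t S_closed(6) by (auto simp: hS_iff)
  qed
qed

lemma hS_mult:
  assumes "a \<in> hS" "s \<in> S" shows "a \<otimes> s \<in> hS" "s \<otimes> a \<in> hS"
  using assms S_closed(1,5) by (auto simp: hS_iff smult_mult_left smult_mult_right subset_eq)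

lemma spec_congruence: "alg_congruence hS AS laurent_ring"
proof -
  interpret AS: ring AS by (rule AS_ring)
  have sub: "abelian_subgroup hS AS"
    by (rule abelian_subgroupI3[OF hS_sub]) unfold_locales
  interpret hS: abelian_subgroup hS AS by (rule sub)
  show "alg_congruence hS AS laurent_ring"
  proof (rule alg_congruence.intro[OF sub], unfold_locales)
    fix a a' b b'
    assume *: "a \<in> carrier AS" "a' \<in> carrier AS" "b \<in> carrier AS" "b' \<in> carrier AS"
      "a \<ominus>\<^bsub>AS\<^esub> a' \<in> hS" "b \<ominus>\<^bsub>AS\<^esub> b' \<in> hS"
    have "a \<otimes> b \<ominus> a' \<otimes> b' = (a \<ominus> a') \<otimes> b \<oplus> a' \<otimes> (b \<ominus> b')"
      using *
      by (simp add: M.minus_eq l_distr r_distr l_minus r_minus M.a_assoc M.r_neg1)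
    moreover have "(a \<ominus> a') \<otimes> b \<in> hS" "a' \<otimes> (b \<ominus> b') \<in> hS"
      using * hS_mult AS_minus by simp_all
    moreover have "c \<oplus> d \<in> hS" if "c \<in> hS" "d \<in> hS" for c d
      using hS.a_closed[OF that] by simp
    ultimately show "a \<otimes>\<^bsub>AS\<^esub> b \<ominus>\<^bsub>AS\<^esub> a' \<otimes>\<^bsub>AS\<^esub> b' \<in> hS"
      using * S_closed(5) AS_minus by simp
  next
    fix c :: "'k poly fract" and a a' assume *: "c \<in> laurent" "a \<in> carrier AS" "a' \<in> carrier AS" "a \<ominus>\<^bsub>AS\<^esub> a' \<in> hS"
    have "c \<odot>\<^bsub>A\<^esub> a \<ominus> c \<odot>\<^bsub>A\<^esub> a' = c \<odot>\<^bsub>A\<^esub> (a \<ominus> a')"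
      using * by (simp add: M.minus_eq smult_r_distr smult_r_minus)
    also have "\<dots> \<in> hS"
    proof -
      obtain s where s: "s \<in> S" "a \<ominus> a' = (qq - 1) \<odot>\<^bsub>A\<^esub> s" using * AS_minus by (auto simp: hS_iff)
      then have "c \<odot>\<^bsub>A\<^esub> (a \<ominus> a') = (qq - 1) \<odot>\<^bsub>A\<^esub> (c \<odot>\<^bsub>A\<^esub> s)"
        using smult_swap[of s c "qq - 1"] by simp
      then show ?thesis using S_closed(7)[OF *(1) s(1)] by (auto simp: hS_iff)
    qed
    finally show "c \<odot>\<^bsub>AS\<^esub> a \<ominus>\<^bsub>AS\<^esub> c \<odot>\<^bsub>AS\<^esub> a' \<in> hS"
      using * S_closed(7) AS_minus by simp
  qed (simp_all add: S_closed)
qed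

end

lemma ordered_monomial_record_hom:
  assumes "\<phi> \<one>\<^bsub>A\<^esub> = \<one>\<^bsub>B\<^esub>"
    and "\<And>a b. a \<in> carrier A \<Longrightarrow> b \<in> carrier A \<Longrightarrow> \<phi> (a \<otimes>\<^bsub>A\<^esub> b) = \<phi> a \<otimes>\<^bsub>B\<^esub> \<phi> b"
    and "monoid A" "x ` {..<n} \<subseteq> carrier A"
  shows "\<phi> (ordered_monomial A n x m) = ordered_monomial B n (\<lambda>i. \<phi> (x i)) m"
proof -
  interpret A: monoid A by fact
  have pow: "\<phi> (a [^]\<^bsub>A\<^esub> k) = \<phi> a [^]\<^bsub>B\<^esub> k" if "a \<in> carrier A" for a and k :: nat
    using that
  proof (induction k)
    case (Suc k)
    have "\<phi> a [^]\<^bsub>B\<^esub> Suc k = \<phi> a [^]\<^bsub>B\<^esub> k \<otimes>\<^bsub>B\<^esub> \<phi> a" by (simp add: nat_pow_def)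
    then show ?case using Suc by (simp add: assms(2))
  qed (simp add: nat_pow_def assms(1))
  have "foldr (\<lambda>i y. (x i [^]\<^bsub>A\<^esub> lookup m i) \<otimes>\<^bsub>A\<^esub> y) ks \<one>\<^bsub>A\<^esub> \<in> carrier A \<and>
    \<phi> (foldr (\<lambda>i y. (x i [^]\<^bsub>A\<^esub> lookup m i) \<otimes>\<^bsub>A\<^esub> y) ks \<one>\<^bsub>A\<^esub>)
      = foldr (\<lambda>i y. (\<phi> (x i) [^]\<^bsub>B\<^esub> lookup m i) \<otimes>\<^bsub>B\<^esub> y) ks \<one>\<^bsub>B\<^esub>" if "x ` set ks \<subseteq> carrier A" for ks
    using that by (induction ks) (simp_all add: assms(1,2) pow)
  from this[of "[0..<n]"] assms(4) show ?thesis by (simp add: ordered_monomial_def atLeast0LessThan)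
qed

context quantization
begin

abbreviation "Sp \<equiv> specialization A S"
abbreviation "bar s \<equiv> hS +>\<^bsub>AS\<^esub> s"
abbreviation "cmap p \<equiv> Poly_Mapping.map const p"
text \<open>Lift of a polynomial over \<open>k\<close> to \<open>S\<close>, with constant
  coefficients and ordered monomials. By \<open>bij_eval\<close> these lifts represent each class
  modulo \<open>q - 1\<close> exactly once.\<close>

abbreviation "cp p \<equiv> lincomb A xm (cmap p)"

lemma spec_image_bar: "spec_image A S = (\<lambda>s. bar s)"
  by (rule ext) (simp add: spec_image_def a_r_coset_carrier_update)

lemma Sp_simps:
  "carrier Sp = (\<lambda>s. bar s) ` S" "\<one>\<^bsub>Sp\<^esub> = bar \<one>" "\<zero>\<^bsub>Sp\<^esub> = bar \<zero>"
  "a \<in> S \<Longrightarrow> b \<in> S \<Longrightarrow> bar a \<otimes>\<^bsub>Sp\<^esub> bar b = bar (a \<otimes> b)"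
  "a \<in> S \<Longrightarrow> b \<in> S \<Longrightarrow> bar a \<oplus>\<^bsub>Sp\<^esub> bar b = bar (a \<oplus> b)"
  "a \<in> S \<Longrightarrow> c \<odot>\<^bsub>Sp\<^esub> bar a = bar (const c \<odot>\<^bsub>A\<^esub> a)"
proof -
  interpret spec: alg_congruence hS AS laurent_ring by (rule spec_congruence)
  show "carrier Sp = (\<lambda>s. bar s) ` S" "\<one>\<^bsub>Sp\<^esub> = bar \<one>" "\<zero>\<^bsub>Sp\<^esub> = bar \<zero>"
    using spec.quot_carrier spec.quot_one spec.quot_zero
    by (simp_all add: specialization_def restrict_scalars_def)
  show "bar a \<otimes>\<^bsub>Sp\<^esub> bar b = bar (a \<otimes> b)" "bar a \<oplus>\<^bsub>Sp\<^esub> bar b = bar (a \<oplus> b)" if "a \<in> S" "b \<in> S"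
    using spec.quot_mult[of a b] spec.quot_add[of a b] that
    by (simp_all add: specialization_def restrict_scalars_def)
  show "c \<odot>\<^bsub>Sp\<^esub> bar a = bar (const c \<odot>\<^bsub>A\<^esub> a)" if "a \<in> S"
    using spec.quot_smult[OF const_laurent, of a c] that
    by (simp add: specialization_def restrict_scalars_def)
qed

lemma bar_eq_iff: "a \<in> S \<Longrightarrow> b \<in> S \<Longrightarrow> bar a = bar b \<longleftrightarrow> a \<ominus> b \<in> hS"
  using alg_congruence.coset_eq_iff[OF spec_congruence, of a b] by (simp add: AS_minus)

lemma commutator_hS: assumes "a \<in> S" "b \<in> S" shows "a \<otimes> b \<ominus> b \<otimes> a \<in> hS"
proof -
  interpret Sp: cring Sp by (rule spec_cring)
  have "bar a \<otimes>\<^bsub>Sp\<^esub> bar b = bar b \<otimes>\<^bsub>Sp\<^esub> bar a"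
    by (rule Sp.m_comm) (use assms in \<open>auto simp: Sp_simps(1)\<close>)
  then show ?thesis using assms by (simp add: Sp_simps bar_eq_iff S_closed)
qed

lemma xm_S: "xm m \<in> S"
proof -
  have "monoid AS" using AS_ring by (simp add: ring_def)
  then have "ordered_monomial AS n x m \<in> carrier AS"
    by (rule ordered_monomial_closed) (use x_S in auto)
  then show ?thesis by (simp add: ordered_monomial_carrier_update)
qed

lemma finsum_S:
  assumes "finite J" "\<And>m. m \<in> J \<Longrightarrow> f m \<in> S"
  shows "(\<Oplus>m\<in>J. f m) \<in> S"
  using assms
proof (induction J rule: finite_induct)
  case (insert m J)
  have "(\<Oplus>m\<in>insert m J. f m) = f m \<oplus> (\<Oplus>m\<in>J. f m)"
    using insert by (intro M.finsum_insert) auto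
  then show ?case using insert S_closed(6) by simp
qed (simp add: S_closed)

lemma lincomb_S: "(\<And>m. lookup c m \<in> laurent) \<Longrightarrow> lincomb A xm c \<in> S"
  unfolding lincomb_def by (intro finsum_S S_closed(7) xm_S) auto

lemma cp_S: "cp p \<in> S"
  by (rule lincomb_S) (simp add: lookup_map_0 const_laurent)

lemma eval_bar: "mpoly_eval n Sp (\<lambda>i. spec_image A S (x i)) p = bar (cp p)"
proof -
  interpret Sp: cring Sp by (rule spec_cring)
  have mon: "monoid AS" using AS_ring by (simp add: ring_def)
  have om: "ordered_monomial Sp n (\<lambda>i. spec_image A S (x i)) m = bar (xm m)" for m
    using ordered_monomial_record_hom[of "\<lambda>s. bar s" AS Sp x n m] mon x_S
    by (auto simp: Sp_simps spec_image_bar ordered_monomial_carrier_update)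
  have sum: "(\<Oplus>\<^bsub>Sp\<^esub>m\<in>J. lookup p m \<odot>\<^bsub>Sp\<^esub> bar (xm m)) = bar (\<Oplus>m\<in>J. const (lookup p m) \<odot>\<^bsub>A\<^esub> xm m)"
    if "finite J" for J
    using that
  proof (induction J rule: finite_induct)
    case empty
    then show ?case by (simp add: Sp_simps)
  next
    case (insert m J)
    have f: "const (lookup p m) \<odot>\<^bsub>A\<^esub> xm m \<in> S" for m
      by (intro S_closed const_laurent xm_S)
    have c: "lookup p m \<odot>\<^bsub>Sp\<^esub> bar (xm m) = bar (const (lookup p m) \<odot>\<^bsub>A\<^esub> xm m)" for m
      by (rule Sp_simps(6)[OF xm_S])
    have "(\<Oplus>\<^bsub>Sp\<^esub>m\<in>insert m J. lookup p m \<odot>\<^bsub>Sp\<^esub> bar (xm m))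
        = (lookup p m \<odot>\<^bsub>Sp\<^esub> bar (xm m)) \<oplus>\<^bsub>Sp\<^esub> (\<Oplus>\<^bsub>Sp\<^esub>m\<in>J. lookup p m \<odot>\<^bsub>Sp\<^esub> bar (xm m))"
      using insert.hyps f by (intro Sp.finsum_insert) (auto simp: c Sp_simps(1))
    also have "\<dots> = bar ((const (lookup p m) \<odot>\<^bsub>A\<^esub> xm m) \<oplus> (\<Oplus>m\<in>J. const (lookup p m) \<odot>\<^bsub>A\<^esub> xm m))"
      unfolding insert.IH unfolding c by (rule Sp_simps(5)[OF f finsum_S[OF insert.hyps(1) f]])
    also have "(const (lookup p m) \<odot>\<^bsub>A\<^esub> xm m) \<oplus> (\<Oplus>m\<in>J. const (lookup p m) \<odot>\<^bsub>A\<^esub> xm m)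
       = (\<Oplus>m\<in>insert m J. const (lookup p m) \<odot>\<^bsub>A\<^esub> xm m)"
      using insert.hyps f by (intro M.finsum_insert[symmetric]) auto
    finally show ?case .
  qed
  have "xm ` keys p \<subseteq> carrier A" using xm_in by blast
  then have "cp p = (\<Oplus>m\<in>keys p. const (lookup p m) \<odot>\<^bsub>A\<^esub> xm m)"
    by (subst lincomb_superset[of xm "keys p"]) (auto simp: keys_map_subset lookup_map_0)
  then show ?thesis
    by (simp add: mpoly_eval_def lincomb_def[of Sp] om sum)
qed

lemma eval_iso: "mpoly_eval n Sp (\<lambda>i. spec_image A S (x i)) \<in> alg_iso base_field (mpoly_alg n) Sp"
  using spec_poly by (simp add: is_polynomial_algebra_on_def)

lemma bij_eval: "bij_betw (\<lambda>p. bar (cp p)) {p. keys p \<subseteq> exponents n} ((\<lambda>s. bar s) ` S)"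
  using eval_iso unfolding alg_iso_def ring_iso_def
  by (simp add: eval_bar[abs_def] Sp_simps(1) monoid_alg_def)

lemma S_approx:
  assumes "s \<in> S" shows "\<exists>p. keys p \<subseteq> exponents n \<and> s \<ominus> cp p \<in> hS"
proof -
  have "bar s \<in> (\<lambda>p. bar (cp p)) ` {p. keys p \<subseteq> exponents n}"
    using bij_eval assms unfolding bij_betw_def by auto
  then obtain p where "keys p \<subseteq> exponents n" "bar s = bar (cp p)" by auto
  then show ?thesis using bar_eq_iff[OF assms cp_S] by blast
qed

lemma cp_0: "cp 0 = \<zero>"
proof -
  have "cmap (0 :: (nat \<Rightarrow>\<^sub>0 nat) \<Rightarrow>\<^sub>0 'k) = 0" by (rule poly_mapping_eqI) (simp add: lookup_map_0)
  then show ?thesis by (simp add: lincomb_0)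
qed

lemma cp_hS:
  assumes "keys p \<subseteq> exponents n" "cp p \<in> hS" shows "p = 0"
proof -
  have "cp p \<ominus> \<zero> \<in> hS" using assms(2) cp_S[of p] by (simp add: M.minus_eq)
  then have "bar (cp p) = bar (cp 0)"
    unfolding cp_0 using bar_eq_iff[OF cp_S S_closed(2)] by blast
  then show ?thesis
    using inj_onD[OF bij_betw_imp_inj_on[OF bij_eval], of p 0] assms(1) by simp
qed

text \<open>Each Laurent coefficient is its value at \<open>q = 1\<close> plus a Laurent multiple of
  \<open>q - 1\<close>.\<close>

lemma lincomb_split:
  assumes "keys d \<subseteq> exponents n" "\<And>m. lookup d m \<in> laurent"
  shows "lincomb A xm d = cp (Poly_Mapping.map res d) \<oplus> ((qq - 1) \<odot>\<^bsub>A\<^esub> lincomb A xm (Poly_Mapping.map quo d))"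
proof -
  have quo0: "quo 0 = (0 :: 'k poly fract)" by (simp add: quo_def res_0)
  have "d = cmap (Poly_Mapping.map res d) + single 0 (qq - 1) * Poly_Mapping.map quo d"
    (is "d = ?a + ?b")
  proof (rule poly_mapping_eqI)
    fix m
    show "lookup d m = lookup (?a + ?b) m"
      using res_quo(1)[OF assms(2)[of m]]
      by (simp only: lookup_add lookup_scale lookup_map_0[where f = quo, OF quo0] lookup_map_0[where f = res, OF res_0]
          lookup_map_0[where f = const, OF const.kappa_zero])
  qed
  moreover have "keys ?a \<subseteq> exponents n" "keys (Poly_Mapping.map quo d) \<subseteq> exponents n"
    using keys_map_subset assms(1) by (meson order_trans)+
  moreover from this have "keys ?b \<subseteq> exponents n"
    using keys_scale by (meson order_trans)
  ultimately show ?thesis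
    using lincomb_add[OF xm_carrier, of ?a ?b] lincomb_scale[OF xm_carrier, of "Poly_Mapping.map quo d"] by simp
qed

lemma qq1_cancel:
  assumes "a \<in> carrier A" "b \<in> carrier A" "(qq - 1) \<odot>\<^bsub>A\<^esub> a = (qq - 1) \<odot>\<^bsub>A\<^esub> b"
  shows "a = b"
proof -
  have "(1 / (qq - 1)) \<odot>\<^bsub>A\<^esub> ((qq - 1) \<odot>\<^bsub>A\<^esub> c) = c" if "c \<in> carrier A" for c
    using smult_assoc1[of "1 / (qq - 1)" "qq - 1" c] smult_one[OF that] that qq_minus_1_nonzero[where 'k='k]
    by simp
  then show ?thesis using assms by metis
qed

text \<open>\<open>clear_denominators\<close> leaves a power of \<open>q - 1\<close>, which is
  removed one factor at a time. If \<open>(q - 1) ^ (j + 1) * u\<close> times \<open>s\<close> has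
  Laurent coordinates, their values at \<open>q = 1\<close> form a polynomial whose lift lies in
  \<open>hS\<close>; they vanish by \<open>cp_hS\<close>, so every coordinate is divisible by
  \<open>q - 1\<close>.\<close>

lemma S_clear:
  assumes "s \<in> S"
  shows "\<exists>u\<in>unit1. \<exists>c. keys c \<subseteq> exponents n \<and> (\<forall>m. lookup c m \<in> laurent) \<and> u \<odot>\<^bsub>A\<^esub> s = lincomb A xm c"
proof -
  define c where "c = coords s"
  have c: "keys c \<subseteq> exponents n" "lincomb A xm c = s"
    using coords[of s] assms by (auto simp: c_def)
  have lc: "lincomb A xm (single 0 l * c) = l \<odot>\<^bsub>A\<^esub> s" for l
    using lincomb_scale[OF xm_carrier c(1)] c(2) by simp
  obtain j u where u: "u \<in> unit1" "\<And>m. (qq - 1) ^ j * u * lookup c m \<in> laurent"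
    using clear_denominators[of c] by blast
  have "\<forall>m. u * lookup c m \<in> laurent"
    using u(2)
  proof (induction j)
    case (Suc j)
    define d where "d = single 0 ((qq - 1) ^ Suc j * u) * c"
    have ld: "lookup d m = (qq - 1) ^ Suc j * u * lookup c m" for m
      by (simp add: d_def lookup_scale)
    have kd: "keys d \<subseteq> exponents n" using keys_scale c(1) unfolding d_def by (meson order_trans)
    have dl: "lookup d m \<in> laurent" for m using Suc.prems by (simp only: ld)
    define b where "b = Poly_Mapping.map quo d"
    have quo0: "quo 0 = (0 :: 'k poly fract)" by (simp add: quo_def res_0)
    have bl: "lookup b m \<in> laurent" for m
      unfolding b_def lookup_map_0[where f = quo, OF quo0] by (rule res_quo(2)[OF dl])
    define e where "e = ((qq - 1) ^ j * u) \<odot>\<^bsub>A\<^esub> s"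
    have pw: "(qq - 1 :: 'k poly fract) ^ i \<in> laurent" for i
      by (induction i) (auto intro: laurent_one laurent_mult qq_minus_1_laurent)
    have e: "e \<in> S" unfolding e_def
      by (intro S_closed(7) laurent_mult pw unit1_laurent u assms)
    have "lincomb A xm d = (qq - 1) \<odot>\<^bsub>A\<^esub> e"
      using smult_assoc1[of "qq - 1" "(qq - 1) ^ j * u" s] assms
      unfolding d_def lc e_def by (simp add: mult.assoc)
    then have "cp (Poly_Mapping.map res d) \<oplus> ((qq - 1) \<odot>\<^bsub>A\<^esub> lincomb A xm b) = (qq - 1) \<odot>\<^bsub>A\<^esub> e"
      using lincomb_split[OF kd dl] by (simp add: b_def)
    moreover have bS: "lincomb A xm b \<in> S" by (rule lincomb_S[OF bl])
    ultimately have "cp (Poly_Mapping.map res d) = (qq - 1) \<odot>\<^bsub>A\<^esub> e \<ominus> (qq - 1) \<odot>\<^bsub>A\<^esub> lincomb A xm b"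
      using e cp_S[of "Poly_Mapping.map res d"]
      by (metis M.add.inv_solve_right M.minus_eq S_carrier UNIV_I carrier_of_type(1) smult_closed)
    also have "\<dots> = (qq - 1) \<odot>\<^bsub>A\<^esub> (e \<ominus> lincomb A xm b)"
      using e bS by (simp add: M.minus_eq smult_r_distr smult_r_minus)
    also have "\<dots> \<in> hS" using S_minus[OF e bS] by (auto simp: hS_iff)
    finally have "Poly_Mapping.map res d = 0"
      by (rule cp_hS[OF order_trans[OF keys_map_subset kd]])
    then have "res (lookup d m) = 0" for m
      using lookup_map_0[where f = res, OF res_0, of d m] by simp
    then have "lookup d m = (qq - 1) * quo (lookup d m)" for m
      using res_quo(1)[OF dl[of m]] by simp
    then have "(qq - 1) * ((qq - 1) ^ j * u * lookup c m) = (qq - 1) * quo (lookup d m)" for m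
      unfolding ld by (simp only: power_Suc mult.assoc)
    then have "(qq - 1) ^ j * u * lookup c m = quo (lookup d m)" for m
      using mult_cancel_left[of "qq - 1 :: 'k poly fract"] qq_minus_1_nonzero[where 'k='k] by metis
    then have "(qq - 1) ^ j * u * lookup c m \<in> laurent" for m
      using res_quo(2)[OF dl[of m]] by simp
    then show ?case by (rule Suc.IH)
  qed simp
  then have "keys (single 0 u * c) \<subseteq> exponents n \<and> (\<forall>m. lookup (single 0 u * c) m \<in> laurent) \<and>
      u \<odot>\<^bsub>A\<^esub> s = lincomb A xm (single 0 u * c)"
    using keys_scale[of u c] c(1) lc by (auto simp: lookup_scale)
  then show ?thesis using u(1) by blast
qed

end

section \<open>The enveloping algebra as a deformation\<close>

lemma central_hom_const: "central_hom (\<lambda>c. endo_scalar (const c) :: ('i::comm_monoid_add, 'k::field_char_0 poly fract) endo)"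
proof
  fix a b :: 'k and r :: "('i, 'k poly fract) endo"
  show "endo_scalar (const (a + b)) = (endo_scalar (const a) + endo_scalar (const b) :: ('i, 'k poly fract) endo)"
    by (simp only: const.kappa_add endo_scalar.kappa_add)
  show "endo_scalar (const (a * b)) = (endo_scalar (const a) * endo_scalar (const b) :: ('i, 'k poly fract) endo)"
    by (simp only: const.kappa_mult endo_scalar.kappa_mult)
  show "endo_scalar (const 1) = (1 :: ('i, 'k poly fract) endo)"
    by simp
  show "endo_scalar (const a) * r = r * endo_scalar (const a)"
    by (rule endo_scalar.kappa_central)
qed

lemma lin_comb_map_const:
  "lin_comb endo_scalar F (Poly_Mapping.map const p)
    = lin_comb (\<lambda>c. endo_scalar (const c) :: ('i::comm_monoid_add, 'k::field_char_0 poly fract) endo) F p"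
  unfolding lin_comb_superset[where \<kappa> = endo_scalar and F = F, OF finite_keys keys_map_subset[of const p] endo_scalar.kappa_zero]
  by (simp add: lin_comb_def lookup_map_0[where f = const, OF const.kappa_zero])

context quantization
begin

section \<open>The ring \<open>E\<close> and the operators \<open>om\<close>\<close>

abbreviation sc :: "'k poly fract \<Rightarrow> ((nat \<Rightarrow>\<^sub>0 nat) \<times> (nat \<Rightarrow>\<^sub>0 nat), 'k poly fract) endo" where
  "sc \<equiv> endo_scalar"
abbreviation "\<kappa> c \<equiv> sc (const c)"
abbreviation "hh \<equiv> sc (qq - 1)"
abbreviation "hinv \<equiv> sc (1 / (qq - 1))"
abbreviation "xl i \<equiv> lmul (x i)"
abbreviation "xr i \<equiv> rmul (x i)"
definition "om i = hinv * (xl i - xr i)"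
definition "E = addspan {lmul s * rmul t |s t. s \<in> S \<and> t \<in> S}"

lemma sc_left: "r * (sc k * s) = sc k * (r * s)"
  by (simp only: mult.assoc[symmetric] endo_scalar.kappa_central[of k r])

lemma hh_hinv: "hh * hinv = 1" "hinv * hh = 1"
  using qq_minus_1_nonzero[where 'k = 'k]
  by (simp_all add: endo_scalar.kappa_mult[symmetric] del: endo_scalar.kappa_one)
    (simp_all)

lemma hinv_hh: "hinv * (hh * r) = r" "hh * (hinv * r) = r"
  by (simp_all add: mult.assoc[symmetric] hh_hinv)

lemma lmul_diff: "a \<in> carrier A \<Longrightarrow> b \<in> carrier A \<Longrightarrow> lmul (a \<ominus> b) = lmul a - lmul b"
  and rmul_diff: "a \<in> carrier A \<Longrightarrow> b \<in> carrier A \<Longrightarrow> rmul (a \<ominus> b) = rmul a - rmul b"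
proof -
  assume ab: "a \<in> carrier A" "b \<in> carrier A"
  have "(a \<ominus> b) \<oplus> b = a" using ab by (simp add: M.minus_eq M.a_assoc M.l_neg)
  then show "lmul (a \<ominus> b) = lmul a - lmul b" "rmul (a \<ominus> b) = rmul a - rmul b"
    using lmul_add[of "a \<ominus> b" b] rmul_add[of "a \<ominus> b" b] ab by (simp_all add: eq_diff_eq)
qed

lemma x_A: "x ` {..<n} \<subseteq> carrier A"
  using x_S by auto

lemma monoid_A: "monoid A"
  using ring_axioms by (simp add: ring_def)

lemma lmul_xm: "lmul (xm m) = pl xl (mlist n m)"
  by (rule ordered_monomial_hom[OF lmul_one lmul_mult monoid_A x_A])

lemma rmul_xm: "rmul (xm m) = pl xr (rev (mlist n m))"
  by (rule ordered_monomial_antihom[OF rmul_one rmul_mult monoid_A x_A])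

lemma lin_map_lincomb:
  assumes add: "\<And>a b. a \<in> carrier A \<Longrightarrow> b \<in> carrier A \<Longrightarrow> \<chi> (a \<oplus> b) = \<chi> a + \<chi> b"
    and smult: "\<And>k a. a \<in> carrier A \<Longrightarrow> \<chi> (k \<odot>\<^bsub>A\<^esub> a) = sc k * \<chi> a"
  shows "\<chi> (lincomb A xm c) = lin_comb sc (\<lambda>m. \<chi> (xm m)) c"
proof -
  have z: "\<chi> \<zero> = 0" using smult[of \<zero> 0] by simp
  have "\<chi> (\<Oplus>m\<in>J. lookup c m \<odot>\<^bsub>A\<^esub> xm m) = (\<Sum>m\<in>J. sc (lookup c m) * \<chi> (xm m))" if "finite J" for J
    using that
  proof (induction J rule: finite_induct)
    case (insert m J)
    have "(\<Oplus>m\<in>insert m J. lookup c m \<odot>\<^bsub>A\<^esub> xm m) = (lookup c m \<odot>\<^bsub>A\<^esub> xm m) \<oplus> (\<Oplus>m\<in>J. lookup c m \<odot>\<^bsub>A\<^esub> xm m)"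
      using insert.hyps xm_in by (intro M.finsum_insert) auto
    then show ?case using insert xm_in by (simp add: add smult M.finsum_closed)
  qed (simp add: z)
  then show ?thesis by (simp add: lincomb_def lin_comb_def)
qed

lemma lmul_cp: "lmul (cp p) = lin_comb \<kappa> (\<lambda>m. lmul (xm m)) p"
  using lin_map_lincomb[of lmul, OF lmul_add lmul_smult] by (simp add: lin_comb_map_const)

lemma rmul_cp: "rmul (cp p) = lin_comb \<kappa> (\<lambda>m. rmul (xm m)) p"
  using lin_map_lincomb[of rmul, OF rmul_add rmul_smult] by (simp add: lin_comb_map_const)

lemma E_sub: "add_subgroup E"
  unfolding E_def by (rule add_subgroup_addspan)

lemma E_gen: "s \<in> S \<Longrightarrow> t \<in> S \<Longrightarrow> lmul s * rmul t \<in> E"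
  unfolding E_def by (rule addspan_gen) auto

lemma lmul_E: "s \<in> S \<Longrightarrow> lmul s \<in> E" and rmul_E: "s \<in> S \<Longrightarrow> rmul s \<in> E"
  using E_gen[of s \<one>] E_gen[of \<one> s] by (simp_all add: S_closed lmul_one rmul_one)

lemma sc_E: "l \<in> laurent \<Longrightarrow> sc l \<in> E"
  using lmul_E[OF S_closed(7)[of l \<one>]] by (simp add: S_closed lmul_smult lmul_one)

lemma lmul_rmul_mult:
  assumes "s \<in> carrier A" "t \<in> carrier A" "s' \<in> carrier A" "t' \<in> carrier A"
  shows "(lmul s * rmul t) * (lmul s' * rmul t') = lmul (s \<otimes> s') * rmul (t' \<otimes> t)"
proof -
  have "(lmul s * rmul t) * (lmul s' * rmul t') = lmul s * (rmul t * lmul s') * rmul t'"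
    by (simp only: mult.assoc)
  also have "\<dots> = lmul (s \<otimes> s') * rmul (t' \<otimes> t)"
    using assms by (simp add: lmul_rmul_commute[symmetric] lmul_mult rmul_mult mult.assoc)
  finally show ?thesis .
qed

lemma E_mult: assumes "a \<in> E" "b \<in> E" shows "a * b \<in> E"
  by (rule addspan_mult[OF assms[unfolded E_def] E_sub]) (auto simp: lmul_rmul_mult intro!: E_gen S_closed(5))

lemma E_one: "1 \<in> E"
  using lmul_E[OF S_closed(3)] by (simp add: lmul_one)

abbreviation "hE \<equiv> (\<lambda>e. hh * e) ` E"

lemma hE_sub: "add_subgroup hE"
  by (rule add_subgroup_image[OF E_sub]) (simp add: right_diff_distrib)

lemma lmul_hS: "a \<in> hS \<Longrightarrow> \<exists>s\<in>S. lmul a = hh * lmul s"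
  and rmul_hS: "a \<in> hS \<Longrightarrow> \<exists>s\<in>S. rmul a = hh * rmul s"
  by (auto simp: hS_iff lmul_smult rmul_smult)

text \<open>Elements of \<open>S\<close> commute modulo \<open>q - 1\<close>; exchanging one tensor
  factor at a time splits the commutator into two multiples of \<open>h\<close>.\<close>

lemma gen_comm:
  assumes "s \<in> S" "t \<in> S" "s' \<in> S" "t' \<in> S"
  shows "(lmul s * rmul t) * (lmul s' * rmul t') - (lmul s' * rmul t') * (lmul s * rmul t) \<in> hE"
proof -
  have d: "lmul (s \<otimes> s') - lmul (s' \<otimes> s) = lmul (s \<otimes> s' \<ominus> s' \<otimes> s)"
    "rmul (t' \<otimes> t) - rmul (t \<otimes> t') = rmul (t' \<otimes> t \<ominus> t \<otimes> t')"
    using assms by (simp_all add: lmul_diff rmul_diff)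
  obtain b where b: "b \<in> S" "lmul (s \<otimes> s') - lmul (s' \<otimes> s) = hh * lmul b"
    using lmul_hS[OF commutator_hS[OF assms(1,3)]] d by auto
  obtain b' where b': "b' \<in> S" "rmul (t' \<otimes> t) - rmul (t \<otimes> t') = hh * rmul b'"
    using rmul_hS[OF commutator_hS[OF assms(4,2)]] d by auto
  have "(lmul s * rmul t) * (lmul s' * rmul t') - (lmul s' * rmul t') * (lmul s * rmul t)
      = (lmul (s \<otimes> s') - lmul (s' \<otimes> s)) * rmul (t' \<otimes> t) + lmul (s' \<otimes> s) * (rmul (t' \<otimes> t) - rmul (t \<otimes> t'))"
    by (simp only: lmul_rmul_mult[OF assms[THEN S_carrier]] lmul_rmul_mult[OF assms(3,4,1,2)[THEN S_carrier]]) (simp add: algebra_simps)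
  also have "\<dots> = hh * (lmul b * rmul (t' \<otimes> t)) + hh * (lmul (s' \<otimes> s) * rmul b')"
    unfolding b b' by (simp add: mult.assoc sc_left)
  also have "\<dots> \<in> hE"
    using assms b b' by (intro add_subgroupD(4)[OF hE_sub] imageI E_gen S_closed)
  finally show ?thesis .
qed

lemma E_comm:
  assumes "a \<in> E" "b \<in> E" shows "a * b - b * a \<in> hE"
proof -
  have 1: "a * (lmul s * rmul t) - (lmul s * rmul t) * a \<in> hE" if "s \<in> S" "t \<in> S" for s t
  proof (rule addspan_map[OF assms(1)[unfolded E_def] hE_sub, of "\<lambda>z. z * (lmul s * rmul t) - (lmul s * rmul t) * z"])
    show "(a - b) * (lmul s * rmul t) - lmul s * rmul t * (a - b)
      = a * (lmul s * rmul t) - lmul s * rmul t * a - (b * (lmul s * rmul t) - lmul s * rmul t * b)" for a b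
      by (simp only: left_diff_distrib right_diff_distrib) simp
    fix g assume "g \<in> {lmul s * rmul t |s t. s \<in> S \<and> t \<in> S}"
    then show "g * (lmul s * rmul t) - lmul s * rmul t * g \<in> hE"
      using gen_comm that by blast
  qed
  show ?thesis
  proof (rule addspan_map[OF assms(2)[unfolded E_def] hE_sub, of "\<lambda>z. a * z - z * a"])
    show "a * (b - c) - (b - c) * a = a * b - b * a - (a * c - c * a)" for b c
      by (simp only: left_diff_distrib right_diff_distrib) simp
  qed (use 1 in blast)
qed

lemma om_comm: "om i * r - r * om i = hinv * ((xl i - xr i) * r - r * (xl i - xr i))"
  unfolding om_def by (simp only: mult.assoc sc_left[of r] right_diff_distrib[symmetric])

lemma x_diff_E: "i < n \<Longrightarrow> xl i - xr i \<in> E"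
  by (intro add_subgroupD(2)[OF E_sub] lmul_E rmul_E x_S)

text \<open>\<open>h * om i = xl i - xr i\<close> lies in \<open>E\<close>, and commutators of
  elements of \<open>E\<close> are divisible by \<open>h\<close> within \<open>E\<close>; one
  division leaves an element of \<open>E\<close>.\<close>

sublocale pf: prefiltration E om n
proof
  fix i e assume "i < n" "e \<in> E"
  then obtain e' where "e' \<in> E" "(xl i - xr i) * e - e * (xl i - xr i) = hh * e'"
    using E_comm[OF x_diff_E] by blast
  then show "om i * e - e * om i \<in> E" by (simp only: om_comm hinv_hh)
qed (rule E_sub E_one E_mult; assumption)+

text \<open>Represents \<open>Omega_tilde A a\<close> for arbitrary \<open>a\<close>, with
  \<open>om i = OM (x i)\<close>.\<close>

definition "OM a = hinv * (lmul a - rmul a)"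

lemma OM_add: "a \<in> carrier A \<Longrightarrow> b \<in> carrier A \<Longrightarrow> OM (a \<oplus> b) = OM a + OM b"
  by (simp add: OM_def lmul_add rmul_add algebra_simps)

lemma OM_smult: "a \<in> carrier A \<Longrightarrow> OM (k \<odot>\<^bsub>A\<^esub> a) = sc k * OM a"
  by (simp add: OM_def lmul_smult rmul_smult sc_left[of hinv] right_diff_distrib)

lemma xl_pl_xr: "xl i * pl xr ks = pl xr ks * xl i"
proof (induction ks)
  case (Cons j ks)
  have "xl i * (xr j * pl xr ks) = (xr j * xl i) * pl xr ks"
    by (simp only: mult.assoc[symmetric] lmul_rmul_commute[of "x i" "x j"])
  also have "\<dots> = xr j * (pl xr ks * xl i)" by (simp only: mult.assoc Cons.IH)
  finally show ?case by (simp add: mult.assoc)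
qed simp

text \<open>The factor \<open>pl xr (rev ks)\<close> agrees with \<open>pl xl ks\<close> modulo \<open>q - 1\<close>, so this recursion makes
  \<open>OM\<close> a derivation modulo \<open>q - 1\<close>.\<close>

lemma OM_list_Cons:
  "hinv * (pl xl (i # ks) - pl xr (rev (i # ks)))
    = xl i * (hinv * (pl xl ks - pl xr (rev ks))) + pl xr (rev ks) * om i"
proof -
  have "pl xl (i # ks) - pl xr (rev (i # ks)) = xl i * (pl xl ks - pl xr (rev ks)) + pl xr (rev ks) * (xl i - xr i)"
    by (simp add: algebra_simps xl_pl_xr)
  then show ?thesis by (simp add: om_def sc_left distrib_left)
qed

lemma OM_xm: "OM (xm m) = hinv * (pl xl (mlist n m) - pl xr (rev (mlist n m)))"
  by (simp add: OM_def lmul_xm rmul_xm)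

lemma xl_E: "i < n \<Longrightarrow> xl i \<in> E" and xr_E: "i < n \<Longrightarrow> xr i \<in> E"
  using lmul_E rmul_E x_S by auto

lemma pl_in_E: "(\<And>i. i < n \<Longrightarrow> F i \<in> E) \<Longrightarrow> set ks \<subseteq> {..<n} \<Longrightarrow> pl F ks \<in> E"
  by (induction ks) (auto intro!: E_one E_mult)

lemma OM_list_W: "set ks \<subseteq> {..<n} \<Longrightarrow> hinv * (pl xl ks - pl xr (rev ks)) \<in> pf.W 1"
proof (induction ks)
  case Nil
  show ?case using add_subgroupD(1)[OF pf.W_sub] by simp
next
  case (Cons i ks)
  have "xl i * (hinv * (pl xl ks - pl xr (rev ks))) \<in> pf.W 1"
    by (rule pf.E_W_mult) (use Cons xl_E in auto)
  moreover have "pl xr (rev ks) \<in> E"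
    by (rule pl_in_E) (use Cons.prems xr_E in auto)
  then have "pl xr (rev ks) * pl om [i] \<in> pf.W 1"
    by (rule pf.W_gen) (use Cons.prems in auto)
  ultimately show ?case
    unfolding OM_list_Cons using add_subgroupD(4)[OF pf.W_sub] by simp
qed

text \<open>For monomials this is \<open>OM_list_W\<close>, but \<open>s\<close> becomes a Laurent
  combination of monomials only after multiplication by \<open>u = 1 + (q - 1) l\<close>. The excess
  \<open>(q - 1) l * OM s\<close> equals \<open>l * (lmul s - rmul s)\<close> and lies in
  \<open>E\<close>.\<close>

lemma OM_W:
  assumes s: "s \<in> S" shows "OM s \<in> pf.W 1"
proof -
  obtain u c where u: "u \<in> unit1" and c: "\<forall>m. lookup c m \<in> laurent" "u \<odot>\<^bsub>A\<^esub> s = lincomb A xm c"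
    using S_clear[OF s] by blast
  obtain l where l: "u = 1 + (qq - 1) * l" "l \<in> laurent" using u by (auto simp: unit1_def)
  have "sc u * OM s = lin_comb sc (\<lambda>m. OM (xm m)) c"
    using OM_smult[of s u] s c(2) lin_map_lincomb[of OM, OF OM_add OM_smult] by simp
  moreover have "sc (lookup c m) * OM (xm m) \<in> pf.W 1" for m
    unfolding OM_xm by (intro pf.E_W_mult sc_E OM_list_W set_mlist) (use c in blast)
  then have "lin_comb sc (\<lambda>m. OM (xm m)) c \<in> pf.W 1"
    unfolding lin_comb_def by (intro add_subgroup_sum[OF pf.W_sub])
  moreover have "sc l * (lmul s - rmul s) \<in> E"
    by (intro E_mult sc_E l add_subgroupD(2)[OF E_sub] lmul_E rmul_E s)
  ultimately have "sc u * OM s - sc l * (lmul s - rmul s) \<in> pf.W 1"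
    using add_subgroupD(2)[OF pf.W_sub, of "sc u * OM s" 1 "sc l * (lmul s - rmul s)"] pf.E_W[of 1] by auto
  moreover have "sc u * OM s - sc l * (lmul s - rmul s) = OM s"
  proof -
    have "sc u * OM s = OM s + sc l * (hh * OM s)"
      by (simp only: l(1) endo_scalar.kappa_add endo_scalar.kappa_mult endo_scalar.kappa_one distrib_right
          mult_1 mult.assoc sc_left[of hh])
    then show ?thesis by (simp add: OM_def hinv_hh)
  qed
  ultimately show ?thesis by simp
qed

lemma commutator_beta:
  assumes "a \<in> S" "b \<in> S" "\<beta> \<in> S" "a \<otimes> b \<ominus> b \<otimes> a = (qq - 1) \<odot>\<^bsub>A\<^esub> \<beta>"
  shows "lmul a * lmul b - lmul b * lmul a = hh * lmul \<beta>"
    "rmul a * rmul b - rmul b * rmul a = - (hh * rmul \<beta>)"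
proof -
  have "lmul (a \<otimes> b \<ominus> b \<otimes> a) = hh * lmul \<beta>" "rmul (a \<otimes> b \<ominus> b \<otimes> a) = hh * rmul \<beta>"
    using assms by (simp_all add: lmul_smult rmul_smult)
  then show "lmul a * lmul b - lmul b * lmul a = hh * lmul \<beta>"
    "rmul a * rmul b - rmul b * rmul a = - (hh * rmul \<beta>)"
    using assms(1,2) by (simp_all add: lmul_diff rmul_diff lmul_mult rmul_mult algebra_simps)
qed

text \<open>The mixed commutators vanish, and right multiplication changes the sign of a commutator.
  The sum is \<open>h * (lmul \<beta> - rmul \<beta>)\<close>, and the two divisions by
  \<open>h\<close>, one from each letter, leave \<open>OM \<beta>\<close>.\<close>

lemma om_om_beta:
  assumes "x i \<in> S" "x j \<in> S" "\<beta> \<in> S" "x i \<otimes> x j \<ominus> x j \<otimes> x i = (qq - 1) \<odot>\<^bsub>A\<^esub> \<beta>"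
  shows "om i * om j - om j * om i = OM \<beta>"
proof -
  have "(xl i - xr i) * (xl j - xr j) - (xl j - xr j) * (xl i - xr i)
    = (xl i * xl j - xl j * xl i) + (xr i * xr j - xr j * xr i)"
    by (simp add: algebra_simps lmul_rmul_commute)
  also have "\<dots> = hh * (lmul \<beta> - rmul \<beta>)"
    using commutator_beta[OF assms] by (simp add: right_diff_distrib)
  finally have *: "(xl i - xr i) * (xl j - xr j) - (xl j - xr j) * (xl i - xr i) = hh * (lmul \<beta> - rmul \<beta>)" .
  have "om i * om j - om j * om i = hinv * (hinv * ((xl i - xr i) * (xl j - xr j) - (xl j - xr j) * (xl i - xr i)))"
    unfolding om_comm
    unfolding om_def by (simp only: mult.assoc sc_left[of "xl i - xr i"] right_diff_distrib[symmetric])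
  also have "\<dots> = OM \<beta>" unfolding * hinv_hh OM_def ..
  finally show ?thesis .
qed

lemma ex_beta: "a \<in> S \<Longrightarrow> b \<in> S \<Longrightarrow> \<exists>\<beta>\<in>S. a \<otimes> b \<ominus> b \<otimes> a = (qq - 1) \<odot>\<^bsub>A\<^esub> \<beta>"
  using commutator_hS by (auto simp: hS_iff)

definition "P = (\<lambda>(a, b). lmul (xm a) * rmul (xm b))"

lemma P_eq: "P = (\<lambda>(a, b). pl xl (mlist n a) * pl xr (rev (mlist n b)))"
  by (simp add: P_def lmul_xm rmul_xm)

text \<open>Each factor of a generator may be replaced by the lift of its class, at the cost of an
  element of \<open>hS\<close>.\<close>

lemma E_span_P:
  "E \<subseteq> addspan ({\<kappa> c * P (a, b) |c a b. a \<in> exponents n \<and> b \<in> exponents n} \<union> hE)" (is "_ \<subseteq> ?T")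
proof -
  have "addspan {lmul s * rmul t |s t. s \<in> S \<and> t \<in> S} \<subseteq> ?T"
  proof (rule addspan_subset[OF add_subgroup_addspan], rule subsetI)
    interpret K: central_hom \<kappa> by (rule central_hom_const)
    fix g assume "g \<in> {lmul s * rmul t |s t. s \<in> S \<and> t \<in> S}"
    then obtain s t where g: "g = lmul s * rmul t" "s \<in> S" "t \<in> S" by auto
    obtain p where p: "keys p \<subseteq> exponents n" "s \<ominus> cp p \<in> hS" using S_approx[OF g(2)] by blast
    obtain r where r: "keys r \<subseteq> exponents n" "t \<ominus> cp r \<in> hS" using S_approx[OF g(3)] by blast
    obtain s' where s': "s' \<in> S" "lmul s - lmul (cp p) = hh * lmul s'"
      using lmul_hS[OF p(2)] g(2) cp_S[of p] by (auto simp: lmul_diff)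
    obtain t' where t': "t' \<in> S" "rmul t - rmul (cp r) = hh * rmul t'"
      using rmul_hS[OF r(2)] g(3) cp_S[of r] by (auto simp: rmul_diff)
    have "g - lmul (cp p) * rmul (cp r) = (lmul s - lmul (cp p)) * rmul t + lmul (cp p) * (rmul t - rmul (cp r))"
      by (simp add: g algebra_simps)
    also have "\<dots> = hh * (lmul s' * rmul t) + hh * (lmul (cp p) * rmul t')"
      unfolding s' t' by (simp add: mult.assoc sc_left)
    also have "\<dots> \<in> hE"
      by (intro add_subgroupD(4)[OF hE_sub] imageI E_gen s' t' cp_S g)
    finally have "g - lmul (cp p) * rmul (cp r) \<in> ?T" by (intro addspan_gen) auto
    moreover have "lmul (cp p) * rmul (cp r) \<in> ?T"
      unfolding lmul_cp rmul_cp lin_comb_def sum_product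
    proof (intro add_subgroup_sum[OF add_subgroup_addspan])
      fix a b assume "a \<in> keys p" "b \<in> keys r"
      then have ab: "a \<in> exponents n" "b \<in> exponents n" using p r by auto
      have "\<kappa> (lookup p a) * lmul (xm a) * (\<kappa> (lookup r b) * rmul (xm b)) = \<kappa> (lookup p a * lookup r b) * P (a, b)"
        by (simp add: P_def K.kappa_mult mult.assoc sc_left[of "lmul _"])
      then show "\<kappa> (lookup p a) * lmul (xm a) * (\<kappa> (lookup r b) * rmul (xm b)) \<in> ?T"
        using ab by (intro addspan_gen) auto
    qed
    ultimately show "g \<in> ?T" using add_subgroup_cancel[OF add_subgroup_addspan] by blast
  qed
  then show ?thesis by (subst (1) E_def)
qed

text \<open>Laurent combinations of the monomials. By \<open>E_clear\<close> every element of
  \<open>E\<close> enters it after multiplication by some \<open>u\<close> congruent to 1.\<close>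

definition "Lspan = addspan {sc l * P p |l p. l \<in> laurent \<and> p \<in> exponents n \<times> exponents n}"

lemma Lspan_repr:
  assumes "r \<in> Lspan"
  shows "\<exists>c. keys c \<subseteq> exponents n \<times> exponents n \<and> (\<forall>p. lookup c p \<in> laurent) \<and> r = lin_comb sc P c"
  using assms unfolding Lspan_def
proof induction
  case addspan_zero
  then show ?case by (intro exI[of _ 0]) (auto simp: laurent_zero)
next
  case (addspan_gen g)
  then obtain l p where "g = sc l * P p" "l \<in> laurent" "p \<in> exponents n \<times> exponents n" by blast
  then show ?case
    by (intro exI[of _ "single p l"]) (auto simp: lookup_single when_def laurent_zero)
next
  case (addspan_diff a b)
  then obtain c d where "keys c \<subseteq> exponents n \<times> exponents n" "\<forall>p. lookup c p \<in> laurent" "a = lin_comb sc P c"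
    "keys d \<subseteq> exponents n \<times> exponents n" "\<forall>p. lookup d p \<in> laurent" "b = lin_comb sc P d" by blast
  then show ?case
    using keys_diff[of c d]
    by (intro exI[of _ "c - d"]) (auto simp: endo_scalar.lin_comb_diff lookup_minus laurent_diff)
qed

lemma Lspan_scale: "l \<in> laurent \<Longrightarrow> r \<in> Lspan \<Longrightarrow> sc l * r \<in> Lspan"
  unfolding Lspan_def
proof (rule addspan_mult_left[OF _ add_subgroup_addspan])
  fix g assume "l \<in> laurent" "g \<in> {sc l * P p |l p. l \<in> laurent \<and> p \<in> exponents n \<times> exponents n}"
  then obtain k p where "g = sc k * P p" "k \<in> laurent" "p \<in> exponents n \<times> exponents n" by blast
  then have "sc l * g = sc (l * k) * P p" "l * k \<in> laurent"
    using \<open>l \<in> laurent\<close> by (simp_all add: endo_scalar.kappa_mult mult.assoc laurent_mult)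
  then show "sc l * g \<in> addspan {sc l * P p |l p. l \<in> laurent \<and> p \<in> exponents n \<times> exponents n}"
    using \<open>p \<in> exponents n \<times> exponents n\<close> by (intro addspan_gen) blast
qed

lemma E_clear: assumes "e \<in> E" shows "\<exists>u\<in>unit1. sc u * e \<in> Lspan"
  using assms unfolding E_def
proof induction
  case addspan_zero
  show ?case using unit1_one by (intro bexI[of _ 1]) (auto simp: Lspan_def intro: addspan.intros)
next
  case (addspan_gen g)
  then obtain s t where g: "g = lmul s * rmul t" "s \<in> S" "t \<in> S" by auto
  obtain u c where u: "u \<in> unit1" "keys c \<subseteq> exponents n" "\<forall>m. lookup c m \<in> laurent" "u \<odot>\<^bsub>A\<^esub> s = lincomb A xm c"
    using S_clear[OF g(2)] by blast
  obtain v d where v: "v \<in> unit1" "keys d \<subseteq> exponents n" "\<forall>m. lookup d m \<in> laurent" "v \<odot>\<^bsub>A\<^esub> t = lincomb A xm d"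
    using S_clear[OF g(3)] by blast
  have l: "sc u * lmul s = lin_comb sc (\<lambda>m. lmul (xm m)) c"
    using lmul_smult[of s u] g u(4) lin_map_lincomb[of lmul, OF lmul_add lmul_smult] by simp
  have r: "sc v * rmul t = lin_comb sc (\<lambda>m. rmul (xm m)) d"
    using rmul_smult[of t v] g v(4) lin_map_lincomb[of rmul, OF rmul_add rmul_smult] by simp
  have "sc (u * v) * g = (sc u * lmul s) * (sc v * rmul t)"
    by (simp add: g(1) endo_scalar.kappa_mult mult.assoc sc_left[of "lmul s"])
  also have "\<dots> \<in> Lspan"
    unfolding l r lin_comb_def sum_product Lspan_def
  proof (intro add_subgroup_sum[OF add_subgroup_addspan])
    fix a b assume "a \<in> keys c" "b \<in> keys d"
    then have ab: "(a, b) \<in> exponents n \<times> exponents n" using u v by auto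
    have "sc (lookup c a) * lmul (xm a) * (sc (lookup d b) * rmul (xm b)) = sc (lookup c a * lookup d b) * P (a, b)"
      by (simp add: P_def endo_scalar.kappa_mult mult.assoc sc_left[of "lmul _"])
    moreover have "lookup c a * lookup d b \<in> laurent" using u v laurent_mult by blast
    ultimately show "sc (lookup c a) * lmul (xm a) * (sc (lookup d b) * rmul (xm b))
      \<in> addspan {sc l * P p |l p. l \<in> laurent \<and> p \<in> exponents n \<times> exponents n}"
      using ab by (intro addspan.addspan_gen) blast
  qed
  finally show ?case using unit1_mult[OF u(1) v(1)] by blast
next
  case (addspan_diff a b)
  then obtain u v where u: "u \<in> unit1" "sc u * a \<in> Lspan" "v \<in> unit1" "sc v * b \<in> Lspan" by blast
  \<comment> \<open>The product of both multipliers clears both summands.\<close>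
  have "sc (u * v) * (a - b) = sc v * (sc u * a) - sc u * (sc v * b)"
    by (simp add: endo_scalar.kappa_mult[symmetric] mult.assoc[symmetric] right_diff_distrib mult.commute[of u v])
  also have "\<dots> \<in> Lspan"
    using Lspan_scale[OF unit1_laurent[OF u(3)] u(2)] Lspan_scale[OF unit1_laurent[OF u(1)] u(4)]
    unfolding Lspan_def by (rule addspan.addspan_diff)
  finally show ?case using unit1_mult[OF u(1,3)] by blast
qed

lemma lin_comb_sc_scale: "sc k * lin_comb sc F c = lin_comb sc F (Poly_Mapping.map (\<lambda>a. k * a) c)"
  unfolding lin_comb_superset[where \<kappa> = sc and F = F, OF finite_keys keys_map_subset[of _ c] endo_scalar.kappa_zero]
  by (simp add: lin_comb_def lookup_map_0 sum_distrib_left endo_scalar.kappa_mult mult.assoc)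

text \<open>If the combination is \<open>h * e\<close> and \<open>u\<close> clears \<open>e\<close>,
  comparing coordinates over \<open>k(q)\<close> gives \<open>u * const f_p = (q - 1) * c_p\<close>
  with \<open>c_p\<close> Laurent. As \<open>u\<close> is congruent to 1, \<open>const f_p\<close>
  is itself a Laurent multiple of \<open>q - 1\<close>.\<close>

lemma P_indep:
  assumes "keys f \<subseteq> exponents n \<times> exponents n" "lin_comb \<kappa> P f \<in> hE"
  shows "f = 0"
proof (rule poly_mapping_eqI)
  fix p
  obtain e where e: "e \<in> E" "lin_comb \<kappa> P f = hh * e" using assms(2) by blast
  obtain u where u: "u \<in> unit1" "sc u * e \<in> Lspan" using E_clear[OF e(1)] by blast
  obtain l where l: "u = 1 + (qq - 1) * l" "l \<in> laurent" using u(1) by (auto simp: unit1_def)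
  obtain c where c: "keys c \<subseteq> exponents n \<times> exponents n" "\<forall>p. lookup c p \<in> laurent" "sc u * e = lin_comb sc P c"
    using Lspan_repr[OF u(2)] by blast
  let ?f = "Poly_Mapping.map (\<lambda>a. u * a) (Poly_Mapping.map const f)"
  let ?c = "Poly_Mapping.map (\<lambda>a. (qq - 1) * a) c"
  have "lin_comb sc P ?f = sc u * lin_comb \<kappa> P f"
    by (simp add: lin_comb_sc_scale[symmetric] lin_comb_map_const)
  also have "\<dots> = hh * (sc u * e)" unfolding e(2) by (rule sc_left)
  also have "\<dots> = lin_comb sc P ?c" unfolding c(3) by (rule lin_comb_sc_scale)
  finally have "lin_comb sc P (?f - ?c) = 0" by (simp add: endo_scalar.lin_comb_diff)
  moreover have "keys ?f \<subseteq> exponents n \<times> exponents n" "keys ?c \<subseteq> exponents n \<times> exponents n"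
    using keys_map_subset assms(1) c(1) by (meson order_trans)+
  then have "keys (?f - ?c) \<subseteq> exponents n \<times> exponents n"
    using keys_diff[of ?f ?c] by blast
  ultimately have "?f - ?c = 0" unfolding P_def by (intro lmul_rmul_indep)
  then have "lookup ?f p = lookup ?c p" by simp
  then have "u * const (lookup f p) = (qq - 1) * lookup c p"
    by (simp add: lookup_map_0 lookup_map_0[where f = const, OF const.kappa_zero])
  then have "const (lookup f p) = (qq - 1) * (lookup c p - l * const (lookup f p))"
    by (simp add: l(1) algebra_simps)
  then have "lookup f p = 0"
    by (rule const_eq_mult) (intro laurent_diff laurent_mult l(2) const_laurent c(2)[rule_format])
  then show "lookup f p = lookup 0 p" by simp
qed

sublocale df: deformation \<kappa> E om n hh xl xr
proof -
  interpret K: central_hom \<kappa> by (rule central_hom_const)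
  show "deformation \<kappa> E om n hh xl xr"
  proof unfold_locales
    fix i j assume "i < n" "j < n"
    then have ij: "x i \<in> S" "x j \<in> S" using x_S by auto
    then obtain \<beta> where "\<beta> \<in> S" "x i \<otimes> x j \<ominus> x j \<otimes> x i = (qq - 1) \<odot>\<^bsub>A\<^esub> \<beta>" using ex_beta by blast
    then show "om i * om j - om j * om i \<in> pf.W 1"
      using om_om_beta[OF ij] OM_W by simp
  next
    fix r show "hh * r = r * hh" by (rule endo_scalar.kappa_central)
  next
    show "E \<subseteq> addspan ({\<kappa> c * (pl xl (mlist n a) * pl xr (rev (mlist n b))) |c a b.
        a \<in> exponents n \<and> b \<in> exponents n} \<union> hE)"
      using E_span_P by (simp add: P_eq)
  next
    fix f assume "keys f \<subseteq> exponents n \<times> exponents n"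
      "lin_comb \<kappa> (\<lambda>(a, b). pl xl (mlist n a) * pl xr (rev (mlist n b))) f \<in> hE"
    then show "f = 0" using P_indep by (simp add: P_eq)
  qed (auto intro: sc_E qq_minus_1_laurent const_laurent xl_E xr_E E_comm[simplified] simp: om_def hinv_hh)
qed

end

lemma diff_eq_diff_of_add_eq:
  fixes a b c d :: "'r::ab_group_add"
  shows "a + c = b + d \<Longrightarrow> a - b = d - c"
  by (simp add: algebra_simps)

context quantization
begin

text \<open>Image of the form in the endomorphism ring (\<open>EF_eq\<close>), generated inductively
  so that statements about it follow by rule induction. Laurent scalars enter as the elements
  \<open>sc l\<close>. For \<open>s\<close> in \<open>S\<close>, the operator \<open>lmul s\<close>
  need not lie in \<open>Cp\<close>.\<close>

inductive_set Cp where
  Cp_xl: "i < n \<Longrightarrow> xl i \<in> Cp"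
| Cp_om: "i < n \<Longrightarrow> om i \<in> Cp"
| Cp_sc: "l \<in> laurent \<Longrightarrow> sc l \<in> Cp"
| Cp_diff: "a \<in> Cp \<Longrightarrow> b \<in> Cp \<Longrightarrow> a - b \<in> Cp"
| Cp_mult: "a \<in> Cp \<Longrightarrow> b \<in> Cp \<Longrightarrow> a * b \<in> Cp"

lemma Cp_one: "1 \<in> Cp" and Cp_zero: "0 \<in> Cp"
  using Cp_sc[OF laurent_one] Cp_sc[OF laurent_zero] by simp_all

lemma Cp_sub: "add_subgroup Cp"
  unfolding add_subgroup_def by (intro conjI ballI Cp_zero Cp_diff)

text \<open>Places \<open>Cp\<close> inside the union of the \<open>W N\<close>, where
  \<open>pX_pO_indep\<close> applies.\<close>

lemma Cp_W: "a \<in> Cp \<Longrightarrow> \<exists>N. a \<in> pf.W N"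
proof (induction rule: Cp.induct)
  case (Cp_xl i)
  then show ?case using pf.E_W[of 0] xl_E by blast
next
  case (Cp_om i)
  then show ?case using pf.W_pl[of "[i]" 1] by auto
next
  case (Cp_sc l)
  then show ?case using pf.E_W[of 0] sc_E by blast
next
  case (Cp_diff a b)
  then obtain M N where "a \<in> pf.W M" "b \<in> pf.W N" by blast
  then have "a \<in> pf.W (max M N)" "b \<in> pf.W (max M N)"
    using pf.W_mono[of M "max M N"] pf.W_mono[of N "max M N"] by auto
  then show ?case using add_subgroupD(2)[OF pf.W_sub] by blast
next
  case (Cp_mult a b)
  then show ?case using pf.W_mult by blast
qed

definition "hCp = (\<lambda>r. hh * r) ` Cp"

lemma hCp_I: "r \<in> Cp \<Longrightarrow> hh * r \<in> hCp"
  by (simp add: hCp_def)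

lemma hCp_sub: "add_subgroup hCp"
  unfolding hCp_def by (rule add_subgroup_image[OF Cp_sub]) (simp add: right_diff_distrib)

lemma hCp_left: "a \<in> Cp \<Longrightarrow> r \<in> hCp \<Longrightarrow> a * r \<in> hCp"
  unfolding hCp_def by (elim imageE) (simp only: sc_left, intro imageI Cp_mult)

lemma hCp_right: "a \<in> Cp \<Longrightarrow> r \<in> hCp \<Longrightarrow> r * a \<in> hCp"
  unfolding hCp_def by (elim imageE) (simp only: mult.assoc, intro imageI Cp_mult)

lemma hCp_Cp: "hCp \<subseteq> Cp"
  unfolding hCp_def by (auto intro!: Cp_mult Cp_sc qq_minus_1_laurent)

lemma pl_Cp: "(\<And>i. i < n \<Longrightarrow> F i \<in> Cp) \<Longrightarrow> set ks \<subseteq> {..<n} \<Longrightarrow> pl F ks \<in> Cp"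
  by (induction ks) (simp_all add: Cp_one Cp_mult)

text \<open>\<open>xr i\<close> commutes with \<open>xl j\<close>, so \<open>xl i\<close> may be
  replaced by \<open>xl i - xr i = h * om i\<close>. The quotient by \<open>h\<close> is thereby
  exhibited inside \<open>Cp\<close>.\<close>

lemma xl_comm_om: "xl i * xl j - xl j * xl i = hh * (om i * xl j - xl j * om i)"
proof -
  have "om i * xl j - xl j * om i = hinv * ((xl i - xr i) * xl j - xl j * (xl i - xr i))"
    by (rule om_comm)
  also have "(xl i - xr i) * xl j - xl j * (xl i - xr i) = xl i * xl j - xl j * xl i"
    by (simp add: left_diff_distrib right_diff_distrib lmul_rmul_commute)
  finally show ?thesis by (simp only: hinv_hh)
qed

lemma xl_comm_hCp: "i < n \<Longrightarrow> j < n \<Longrightarrow> xl i * xl j - xl j * xl i \<in> hCp"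
  unfolding xl_comm_om by (intro hCp_I Cp_diff Cp_mult Cp_xl Cp_om)

lemma xl_perm:
  assumes "mset ks = mset js" "set ks \<subseteq> {..<n}"
  shows "pl xl ks - pl xl js \<in> hCp"
proof (rule swap_imp_perm_cong[OF hCp_sub, where M = "mset ks"])
  fix u v i j assume "mset (u @ i # j # v) = mset ks"
  then have *: "set (u @ i # j # v) \<subseteq> {..<n}"
    using assms(2) by (metis set_mset_mset)
  have "pl xl u * ((xl i * xl j - xl j * xl i) * pl xl v) \<in> hCp"
    by (intro hCp_left hCp_right xl_comm_hCp pl_Cp Cp_xl) (use * in auto)
  then show "pl xl (u @ i # j # v) - pl xl (u @ j # i # v) \<in> hCp"
    by (simp add: algebra_simps)
qed (use assms in auto)

lemma om_xl_beta:
  assumes "x i \<in> S" "x j \<in> S" "\<beta> \<in> S" "x i \<otimes> x j \<ominus> x j \<otimes> x i = (qq - 1) \<odot>\<^bsub>A\<^esub> \<beta>"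
  shows "om i * xl j - xl j * om i = lmul \<beta>"
proof -
  have "hh * (om i * xl j - xl j * om i) = hh * lmul \<beta>"
    using xl_comm_om[of i j] commutator_beta(1)[OF assms] by simp
  then have "hinv * (hh * (om i * xl j - xl j * om i)) = hinv * (hh * lmul \<beta>)" by (rule arg_cong)
  then show ?thesis by (simp only: hinv_hh)
qed

text \<open>An element of \<open>S\<close> need not lie in the Laurent span of the monomials, but it does after
  multiplication by some \<open>u \<equiv> 1\<close> modulo \<open>q - 1\<close>.\<close>

lemma approx_mod_hCp:
  assumes add: "\<And>a b. a \<in> carrier A \<Longrightarrow> b \<in> carrier A \<Longrightarrow> \<chi> (a \<oplus> b) = \<chi> a + \<chi> b"
    and smult: "\<And>k a. a \<in> carrier A \<Longrightarrow> \<chi> (k \<odot>\<^bsub>A\<^esub> a) = sc k * \<chi> a"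
    and xm: "\<And>m. \<chi> (xm m) \<in> Cp"
    and s: "s \<in> S" "\<chi> s \<in> Cp" and p: "keys p \<subseteq> exponents n" "s \<ominus> cp p \<in> hS"
  shows "\<chi> s - lin_comb \<kappa> (\<lambda>m. \<chi> (xm m)) p \<in> hCp"
proof -
  obtain u c where u: "u \<in> unit1" and c: "keys c \<subseteq> exponents n" "\<And>m. lookup c m \<in> laurent"
    "u \<odot>\<^bsub>A\<^esub> s = lincomb A xm c"
    using S_clear[OF s(1)] by blast
  obtain l where l: "u = 1 + (qq - 1) * l" "l \<in> laurent" using u by (auto simp: unit1_def)
  let ?d = "Poly_Mapping.map quo c" and ?r = "Poly_Mapping.map res c"
  have quo0: "quo 0 = (0 :: 'k poly fract)" by (simp add: quo_def res_0)
  have dl: "lookup ?d m \<in> laurent" for m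
    unfolding lookup_map_0[where f = quo, OF quo0] by (rule res_quo(2)[OF c(2)])
  have dS: "lincomb A xm ?d \<in> S" by (rule lincomb_S[OF dl])
  have us: "u \<odot>\<^bsub>A\<^esub> s = s \<oplus> ((qq - 1) \<odot>\<^bsub>A\<^esub> (l \<odot>\<^bsub>A\<^esub> s))"
    using smult_l_distr[of 1 "(qq - 1) * l" s] smult_assoc1[of "qq - 1" l s] smult_one[of s] s(1)
    by (simp add: l(1))
  have split: "u \<odot>\<^bsub>A\<^esub> s = cp ?r \<oplus> ((qq - 1) \<odot>\<^bsub>A\<^esub> lincomb A xm ?d)"
    unfolding c(3) by (rule lincomb_split[OF c(1,2)])
  have lS: "l \<odot>\<^bsub>A\<^esub> s \<in> S" by (rule S_closed(7)[OF l(2) s(1)])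
  have barh: "bar (a \<oplus> ((qq - 1) \<odot>\<^bsub>A\<^esub> b)) = bar a" if "a \<in> S" "b \<in> S" for a b
  proof -
    have hb: "(qq - 1) \<odot>\<^bsub>A\<^esub> b \<in> S" by (rule S_closed(7)[OF qq_minus_1_laurent that(2)])
    have "(a \<oplus> ((qq - 1) \<odot>\<^bsub>A\<^esub> b)) \<ominus> a = (qq - 1) \<odot>\<^bsub>A\<^esub> b"
      using that hb by (simp add: M.minus_eq M.a_ac M.r_neg1 M.r_neg2)
    then show ?thesis using that hb by (subst bar_eq_iff) (auto simp: S_closed hS_iff)
  qed
  \<comment> \<open>The values at \<open>q = 1\<close> of the cleared coordinates form
    \<open>p\<close>: both polynomials represent the class of \<open>s\<close>.\<close>
  have "bar (cp ?r) = bar (u \<odot>\<^bsub>A\<^esub> s)"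
    unfolding split by (rule barh[OF cp_S dS, symmetric])
  also have "\<dots> = bar s" unfolding us by (rule barh[OF s(1) lS])
  also have "\<dots> = bar (cp p)" using p(2) bar_eq_iff[OF s(1) cp_S] by blast
  finally have "bar (cp ?r) = bar (cp p)" .
  moreover have "keys ?r \<subseteq> exponents n" using keys_map_subset[of res c] c(1) by blast
  ultimately have "?r = p"
    using inj_onD[OF bij_betw_imp_inj_on[OF bij_eval], of ?r p] p(1) by simp
  then have "\<chi> (u \<odot>\<^bsub>A\<^esub> s) = \<chi> (cp p) + hh * \<chi> (lincomb A xm ?d)"
    unfolding split using cp_S[of p] dS by (simp add: add smult)
  moreover have "\<chi> (u \<odot>\<^bsub>A\<^esub> s) = \<chi> s + hh * (sc l * \<chi> s)"
    unfolding us using s(1) lS by (simp add: add smult)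
  \<comment> \<open>Two expansions of \<open>\<chi>\<close> at the multiple \<open>u\<close> of
    \<open>s\<close>, one from \<open>u = 1 + (q - 1) l\<close> and one from the coordinates. Their
    difference gives the quotient by \<open>h\<close> explicitly, as an element of
    \<open>Cp\<close>.\<close>
  ultimately have "\<chi> s + hh * (sc l * \<chi> s) = \<chi> (cp p) + hh * \<chi> (lincomb A xm ?d)"
    by (rule trans[OF sym, rotated])
  then have "\<chi> s - \<chi> (cp p) = hh * (\<chi> (lincomb A xm ?d) - sc l * \<chi> s)"
    unfolding right_diff_distrib by (rule diff_eq_diff_of_add_eq)
  moreover have lm: "\<chi> (lincomb A xm c) = lin_comb sc (\<lambda>m. \<chi> (xm m)) c" for c
    by (rule lin_map_lincomb) (simp_all add: add smult)
  moreover have "\<chi> (lincomb A xm ?d) \<in> Cp"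
    unfolding lm lin_comb_def
    by (intro add_subgroup_sum[OF Cp_sub] Cp_mult Cp_sc dl xm)
  then have "hh * (\<chi> (lincomb A xm ?d) - sc l * \<chi> s) \<in> hCp"
    by (intro hCp_I Cp_diff Cp_mult Cp_sc l(2) s(2))
  moreover have "\<chi> (cp p) = lin_comb \<kappa> (\<lambda>m. \<chi> (xm m)) p"
    by (simp add: lm lin_comb_map_const)
  ultimately show ?thesis by simp
qed

abbreviation "pX m \<equiv> pl xl (mlist n m)"

lemma pX_Cp: "pX m \<in> Cp"
  by (rule pl_Cp[OF Cp_xl set_mlist])

lemma of_nat_Cp: "of_nat k \<in> Cp"
  by (induction k) (simp_all add: Cp_zero Cp_one add_subgroupD(4)[OF Cp_sub])

text \<open>Leibniz rule by induction on the word: in \<open>OM_list_Cons\<close> the first summand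
  differentiates the tail and the second contributes the letter \<open>i\<close>. Where an exponent
  is 0, truncated subtraction does not lower it, but then the coefficient vanishes.\<close>

lemma OM_deriv_list:
  assumes "set ks \<subseteq> {..<n}"
  shows "hinv * (pl xl ks - pl xr (rev ks))
      - (\<Sum>l<n. of_nat (lookup (expo ks) l) * (pX (expo ks - single l 1) * om l)) \<in> hCp"
    (is "?D ks - ?s ks \<in> hCp")
  using assms
proof (induction ks)
  case Nil
  then show ?case using add_subgroupD(1)[OF hCp_sub] by simp
next
  case (Cons i ks)
  let ?m = "expo ks"
  have i: "i < n" and ks: "set ks \<subseteq> {..<n}" and IH: "?D ks - ?s ks \<in> hCp" using Cons by auto
  have s: "?s ks \<in> Cp"
    by (intro add_subgroup_sum[OF Cp_sub] Cp_mult of_nat_Cp pX_Cp Cp_om) auto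
  have D: "?D ks \<in> Cp"
    using add_subgroup_cancel[OF Cp_sub, of "?D ks" "?s ks"] hCp_Cp IH s by blast
  \<comment> \<open>Exact form of the agreement of left and right words modulo \<open>h\<close>; the
    difference stays in \<open>hCp\<close> because \<open>?D ks\<close> lies in
    \<open>Cp\<close>.\<close>
  have xr: "pl xr (rev ks) = pl xl ks - hh * ?D ks" by (simp add: hinv_hh)
  have "pl xl ks - pX ?m \<in> hCp"
    by (rule xl_perm) (simp_all add: mset_mlist_expo ks)
  then have 1: "(pl xl ks - pX ?m) * om i \<in> hCp" by (rule hCp_right[OF Cp_om[OF i]])
  have 2: "hh * ?D ks * om i \<in> hCp"
    by (intro hCp_right hCp_I D Cp_om i)
  have 3: "xl i * (?D ks - ?s ks) \<in> hCp"
    by (rule hCp_left[OF Cp_xl[OF i] IH])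
  \<comment> \<open>The sum for the tail with the letter \<open>i\<close> put in front; the sum for
    \<open>i # ks\<close> has only the term \<open>pX ?m * om i\<close> in addition.\<close>
  define T where "T = (\<Sum>l<n. of_nat (lookup ?m l) * (pX (expo (i # ks) - single l 1) * om l))"
  have 4: "xl i * ?s ks - T \<in> hCp"
  proof -
    have "xl i * (of_nat (lookup ?m l) * (pX (?m - single l 1) * om l))
        - of_nat (lookup ?m l) * (pX (expo (i # ks) - single l 1) * om l) \<in> hCp" if l: "l < n" for l
    proof (cases "lookup ?m l = 0")
      case True
      then show ?thesis using add_subgroupD(1)[OF hCp_sub] by simp
    next
      case False
      have e: "expo (i # ks) - single l 1 = single i 1 + (?m - single l 1)"
        by (rule poly_mapping_eqI) (use False in \<open>auto simp: lookup_minus lookup_add lookup_single when_def\<close>)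
      have "pl xl (i # mlist n (?m - single l 1)) - pX (expo (i # ks) - single l 1) \<in> hCp"
        unfolding e by (rule xl_perm) (use i set_mlist df.mset_mlist_Cons in auto)
      then have "of_nat (lookup ?m l) * ((xl i * pX (?m - single l 1) - pX (expo (i # ks) - single l 1)) * om l) \<in> hCp"
        by (intro hCp_left of_nat_Cp hCp_right Cp_om l) simp
      moreover have "xl i * (of_nat k * r) = of_nat k * (xl i * r)" for k r
        by (simp only: mult.assoc[symmetric] mult_of_nat_commute[of k "xl i"])
      ultimately show ?thesis by (simp only: left_diff_distrib right_diff_distrib mult.assoc)
    qed
    then have "(\<Sum>l<n. xl i * (of_nat (lookup ?m l) * (pX (?m - single l 1) * om l))
        - of_nat (lookup ?m l) * (pX (expo (i # ks) - single l 1) * om l)) \<in> hCp"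
      by (intro add_subgroup_sum[OF hCp_sub]) auto
    then show ?thesis by (simp only: T_def sum_distrib_left sum_subtractf)
  qed
  have 5: "?s (i # ks) = T + pX ?m * om i"
  proof -
    have "?s (i # ks) = (\<Sum>l<n. of_nat (lookup ?m l) * (pX (expo (i # ks) - single l 1) * om l)
        + (if l = i then pX ?m * om i else 0))"
      by (rule sum.cong) (auto simp: lookup_add lookup_single when_def distrib_right)
    also have "\<dots> = T + pX ?m * om i"
      using i by (simp add: T_def sum.distrib)
    finally show ?thesis .
  qed
  have "?D (i # ks) - ?s (i # ks)
    = xl i * (?D ks - ?s ks) + (xl i * ?s ks - T) + (pl xl ks - pX ?m) * om i - hh * ?D ks * om i"
    unfolding OM_list_Cons 5
    by (subst xr) (simp only: left_diff_distrib right_diff_distrib, simp)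
  also have "\<dots> \<in> hCp"
    by (intro add_subgroupD(2,4)[OF hCp_sub] 1 2 3 4)
  finally show ?case .
qed

lemma OM_deriv:
  assumes "m \<in> exponents n"
  shows "OM (xm m) - (\<Sum>l<n. of_nat (lookup m l) * (pX (m - single l 1) * om l)) \<in> hCp"
  using OM_deriv_list[OF set_mlist, of m] assms by (simp only: OM_xm expo_mlist)

lemma OM_xm_Cp: "OM (xm m) \<in> Cp"
proof -
  have "hinv * (pl xl ks - pl xr (rev ks)) \<in> Cp" if "set ks \<subseteq> {..<n}" for ks
  proof -
    have "(\<Sum>l<n. of_nat (lookup (expo ks) l) * (pX (expo ks - single l 1) * om l)) \<in> Cp"
      by (intro add_subgroup_sum[OF Cp_sub] Cp_mult of_nat_Cp pX_Cp Cp_om) auto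
    then show ?thesis
      using add_subgroup_cancel[OF Cp_sub] hCp_Cp OM_deriv_list[OF that] by blast
  qed
  then show ?thesis by (simp only: OM_xm set_mlist)
qed

lemma lmul_xm_Cp: "lmul (xm m) \<in> Cp"
  unfolding lmul_xm by (rule pX_Cp)

definition is_beta where
  "is_beta i j \<beta> \<longleftrightarrow> \<beta> \<in> S \<and> x i \<otimes> x j \<ominus> x j \<otimes> x i = (qq - 1) \<odot>\<^bsub>A\<^esub> \<beta>"

text \<open>\<open>lmul \<beta>\<close> lies in \<open>Cp\<close> because it is a commutator of
  generators; membership of \<open>\<beta>\<close> in \<open>S\<close> alone would not give this.
  Hence \<open>approx_mod_hCp\<close> applies.\<close>

lemma om_xl_relation:
  assumes "i < n" "j < n" "is_beta i j \<beta>" "keys p \<subseteq> exponents n" "\<beta> \<ominus> cp p \<in> hS"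
  shows "om i * xl j - xl j * om i - lin_comb \<kappa> pX p \<in> hCp"
proof -
  have b: "om i * xl j - xl j * om i = lmul \<beta>"
    by (rule om_xl_beta) (use assms x_S in \<open>auto simp: is_beta_def\<close>)
  have "lmul \<beta> \<in> Cp" unfolding b[symmetric] by (intro Cp_diff Cp_mult Cp_om Cp_xl assms)
  then have "lmul \<beta> - lin_comb \<kappa> (\<lambda>m. lmul (xm m)) p \<in> hCp"
    by (intro approx_mod_hCp[of lmul] lmul_add lmul_smult lmul_xm_Cp)
      (use assms in \<open>auto simp: is_beta_def\<close>)
  then show ?thesis by (simp only: b lmul_xm)
qed

lemma om_om_relation:
  assumes "i < n" "j < n" "is_beta i j \<beta>" "keys p \<subseteq> exponents n" "\<beta> \<ominus> cp p \<in> hS"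
  shows "om i * om j - om j * om i
    - lin_comb \<kappa> (\<lambda>m. \<Sum>l<n. of_nat (lookup m l) * (pX (m - single l 1) * om l)) p \<in> hCp"
proof -
  have b: "om i * om j - om j * om i = OM \<beta>"
    by (rule om_om_beta) (use assms x_S in \<open>auto simp: is_beta_def\<close>)
  have "OM \<beta> \<in> Cp" unfolding b[symmetric] by (intro Cp_diff Cp_mult Cp_om assms)
  then have 1: "OM \<beta> - lin_comb \<kappa> (\<lambda>m. OM (xm m)) p \<in> hCp"
    by (intro approx_mod_hCp[of OM] OM_add OM_smult OM_xm_Cp)
      (use assms in \<open>auto simp: is_beta_def\<close>)
  have 2: "lin_comb \<kappa> (\<lambda>m. OM (xm m)) p
      - lin_comb \<kappa> (\<lambda>m. \<Sum>l<n. of_nat (lookup m l) * (pX (m - single l 1) * om l)) p \<in> hCp"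
  proof (rule df.lin_comb_cong_mod[OF hCp_sub])
    fix m c assume "m \<in> keys p"
    then have "m \<in> exponents n" using assms(4) by blast
    then show "\<kappa> c * (OM (xm m) - (\<Sum>l<n. of_nat (lookup m l) * (pX (m - single l 1) * om l))) \<in> hCp"
      by (intro hCp_left Cp_sc const_laurent OM_deriv)
  qed
  show ?thesis unfolding b by (rule add_subgroup_trans[OF hCp_sub 1 2])
qed

end

section \<open>The presented algebra\<close>

lemma sum_single_expansion: "f = (\<Sum>w\<in>keys f. single w (lookup f w))"
  by (rule poly_mapping_eqI) (auto simp: lookup_sum lookup_single when_def in_keys_iff)

lemma central_hom_single: "central_hom (single (0::'m::monoid_add) :: 'k::comm_ring_1 \<Rightarrow> 'm \<Rightarrow>\<^sub>0 'k)"
proof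
  fix a :: 'k and r :: "'m \<Rightarrow>\<^sub>0 'k"
  have "single 0 a * (\<Sum>w\<in>keys r. single w (lookup r w)) = (\<Sum>w\<in>keys r. single w (lookup r w)) * single 0 a"
    by (simp add: sum_distrib_left sum_distrib_right mult_single mult.commute)
  then show "single 0 a * r = r * single 0 a" by (simp only: sum_single_expansion[symmetric])
qed (simp_all add: single_add mult_single)

lemma (in central_hom) lin_comb_sum: "lin_comb \<kappa> F (\<Sum>a\<in>I. f a) = (\<Sum>a\<in>I. lin_comb \<kappa> F (f a))"
  by (induction I rule: infinite_finite_induct) (auto simp: lin_comb_add)

text \<open>Universal property of a monoid algebra: a multiplicative \<open>F\<close> extends to an
  algebra homomorphism.\<close>

lemma (in central_hom) lin_comb_mult:
  assumes "\<And>u v. F (u + v) = F u * F v"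
  shows "lin_comb \<kappa> F (f * g) = lin_comb \<kappa> F f * lin_comb \<kappa> F g"
proof -
  have "f * g = (\<Sum>u\<in>keys f. \<Sum>v\<in>keys g. single (u + v) (lookup f u * lookup g v))"
    by (subst (1) sum_single_expansion[of f], subst (1) sum_single_expansion[of g])
      (simp add: sum_product mult_single)
  moreover have "\<kappa> (a * b) * (F u * F v) = \<kappa> a * F u * (\<kappa> b * F v)" for a b u v
    by (simp only: kappa_mult mult.assoc[symmetric]) (simp only: mult.assoc kappa_central[of b "F u"])
  ultimately show ?thesis
    by (simp add: lin_comb_sum assms) (simp add: lin_comb_def sum_product)
qed

lemma monoid_alg_ring:
  assumes "0 \<in> W" "\<And>u v. u \<in> W \<Longrightarrow> v \<in> W \<Longrightarrow> u + v \<in> W"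
  shows "ring (monoid_alg W :: ('k::field_char_0, 'm::monoid_add \<Rightarrow>\<^sub>0 'k) module)"
proof (rule ringI)
  show "abelian_group (monoid_alg W :: ('k, 'm \<Rightarrow>\<^sub>0 'k) module)"
  proof (rule abelian_groupI)
    fix f :: "'m \<Rightarrow>\<^sub>0 'k" assume "f \<in> carrier (monoid_alg W)"
    then show "\<exists>g\<in>carrier (monoid_alg W). g \<oplus>\<^bsub>monoid_alg W\<^esub> f = \<zero>\<^bsub>monoid_alg W\<^esub>"
      by (intro bexI[of _ "- f"]) (auto simp: monoid_alg_def in_keys_iff)
  qed (use keys_add in \<open>force simp: monoid_alg_def add_ac\<close>)+
  show "monoid (monoid_alg W :: ('k, 'm \<Rightarrow>\<^sub>0 'k) module)"
  proof (rule monoidI)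
    fix f g :: "'m \<Rightarrow>\<^sub>0 'k" assume "f \<in> carrier (monoid_alg W)" "g \<in> carrier (monoid_alg W)"
    then show "f \<otimes>\<^bsub>monoid_alg W\<^esub> g \<in> carrier (monoid_alg W)"
      using keys_mult[of f g] assms(2) by (fastforce simp: monoid_alg_def)
  qed (use assms in \<open>auto simp: monoid_alg_def mult.assoc\<close>)
qed (auto simp: monoid_alg_def algebra_simps)

lemma monoid_alg_finsum:
  assumes "ring (monoid_alg W :: ('k::field_char_0, 'm::monoid_add \<Rightarrow>\<^sub>0 'k) module)"
    and "finite J" "\<And>j. j \<in> J \<Longrightarrow> f j \<in> carrier (monoid_alg W :: ('k, 'm \<Rightarrow>\<^sub>0 'k) module)"
  shows "(\<Oplus>\<^bsub>monoid_alg W\<^esub>j\<in>J. f j) = (\<Sum>j\<in>J. (f j :: 'm \<Rightarrow>\<^sub>0 'k))"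
proof -
  interpret ring "monoid_alg W :: ('k, 'm \<Rightarrow>\<^sub>0 'k) module" by fact
  show ?thesis
    using assms(2,3)
  proof (induction J rule: finite_induct)
    case (insert j J)
    have "(\<Oplus>\<^bsub>monoid_alg W\<^esub>j\<in>insert j J. f j) = f j \<oplus>\<^bsub>monoid_alg W\<^esub> (\<Oplus>\<^bsub>monoid_alg W\<^esub>j\<in>J. f j)"
      using insert by (intro finsum_insert) auto
    then show ?case using insert by (simp add: monoid_alg_def)
  qed (simp only: finsum_empty, simp add: monoid_alg_def)
qed

context quantization
begin

lemma app_lmul_unit: "a \<in> carrier A \<Longrightarrow> app (lmul a) (single (0, 0) 1) = lin_ext (\<lambda>w. single (w, 0) 1) (coords a)"
  by (simp add: lmul_def app_endo_of ltab_def xm_0 high_zero)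

text \<open>The coordinates of an element are recovered by applying its operator to the vector at
  index \<open>(0, 0)\<close>.\<close>

lemma lmul_inject:
  assumes "a \<in> carrier A" "b \<in> carrier A" "lmul a = lmul b" shows "a = b"
proof -
  have l: "lookup (app (lmul c) (single (0, 0) 1)) (w, 0) = lookup (coords c) w" if "c \<in> carrier A" for c w
    by (auto simp: app_lmul_unit[OF that] lin_comb_def lookup_sum mult_single lookup_single when_def in_keys_iff)
  have "coords a = coords b"
    by (rule poly_mapping_eqI) (metis l assms)
  then show ?thesis using coords(2) assms by metis
qed

lemma commutator_quotient_eq:
  assumes "a \<in> S" "b \<in> S" "\<beta> \<in> S" "a \<otimes> b \<ominus> b \<otimes> a = (qq - 1) \<odot>\<^bsub>A\<^esub> \<beta>"
  shows "commutator_quotient A S a b = \<beta>"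
  unfolding commutator_quotient_def
proof (rule the_equality)
  fix c assume c: "c \<in> S \<and> a \<otimes> b \<ominus> b \<otimes> a = (qq - 1) \<odot>\<^bsub>A\<^esub> c"
  show "c = \<beta>" by (rule qq1_cancel) (use c assms in auto)
qed (use assms in auto)

lemma coset_diff:
  assumes "a \<in> S" "b \<in> bar a" shows "b \<in> S" "\<exists>s\<in>S. lmul b = lmul a + hh * lmul s"
proof -
  have "b \<in> carrier AS \<and> b \<ominus>\<^bsub>AS\<^esub> a \<in> hS"
    using alg_congruence.mem_coset_iff[OF spec_congruence, of a b] assms by simp
  then have b: "b \<in> S" "b \<ominus> a \<in> hS" using AS_minus assms by auto
  then show "b \<in> S" "\<exists>s\<in>S. lmul b = lmul a + hh * lmul s"
    using lmul_hS[OF b(2)] assms(1) by (auto simp: lmul_diff diff_eq_eq add.commute)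
qed

lemma bar_self: "a \<in> S \<Longrightarrow> a \<in> bar a"
  using alg_congruence.mem_coset_iff[OF spec_congruence, of a a] hS_sub
  by (simp add: AS_minus M.minus_eq M.r_neg hS_iff) (metis S_closed(2) smult_r_null carrier_of_type(1) UNIV_I)

text \<open>\<open>semiclassical_bracket\<close> is a union over all representatives, so
  \<open>a + h s\<close> and \<open>b + h t\<close> have to give the same coset. In their commutator
  every correction carries a second factor \<open>h\<close>, because commutators in \<open>S\<close>
  are themselves divisible by \<open>h\<close>.\<close>

lemma bracket_bar:
  assumes "a \<in> S" "b \<in> S" "\<beta> \<in> S" "a \<otimes> b \<ominus> b \<otimes> a = (qq - 1) \<odot>\<^bsub>A\<^esub> \<beta>"
  shows "semiclassical_bracket A S (bar a) (bar b) = bar \<beta>"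
proof -
  have "spec_image A S (commutator_quotient A S a' b') = bar \<beta>" if a': "a' \<in> bar a" and b': "b' \<in> bar b" for a' b'
  proof -
    obtain s where s: "a' \<in> S" "s \<in> S" "lmul a' = lmul a + hh * lmul s" using coset_diff[OF assms(1) a'] by blast
    obtain t where t: "b' \<in> S" "t \<in> S" "lmul b' = lmul b + hh * lmul t" using coset_diff[OF assms(2) b'] by blast
    obtain \<beta>' where \<beta>': "\<beta>' \<in> S" "a' \<otimes> b' \<ominus> b' \<otimes> a' = (qq - 1) \<odot>\<^bsub>A\<^esub> \<beta>'"
      using ex_beta[OF s(1) t(1)] by blast
    obtain g1 where g1: "g1 \<in> S" "s \<otimes> b \<ominus> b \<otimes> s = (qq - 1) \<odot>\<^bsub>A\<^esub> g1" using ex_beta[OF s(2) assms(2)] by blast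
    obtain g2 where g2: "g2 \<in> S" "a \<otimes> t \<ominus> t \<otimes> a = (qq - 1) \<odot>\<^bsub>A\<^esub> g2" using ex_beta[OF assms(1) t(2)] by blast
    obtain g3 where g3: "g3 \<in> S" "s \<otimes> t \<ominus> t \<otimes> s = (qq - 1) \<odot>\<^bsub>A\<^esub> g3" using ex_beta[OF s(2) t(2)] by blast
    let ?g = "(g1 \<oplus> g2) \<oplus> ((qq - 1) \<odot>\<^bsub>A\<^esub> g3)"
    have gS: "?g \<in> S" by (intro S_closed g1 g2 g3 qq_minus_1_laurent)
    have "hh * lmul \<beta>' = lmul a' * lmul b' - lmul b' * lmul a'"
      using commutator_beta(1)[OF s(1) t(1) \<beta>'] by simp
    also have "\<dots> = (lmul a * lmul b - lmul b * lmul a) + hh * (lmul s * lmul b - lmul b * lmul s)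
        + hh * (lmul a * lmul t - lmul t * lmul a) + hh * (hh * (lmul s * lmul t - lmul t * lmul s))"
      by (simp add: s(3) t(3) distrib_left distrib_right right_diff_distrib mult.assoc
          sc_left[of "lmul a"] sc_left[of "lmul b"] sc_left[of "lmul s"] sc_left[of "lmul t"])
    also have "\<dots> = hh * (lmul \<beta> + hh * lmul ?g)"
      using commutator_beta(1)[OF assms] commutator_beta(1)[OF s(2) assms(2) g1]
        commutator_beta(1)[OF assms(1) t(2) g2] commutator_beta(1)[OF s(2) t(2) g3] g1(1) g2(1) g3(1)
      by (simp add: lmul_add lmul_smult distrib_left add.assoc)
    finally have "hinv * (hh * lmul \<beta>') = hinv * (hh * (lmul \<beta> + hh * lmul ?g))" by (rule arg_cong)
    then have "lmul \<beta>' = lmul \<beta> + hh * lmul ?g" by (simp only: hinv_hh)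
    then have "lmul (\<beta>' \<ominus> \<beta>) = lmul ((qq - 1) \<odot>\<^bsub>A\<^esub> ?g)"
      using \<beta>' assms(3) S_carrier[OF gS] by (simp add: lmul_diff lmul_smult)
    then have "\<beta>' \<ominus> \<beta> = (qq - 1) \<odot>\<^bsub>A\<^esub> ?g"
      using \<beta>'(1) assms(3) S_carrier[OF gS] by (intro lmul_inject) auto
    then have "\<beta>' \<ominus> \<beta> \<in> hS" using gS by (auto simp: hS_iff)
    then have "bar \<beta>' = bar \<beta>" using bar_eq_iff[OF \<beta>'(1) assms(3)] by blast
    then show ?thesis
      by (simp only: commutator_quotient_eq[OF s(1) t(1) \<beta>'] spec_image_bar)
  qed
  then show ?thesis
    unfolding semiclassical_bracket_def using bar_self[OF assms(1)] bar_self[OF assms(2)] by blast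
qed

definition pij :: "nat \<Rightarrow> nat \<Rightarrow> (nat \<Rightarrow>\<^sub>0 nat) \<Rightarrow>\<^sub>0 'k" where
  "pij i j = mpoly_repr n Sp (\<lambda>i. spec_image A S (x i))
     (semiclassical_bracket A S (spec_image A S (x i)) (spec_image A S (x j)))"

text \<open>Links the polynomial in the relations of \<open>P(A)\<close> to an actual commutator
  quotient in \<open>S\<close>.\<close>

lemma pij:
  assumes "i < n" "j < n"
  shows "\<exists>\<beta>. is_beta i j \<beta> \<and> keys (pij i j) \<subseteq> exponents n \<and> \<beta> \<ominus> cp (pij i j) \<in> hS"
proof -
  have ij: "x i \<in> S" "x j \<in> S" using x_S assms by auto
  obtain \<beta> where \<beta>: "\<beta> \<in> S" "x i \<otimes> x j \<ominus> x j \<otimes> x i = (qq - 1) \<odot>\<^bsub>A\<^esub> \<beta>" using ex_beta[OF ij] by blast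
  obtain p where p: "keys p \<subseteq> exponents n" "\<beta> \<ominus> cp p \<in> hS" using S_approx[OF \<beta>(1)] by blast
  have eq: "bar (cp p) = bar \<beta>"
    using iffD2[OF bar_eq_iff[OF \<beta>(1) cp_S] p(2)] by (rule sym)
  have "pij i j = p"
    unfolding pij_def mpoly_repr_def spec_image_bar bracket_bar[OF ij \<beta>]
  proof (rule the_equality)
    show "p \<in> carrier (mpoly_alg n) \<and> mpoly_eval n Sp (\<lambda>i. bar (x i)) p = bar \<beta>"
      using p(1) eq eval_bar[of p] by (simp add: monoid_alg_def spec_image_bar)
    fix r assume "r \<in> carrier (mpoly_alg n) \<and> mpoly_eval n Sp (\<lambda>i. bar (x i)) r = bar \<beta>"
    then have "keys r \<subseteq> exponents n" "bar (cp r) = bar (cp p)"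
      using eq eval_bar[of r] by (simp_all add: monoid_alg_def spec_image_bar)
    then show "r = p" using inj_onD[OF bij_betw_imp_inj_on[OF bij_eval], of r p] p(1) by simp
  qed
  then show ?thesis using \<beta> p by (auto simp: is_beta_def)
qed

section \<open>The free algebra and its homomorphism to the endomorphism ring\<close>

abbreviation env_words :: "env_gen word set" where
  "env_words \<equiv> {w. set (letters w) \<subseteq> Y ` {..<n} \<union> Omega ` {..<n}}"
abbreviation FA :: "('k, env_gen word \<Rightarrow>\<^sub>0 'k) module" where "FA \<equiv> env_free_alg n"
abbreviation fy :: "nat \<Rightarrow> env_gen word \<Rightarrow>\<^sub>0 'k" where "fy i \<equiv> gen_elem (Y i)"
abbreviation fo :: "nat \<Rightarrow> env_gen word \<Rightarrow>\<^sub>0 'k" where "fo i \<equiv> gen_elem (Omega i)"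
abbreviation kf :: "'k \<Rightarrow> env_gen word \<Rightarrow>\<^sub>0 'k" where "kf \<equiv> single 0"

lemma env_words_monoid:
  "0 \<in> env_words" "u \<in> env_words \<Longrightarrow> v \<in> env_words \<Longrightarrow> u + v \<in> env_words"
  by (auto simp: zero_word_def plus_word_def)

lemma FA_ring: "ring FA"
  unfolding env_free_alg_def by (rule monoid_alg_ring[OF env_words_monoid])

lemma FA_simps:
  "f \<in> carrier FA \<longleftrightarrow> keys f \<subseteq> env_words" "f \<otimes>\<^bsub>FA\<^esub> g = f * g" "f \<oplus>\<^bsub>FA\<^esub> g = f + g" "\<one>\<^bsub>FA\<^esub> = 1"
  "\<zero>\<^bsub>FA\<^esub> = 0" "c \<odot>\<^bsub>FA\<^esub> f = kf c * f"
  by (simp_all add: env_free_alg_def monoid_alg_def)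

lemma FA_sub: "add_subgroup (carrier FA)"
  unfolding add_subgroup_def
proof (intro conjI ballI)
  fix f g assume "f \<in> carrier FA" "g \<in> carrier FA"
  then show "f - g \<in> carrier FA" using keys_diff[of f g] unfolding FA_simps(1) by blast
qed (simp add: FA_simps(1))

lemma FA_mult: "f \<in> carrier FA \<Longrightarrow> g \<in> carrier FA \<Longrightarrow> f * g \<in> carrier FA"
  using ring.ring_simprules(5)[OF FA_ring, of f g] by (simp add: FA_simps(2))

lemma FA_kf: "kf c \<in> carrier FA"
  unfolding FA_simps(1) by (auto simp: zero_word_def)

lemma FA_one: "1 \<in> carrier FA"
  using FA_kf[of 1] by simp

lemma FA_y: "i < n \<Longrightarrow> fy i \<in> carrier FA" and FA_o: "i < n \<Longrightarrow> fo i \<in> carrier FA"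
  unfolding FA_simps(1) by (auto simp: gen_elem_def)

lemma FA_pl: "(\<And>i. i < n \<Longrightarrow> F i \<in> carrier FA) \<Longrightarrow> set ks \<subseteq> {..<n} \<Longrightarrow> pl F ks \<in> carrier FA"
  by (induction ks) (simp_all add: FA_one FA_mult)

interpretation KF: central_hom kf
  by (rule central_hom_single)

lemma gen_word: "prod_list (map gen_elem gs) = single (Word gs) (1::'k)"
proof (induction gs)
  case Nil
  then show ?case by (simp add: zero_word_def[symmetric])
next
  case (Cons g gs)
  then show ?case by (simp add: gen_elem_def mult_single plus_word_def)
qed

lemma single_word: "single w c = kf c * prod_list (map gen_elem (letters w))"
  by (simp add: gen_word mult_single)

definition ev :: "env_gen \<Rightarrow> ((nat \<Rightarrow>\<^sub>0 nat) \<times> (nat \<Rightarrow>\<^sub>0 nat), 'k poly fract) endo" where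
  "ev g = (case g of Y i \<Rightarrow> xl i | Omega i \<Rightarrow> om i)"

text \<open>The \<open>k\<close>-algebra homomorphism that sends \<open>y_i\<close> to
  \<open>xl i\<close> and \<open>Omega_i\<close> to \<open>om i\<close>. Modulo \<open>hCp\<close>
  it is onto \<open>Cp\<close> (\<open>Phi_surj\<close>) with kernel \<open>I\<close>
  (\<open>Phi_kernel\<close>).\<close>

definition "Phi = lin_comb \<kappa> (\<lambda>w. prod_list (map ev (letters w)))"

lemma Phi_diff: "Phi (f - g) = Phi f - Phi g"
  and Phi_add: "Phi (f + g) = Phi f + Phi g"
  and Phi_sum: "Phi (\<Sum>a\<in>I. F a) = (\<Sum>a\<in>I. Phi (F a))"
  unfolding Phi_def by (rule df.lin_comb_diff df.lin_comb_add df.lin_comb_sum)+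

lemma Phi_mult: "Phi (f * g) = Phi f * Phi g"
  unfolding Phi_def by (rule df.lin_comb_mult) (simp add: plus_word_def)

lemma Phi_kf: "Phi (kf c) = \<kappa> c"
  by (simp add: Phi_def zero_word_def)

lemma Phi_one: "Phi 1 = 1"
  using Phi_kf[of 1] by simp

lemma Phi_gen: "Phi (fy i) = xl i" "Phi (fo i) = om i"
  by (simp_all add: Phi_def gen_elem_def ev_def)

lemma Phi_pl: "Phi (pl F ks) = pl (\<lambda>i. Phi (F i)) ks"
  by (induction ks) (simp_all add: Phi_one Phi_mult)

lemma Phi_pl_y: "Phi (pl fy ks) = pl xl ks" and Phi_pl_o: "Phi (pl fo ks) = pl om ks"
  by (simp_all only: Phi_pl Phi_gen)

lemma Phi_lin_comb: "Phi (lin_comb kf F c) = lin_comb \<kappa> (\<lambda>p. Phi (F p)) c"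
  by (simp add: lin_comb_def Phi_sum Phi_mult Phi_kf)

lemma iota_lift_eq: "iota_lift n p = lin_comb kf (\<lambda>m. pl fy (mlist n m)) p"
proof -
  have m: "monoid FA" using FA_ring by (simp add: ring_def)
  have om: "ordered_monomial FA n fy m = pl fy (mlist n m)" for m
    by (rule ordered_monomial_hom[where \<phi> = "\<lambda>f. f", OF _ _ m]) (use FA_y in \<open>auto simp: FA_simps(2,4)\<close>)
  have c: "kf (lookup p m) * pl fy (mlist n m) \<in> carrier FA" for m
    by (intro FA_mult FA_kf FA_pl FA_y set_mlist)
  have "iota_lift n p = (\<Oplus>\<^bsub>FA\<^esub>m\<in>keys p. kf (lookup p m) * pl fy (mlist n m))"
    by (simp add: iota_lift_def mpoly_eval_def lincomb_def om FA_simps(6))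
  also have "\<dots> = (\<Sum>m\<in>keys p. kf (lookup p m) * pl fy (mlist n m))"
    using monoid_alg_finsum[OF monoid_alg_ring[OF env_words_monoid], of "keys p"
        "\<lambda>m. kf (lookup p m) * pl fy (mlist n m)"] c
    unfolding env_free_alg_def by simp
  finally show ?thesis by (simp add: lin_comb_def)
qed

lemma FA_iota: "iota_lift n p \<in> carrier FA"
  unfolding iota_lift_eq
  by (rule KF.lin_comb_in[OF FA_sub]) (intro FA_mult FA_kf FA_pl FA_y set_mlist)

abbreviation "rels \<equiv> poisson_env_relations n Sp (semiclassical_bracket A S) (\<lambda>i. spec_image A S (x i))"

lemma rels_cases:
  "rels = {fy i * fy j - fy j * fy i | i j. i < n \<and> j < n} \<union>
    {fo i * fy j - fy j * fo i - iota_lift n (pij i j) | i j. i < n \<and> j < n} \<union>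
    {fo i * fo j - fo j * fo i - (\<Sum>l<n. iota_lift n (mpoly_deriv l (pij i j)) * fo l) | i j. i < j \<and> j < n}"
  unfolding poisson_env_relations_def Let_def pij_def ..

lemma rels_FA: "rels \<subseteq> carrier FA"
  unfolding rels_cases
  by (auto intro!: add_subgroupD(2)[OF FA_sub] add_subgroup_sum[OF FA_sub] FA_mult FA_iota FA_y FA_o)

lemma kappa_of_nat: "\<kappa> (of_nat k) = of_nat k"
  by (induction k) (simp_all add: df.kappa_add del: of_nat_Suc, simp add: df.kappa_add)

text \<open>Matches the derivative terms of the relations with the derivation formula
  \<open>OM_deriv\<close>, after exchanging the sums over variables and monomials.\<close>

lemma Phi_deriv:
  "Phi (\<Sum>l<n. iota_lift n (mpoly_deriv l p) * fo l)
    = lin_comb \<kappa> (\<lambda>m. \<Sum>l<n. of_nat (lookup m l) * (pX (m - single l 1) * om l)) p"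
proof -
  have "Phi (iota_lift n (mpoly_deriv l p)) = (\<Sum>m\<in>keys p. \<kappa> (lookup p m) * (of_nat (lookup m l) * pX (m - single l 1)))" for l
    unfolding iota_lift_eq Phi_lin_comb Phi_pl_y mpoly_deriv_def df.lin_comb_sum df.lin_comb_single
      df.kappa_mult kappa_of_nat mult.assoc ..
  then have "Phi (\<Sum>l<n. iota_lift n (mpoly_deriv l p) * fo l)
      = (\<Sum>l<n. \<Sum>m\<in>keys p. \<kappa> (lookup p m) * (of_nat (lookup m l) * (pX (m - single l 1) * om l)))"
    by (simp add: Phi_sum Phi_mult Phi_gen sum_distrib_right mult.assoc)
  also have "\<dots> = (\<Sum>m\<in>keys p. \<Sum>l<n. \<kappa> (lookup p m) * (of_nat (lookup m l) * (pX (m - single l 1) * om l)))"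
    by (rule sum.swap)
  finally show ?thesis by (simp add: lin_comb_def sum_distrib_left)
qed

lemma Phi_rels: "r \<in> rels \<Longrightarrow> Phi r \<in> hCp"
  unfolding rels_cases
proof (elim UnE)
  assume "r \<in> {fy i * fy j - fy j * fy i | i j. i < n \<and> j < n}"
  then show ?thesis by (auto simp: Phi_diff Phi_mult Phi_gen xl_comm_hCp)
next
  assume "r \<in> {fo i * fy j - fy j * fo i - iota_lift n (pij i j) | i j. i < n \<and> j < n}"
  then obtain i j where r: "r = fo i * fy j - fy j * fo i - iota_lift n (pij i j)" "i < n" "j < n" by blast
  obtain \<beta> where "is_beta i j \<beta>" "keys (pij i j) \<subseteq> exponents n" "\<beta> \<ominus> cp (pij i j) \<in> hS"
    using pij[OF r(2,3)] by blast
  from om_xl_relation[OF r(2,3) this] show ?thesis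
    by (simp only: r(1) Phi_diff Phi_mult Phi_gen iota_lift_eq Phi_lin_comb Phi_pl_y)
next
  assume "r \<in> {fo i * fo j - fo j * fo i - (\<Sum>l<n. iota_lift n (mpoly_deriv l (pij i j)) * fo l) | i j. i < j \<and> j < n}"
  then obtain i j where r: "r = fo i * fo j - fo j * fo i - (\<Sum>l<n. iota_lift n (mpoly_deriv l (pij i j)) * fo l)"
    "i < n" "j < n" by (auto dest: less_trans)
  obtain \<beta> where "is_beta i j \<beta>" "keys (pij i j) \<subseteq> exponents n" "\<beta> \<ominus> cp (pij i j) \<in> hS"
    using pij[OF r(2,3)] by blast
  from om_om_relation[OF r(2,3) this] show ?thesis
    by (simp only: r(1) Phi_diff[of _ "sum _ _"] Phi_deriv Phi_diff[of "_ * _"] Phi_mult Phi_gen)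
qed

definition "I = genideal FA rels"

lemma I_ideal: "ideal I FA"
  unfolding I_def by (rule ring.genideal_ideal[OF FA_ring rels_FA])

lemma rels_I: "rels \<subseteq> I"
  unfolding I_def by (rule ring.genideal_self[OF FA_ring rels_FA])

lemma I_FA: "I \<subseteq> carrier FA"
  using ideal.Icarr[OF I_ideal] by blast

lemma I_left: "f \<in> carrier FA \<Longrightarrow> r \<in> I \<Longrightarrow> f * r \<in> I"
  and I_right: "f \<in> carrier FA \<Longrightarrow> r \<in> I \<Longrightarrow> r * f \<in> I"
  using ideal.I_l_closed[OF I_ideal, of r f] ideal.I_r_closed[OF I_ideal, of r f]
  by (simp_all add: FA_simps(2))

lemma I_sub: "add_subgroup I"
  unfolding add_subgroup_def
proof (intro conjI ballI)
  have as: "additive_subgroup I FA" using I_ideal by (simp add: ideal_def)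
  show "0 \<in> I" using additive_subgroup.zero_closed[OF as] by (simp add: FA_simps(5))
  fix a b assume "a \<in> I" "b \<in> I"
  moreover from this have "kf (- 1) * b \<in> I" by (intro I_left FA_kf)
  ultimately have "a \<oplus>\<^bsub>FA\<^esub> (kf (- 1) * b) \<in> I" by (intro additive_subgroup.a_closed[OF as])
  then show "a - b \<in> I" by (simp add: FA_simps(3) single_uminus)
qed

lemma I_minimal:
  assumes "ideal J FA" "rels \<subseteq> J" shows "I \<subseteq> J"
  unfolding I_def by (rule ring.genideal_minimal[OF FA_ring assms])

end

context quantization
begin

interpretation KF: central_hom kf
  by (rule central_hom_single)

text \<open>Induction principle for the free algebra: words grow by adding letters on the
  left.\<close>

lemma FA_generated:
  assumes "add_subgroup J" "\<And>c. kf c \<in> J"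
    "\<And>i f. i < n \<Longrightarrow> f \<in> J \<Longrightarrow> fy i * f \<in> J" "\<And>i f. i < n \<Longrightarrow> f \<in> J \<Longrightarrow> fo i * f \<in> J"
  shows "carrier FA \<subseteq> J"
proof
  fix f assume f: "f \<in> carrier FA"
  have "kf c * prod_list (map gen_elem gs) \<in> J" if "set gs \<subseteq> Y ` {..<n} \<union> Omega ` {..<n}" for c gs
    using that
  proof (induction gs)
    case (Cons g gs)
    have "kf c * prod_list (map gen_elem (g # gs)) = gen_elem g * (kf c * prod_list (map gen_elem gs))"
      by (simp add: mult.assoc[symmetric] KF.kappa_central[of c "gen_elem g"])
    then show ?case using Cons assms(3,4) by auto
  qed (simp add: assms(2))
  then have "single w (lookup f w) \<in> J" if "w \<in> keys f" for w
    using that f unfolding FA_simps(1) single_word[of w] by blast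
  then have "(\<Sum>w\<in>keys f. single w (lookup f w)) \<in> J"
    by (rule add_subgroup_sum[OF assms(1)])
  then show "f \<in> J" by (simp only: sum_single_expansion[symmetric])
qed

lemma Phi_FA: "f \<in> carrier FA \<Longrightarrow> Phi f \<in> Cp"
proof -
  have "carrier FA \<subseteq> {f. Phi f \<in> Cp}"
  proof (rule FA_generated)
    show "add_subgroup {f. Phi f \<in> Cp}"
      by (rule add_subgroup_vimage[OF Cp_sub Phi_diff])
  qed (auto simp: Phi_kf Phi_mult Phi_gen intro: Cp_sc const_laurent Cp_mult Cp_xl Cp_om)
  then show "f \<in> carrier FA \<Longrightarrow> Phi f \<in> Cp" by blast
qed

text \<open>The preimage of \<open>hCp\<close> is an ideal of the free algebra that contains the
  relations, hence the ideal generated by them.\<close>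

lemma Phi_I: "r \<in> I \<Longrightarrow> Phi r \<in> hCp"
proof -
  let ?J = "{f \<in> carrier FA. Phi f \<in> hCp}"
  interpret FA: ring FA by (rule FA_ring)
  have m1: "\<ominus>\<^bsub>FA\<^esub> f = - f" if "f \<in> carrier FA" for f
  proof -
    have "- f \<in> carrier FA" by (rule add_subgroupD(3)[OF FA_sub that])
    moreover have "f \<oplus>\<^bsub>FA\<^esub> (- f) = \<zero>\<^bsub>FA\<^esub>" by (simp add: FA_simps(3,5))
    ultimately show ?thesis using FA.minus_equality[of "- f" f] that by (simp add: FA_simps(3,5))
  qed
  have "ideal ?J FA"
  proof (rule idealI[OF FA_ring])
    show "subgroup ?J (add_monoid FA)"
    proof (rule FA.add.subgroupI)
      show "?J \<noteq> {}"
        using add_subgroupD(1)[OF FA_sub] add_subgroupD(1)[OF hCp_sub] Phi_diff[of 0 0] by auto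
      fix a assume a: "a \<in> ?J"
      have "- a \<in> carrier FA" using add_subgroupD(3)[OF FA_sub] a by blast
      moreover have "Phi (- a) = - Phi a" using Phi_diff[of 0 a] Phi_diff[of 0 0] by simp
      ultimately show "\<ominus>\<^bsub>FA\<^esub> a \<in> ?J" using a m1[of a] add_subgroupD(3)[OF hCp_sub] by auto
      fix b assume "b \<in> ?J"
      then show "a \<oplus>\<^bsub>FA\<^esub> b \<in> ?J"
        using a add_subgroupD(4)[OF FA_sub] add_subgroupD(4)[OF hCp_sub] by (simp add: FA_simps(3) Phi_add)
    qed blast
  next
    fix a f assume "a \<in> ?J" "f \<in> carrier FA"
    then show "f \<otimes>\<^bsub>FA\<^esub> a \<in> ?J" "a \<otimes>\<^bsub>FA\<^esub> f \<in> ?J"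
      unfolding FA_simps(2) mem_Collect_eq Phi_mult
      using hCp_left[OF Phi_FA] hCp_right[OF Phi_FA] FA_mult by auto
  qed
  moreover have "rels \<subseteq> ?J" using rels_FA Phi_rels by blast
  ultimately show "r \<in> I \<Longrightarrow> Phi r \<in> hCp" using I_minimal by blast
qed

abbreviation "py m \<equiv> pl fy (mlist n m)"
abbreviation "po m \<equiv> pl fo (mlist n m)"

text \<open>Preimage in the free algebra of the subalgebra of \<open>P(A)\<close> generated by the
  \<open>y_i\<close>. With \<open>I\<close> included it plays the part of \<open>E\<close> in the
  filtration argument, and calculations in \<open>P(A)\<close> stay inside the type of the free
  algebra.\<close>

definition "Ef = addspan ({kf c * py m | c m. m \<in> exponents n} \<union> I)"

lemma Ef_sub: "add_subgroup Ef"
  unfolding Ef_def by (rule add_subgroup_addspan)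

lemma I_Ef: "I \<subseteq> Ef"
  unfolding Ef_def using addspan_gen by blast

lemma Ef_gen: "m \<in> exponents n \<Longrightarrow> kf c * py m \<in> Ef"
  unfolding Ef_def by (rule addspan_gen) blast

lemma py_FA: "py m \<in> carrier FA"
  by (rule FA_pl[OF FA_y set_mlist])

lemma po_FA: "po m \<in> carrier FA"
  by (rule FA_pl[OF FA_o set_mlist])

lemma y_comm_I: "i < n \<Longrightarrow> j < n \<Longrightarrow> fy i * fy j - fy j * fy i \<in> I"
  using rels_I unfolding rels_cases by blast

lemma y_perm:
  assumes "mset ks = mset js" "set ks \<subseteq> {..<n}"
  shows "pl fy ks - pl fy js \<in> I"
proof (rule swap_imp_perm_cong[OF I_sub, where M = "mset ks"])
  fix u v i j assume "mset (u @ i # j # v) = mset ks"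
  then have *: "set (u @ i # j # v) \<subseteq> {..<n}"
    using assms(2) by (metis set_mset_mset)
  have "pl fy u * ((fy i * fy j - fy j * fy i) * pl fy v) \<in> I"
    by (intro I_left I_right y_comm_I FA_pl FA_y) (use * in auto)
  then show "pl fy (u @ i # j # v) - pl fy (u @ j # i # v) \<in> I"
    by (simp add: algebra_simps)
qed (use assms in auto)

lemma y_list_Ef: assumes "set ks \<subseteq> {..<n}" shows "kf c * pl fy ks \<in> Ef"
proof -
  have "pl fy ks - py (expo ks) \<in> I"
    by (rule y_perm) (simp_all add: mset_mlist_expo assms)
  then have "kf c * (pl fy ks - py (expo ks)) \<in> Ef"
    using I_left[OF FA_kf] I_Ef by blast
  moreover have "kf c * py (expo ks) \<in> Ef" by (rule Ef_gen[OF expo_exponents[OF assms]])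
  ultimately show ?thesis
    using add_subgroup_cancel[OF Ef_sub, of "kf c * pl fy ks" "kf c * py (expo ks)"]
    by (simp add: right_diff_distrib)
qed

lemma Ef_mult:
  assumes "a \<in> Ef" "b \<in> Ef" shows "a * b \<in> Ef"
proof (rule addspan_mult[OF assms[unfolded Ef_def] Ef_sub])
  fix g k assume g: "g \<in> {kf c * py m | c m. m \<in> exponents n} \<union> I"
    and k: "k \<in> {kf c * py m | c m. m \<in> exponents n} \<union> I"
  have gF: "g \<in> carrier FA" and kF: "k \<in> carrier FA"
    using g k I_FA FA_mult[OF FA_kf py_FA] by blast+
  show "g * k \<in> Ef"
  proof (cases "g \<in> I \<or> k \<in> I")
    case True
    then show ?thesis using I_left[OF gF] I_right[OF kF] I_Ef by blast
  next
    case False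
    then obtain c m d m' where *: "g = kf c * py m" "k = kf d * py m'" using g k by blast
    have "g * k = kf (c * d) * pl fy (mlist n m @ mlist n m')"
      by (simp add: * KF.kappa_mult mult.assoc)
        (simp add: mult.assoc[symmetric] KF.kappa_central[of d "py m"])
    then show ?thesis using y_list_Ef[of "mlist n m @ mlist n m'"] set_mlist by simp
  qed
qed

lemma Ef_one: "1 \<in> Ef"
  using y_list_Ef[of "[]" 1] by simp

lemma Ef_y: "i < n \<Longrightarrow> fy i \<in> Ef"
  using y_list_Ef[of "[i]" 1] by simp

lemma Ef_kf: "kf c \<in> Ef"
  using y_list_Ef[of "[]" c] by simp

lemma Ef_pl_y: "set ks \<subseteq> {..<n} \<Longrightarrow> pl fy ks \<in> Ef"
  using y_list_Ef[of ks 1] by simp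

lemma Ef_lin_comb: "lin_comb kf py p \<in> Ef"
  by (rule KF.lin_comb_in[OF Ef_sub]) (rule y_list_Ef[OF set_mlist])

lemma o_y_comm: assumes "i < n" "j < n" shows "fo i * fy j - fy j * fo i \<in> Ef"
proof -
  have "fo i * fy j - fy j * fo i - iota_lift n (pij i j) \<in> Ef"
    using assms rels_I I_Ef unfolding rels_cases by blast
  then show ?thesis
    using add_subgroup_cancel[OF Ef_sub] Ef_lin_comb unfolding iota_lift_eq by blast
qed

lemma o_y_list_comm:
  assumes i: "i < n"
  shows "set ks \<subseteq> {..<n} \<Longrightarrow> fo i * pl fy ks - pl fy ks * fo i \<in> Ef"
proof (induction ks)
  case Nil
  then show ?case using add_subgroupD(1)[OF Ef_sub] by simp
next
  case (Cons j ks)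
  have "(fo i * fy j - fy j * fo i) * pl fy ks + fy j * (fo i * pl fy ks - pl fy ks * fo i) \<in> Ef"
    by (intro add_subgroupD(4)[OF Ef_sub] Ef_mult o_y_comm i Ef_pl_y Ef_y) (use Cons in auto)
  then show ?case by (simp add: algebra_simps)
qed

lemma prefilt_Ef: "prefiltration Ef fo n"
proof
  fix i e assume i: "i < n" and e: "e \<in> Ef"
  show "fo i * e - e * fo i \<in> Ef"
  proof (rule addspan_map[OF e[unfolded Ef_def] Ef_sub, of "\<lambda>e. fo i * e - e * fo i"])
    show "fo i * (a - b) - (a - b) * fo i = fo i * a - a * fo i - (fo i * b - b * fo i)" for a b
      by (simp add: algebra_simps)
    fix g assume "g \<in> {kf c * py m | c m. m \<in> exponents n} \<union> I"
    then show "fo i * g - g * fo i \<in> Ef"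
    proof
      assume "g \<in> {kf c * py m | c m. m \<in> exponents n}"
      then obtain c m where g: "g = kf c * py m" by blast
      have "kf c * (fo i * py m - py m * fo i) \<in> Ef"
        by (intro Ef_mult Ef_kf o_y_list_comm i set_mlist)
      moreover have "fo i * g = kf c * (fo i * py m)"
        by (simp only: g mult.assoc[symmetric] KF.kappa_central[of c "fo i"])
      ultimately show ?thesis by (simp add: g right_diff_distrib mult.assoc)
    next
      assume "g \<in> I"
      then show ?thesis
        using add_subgroupD(2)[OF I_sub I_left[OF FA_o[OF i]] I_right[OF FA_o[OF i]]] I_Ef by blast
    qed
  qed
qed (rule Ef_sub Ef_one Ef_mult; assumption)+

text \<open>The third family of relations bounds the commutators for \<open>i < j\<close>; the
  remaining pairs follow by antisymmetry.\<close>

lemma filt_Ef: "filtration Ef fo n"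
proof -
  interpret F: prefiltration Ef fo n by (rule prefilt_Ef)
  have *: "fo i * fo j - fo j * fo i \<in> F.W 1" if ij: "i < j" "j < n" for i j
  proof -
    have "fo i * fo j - fo j * fo i - (\<Sum>l<n. iota_lift n (mpoly_deriv l (pij i j)) * fo l) \<in> I"
      using ij rels_I unfolding rels_cases by blast
    then have "fo i * fo j - fo j * fo i - (\<Sum>l<n. iota_lift n (mpoly_deriv l (pij i j)) * fo l) \<in> F.W 1"
      using I_Ef F.E_W by blast
    moreover have "(\<Sum>l<n. iota_lift n (mpoly_deriv l (pij i j)) * fo l) \<in> F.W 1"
    proof (rule add_subgroup_sum[OF F.W_sub])
      fix l assume "l \<in> {..<n}"
      then show "iota_lift n (mpoly_deriv l (pij i j)) * fo l \<in> F.W 1"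
        using F.W_gen[of "iota_lift n (mpoly_deriv l (pij i j))" "[l]" 1] Ef_lin_comb
        unfolding iota_lift_eq by simp
    qed
    ultimately show ?thesis using add_subgroup_cancel[OF F.W_sub] by blast
  qed
  show ?thesis
  proof
    fix i j assume ij: "i < n" "j < n"
    consider "i < j" | "i = j" | "j < i" by linarith
    then show "fo i * fo j - fo j * fo i \<in> F.W 1"
    proof cases
      case 1
      then show ?thesis using * ij by blast
    next
      case 2
      then show ?thesis using add_subgroupD(1)[OF F.W_sub] by simp
    next
      case 3
      then show ?thesis using add_subgroupD(3)[OF F.W_sub *[OF 3 ij(1)]] by simp
    qed
  qed
qed

text \<open>Spanning half of a Poincare-Birkhoff-Witt theorem for \<open>P(A)\<close>. The
  filtration exhausts the free algebra, and \<open>W_top\<close> sorts the letters \<open>fo\<close>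
  degree by degree.\<close>

lemma FA_span:
  assumes "f \<in> carrier FA"
  shows "\<exists>c. keys c \<subseteq> exponents n \<times> exponents n \<and> f - lin_comb kf (\<lambda>(a, b). py a * po b) c \<in> I"
proof -
  interpret F: filtration Ef fo n by (rule filt_Ef)
  have "carrier FA \<subseteq> {f. \<exists>N. f \<in> F.W N}"
  proof (rule FA_generated)
    show "add_subgroup {f. \<exists>N. f \<in> F.W N}"
      unfolding add_subgroup_def
    proof (intro conjI ballI)
      show "0 \<in> {f. \<exists>N. f \<in> F.W N}" using add_subgroupD(1)[OF F.W_sub] by blast
      fix a b assume "a \<in> {f. \<exists>N. f \<in> F.W N}" "b \<in> {f. \<exists>N. f \<in> F.W N}"
      then obtain M N where "a \<in> F.W M" "b \<in> F.W N" by blast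
      then have "a \<in> F.W (max M N)" "b \<in> F.W (max M N)"
        using F.W_mono[of M "max M N"] F.W_mono[of N "max M N"] by auto
      then show "a - b \<in> {f. \<exists>N. f \<in> F.W N}" using add_subgroupD(2)[OF F.W_sub] by blast
    qed
    show "kf c \<in> {f. \<exists>N. f \<in> F.W N}" for c
      using Ef_kf F.E_W by blast
    show "fy i * f \<in> {f. \<exists>N. f \<in> F.W N}" if "i < n" "f \<in> {f. \<exists>N. f \<in> F.W N}" for i f
      using that F.E_W_mult[OF Ef_y] by blast
    show "fo i * f \<in> {f. \<exists>N. f \<in> F.W N}" if "i < n" "f \<in> {f. \<exists>N. f \<in> F.W N}" for i f
      using that F.om_W_mult by blast
  qed
  then obtain N where "f \<in> F.W N" using assms by blast
  \<comment> \<open>Induction on the degree: besides the sorted words of length \<open>N\<close>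
    only \<open>F.V N\<close> remains, which is 0 or the preceding step of the filtration.\<close>
  moreover have T: "F.W N \<subseteq> addspan ({kf c * (case p of (a, b) \<Rightarrow> py a * po b) | c p. p \<in> exponents n \<times> exponents n} \<union> I)"
    (is "_ \<subseteq> ?T") for N
  proof (induction N rule: less_induct)
    case (less N)
    show ?case
    proof
      fix w assume "w \<in> F.W N"
      then have "w \<in> addspan ({e * po d |e d. e \<in> Ef \<and> d \<in> exponents n \<and> length (mlist n d) = N} \<union> F.V N)"
        by (rule F.W_top)
      moreover have "{e * po d |e d. e \<in> Ef \<and> d \<in> exponents n \<and> length (mlist n d) = N} \<union> F.V N \<subseteq> ?T"
      proof (intro Un_least subsetI)
        fix g assume "g \<in> {e * po d |e d. e \<in> Ef \<and> d \<in> exponents n \<and> length (mlist n d) = N}"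
        then obtain e d where g: "g = e * po d" "e \<in> Ef" "d \<in> exponents n" by blast
        show "g \<in> ?T"
          unfolding g(1)
        proof (rule addspan_mult_right[OF g(2)[unfolded Ef_def] add_subgroup_addspan])
          fix k assume "k \<in> {kf c * py m | c m. m \<in> exponents n} \<union> I"
          then show "k * po d \<in> ?T"
          proof
            assume "k \<in> I"
            then show ?thesis using I_right[OF po_FA] by (intro addspan_gen) blast
          next
            assume "k \<in> {kf c * py m | c m. m \<in> exponents n}"
            then obtain c m where "k = kf c * py m" "m \<in> exponents n" by blast
            then have "k * po d = kf c * (case (m, d) of (a, b) \<Rightarrow> py a * po b)" "(m, d) \<in> exponents n \<times> exponents n"
              using g(3) by (simp_all add: mult.assoc)
            then show ?thesis by (intro addspan_gen UnI1 CollectI) blast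
          qed
        qed
      next
        fix g assume g: "g \<in> F.V N"
        show "g \<in> ?T"
        proof (cases N)
          case 0
          then show ?thesis using g addspan_zero by (simp add: F.V_def)
        next
          case (Suc M)
          then show ?thesis using g less.IH[of M] by (auto simp: F.V_def)
        qed
      qed
      ultimately show "w \<in> ?T" using addspan_subset[OF add_subgroup_addspan] by blast
    qed
  qed
  ultimately have "f \<in> addspan ({kf c * (case p of (a, b) \<Rightarrow> py a * po b) | c p. p \<in> exponents n \<times> exponents n} \<union> I)"
    by blast
  from KF.span_repr[OF this I_sub] show ?thesis .
qed

text \<open>Modulo \<open>I\<close>, \<open>f\<close> is a combination of the spanning set. If its
  image is divisible by \<open>h\<close>, all coefficients vanish by
  \<open>pX_pO_indep\<close>.\<close>

lemma Phi_kernel: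
  assumes "f \<in> carrier FA"
  shows "Phi f \<in> hCp \<longleftrightarrow> f \<in> I"
proof
  assume f: "Phi f \<in> hCp"
  obtain c where c: "keys c \<subseteq> exponents n \<times> exponents n" "f - lin_comb kf (\<lambda>(a, b). py a * po b) c \<in> I"
    using FA_span[OF assms] by blast
  have "Phi f - Phi (lin_comb kf (\<lambda>(a, b). py a * po b) c) \<in> hCp"
    using Phi_I[OF c(2)] by (simp only: Phi_diff)
  then have "Phi (lin_comb kf (\<lambda>(a, b). py a * po b) c) \<in> hCp"
    using f add_subgroup_cancel[OF hCp_sub] by blast
  moreover have "Phi (case p of (a, b) \<Rightarrow> py a * po b) = (case p of (a, b) \<Rightarrow> pX a * pl om (mlist n b))" for p
    by (cases p) (simp add: Phi_mult Phi_pl_y Phi_pl_o)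
  ultimately have "lin_comb \<kappa> (\<lambda>(a, b). pX a * pl om (mlist n b)) c \<in> hCp"
    by (simp add: Phi_lin_comb)
  then obtain g where g: "g \<in> Cp" "lin_comb \<kappa> (\<lambda>(a, b). pX a * pl om (mlist n b)) c = hh * g"
    by (auto simp: hCp_def)
  obtain M where "g \<in> pf.W M" using Cp_W[OF g(1)] by blast
  then have "c = 0" by (rule df.pX_pO_indep[OF c(1) g(2)])
  then show "f \<in> I" using c(2) by simp
qed (rule Phi_I)

lemma Phi_surj: "r \<in> Cp \<Longrightarrow> \<exists>f\<in>carrier FA. r - Phi f \<in> hCp"
proof (induction rule: Cp.induct)
  case (Cp_xl i)
  show ?case
    by (intro bexI[of _ "fy i"] FA_y Cp_xl) (simp add: Phi_gen add_subgroupD(1)[OF hCp_sub])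
next
  case (Cp_om i)
  show ?case
    by (intro bexI[of _ "fo i"] FA_o Cp_om) (simp add: Phi_gen add_subgroupD(1)[OF hCp_sub])
next
  case (Cp_sc l)
  \<comment> \<open>A Laurent scalar is replaced by its value at \<open>q = 1\<close>.\<close>
  have "sc l - Phi (kf (res l)) = hh * sc (quo l)"
    unfolding Phi_kf endo_scalar.kappa_mult[symmetric] endo_scalar.kappa_diff[symmetric]
    using res_quo(1)[OF Cp_sc] by (metis add_diff_cancel_left')
  then show ?case
    using hCp_I[OF Cp.Cp_sc[OF res_quo(2)[OF Cp_sc]]] FA_kf by metis
next
  case (Cp_diff a b)
  then obtain f g where fg: "f \<in> carrier FA" "a - Phi f \<in> hCp" "g \<in> carrier FA" "b - Phi g \<in> hCp" by blast
  have "(a - b) - Phi (f - g) = (a - Phi f) - (b - Phi g)" by (simp add: Phi_diff)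
  also have "\<dots> \<in> hCp" by (rule add_subgroupD(2)[OF hCp_sub fg(2,4)])
  finally show ?case using add_subgroupD(2)[OF FA_sub fg(1,3)] by blast
next
  case (Cp_mult a b)
  then obtain f g where fg: "f \<in> carrier FA" "a - Phi f \<in> hCp" "g \<in> carrier FA" "b - Phi g \<in> hCp" by blast
  have "a * b - Phi (f * g) = a * (b - Phi g) + (a - Phi f) * Phi g"
    by (simp add: Phi_mult algebra_simps)
  also have "\<dots> \<in> hCp"
    by (intro add_subgroupD(4)[OF hCp_sub] hCp_left hCp_right Phi_FA fg Cp_mult)
  finally show ?case using FA_mult[OF fg(1,3)] by blast
qed

end

section \<open>Tensor products\<close>

lemma central_hom_of_int: "central_hom (of_int :: int \<Rightarrow> 'r::ring_1)"
  by unfold_locales (simp, simp, simp, rule mult_of_int_commute)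

text \<open>\<open>F\<close> induces a ring homomorphism on \<open>M \<otimes>\<^sub>R N\<close>, regarded as an algebra over \<open>Q\<close> acting
  on \<open>N\<close>.\<close>

locale tensor_rep =
  fixes R Q :: "'s ring" and M :: "('s, 'a) module" and N :: "('s, 'b) module"
    and F :: "'a \<times> 'b \<Rightarrow> 'r::ring_1" and \<sigma> :: "'s \<Rightarrow> 'r"
  assumes M_closed: "\<one>\<^bsub>M\<^esub> \<in> carrier M"
      "\<And>a b. a \<in> carrier M \<Longrightarrow> b \<in> carrier M \<Longrightarrow> a \<oplus>\<^bsub>M\<^esub> b \<in> carrier M"
      "\<And>a b. a \<in> carrier M \<Longrightarrow> b \<in> carrier M \<Longrightarrow> a \<otimes>\<^bsub>M\<^esub> b \<in> carrier M"
      "\<And>r a. r \<in> carrier R \<Longrightarrow> a \<in> carrier M \<Longrightarrow> r \<odot>\<^bsub>M\<^esub> a \<in> carrier M"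
    and N_closed: "\<one>\<^bsub>N\<^esub> \<in> carrier N"
      "\<And>a b. a \<in> carrier N \<Longrightarrow> b \<in> carrier N \<Longrightarrow> a \<oplus>\<^bsub>N\<^esub> b \<in> carrier N"
      "\<And>a b. a \<in> carrier N \<Longrightarrow> b \<in> carrier N \<Longrightarrow> a \<otimes>\<^bsub>N\<^esub> b \<in> carrier N"
      "\<And>r a. r \<in> carrier Q \<Longrightarrow> a \<in> carrier N \<Longrightarrow> r \<odot>\<^bsub>N\<^esub> a \<in> carrier N"
    and R_Q: "carrier R \<subseteq> carrier Q"
    and F_add_left: "\<And>a a' b. a \<in> carrier M \<Longrightarrow> a' \<in> carrier M \<Longrightarrow> b \<in> carrier N \<Longrightarrow>
        F (a \<oplus>\<^bsub>M\<^esub> a', b) = F (a, b) + F (a', b)"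
    and F_add_right: "\<And>a b b'. a \<in> carrier M \<Longrightarrow> b \<in> carrier N \<Longrightarrow> b' \<in> carrier N \<Longrightarrow>
        F (a, b \<oplus>\<^bsub>N\<^esub> b') = F (a, b) + F (a, b')"
    and F_balanced: "\<And>r a b. r \<in> carrier R \<Longrightarrow> a \<in> carrier M \<Longrightarrow> b \<in> carrier N \<Longrightarrow>
        F (r \<odot>\<^bsub>M\<^esub> a, b) = F (a, r \<odot>\<^bsub>N\<^esub> b)"
    and F_smult: "\<And>r a b. r \<in> carrier Q \<Longrightarrow> a \<in> carrier M \<Longrightarrow> b \<in> carrier N \<Longrightarrow>
        F (a, r \<odot>\<^bsub>N\<^esub> b) = \<sigma> r * F (a, b)"
    and F_mult: "\<And>a b c d. a \<in> carrier M \<Longrightarrow> b \<in> carrier N \<Longrightarrow> c \<in> carrier M \<Longrightarrow> d \<in> carrier N \<Longrightarrow>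
        F (a \<otimes>\<^bsub>M\<^esub> c, b \<otimes>\<^bsub>N\<^esub> d) = F (a, b) * F (c, d)"
    and F_one: "F (\<one>\<^bsub>M\<^esub>, \<one>\<^bsub>N\<^esub>) = 1"
begin

interpretation Z: central_hom "of_int :: int \<Rightarrow> 'r"
  by (rule central_hom_of_int)

abbreviation "FP \<equiv> free_pairs M N"
abbreviation "K \<equiv> tensor_kernel R M N"
definition "\<rho> = lin_comb of_int F"

lemma rho_add: "\<rho> (f + g) = \<rho> f + \<rho> g" and rho_diff: "\<rho> (f - g) = \<rho> f - \<rho> g"
  and rho_zero [simp]: "\<rho> 0 = 0"
  by (simp_all add: \<rho>_def Z.lin_comb_add Z.lin_comb_diff)

lemma rho_frag_of [simp]: "\<rho> (frag_of p) = F p"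
  by (simp add: \<rho>_def)

lemma rho_frag_cmul: "\<rho> (frag_cmul k f) = of_int k * \<rho> f"
proof -
  have "keys (frag_cmul k f) \<subseteq> keys f" by (rule keys_cmul)
  then have "\<rho> (frag_cmul k f) = (\<Sum>p\<in>keys f. of_int (lookup (frag_cmul k f) p) * F p)"
    unfolding \<rho>_def by (intro lin_comb_superset) auto
  then show ?thesis by (simp add: \<rho>_def lin_comb_def sum_distrib_left mult.assoc)
qed

lemma rho_sum: "\<rho> (sum f I) = (\<Sum>i\<in>I. \<rho> (f i))"
  unfolding \<rho>_def by (rule Z.lin_comb_sum)

lemma rho_frag_extend: "\<rho> (frag_extend \<phi> f) = (\<Sum>p\<in>keys f. of_int (lookup f p) * \<rho> (\<phi> p))"
  by (simp add: frag_extend_def rho_sum rho_frag_cmul)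

lemma FP_simps:
  "f \<in> carrier FP \<longleftrightarrow> keys f \<subseteq> carrier M \<times> carrier N" "f \<oplus>\<^bsub>FP\<^esub> g = f + g" "\<zero>\<^bsub>FP\<^esub> = 0"
  "\<one>\<^bsub>FP\<^esub> = frag_of (\<one>\<^bsub>M\<^esub>, \<one>\<^bsub>N\<^esub>)"
  "f \<otimes>\<^bsub>FP\<^esub> g = frag_extend (\<lambda>(a, b). frag_extend (\<lambda>(c, d). frag_of (a \<otimes>\<^bsub>M\<^esub> c, b \<otimes>\<^bsub>N\<^esub> d)) g) f"
  "r \<odot>\<^bsub>FP\<^esub> f = frag_extend (\<lambda>(a, b). frag_of (a, r \<odot>\<^bsub>N\<^esub> b)) f"
  by (simp_all add: free_pairs_def)

lemma FP_sub: "add_subgroup (carrier FP)"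
  unfolding add_subgroup_def
proof (intro conjI ballI)
  fix f g assume "f \<in> carrier FP" "g \<in> carrier FP"
  then show "f - g \<in> carrier FP" using keys_diff[of f g] unfolding FP_simps(1) by blast
qed (simp add: FP_simps(1))

lemma FP_frag_of: "a \<in> carrier M \<Longrightarrow> b \<in> carrier N \<Longrightarrow> frag_of (a, b) \<in> carrier FP"
  by (simp add: FP_simps(1))

lemma FP_one: "\<one>\<^bsub>FP\<^esub> \<in> carrier FP"
  unfolding FP_simps(4) by (intro FP_frag_of M_closed N_closed)

lemma FP_abelian: "abelian_group FP"
  and FP_minus: "f \<in> carrier FP \<Longrightarrow> g \<in> carrier FP \<Longrightarrow> f \<ominus>\<^bsub>FP\<^esub> g = f - g"
proof -
  have *: "inj_on (\<lambda>f. f) (carrier FP)" "\<zero>\<^bsub>FP\<^esub> \<in> carrier FP" "\<zero>\<^bsub>FP\<^esub> = 0"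
    "\<And>f g. f \<in> carrier FP \<Longrightarrow> g \<in> carrier FP \<Longrightarrow> f \<oplus>\<^bsub>FP\<^esub> g \<in> carrier FP"
    "\<And>f g. f \<in> carrier FP \<Longrightarrow> g \<in> carrier FP \<Longrightarrow> f \<oplus>\<^bsub>FP\<^esub> g = f + g"
    "\<And>f. f \<in> carrier FP \<Longrightarrow> - f \<in> (\<lambda>f. f) ` carrier FP"
    using add_subgroupD[OF FP_sub] by (simp_all add: FP_simps(2,3))
  show "abelian_group FP" by (rule abelian_group_of_inj(1)[OF *])
  show "f \<in> carrier FP \<Longrightarrow> g \<in> carrier FP \<Longrightarrow> f \<ominus>\<^bsub>FP\<^esub> g = f - g"
    by (rule abelian_group_of_inj(2)[OF *])
qed

lemma FP_mult:
  assumes "f \<in> carrier FP" "g \<in> carrier FP"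
  shows "f \<otimes>\<^bsub>FP\<^esub> g \<in> carrier FP" "\<rho> (f \<otimes>\<^bsub>FP\<^esub> g) = \<rho> f * \<rho> g"
proof -
  have k: "keys (frag_extend (\<lambda>(c, d). frag_of (a \<otimes>\<^bsub>M\<^esub> c, b \<otimes>\<^bsub>N\<^esub> d)) g) \<subseteq> carrier M \<times> carrier N"
    if "a \<in> carrier M" "b \<in> carrier N" for a b
    using keys_frag_extend[of "\<lambda>(c, d). frag_of (a \<otimes>\<^bsub>M\<^esub> c, b \<otimes>\<^bsub>N\<^esub> d)" g] assms(2) that M_closed(3) N_closed(3)
    unfolding FP_simps(1) by (fastforce split: prod.splits)
  show "f \<otimes>\<^bsub>FP\<^esub> g \<in> carrier FP"
    unfolding FP_simps(1,5)
  proof (rule order_trans[OF keys_frag_extend], rule UN_least)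
    fix p assume "p \<in> keys f"
    then obtain a b where "p = (a, b)" "a \<in> carrier M" "b \<in> carrier N"
      using assms(1) unfolding FP_simps(1) by blast
    then show "keys (case p of (a, b) \<Rightarrow> frag_extend (\<lambda>(c, d). frag_of (a \<otimes>\<^bsub>M\<^esub> c, b \<otimes>\<^bsub>N\<^esub> d)) g)
      \<subseteq> carrier M \<times> carrier N" using k by simp
  qed
  have inner: "\<rho> (case p of (a, b) \<Rightarrow> frag_extend (\<lambda>(c, d). frag_of (a \<otimes>\<^bsub>M\<^esub> c, b \<otimes>\<^bsub>N\<^esub> d)) g) = F p * \<rho> g"
    if pf: "p \<in> keys f" for p
  proof -
    obtain a b where p: "p = (a, b)" "a \<in> carrier M" "b \<in> carrier N"
      using pf assms(1) unfolding FP_simps(1) by blast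
    have "\<rho> (frag_extend (\<lambda>(c, d). frag_of (a \<otimes>\<^bsub>M\<^esub> c, b \<otimes>\<^bsub>N\<^esub> d)) g)
        = (\<Sum>q\<in>keys g. of_int (lookup g q) * (F p * F q))"
      unfolding rho_frag_extend
    proof (rule sum.cong[OF refl])
      fix q assume "q \<in> keys g"
      then obtain c d where "q = (c, d)" "c \<in> carrier M" "d \<in> carrier N"
        using assms(2) unfolding FP_simps(1) by blast
      then show "of_int (lookup g q) * \<rho> (case q of (c, d) \<Rightarrow> frag_of (a \<otimes>\<^bsub>M\<^esub> c, b \<otimes>\<^bsub>N\<^esub> d))
        = of_int (lookup g q) * (F p * F q)"
        using F_mult[OF p(2,3)] by (simp add: p(1))
    qed
    also have "\<dots> = F p * \<rho> g"
      unfolding \<rho>_def lin_comb_def sum_distrib_left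
      by (simp only: mult.assoc[symmetric] mult_of_int_commute[of _ "F p"])
    finally show ?thesis by (simp add: p(1))
  qed
  have "\<rho> (f \<otimes>\<^bsub>FP\<^esub> g) = (\<Sum>p\<in>keys f. of_int (lookup f p) * (F p * \<rho> g))"
    unfolding FP_simps(5) rho_frag_extend by (rule sum.cong[OF refl]) (simp only: inner)
  also have "\<dots> = \<rho> f * \<rho> g"
    unfolding \<rho>_def lin_comb_def[of _ F f] sum_distrib_right mult.assoc ..
  finally show "\<rho> (f \<otimes>\<^bsub>FP\<^esub> g) = \<rho> f * \<rho> g" .
qed

lemma FP_smult:
  assumes "r \<in> carrier Q" "f \<in> carrier FP"
  shows "r \<odot>\<^bsub>FP\<^esub> f \<in> carrier FP" "\<rho> (r \<odot>\<^bsub>FP\<^esub> f) = \<sigma> r * \<rho> f"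
proof -
  show "r \<odot>\<^bsub>FP\<^esub> f \<in> carrier FP"
    unfolding FP_simps(1,6)
  proof (rule order_trans[OF keys_frag_extend], rule UN_least)
    fix p assume "p \<in> keys f"
    then obtain a b where "p = (a, b)" "a \<in> carrier M" "b \<in> carrier N"
      using assms(2) unfolding FP_simps(1) by blast
    then show "keys (case p of (a, b) \<Rightarrow> frag_of (a, r \<odot>\<^bsub>N\<^esub> b)) \<subseteq> carrier M \<times> carrier N"
      using N_closed(4)[OF assms(1)] by simp
  qed
  have "\<rho> (r \<odot>\<^bsub>FP\<^esub> f) = (\<Sum>p\<in>keys f. of_int (lookup f p) * (\<sigma> r * F p))"
    unfolding FP_simps(6) rho_frag_extend
  proof (rule sum.cong[OF refl])
    fix p assume "p \<in> keys f"
    then obtain a b where "p = (a, b)" "a \<in> carrier M" "b \<in> carrier N"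
      using assms(2) unfolding FP_simps(1) by blast
    then show "of_int (lookup f p) * \<rho> (case p of (a, b) \<Rightarrow> frag_of (a, r \<odot>\<^bsub>N\<^esub> b)) = of_int (lookup f p) * (\<sigma> r * F p)"
      using F_smult[OF assms(1)] by simp
  qed
  also have "\<dots> = \<sigma> r * \<rho> f"
    unfolding \<rho>_def lin_comb_def sum_distrib_left
    by (simp only: mult.assoc[symmetric] mult_of_int_commute[of _ "\<sigma> r"])
  finally show "\<rho> (r \<odot>\<^bsub>FP\<^esub> f) = \<sigma> r * \<rho> f" .
qed

lemma relations_closed: "tensor_relations R M N \<subseteq> {f \<in> carrier FP. \<rho> f = 0}"
proof
  fix f assume "f \<in> tensor_relations R M N"
  then consider
    a a' b where "f = frag_of (a \<oplus>\<^bsub>M\<^esub> a', b) - frag_of (a, b) - frag_of (a', b)" "a \<in> carrier M" "a' \<in> carrier M" "b \<in> carrier N"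
  | a b b' where "f = frag_of (a, b \<oplus>\<^bsub>N\<^esub> b') - frag_of (a, b) - frag_of (a, b')" "a \<in> carrier M" "b \<in> carrier N" "b' \<in> carrier N"
  | r a b where "f = frag_of (r \<odot>\<^bsub>M\<^esub> a, b) - frag_of (a, r \<odot>\<^bsub>N\<^esub> b)" "r \<in> carrier R" "a \<in> carrier M" "b \<in> carrier N"
    unfolding tensor_relations_def by blast
  then show "f \<in> {f \<in> carrier FP. \<rho> f = 0}"
  proof cases
    case 1
    then show ?thesis
      by (auto simp: rho_diff F_add_left intro!: add_subgroupD(2)[OF FP_sub] FP_frag_of M_closed)
  next
    case 2
    then show ?thesis
      by (auto simp: rho_diff F_add_right intro!: add_subgroupD(2)[OF FP_sub] FP_frag_of N_closed)
  next
    case 3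
    moreover from this have "r \<in> carrier Q" using R_Q by blast
    ultimately show ?thesis
      by (auto simp: rho_diff F_balanced intro!: add_subgroupD(2)[OF FP_sub] FP_frag_of M_closed N_closed)
  qed
qed

lemma K_subgroup: "subgroup K (add_monoid FP)"
proof -
  interpret FP: abelian_group FP by (rule FP_abelian)
  show ?thesis
    unfolding tensor_kernel_def using relations_closed
    by (intro FP.add.generate_is_subgroup) auto
qed

lemma K_add_subgroup: "add_subgroup K"
proof -
  interpret FP: abelian_group FP by (rule FP_abelian)
  interpret K: additive_subgroup K FP by (rule additive_subgroup.intro[OF K_subgroup])
  show ?thesis
    unfolding add_subgroup_def
  proof (intro conjI ballI)
    show "0 \<in> K" using K.zero_closed by (simp add: FP_simps(3))
    fix a b assume ab: "a \<in> K" "b \<in> K"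
    then have "a \<oplus>\<^bsub>FP\<^esub> (\<ominus>\<^bsub>FP\<^esub> b) \<in> K" by (intro K.a_closed K.a_inv_closed)
    moreover have "a \<oplus>\<^bsub>FP\<^esub> (\<ominus>\<^bsub>FP\<^esub> b) = a - b"
      using FP_minus[of a b] K.a_Hcarr ab by (simp add: a_minus_def)
    ultimately show "a - b \<in> K" by simp
  qed
qed

lemma relations_K: "tensor_relations R M N \<subseteq> K"
  unfolding tensor_kernel_def by (auto intro: generate.incl)

lemma K_rho: "K \<subseteq> {f \<in> carrier FP. \<rho> f = 0}"
proof -
  interpret FP: abelian_group FP by (rule FP_abelian)
  have "subgroup {f \<in> carrier FP. \<rho> f = 0} (add_monoid FP)"
  proof (rule FP.add.subgroupI)
    show "{f \<in> carrier FP. \<rho> f = 0} \<noteq> {}" using add_subgroupD(1)[OF FP_sub] by fastforce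
    fix a assume a: "a \<in> {f \<in> carrier FP. \<rho> f = 0}"
    have "\<ominus>\<^bsub>FP\<^esub> a = \<zero>\<^bsub>FP\<^esub> \<ominus>\<^bsub>FP\<^esub> a" using a by (simp add: a_minus_def)
    also have "\<dots> = - a" using FP_minus[of "\<zero>\<^bsub>FP\<^esub>" a] a FP.zero_closed by (simp add: FP_simps(3))
    finally show "\<ominus>\<^bsub>FP\<^esub> a \<in> {f \<in> carrier FP. \<rho> f = 0}"
      using a add_subgroupD(3)[OF FP_sub, of a] rho_diff[of 0 a] by simp
    fix b assume "b \<in> {f \<in> carrier FP. \<rho> f = 0}"
    then show "a \<oplus>\<^bsub>FP\<^esub> b \<in> {f \<in> carrier FP. \<rho> f = 0}"
      using a add_subgroupD(4)[OF FP_sub, of a b] by (simp add: FP_simps(2) rho_add)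
  qed blast
  then show ?thesis
    unfolding tensor_kernel_def by (intro FP.add.generate_subgroup_incl relations_closed)
qed

lemma K_add_left: "a \<in> carrier M \<Longrightarrow> a' \<in> carrier M \<Longrightarrow> b \<in> carrier N \<Longrightarrow>
    frag_of (a \<oplus>\<^bsub>M\<^esub> a', b) - (frag_of (a, b) + frag_of (a', b)) \<in> K"
  and K_add_right: "a \<in> carrier M \<Longrightarrow> b \<in> carrier N \<Longrightarrow> b' \<in> carrier N \<Longrightarrow>
    frag_of (a, b \<oplus>\<^bsub>N\<^esub> b') - (frag_of (a, b) + frag_of (a, b')) \<in> K"
  and K_balanced: "r \<in> carrier R \<Longrightarrow> a \<in> carrier M \<Longrightarrow> b \<in> carrier N \<Longrightarrow>
    frag_of (r \<odot>\<^bsub>M\<^esub> a, b) - frag_of (a, r \<odot>\<^bsub>N\<^esub> b) \<in> K"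
  using relations_K unfolding tensor_relations_def diff_diff_eq by blast+

end

text \<open>Faithfulness identifies the tensor kernel with the zero set of the multiplicative map
  \<open>\<rho>\<close>. Its compatibility with products (\<open>congruence\<close>) then follows
  without calculating with the generating relations.\<close>

locale faithful_tensor_rep = tensor_rep +
  assumes faithful: "\<And>f. f \<in> carrier (free_pairs M N) \<Longrightarrow> lin_comb of_int F f = 0 \<Longrightarrow> f \<in> tensor_kernel R M N"
begin

lemma K_iff: "f \<in> carrier FP \<Longrightarrow> f \<in> K \<longleftrightarrow> \<rho> f = 0"
  using K_rho faithful unfolding \<rho>_def by blast

lemma diff_K_iff: "f \<in> carrier FP \<Longrightarrow> g \<in> carrier FP \<Longrightarrow> f \<ominus>\<^bsub>FP\<^esub> g \<in> K \<longleftrightarrow> \<rho> f = \<rho> g"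
  using K_iff[OF add_subgroupD(2)[OF FP_sub, of f g]] by (simp add: FP_minus rho_diff)

lemma congruence: "alg_congruence K FP Q"
proof (intro alg_congruence.intro abelian_subgroupI3 additive_subgroup.intro K_subgroup FP_abelian
    alg_congruence_axioms.intro)
  show "a \<otimes>\<^bsub>FP\<^esub> b \<ominus>\<^bsub>FP\<^esub> a' \<otimes>\<^bsub>FP\<^esub> b' \<in> K"
    if "a \<in> carrier FP" "a' \<in> carrier FP" "b \<in> carrier FP" "b' \<in> carrier FP"
      "a \<ominus>\<^bsub>FP\<^esub> a' \<in> K" "b \<ominus>\<^bsub>FP\<^esub> b' \<in> K" for a a' b b'
    using that by (simp add: diff_K_iff FP_mult)
  show "c \<odot>\<^bsub>FP\<^esub> a \<ominus>\<^bsub>FP\<^esub> c \<odot>\<^bsub>FP\<^esub> a' \<in> K"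
    if "c \<in> carrier Q" "a \<in> carrier FP" "a' \<in> carrier FP" "a \<ominus>\<^bsub>FP\<^esub> a' \<in> K" for c a a'
    using that by (simp add: diff_K_iff FP_smult)
qed (simp_all add: FP_mult FP_one FP_smult)

end

text \<open>From \<open>z \<otimes> b = z \<otimes> b + z \<otimes> b\<close>. Zero is characterised
  by \<open>z + z = z\<close> because the locale provides no group structure on \<open>M\<close> and
  \<open>N\<close>.\<close>

lemma (in tensor_rep) K_zero_left:
  assumes "b \<in> carrier N" "z \<in> carrier M" "z \<oplus>\<^bsub>M\<^esub> z = z"
  shows "frag_of (z, b) \<in> K"
  using add_subgroupD(3)[OF K_add_subgroup K_add_left[OF assms(2,2,1)]] assms(3) by simp

lemma (in tensor_rep) K_zero_right:
  assumes "a \<in> carrier M" "z \<in> carrier N" "z \<oplus>\<^bsub>N\<^esub> z = z"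
  shows "frag_of (a, z) \<in> K"
  using add_subgroupD(3)[OF K_add_subgroup K_add_right[OF assms(1,2,2)]] assms(3) by simp

context quantization
begin

section \<open>The enveloping algebra inside the endomorphism ring\<close>

definition "F1 = (\<lambda>(a, b). lmul a * rmul b)"

lemma opposite_simps:
  "carrier (opposite A) = carrier A" "a \<otimes>\<^bsub>opposite A\<^esub> b = b \<otimes> a" "\<one>\<^bsub>opposite A\<^esub> = \<one>"
  "a \<oplus>\<^bsub>opposite A\<^esub> b = a \<oplus> b" "k \<odot>\<^bsub>opposite A\<^esub> a = k \<odot>\<^bsub>A\<^esub> a" "\<zero>\<^bsub>opposite A\<^esub> = \<zero>"
  by (simp_all add: opposite_def)

lemma env_rep: "tensor_rep ratfun_field ratfun_field A (opposite A) F1 sc"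
  by (rule tensor_rep.intro)
    (simp_all add: opposite_simps F1_def lmul_add rmul_add lmul_smult rmul_smult sc_left[of "lmul _"]
      distrib_left distrib_right mult.assoc[of "sc _"] lmul_rmul_mult lmul_one rmul_one)

interpretation T: tensor_rep ratfun_field ratfun_field A "opposite A" F1 sc
  by (rule env_rep)

text \<open>Left factors are expanded in the monomial basis and the scalars moved to the right.
  \<open>B\<close> is a total function vanishing off \<open>J\<close>, so that two normal forms can
  be subtracted over \<open>J \<union> J'\<close>.\<close>

lemma env_normal_form:
  assumes "f \<in> carrier (free_pairs A (opposite A))"
  shows "\<exists>J B. finite J \<and> J \<subseteq> exponents n \<and> (\<forall>m. B m \<in> carrier A) \<and> (\<forall>m. m \<notin> J \<longrightarrow> B m = \<zero>) \<and>
    f - (\<Sum>m\<in>J. frag_of (xm m, B m)) \<in> T.K"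
proof -
  have k: "keys f \<subseteq> carrier A \<times> carrier A"
    using assms unfolding T.FP_simps(1) opposite_simps .
  show ?thesis
    using k
  proof (induction f rule: frag_induction)
    case zero
    show ?case
      by (intro exI[of _ "{}"] exI[of _ "\<lambda>_. \<zero>"]) (simp add: add_subgroupD(1)[OF T.K_add_subgroup])
  next
    case (one p)
    then obtain a b where p: "p = (a, b)" "a \<in> carrier A" "b \<in> carrier A" by blast
    define c where "c = coords a"
    have cl: "lookup c m \<odot>\<^bsub>A\<^esub> xm m \<in> carrier A" for m using xm_in by simp
    have "frag_of ((\<Oplus>m\<in>J. lookup c m \<odot>\<^bsub>A\<^esub> xm m), b) - (\<Sum>m\<in>J. frag_of (xm m, lookup c m \<odot>\<^bsub>A\<^esub> b)) \<in> T.K"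
      if "finite J" for J
      using that
    proof (induction J rule: finite_induct)
      case empty
      then show ?case using T.K_zero_left[of b "\<zero>"] p by (simp add: opposite_simps)
    next
      case (insert m J)
      let ?s = "\<Oplus>m\<in>J. lookup c m \<odot>\<^bsub>A\<^esub> xm m" and ?t = "lookup c m \<odot>\<^bsub>A\<^esub> xm m"
      have s: "?s \<in> carrier A" using cl by (intro M.finsum_closed) auto
      have e: "(\<Oplus>m\<in>insert m J. lookup c m \<odot>\<^bsub>A\<^esub> xm m) = ?t \<oplus> ?s"
        using insert.hyps cl by (intro M.finsum_insert) auto
      have 1: "frag_of (?t \<oplus> ?s, b) - (frag_of (?t, b) + frag_of (?s, b)) \<in> T.K"
        using T.K_add_left[OF cl s, of b] p by (simp only: opposite_simps)
      have 2: "frag_of (?t, b) - frag_of (xm m, lookup c m \<odot>\<^bsub>A\<^esub> b) \<in> T.K"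
        using T.K_balanced[of "lookup c m" "xm m" b] xm_in p by (simp add: opposite_simps)
      have "(frag_of (?t \<oplus> ?s, b) - (frag_of (?t, b) + frag_of (?s, b)))
          + (frag_of (?t, b) - frag_of (xm m, lookup c m \<odot>\<^bsub>A\<^esub> b))
          + (frag_of (?s, b) - (\<Sum>m\<in>J. frag_of (xm m, lookup c m \<odot>\<^bsub>A\<^esub> b))) \<in> T.K"
        by (intro add_subgroupD(4)[OF T.K_add_subgroup] 1 2 insert.IH)
      then show ?case unfolding e sum.insert[OF insert.hyps] by (simp add: algebra_simps)
    qed
    from this[of "keys c"] have "frag_of (a, b) - (\<Sum>m\<in>keys c. frag_of (xm m, lookup c m \<odot>\<^bsub>A\<^esub> b)) \<in> T.K"
      using coords(2)[OF p(2)] by (simp add: c_def lincomb_def)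
    then show ?case
      using coords(1)[OF p(2)] p smult_l_null[of b]
      by (intro exI[of _ "keys c"] exI[of _ "\<lambda>m. lookup c m \<odot>\<^bsub>A\<^esub> b"]) (auto simp: c_def in_keys_iff)
  next
    case (diff f g)
    obtain J B where J: "finite J" "J \<subseteq> exponents n" "\<forall>m. B m \<in> carrier A" "\<forall>m. m \<notin> J \<longrightarrow> B m = \<zero>"
      "f - (\<Sum>m\<in>J. frag_of (xm m, B m)) \<in> T.K" using diff by blast
    obtain J' B' where J': "finite J'" "J' \<subseteq> exponents n" "\<forall>m. B' m \<in> carrier A" "\<forall>m. m \<notin> J' \<longrightarrow> B' m = \<zero>"
      "g - (\<Sum>m\<in>J'. frag_of (xm m, B' m)) \<in> T.K" using diff by blast
    have z: "frag_of (xm m, \<zero>) \<in> T.K" for m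
      by (rule T.K_zero_right) (simp_all add: opposite_simps xm_in)
    \<comment> \<open>Enlarging the index set adds only terms with right factor zero, which lie in
      the kernel.\<close>
    have ext: "h - (\<Sum>m\<in>J \<union> J'. frag_of (xm m, C m)) \<in> T.K"
      if "I \<subseteq> J \<union> J'" "\<forall>m. m \<notin> I \<longrightarrow> C m = \<zero>" "h - (\<Sum>m\<in>I. frag_of (xm m, C m)) \<in> T.K" for h C I
    proof -
      have "(\<Sum>m\<in>J \<union> J'. frag_of (xm m, C m)) = (\<Sum>m\<in>J \<union> J' - I. frag_of (xm m, C m)) + (\<Sum>m\<in>I. frag_of (xm m, C m))"
        using J(1) J'(1) that(1) by (intro sum.subset_diff) auto
      moreover have "(\<Sum>m\<in>J \<union> J' - I. frag_of (xm m, C m)) \<in> T.K"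
        by (rule add_subgroup_sum[OF T.K_add_subgroup]) (use that(2) z in auto)
      ultimately show ?thesis
        using add_subgroupD(2)[OF T.K_add_subgroup that(3), of "\<Sum>m\<in>J \<union> J' - I. frag_of (xm m, C m)"]
        by (simp add: diff_diff_eq add.commute)
    qed
    have d: "(\<Sum>m\<in>J \<union> J'. frag_of (xm m, B m)) - (\<Sum>m\<in>J \<union> J'. frag_of (xm m, B' m))
        - (\<Sum>m\<in>J \<union> J'. frag_of (xm m, B m \<ominus> B' m)) \<in> T.K"
      unfolding sum_subtractf[symmetric]
    proof (rule add_subgroup_sum[OF T.K_add_subgroup])
      fix m
      have "(B m \<ominus> B' m) \<oplus> B' m = B m"
        using J(3) J'(3) by (simp add: M.minus_eq M.a_assoc M.l_neg)
      then show "frag_of (xm m, B m) - frag_of (xm m, B' m) - frag_of (xm m, B m \<ominus> B' m) \<in> T.K"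
        using T.K_add_right[of "xm m" "B m \<ominus> B' m" "B' m"] J(3) J'(3) xm_in
        by (simp add: opposite_simps algebra_simps)
    qed
    have "(f - (\<Sum>m\<in>J \<union> J'. frag_of (xm m, B m))) - (g - (\<Sum>m\<in>J \<union> J'. frag_of (xm m, B' m)))
      + ((\<Sum>m\<in>J \<union> J'. frag_of (xm m, B m)) - (\<Sum>m\<in>J \<union> J'. frag_of (xm m, B' m))
        - (\<Sum>m\<in>J \<union> J'. frag_of (xm m, B m \<ominus> B' m))) \<in> T.K"
      by (intro add_subgroupD(2,4)[OF T.K_add_subgroup] d ext[OF _ J(4,5)] ext[OF _ J'(4,5)]) auto
    then have "f - g - (\<Sum>m\<in>J \<union> J'. frag_of (xm m, B m \<ominus> B' m)) \<in> T.K"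
      by (simp add: algebra_simps)
    then show ?case
      using J J' by (intro exI[of _ "J \<union> J'"] exI[of _ "\<lambda>m. B m \<ominus> B' m"]) (auto simp: M.minus_eq)
  qed
qed

text \<open>Expanding each \<open>B m\<close> in the monomial basis reduces this to
  \<open>lmul_rmul_indep\<close>.\<close>

lemma lmul_rmul_sum_indep:
  assumes "finite J" "J \<subseteq> exponents n" "\<And>m. B m \<in> carrier A" "(\<Sum>m\<in>J. lmul (xm m) * rmul (B m)) = 0" "m \<in> J"
  shows "B m = \<zero>"
proof -
  define c where "c = (\<Sum>m\<in>J. \<Sum>r\<in>keys (coords (B m)). single (m, r) (lookup (coords (B m)) r))"
  have l: "lookup c (m, r) = lookup (coords (B m)) r" if "m \<in> J" for m r
  proof -
    have "lookup c (m, r) = (\<Sum>m'\<in>J. if m' = m then lookup (coords (B m)) r else 0)"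
      unfolding c_def lookup_sum
      by (rule sum.cong[OF refl]) (auto simp: lookup_single when_def in_keys_iff intro!: sum.neutral)
    then show ?thesis using that assms(1) by simp
  qed
  have "keys c \<subseteq> exponents n \<times> exponents n"
  proof
    fix p assume "p \<in> keys c"
    then obtain m r where "m \<in> J" "r \<in> keys (coords (B m))" "p = (m, r)"
      unfolding c_def using keys_sum by (force dest!: subsetD[OF keys_sum] split: if_splits)
    then show "p \<in> exponents n \<times> exponents n" using coords(1)[OF assms(3)] assms(2) by blast
  qed
  moreover have "lin_comb sc P c = 0"
  proof -
    have "rmul (B m) = lin_comb sc (\<lambda>r. rmul (xm r)) (coords (B m))" for m
      using lin_map_lincomb[of rmul "coords (B m)", OF rmul_add rmul_smult] coords(2)[OF assms(3)] by simp
    then have "lmul (xm m) * rmul (B m) = (\<Sum>r\<in>keys (coords (B m)). sc (lookup (coords (B m)) r) * P (m, r))" for m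
      by (simp add: lin_comb_def sum_distrib_left sc_left[of "lmul (xm m)"] P_def)
    then have "lin_comb sc P c = (\<Sum>m\<in>J. lmul (xm m) * rmul (B m))"
      by (simp only: c_def endo_scalar.lin_comb_sum endo_scalar.lin_comb_single)
    then show ?thesis using assms(4) by simp
  qed
  ultimately have "c = 0" unfolding P_def by (rule lmul_rmul_indep)
  then have "coords (B m) = 0"
    using l[OF assms(5)] by (intro poly_mapping_eqI) simp
  then show ?thesis using coords(2)[OF assms(3)[of m]] by (simp add: lincomb_0)
qed

text \<open>Under \<open>\<rho>\<close> the normal form becomes a relation among the
  \<open>lmul (xm m)\<close> with right coefficients, which forces each \<open>B m\<close> to be
  zero.\<close>

lemma env_faithful: "faithful_tensor_rep ratfun_field ratfun_field A (opposite A) F1 sc"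
proof (intro faithful_tensor_rep.intro env_rep faithful_tensor_rep_axioms.intro)
  fix f assume f: "f \<in> carrier (free_pairs A (opposite A))" "lin_comb of_int F1 f = 0"
  obtain J B where J: "finite J" "J \<subseteq> exponents n" "\<forall>m. B m \<in> carrier A"
    "f - (\<Sum>m\<in>J. frag_of (xm m, B m)) \<in> T.K" using env_normal_form[OF f(1)] by blast
  have "T.\<rho> (f - (\<Sum>m\<in>J. frag_of (xm m, B m))) = 0" using T.K_rho J(4) by blast
  moreover have "T.\<rho> f = 0" using f(2) by (simp add: T.\<rho>_def)
  ultimately have "(\<Sum>m\<in>J. F1 (xm m, B m)) = 0"
    by (simp only: T.rho_diff T.rho_sum T.rho_frag_of) simp
  then have "(\<Sum>m\<in>J. lmul (xm m) * rmul (B m)) = 0" by (simp add: F1_def)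
  then have B: "B m = \<zero>" if "m \<in> J" for m
    using lmul_rmul_sum_indep[OF J(1,2), of B] J(3) that by blast
  have "(\<Sum>m\<in>J. frag_of (xm m, B m)) \<in> T.K"
  proof (rule add_subgroup_sum[OF T.K_add_subgroup])
    fix m assume "m \<in> J"
    then show "frag_of (xm m, B m) \<in> T.K"
      using T.K_zero_right[of "xm m" "\<zero>"] B xm_in by (simp add: opposite_simps)
  qed
  then show "f \<in> T.K" using J(4) add_subgroup_cancel[OF T.K_add_subgroup] by blast
qed

end

context quantization
begin

interpretation T: faithful_tensor_rep ratfun_field ratfun_field A "opposite A" F1 sc
  by (rule env_faithful)

abbreviation "Env \<equiv> env_alg A"

lemma Env_eq: "Env = quot_alg T.FP T.K"
  by (simp add: env_alg_def tensor_alg_def)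

definition "EK = T.\<rho> ` carrier T.FP"

text \<open>The map induced by \<open>\<rho>\<close>, which is constant on cosets of the kernel. It
  identifies \<open>env_alg A\<close> with the subring \<open>EK\<close>, with inverse
  \<open>ival\<close>.\<close>

definition val :: "('a \<times> 'a \<Rightarrow>\<^sub>0 int) set \<Rightarrow> ((nat \<Rightarrow>\<^sub>0 nat) \<times> (nat \<Rightarrow>\<^sub>0 nat), 'k poly fract) endo" where
  "val W = the_elem (T.\<rho> ` W)"

lemma val_iso:
  "val \<in> alg_iso ratfun_field Env
     \<lparr>carrier = EK, monoid.mult = (*), one = 1, ring.zero = 0, add = (+), module.smult = (\<lambda>k r. sc k * r)\<rparr>"
  and val_coset: "f \<in> carrier T.FP \<Longrightarrow> val (T.K +>\<^bsub>T.FP\<^esub> f) = T.\<rho> f"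
proof -
  let ?B = "\<lparr>carrier = EK, monoid.mult = (*), one = 1, ring.zero = 0, add = (+), module.smult = (\<lambda>k r. sc k * r)\<rparr>"
  interpret C: alg_congruence T.K T.FP ratfun_field by (rule T.congruence)
  note iso = C.first_isomorphism[of T.\<rho> ?B]
  have *: "\<And>a. a \<in> carrier T.FP \<Longrightarrow> T.\<rho> a \<in> carrier ?B"
    "\<And>a b. a \<in> carrier T.FP \<Longrightarrow> b \<in> carrier T.FP \<Longrightarrow> T.\<rho> (a \<otimes>\<^bsub>T.FP\<^esub> b) = T.\<rho> a \<otimes>\<^bsub>?B\<^esub> T.\<rho> b"
    "\<And>a b. a \<in> carrier T.FP \<Longrightarrow> b \<in> carrier T.FP \<Longrightarrow> T.\<rho> (a \<oplus>\<^bsub>T.FP\<^esub> b) = T.\<rho> a \<oplus>\<^bsub>?B\<^esub> T.\<rho> b"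
    "T.\<rho> \<one>\<^bsub>T.FP\<^esub> = \<one>\<^bsub>?B\<^esub>"
    "\<And>c a. c \<in> carrier (ratfun_field :: 'k poly fract ring) \<Longrightarrow> a \<in> carrier T.FP \<Longrightarrow> T.\<rho> (c \<odot>\<^bsub>T.FP\<^esub> a) = c \<odot>\<^bsub>?B\<^esub> T.\<rho> a"
    "\<And>a b. a \<in> carrier T.FP \<Longrightarrow> b \<in> carrier T.FP \<Longrightarrow> T.\<rho> a = T.\<rho> b \<longleftrightarrow> a \<ominus>\<^bsub>T.FP\<^esub> b \<in> T.K"
    "carrier ?B \<subseteq> T.\<rho> ` carrier T.FP"
    by (simp_all add: EK_def T.FP_mult T.FP_smult T.diff_K_iff T.FP_simps(2,4) T.rho_add T.F_one)
  show "val \<in> alg_iso ratfun_field Env ?B"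
    using iso(1)[OF *] unfolding Env_eq val_def[abs_def] .
  show "f \<in> carrier T.FP \<Longrightarrow> val (T.K +>\<^bsub>T.FP\<^esub> f) = T.\<rho> f"
    unfolding val_def by (rule iso(2)[OF *])
qed

lemma val_hom:
  "W \<in> carrier Env \<Longrightarrow> V \<in> carrier Env \<Longrightarrow> W \<otimes>\<^bsub>Env\<^esub> V \<in> carrier Env \<and> val (W \<otimes>\<^bsub>Env\<^esub> V) = val W * val V"
  "W \<in> carrier Env \<Longrightarrow> V \<in> carrier Env \<Longrightarrow> W \<oplus>\<^bsub>Env\<^esub> V \<in> carrier Env \<and> val (W \<oplus>\<^bsub>Env\<^esub> V) = val W + val V"
  "\<one>\<^bsub>Env\<^esub> \<in> carrier Env \<and> val \<one>\<^bsub>Env\<^esub> = 1" "\<zero>\<^bsub>Env\<^esub> \<in> carrier Env \<and> val \<zero>\<^bsub>Env\<^esub> = 0"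
  "W \<in> carrier Env \<Longrightarrow> k \<odot>\<^bsub>Env\<^esub> W \<in> carrier Env \<and> val (k \<odot>\<^bsub>Env\<^esub> W) = sc k * val W"
proof -
  interpret C: alg_congruence T.K T.FP ratfun_field by (rule T.congruence)
  have vm: "W \<in> carrier Env \<Longrightarrow> V \<in> carrier Env \<Longrightarrow> val (W \<otimes>\<^bsub>Env\<^esub> V) = val W * val V"
    and va: "W \<in> carrier Env \<Longrightarrow> V \<in> carrier Env \<Longrightarrow> val (W \<oplus>\<^bsub>Env\<^esub> V) = val W + val V"
    and vo: "val \<one>\<^bsub>Env\<^esub> = 1"
    and vs: "W \<in> carrier Env \<Longrightarrow> val (k \<odot>\<^bsub>Env\<^esub> W) = sc k * val W"
    using val_iso unfolding alg_iso_def ring_iso_def ring_hom_def by simp_all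
  have cl: "W \<in> carrier Env \<Longrightarrow> \<exists>f\<in>carrier T.FP. W = T.K +>\<^bsub>T.FP\<^esub> f" for W
    unfolding Env_eq C.quot_carrier by blast
  have inC: "f \<in> carrier T.FP \<Longrightarrow> T.K +>\<^bsub>T.FP\<^esub> f \<in> carrier Env" for f
    unfolding Env_eq C.quot_carrier by blast
  show "\<one>\<^bsub>Env\<^esub> \<in> carrier Env \<and> val \<one>\<^bsub>Env\<^esub> = 1"
    using vo inC[OF C.one_closed] by (simp add: Env_eq C.quot_one)
  show "\<zero>\<^bsub>Env\<^esub> \<in> carrier Env \<and> val \<zero>\<^bsub>Env\<^esub> = 0"
    using inC[OF C.zero_closed] val_coset[OF C.zero_closed] by (simp add: Env_eq C.quot_zero T.FP_simps(3))
  show "W \<otimes>\<^bsub>Env\<^esub> V \<in> carrier Env \<and> val (W \<otimes>\<^bsub>Env\<^esub> V) = val W * val V"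
    "W \<oplus>\<^bsub>Env\<^esub> V \<in> carrier Env \<and> val (W \<oplus>\<^bsub>Env\<^esub> V) = val W + val V" if WV: "W \<in> carrier Env" "V \<in> carrier Env"
  proof -
    obtain f g where fg: "f \<in> carrier T.FP" "W = T.K +>\<^bsub>T.FP\<^esub> f" "g \<in> carrier T.FP" "V = T.K +>\<^bsub>T.FP\<^esub> g"
      using cl[OF WV(1)] cl[OF WV(2)] by blast
    have "W \<otimes>\<^bsub>Env\<^esub> V = T.K +>\<^bsub>T.FP\<^esub> (f \<otimes>\<^bsub>T.FP\<^esub> g)"
      unfolding Env_eq fg by (rule C.quot_mult[OF fg(1,3)])
    then show "W \<otimes>\<^bsub>Env\<^esub> V \<in> carrier Env \<and> val (W \<otimes>\<^bsub>Env\<^esub> V) = val W * val V"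
      using inC[OF C.mult_closed[OF fg(1,3)]] vm[OF WV] by simp
    have "W \<oplus>\<^bsub>Env\<^esub> V = T.K +>\<^bsub>T.FP\<^esub> (f \<oplus>\<^bsub>T.FP\<^esub> g)"
      unfolding Env_eq fg by (rule C.quot_add[OF fg(1,3)])
    then show "W \<oplus>\<^bsub>Env\<^esub> V \<in> carrier Env \<and> val (W \<oplus>\<^bsub>Env\<^esub> V) = val W + val V"
      using inC[OF C.a_closed[OF fg(1,3)]] va[OF WV] by simp
  qed
  show "k \<odot>\<^bsub>Env\<^esub> W \<in> carrier Env \<and> val (k \<odot>\<^bsub>Env\<^esub> W) = sc k * val W" if W: "W \<in> carrier Env"
  proof -
    obtain f where f: "f \<in> carrier T.FP" "W = T.K +>\<^bsub>T.FP\<^esub> f" using cl[OF W] by blast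
    have "k \<odot>\<^bsub>Env\<^esub> W = T.K +>\<^bsub>T.FP\<^esub> (k \<odot>\<^bsub>T.FP\<^esub> f)"
      unfolding Env_eq f by (rule C.quot_smult) (simp_all add: f)
    then show ?thesis using inC[OF C.smult_closed[OF _ f(1)], of k] vs[OF W] by simp
  qed
qed

lemma val_inj: "W \<in> carrier Env \<Longrightarrow> V \<in> carrier Env \<Longrightarrow> val W = val V \<longleftrightarrow> W = V"
  and val_range: "val ` carrier Env = EK"
  using val_iso unfolding alg_iso_def ring_iso_def bij_betw_def inj_on_def by auto

definition "ival r = inv_into (carrier Env) val r"

lemma ival: "r \<in> EK \<Longrightarrow> ival r \<in> carrier Env" "r \<in> EK \<Longrightarrow> val (ival r) = r"
  unfolding ival_def val_range[symmetric] by (auto intro: inv_into_into f_inv_into_f)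

lemma val_EK: "W \<in> carrier Env \<Longrightarrow> val W \<in> EK"
  using val_range by blast

lemma EK_sub: "add_subgroup EK"
  unfolding EK_def by (rule add_subgroup_image[OF T.FP_sub T.rho_diff])

lemma EK_mult: "r \<in> EK \<Longrightarrow> s \<in> EK \<Longrightarrow> r * s \<in> EK"
  using val_hom(1)[OF ival(1) ival(1), of r s] val_EK by (metis ival(2))

lemma EK_smult: "r \<in> EK \<Longrightarrow> sc k * r \<in> EK"
  using val_hom(5)[OF ival(1), of r k] val_EK by (metis ival(2))

lemma EK_one: "1 \<in> EK"
  using val_hom(3) val_EK by metis

lemma EK_sc: "sc k \<in> EK"
  using EK_smult[OF EK_one, of k] by simp

lemma env_tensor:
  assumes "a \<in> carrier A" "b \<in> carrier A"
  shows "env_tensor A a b \<in> carrier Env" "val (env_tensor A a b) = lmul a * rmul b"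
proof -
  interpret C: alg_congruence T.K T.FP ratfun_field by (rule T.congruence)
  have f: "frag_of (a, b) \<in> carrier T.FP"
    by (rule T.FP_frag_of) (use assms in \<open>simp_all add: opposite_simps\<close>)
  show "env_tensor A a b \<in> carrier Env"
    unfolding pure_tensor_def Env_eq C.quot_carrier using f by blast
  show "val (env_tensor A a b) = lmul a * rmul b"
    unfolding pure_tensor_def val_coset[OF f] by (simp add: T.rho_frag_of) (simp add: F1_def)
qed

lemma Env_abelian: "abelian_group Env"
  and val_minus: "W \<in> carrier Env \<Longrightarrow> V \<in> carrier Env \<Longrightarrow> val (W \<ominus>\<^bsub>Env\<^esub> V) = val W - val V"
proof -
  have *: "inj_on val (carrier Env)" "\<zero>\<^bsub>Env\<^esub> \<in> carrier Env" "val \<zero>\<^bsub>Env\<^esub> = 0"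
    "\<And>a b. a \<in> carrier Env \<Longrightarrow> b \<in> carrier Env \<Longrightarrow> a \<oplus>\<^bsub>Env\<^esub> b \<in> carrier Env"
    "\<And>a b. a \<in> carrier Env \<Longrightarrow> b \<in> carrier Env \<Longrightarrow> val (a \<oplus>\<^bsub>Env\<^esub> b) = val a + val b"
    "\<And>a. a \<in> carrier Env \<Longrightarrow> - val a \<in> val ` carrier Env"
    using val_inj val_hom add_subgroupD(3)[OF EK_sub val_EK] unfolding val_range by (auto simp: inj_on_def)
  show "abelian_group Env" by (rule abelian_group_of_inj(1)[OF *])
  show "W \<in> carrier Env \<Longrightarrow> V \<in> carrier Env \<Longrightarrow> val (W \<ominus>\<^bsub>Env\<^esub> V) = val W - val V"
    by (rule abelian_group_of_inj(2)[OF *])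
qed

lemma Env_minus_closed: "W \<in> carrier Env \<Longrightarrow> V \<in> carrier Env \<Longrightarrow> W \<ominus>\<^bsub>Env\<^esub> V \<in> carrier Env"
  by (rule abelian_group.minus_closed[OF Env_abelian])

lemma val_uminus: "W \<in> carrier Env \<Longrightarrow> \<ominus>\<^bsub>Env\<^esub> W \<in> carrier Env \<and> val (\<ominus>\<^bsub>Env\<^esub> W) = - val W"
proof -
  interpret Env: abelian_group Env by (rule Env_abelian)
  assume W: "W \<in> carrier Env"
  have "\<ominus>\<^bsub>Env\<^esub> W = \<zero>\<^bsub>Env\<^esub> \<ominus>\<^bsub>Env\<^esub> W" using W by (simp add: Env.minus_eq)
  then show ?thesis using val_minus[of "\<zero>\<^bsub>Env\<^esub>" W] val_hom(4) W by simp
qed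

lemma Omega_tilde_val:
  assumes "a \<in> carrier A"
  shows "Omega_tilde A a \<in> carrier Env" "val (Omega_tilde A a) = OM a"
proof -
  have t: "env_tensor A a \<one> \<in> carrier Env" "env_tensor A \<one> a \<in> carrier Env"
    using env_tensor(1) assms by simp_all
  have "val (env_tensor A a \<one> \<ominus>\<^bsub>Env\<^esub> env_tensor A \<one> a) = lmul a - rmul a"
    using val_minus[OF t] assms by (simp add: env_tensor(2) lmul_one rmul_one)
  then show "Omega_tilde A a \<in> carrier Env" "val (Omega_tilde A a) = OM a"
    unfolding Omega_tilde_def OM_def using val_hom(5)[OF Env_minus_closed[OF t]] by simp_all
qed

lemma xl_EK: "i < n \<Longrightarrow> xl i \<in> EK" and om_EK: "i < n \<Longrightarrow> om i \<in> EK"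
proof -
  assume i: "i < n"
  then have a: "x i \<in> carrier A" using x_S by simp
  show "xl i \<in> EK"
    using val_EK[OF env_tensor(1)[OF a one_closed]] env_tensor(2)[OF a one_closed] by (simp add: rmul_one)
  show "om i \<in> EK"
    using val_EK[OF Omega_tilde_val(1)[OF a]] Omega_tilde_val(2)[OF a] by (simp add: om_def OM_def)
qed

lemma Cp_EK: "r \<in> Cp \<Longrightarrow> r \<in> EK"
  by (induction rule: Cp.induct) (intro xl_EK om_EK EK_sc add_subgroupD(2)[OF EK_sub] EK_mult; assumption)+

abbreviation "EF \<equiv> env_form A n x"

lemma Cp_subalgebra: "is_subalgebra laurent_ring {W \<in> carrier Env. val W \<in> Cp} Env" (is "is_subalgebra _ ?V _")
proof -
  interpret Env: abelian_group Env by (rule Env_abelian)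
  have "subgroup ?V (add_monoid Env)"
  proof (rule Env.add.subgroupI)
    show "?V \<noteq> {}" using val_hom(4) Cp_zero by auto
    show "\<ominus>\<^bsub>Env\<^esub> a \<in> ?V" if "a \<in> ?V" for a
      using that val_uminus[of a] add_subgroupD(3)[OF Cp_sub] by simp
    show "a \<oplus>\<^bsub>Env\<^esub> b \<in> ?V" if "a \<in> ?V" "b \<in> ?V" for a b
      using that val_hom(2)[of a b] add_subgroupD(4)[OF Cp_sub] by simp
  qed blast
  moreover have "submonoid ?V Env"
    by (rule submonoid.intro) (use val_hom(1,3) Cp_one Cp_mult in auto)
  ultimately show ?thesis
    unfolding is_subalgebra_def subring_def using val_hom(5) Cp_mult Cp_sc by auto
qed

text \<open>The preimage of \<open>Cp\<close> is a subalgebra containing the generators. Conversely,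
  rule induction on \<open>Cp\<close> shows that \<open>ival r\<close> lies in every such
  subalgebra.\<close>

lemma EF_eq: "EF = {W \<in> carrier Env. val W \<in> Cp}" (is "_ = ?V")
proof
  let ?G = "(\<lambda>i. env_tensor A (x i) \<one>) ` {..<n} \<union> (\<lambda>i. Omega_tilde A (x i)) ` {..<n}"
  have xA: "x i \<in> carrier A" if "i < n" for i using x_S that by simp
  have gx: "env_tensor A (x i) \<one> \<in> carrier Env" "val (env_tensor A (x i) \<one>) = xl i" if "i < n" for i
    using env_tensor[OF xA[OF that] one_closed] by (simp_all add: rmul_one)
  have go: "Omega_tilde A (x i) \<in> carrier Env" "val (Omega_tilde A (x i)) = om i" if "i < n" for i
    using Omega_tilde_val[OF xA[OF that]] by (simp_all add: om_def OM_def)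
  have "?G \<subseteq> ?V" using gx go Cp_xl Cp_om by auto
  then show "EF \<subseteq> ?V"
    unfolding env_form_def generated_subalgebra_def using Cp_subalgebra by blast
  show "?V \<subseteq> EF"
    unfolding env_form_def generated_subalgebra_def
  proof (intro Inter_greatest subsetI)
    fix B W assume B: "B \<in> {B. is_subalgebra laurent_ring B Env \<and> ?G \<subseteq> B}" and W: "W \<in> ?V"
    have sub: "subring B Env" "\<And>c V. c \<in> laurent \<Longrightarrow> V \<in> B \<Longrightarrow> c \<odot>\<^bsub>Env\<^esub> V \<in> B"
      using B by (auto simp: is_subalgebra_def)
    note S = subringE[OF sub(1)]
    have "ival r \<in> B" if "r \<in> Cp" for r
      using that
    proof (induction rule: Cp.induct)
      case (Cp_xl i)
      then have "ival (xl i) = env_tensor A (x i) \<one>"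
        using val_inj[OF ival(1) gx(1)] ival(2) gx(2) xl_EK by metis
      then show ?case using B Cp_xl by auto
    next
      case (Cp_om i)
      then have "ival (om i) = Omega_tilde A (x i)"
        using val_inj[OF ival(1) go(1)] ival(2) go(2) om_EK by metis
      then show ?case using B Cp_om by auto
    next
      case (Cp_sc l)
      have "val (l \<odot>\<^bsub>Env\<^esub> \<one>\<^bsub>Env\<^esub>) = sc l" "l \<odot>\<^bsub>Env\<^esub> \<one>\<^bsub>Env\<^esub> \<in> carrier Env"
        using val_hom(5)[of "\<one>\<^bsub>Env\<^esub>" l] val_hom(3) by simp_all
      then have "ival (sc l) = l \<odot>\<^bsub>Env\<^esub> \<one>\<^bsub>Env\<^esub>"
        using val_inj[OF ival(1)[OF EK_sc]] ival(2)[OF EK_sc] by metis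
      then show ?case using sub(2)[OF Cp_sc S(3)] by simp
    next
      case (Cp_diff a b)
      have e: "a \<in> EK" "b \<in> EK" "a - b \<in> EK"
        using Cp_EK[OF Cp_diff(1)] Cp_EK[OF Cp_diff(2)] add_subgroupD(2)[OF EK_sub] by blast+
      have "val (ival a \<ominus>\<^bsub>Env\<^esub> ival b) = a - b"
        using val_minus[OF ival(1)[OF e(1)] ival(1)[OF e(2)]] by (simp only: ival(2)[OF e(1)] ival(2)[OF e(2)])
      then have "ival (a - b) = ival a \<ominus>\<^bsub>Env\<^esub> ival b"
        using val_inj[OF ival(1)[OF e(3)] Env_minus_closed[OF ival(1)[OF e(1)] ival(1)[OF e(2)]]] ival(2)[OF e(3)] by simp
      also have "\<dots> \<in> B" unfolding a_minus_def by (intro S(7) S(5) Cp_diff)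
      finally show ?case .
    next
      case (Cp_mult a b)
      have e: "a \<in> EK" "b \<in> EK" "a * b \<in> EK"
        using Cp_EK[OF Cp_mult(1)] Cp_EK[OF Cp_mult(2)] EK_mult by blast+
      have v: "val (ival a \<otimes>\<^bsub>Env\<^esub> ival b) = a * b" "ival a \<otimes>\<^bsub>Env\<^esub> ival b \<in> carrier Env"
        using val_hom(1)[OF ival(1)[OF e(1)] ival(1)[OF e(2)]] by (simp_all only: ival(2)[OF e(1)] ival(2)[OF e(2)])
      then have "ival (a * b) = ival a \<otimes>\<^bsub>Env\<^esub> ival b"
        using val_inj[OF ival(1)[OF e(3)] v(2)] ival(2)[OF e(3)] by simp
      also have "\<dots> \<in> B" by (intro S(6) Cp_mult)
      finally show ?case .
    qed
    moreover have "ival (val W) = W"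
      using val_inj[OF ival(1)[OF val_EK]] ival(2)[OF val_EK] W by blast
    ultimately show "W \<in> B" using W by (metis (mono_tags, lifting) mem_Collect_eq)
  qed
qed

end

section \<open>The form and its specialization\<close>

lemma unit1_nonzero: "u \<in> unit1 \<Longrightarrow> u \<noteq> (0 :: 'k::field_char_0 poly fract)"
proof
  assume "u \<in> unit1" "u = 0"
  then obtain l where l: "1 + (qq - 1) * l = (0 :: 'k poly fract)" "l \<in> laurent" by (auto simp: unit1_def)
  then have "const 1 = (qq - 1) * - l" by (simp add: eq_neg_iff_add_eq_0)
  then have "(1::'k) = 0" by (rule const_eq_mult) (rule laurent_minus[OF l(2)])
  then show False by simp
qed

text \<open>\<open>k(q)\<close> is the field of fractions of the Laurent polynomials; the
  denominator comes from \<open>clear_denominator\<close>.\<close>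

lemma laurent_quotient:
  fixes c :: "'k::field_char_0 poly fract"
  shows "\<exists>l\<in>laurent. \<exists>d\<in>laurent. d \<noteq> 0 \<and> c = l * (1 / d)"
proof -
  obtain j u where u: "u \<in> unit1" "(qq - 1) ^ j * u * c \<in> laurent" using clear_denominator by blast
  have p: "(qq - 1 :: 'k poly fract) ^ i \<in> laurent" for i
    by (induction i) (auto intro: laurent_one laurent_mult qq_minus_1_laurent)
  let ?d = "(qq - 1) ^ j * u"
  have "?d \<noteq> 0" using unit1_nonzero[OF u(1)] qq_minus_1_nonzero[where 'k = 'k] by simp
  moreover from this have "c = (?d * c) * (1 / ?d)" by simp
  moreover have "?d \<in> laurent" by (intro laurent_mult p unit1_laurent u)
  ultimately show ?thesis using u(2) by blast
qed

context quantization
begin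

abbreviation "EnvF \<equiv> Env\<lparr>carrier := EF\<rparr>"

lemma EF_simps:
  "W \<in> EF \<longleftrightarrow> W \<in> carrier Env \<and> val W \<in> Cp"
  by (simp add: EF_eq)

lemma EF_closed:
  "\<one>\<^bsub>Env\<^esub> \<in> EF" "\<zero>\<^bsub>Env\<^esub> \<in> EF" "W \<in> EF \<Longrightarrow> V \<in> EF \<Longrightarrow> W \<oplus>\<^bsub>Env\<^esub> V \<in> EF"
  "W \<in> EF \<Longrightarrow> V \<in> EF \<Longrightarrow> W \<otimes>\<^bsub>Env\<^esub> V \<in> EF" "W \<in> EF \<Longrightarrow> V \<in> EF \<Longrightarrow> W \<ominus>\<^bsub>Env\<^esub> V \<in> EF"
  "l \<in> laurent \<Longrightarrow> W \<in> EF \<Longrightarrow> l \<odot>\<^bsub>Env\<^esub> W \<in> EF"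
  using val_hom val_minus Env_minus_closed add_subgroupD(4)[OF Cp_sub] Cp_diff Cp_mult Cp_sc Cp_one Cp_zero
  by (simp_all add: EF_simps)

text \<open>The natural map of the form, \<open>W \<otimes> c \<mapsto> c W\<close>, followed by
  \<open>val\<close>.\<close>

definition "F2 = (\<lambda>(W, c). sc c * val W)"

lemma ratfun_alg_simps:
  "carrier ratfun_alg = UNIV" "a \<otimes>\<^bsub>ratfun_alg\<^esub> b = a * b" "\<one>\<^bsub>ratfun_alg\<^esub> = 1"
  "a \<oplus>\<^bsub>ratfun_alg\<^esub> b = a + b" "k \<odot>\<^bsub>ratfun_alg\<^esub> a = k * a"
  by (simp_all add: ratfun_alg_def)

lemma form_rep: "tensor_rep laurent_ring ratfun_field EnvF ratfun_alg F2 sc"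
proof (rule tensor_rep.intro)
  fix a b c d assume "a \<in> carrier EnvF" "c \<in> carrier EnvF"
  then have "val (a \<otimes>\<^bsub>Env\<^esub> c) = val a * val c" using val_hom(1)[of a c] by (simp add: EF_simps)
  then have "F2 (a \<otimes>\<^bsub>Env\<^esub> c, b * d) = sc b * (sc d * (val a * val c))"
    by (simp add: F2_def endo_scalar.kappa_mult mult.assoc)
  also have "\<dots> = F2 (a, b) * F2 (c, d)"
    by (simp add: F2_def mult.assoc sc_left[of "val a"])
  finally show "F2 (a \<otimes>\<^bsub>EnvF\<^esub> c, b \<otimes>\<^bsub>ratfun_alg\<^esub> d) = F2 (a, b) * F2 (c, d)"
    by (simp add: ratfun_alg_simps)
next
  fix r :: "'k poly fract" and a b
  assume "r \<in> laurent" "a \<in> carrier EnvF"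
  then have "val (r \<odot>\<^bsub>Env\<^esub> a) = sc r * val a" using val_hom(5)[of a r] by (simp add: EF_simps)
  then show "F2 (r \<odot>\<^bsub>EnvF\<^esub> a, b) = F2 (a, r \<odot>\<^bsub>ratfun_alg\<^esub> b)"
    by (simp add: F2_def ratfun_alg_simps endo_scalar.kappa_mult mult.assoc sc_left[of "sc b"])
next
  fix r a b assume "a \<in> carrier EnvF"
  show "F2 (a, r \<odot>\<^bsub>ratfun_alg\<^esub> b) = sc r * F2 (a, b)"
    by (simp add: F2_def ratfun_alg_simps endo_scalar.kappa_mult mult.assoc)
next
  fix a a' b assume "a \<in> carrier EnvF" "a' \<in> carrier EnvF"
  then have "val (a \<oplus>\<^bsub>Env\<^esub> a') = val a + val a'" using val_hom(2)[of a a'] by (simp add: EF_simps)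
  then show "F2 (a \<oplus>\<^bsub>EnvF\<^esub> a', b) = F2 (a, b) + F2 (a', b)"
    by (simp add: F2_def distrib_left)
next
  fix a b b' assume "a \<in> carrier EnvF"
  show "F2 (a, b \<oplus>\<^bsub>ratfun_alg\<^esub> b') = F2 (a, b) + F2 (a, b')"
    by (simp add: F2_def ratfun_alg_simps endo_scalar.kappa_add distrib_right)
next
  show "F2 (\<one>\<^bsub>EnvF\<^esub>, \<one>\<^bsub>ratfun_alg\<^esub>) = 1"
    using val_hom(3) by (simp add: F2_def ratfun_alg_simps)
qed (simp_all add: EF_closed ratfun_alg_simps)

interpretation T2: tensor_rep laurent_ring ratfun_field EnvF ratfun_alg F2 sc
  by (rule form_rep)

text \<open>Common denominators: numerators are Laurent polynomials and can be moved into the left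
  factor, so every tensor is a single \<open>W \<otimes> 1/d\<close>.\<close>

lemma form_normal_form:
  assumes "f \<in> carrier (free_pairs EnvF (ratfun_alg :: ('k poly fract, 'k poly fract) module))"
  shows "\<exists>W\<in>EF. \<exists>d\<in>laurent. d \<noteq> 0 \<and> f - frag_of (W, 1 / d) \<in> T2.K"
proof -
  have k: "keys f \<subseteq> EF \<times> UNIV"
    using assms unfolding T2.FP_simps(1) by (simp add: ratfun_alg_simps)
  have bal: "frag_of (l \<odot>\<^bsub>Env\<^esub> W, c) - frag_of (W, l * c) \<in> T2.K" if "l \<in> laurent" "W \<in> EF" for l W c
    using T2.K_balanced[of l W c] that by (simp add: ratfun_alg_simps)
  have z: "frag_of (\<zero>\<^bsub>Env\<^esub>, c) \<in> T2.K" for c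
  proof (rule T2.K_zero_left)
    interpret Env: abelian_group Env by (rule Env_abelian)
    show "\<zero>\<^bsub>Env\<^esub> \<oplus>\<^bsub>EnvF\<^esub> \<zero>\<^bsub>Env\<^esub> = \<zero>\<^bsub>Env\<^esub>" by simp
  qed (simp_all add: ratfun_alg_simps EF_closed)
  show ?thesis
    using k
  proof (induction f rule: frag_induction)
    case zero
    have "0 - frag_of (\<zero>\<^bsub>Env\<^esub>, 1 / 1) \<in> T2.K"
      using add_subgroupD(3)[OF T2.K_add_subgroup z] by simp
    then show ?case using EF_closed(2) laurent_one by (metis zero_neq_one)
  next
    case (one p)
    then obtain W c where p: "p = (W, c)" "W \<in> EF" by blast
    obtain l d where l: "l \<in> laurent" "d \<in> laurent" "d \<noteq> 0" "c = l * (1 / d)" using laurent_quotient by blast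
    have "frag_of p - frag_of (l \<odot>\<^bsub>Env\<^esub> W, 1 / d) \<in> T2.K"
      using add_subgroupD(3)[OF T2.K_add_subgroup bal[OF l(1) p(2), of "1 / d"]]
      unfolding p(1) l(4) by (simp only: minus_diff_eq)
    then show ?case using EF_closed(6)[OF l(1) p(2)] l(2,3) by blast
  next
    case (diff f g)
    then obtain W d V e where W: "W \<in> EF" "d \<in> laurent" "d \<noteq> 0" "f - frag_of (W, 1 / d) \<in> T2.K"
      and V: "V \<in> EF" "e \<in> laurent" "e \<noteq> 0" "g - frag_of (V, 1 / e) \<in> T2.K" by blast
    \<comment> \<open>Both tensors are brought to the denominator \<open>d * e\<close>.\<close>
    let ?c = "1 / (d * e)" and ?W = "e \<odot>\<^bsub>Env\<^esub> W" and ?V = "d \<odot>\<^bsub>Env\<^esub> V"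
    have WV: "?W \<in> EF" "?V \<in> EF" using EF_closed(6) W V by blast+
    have 1: "frag_of (?W, ?c) - frag_of (W, 1 / d) \<in> T2.K"
      using bal[OF V(2) W(1), of ?c] V(3) by simp
    have 2: "frag_of (?V, ?c) - frag_of (V, 1 / e) \<in> T2.K"
      using bal[OF W(2) V(1), of ?c] W(3) by simp
    interpret Env: abelian_group Env by (rule Env_abelian)
    have "(?W \<ominus>\<^bsub>Env\<^esub> ?V) \<oplus>\<^bsub>Env\<^esub> ?V = ?W"
      using WV by (simp add: EF_simps Env.minus_eq Env.a_assoc Env.l_neg)
    then have 3: "frag_of (?W, ?c) - (frag_of (?W \<ominus>\<^bsub>Env\<^esub> ?V, ?c) + frag_of (?V, ?c)) \<in> T2.K"
      using T2.K_add_left[of "?W \<ominus>\<^bsub>Env\<^esub> ?V" ?V ?c] EF_closed(5)[OF WV] WV by (simp add: ratfun_alg_simps)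
    have "(f - frag_of (W, 1 / d)) - (g - frag_of (V, 1 / e)) - (frag_of (?W, ?c) - frag_of (W, 1 / d))
        + (frag_of (?V, ?c) - frag_of (V, 1 / e)) + (frag_of (?W, ?c) - (frag_of (?W \<ominus>\<^bsub>Env\<^esub> ?V, ?c) + frag_of (?V, ?c))) \<in> T2.K"
      by (intro add_subgroupD(2,4)[OF T2.K_add_subgroup] 1 2 3 W V)
    then have "f - g - frag_of (?W \<ominus>\<^bsub>Env\<^esub> ?V, ?c) \<in> T2.K" by (simp add: algebra_simps)
    moreover have "d * e \<in> laurent" "d * e \<noteq> 0" using laurent_mult[OF W(2) V(2)] W(3) V(3) by simp_all
    ultimately show ?case using EF_closed(5)[OF WV] by blast
  qed
qed

text \<open>If \<open>W \<otimes> 1/d\<close> has image zero, then \<open>W\<close> is zero, as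
  \<open>sc (1 / d)\<close> is invertible and \<open>val\<close> is injective.\<close>

lemma form_faithful: "faithful_tensor_rep laurent_ring ratfun_field EnvF ratfun_alg F2 sc"
proof (intro faithful_tensor_rep.intro form_rep faithful_tensor_rep_axioms.intro)
  fix f assume f: "f \<in> carrier (free_pairs EnvF (ratfun_alg :: ('k poly fract, 'k poly fract) module))" "lin_comb of_int F2 f = 0"
  obtain W d where W: "W \<in> EF" "d \<in> laurent" "d \<noteq> 0" "f - frag_of (W, 1 / d) \<in> T2.K"
    using form_normal_form[OF f(1)] by blast
  have "T2.\<rho> (f - frag_of (W, 1 / d)) = 0" using T2.K_rho W(4) by blast
  moreover have "T2.\<rho> f = 0" using f(2) by (simp add: T2.\<rho>_def)
  ultimately have "F2 (W, 1 / d) = 0"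
    by (simp only: T2.rho_diff T2.rho_frag_of) simp
  then have "sc d * (sc (1 / d) * val W) = 0" by (simp add: F2_def)
  then have "val W = 0"
    using W(3) by (simp only: mult.assoc[symmetric] endo_scalar.kappa_mult[symmetric]) simp
  then have "W = \<zero>\<^bsub>Env\<^esub>"
    using val_inj[of W "\<zero>\<^bsub>Env\<^esub>"] val_hom(4) W(1) by (simp add: EF_simps)
  moreover have "\<zero>\<^bsub>Env\<^esub> \<oplus>\<^bsub>Env\<^esub> \<zero>\<^bsub>Env\<^esub> = \<zero>\<^bsub>Env\<^esub>"
    using abelian_group.axioms(1)[OF Env_abelian] by (simp add: abelian_monoid.r_zero abelian_monoid.zero_closed)
  ultimately have "frag_of (W, 1 / d) \<in> T2.K"
    using T2.K_zero_left[of "1 / d" W] EF_closed(2) by (simp add: ratfun_alg_simps)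
  then show "f \<in> T2.K" using W(4) add_subgroup_cancel[OF T2.K_add_subgroup] by blast
qed

text \<open>\<open>xr i = xl i - h * om i\<close> lies in \<open>Cp\<close>, so \<open>Cp\<close>
  contains all products of left and right monomials, and these span \<open>EK\<close> over
  \<open>k(q)\<close>.\<close>

lemma scaled_Cp_EK:
  assumes J: "add_subgroup J" and c: "\<And>k r. r \<in> Cp \<Longrightarrow> sc k * r \<in> J"
  shows "EK \<subseteq> J"
proof
  interpret T: faithful_tensor_rep ratfun_field ratfun_field A "opposite A" F1 sc
    by (rule env_faithful)
  fix r assume "r \<in> EK"
  then obtain f where f: "f \<in> carrier T.FP" "r = T.\<rho> f" unfolding EK_def by blast
  have xr_Cp: "xr i \<in> Cp" if "i < n" for i
  proof -
    have "xr i = xl i - hh * om i" by (simp add: om_def hinv_hh)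
    also have "\<dots> \<in> Cp" by (intro Cp_diff Cp_xl Cp_mult Cp_om Cp_sc qq_minus_1_laurent that)
    finally show ?thesis .
  qed
  have P_Cp: "lmul (xm m) * rmul (xm m') \<in> Cp" for m m'
    unfolding lmul_xm rmul_xm by (intro Cp_mult pl_Cp Cp_xl xr_Cp) (use set_mlist in auto)
  have "F1 (a, b) \<in> J" if ab: "a \<in> carrier A" "b \<in> carrier A" for a b
  proof -
    have l: "lmul a = lin_comb sc (\<lambda>m. lmul (xm m)) (coords a)"
      using lin_map_lincomb[of lmul "coords a", OF lmul_add lmul_smult] coords(2)[OF ab(1)] by simp
    have r: "rmul b = lin_comb sc (\<lambda>m. rmul (xm m)) (coords b)"
      using lin_map_lincomb[of rmul "coords b", OF rmul_add rmul_smult] coords(2)[OF ab(2)] by simp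
    have "lmul a * rmul b \<in> J"
      unfolding l r lin_comb_def sum_product
    proof (intro add_subgroup_sum[OF J])
      fix m m'
      have "sc (lookup (coords a) m) * lmul (xm m) * (sc (lookup (coords b) m') * rmul (xm m'))
        = sc (lookup (coords a) m * lookup (coords b) m') * (lmul (xm m) * rmul (xm m'))"
        by (simp add: endo_scalar.kappa_mult mult.assoc sc_left[of "lmul _"])
      then show "sc (lookup (coords a) m) * lmul (xm m) * (sc (lookup (coords b) m') * rmul (xm m')) \<in> J"
        using c[OF P_Cp] by simp
    qed
    then show ?thesis by (simp add: F1_def)
  qed
  \<comment> \<open>Integer multiples occur because elements of the tensor product are formal sums
    over the integers.\<close>
  moreover have int: "of_int k * r \<in> J" if r: "r \<in> J" for k r
  proof (induction k rule: int_induct[where k = 0])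
    case base
    show ?case using add_subgroupD(1)[OF J] by simp
  next
    case (step1 i)
    then show ?case using add_subgroupD(4)[OF J _ r] by (simp add: distrib_right)
  next
    case (step2 i)
    then show ?case using add_subgroupD(2)[OF J _ r] by (simp add: left_diff_distrib)
  qed
  moreover have "\<exists>a b. p = (a, b) \<and> a \<in> carrier A \<and> b \<in> carrier A" if "p \<in> keys f" for p
    using that f(1) unfolding T.FP_simps(1) opposite_simps by blast
  ultimately have "of_int (lookup f p) * F1 p \<in> J" if "p \<in> keys f" for p
    using that by metis
  then show "r \<in> J"
    unfolding f(2) T.\<rho>_def lin_comb_def by (rule add_subgroup_sum[OF J])
qed

text \<open>The natural map is realised as \<open>\<rho>\<close> followed by \<open>ival\<close>; it
  is injective on the tensor product by \<open>form_faithful\<close> and onto by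
  \<open>scaled_Cp_EK\<close>.\<close>

lemma EF_is_form: "is_form Env EF"
proof -
  interpret T2: faithful_tensor_rep laurent_ring ratfun_field EnvF ratfun_alg F2 sc
    by (rule form_faithful)
  interpret C: alg_congruence T2.K T2.FP ratfun_field by (rule T2.congruence)
  have F2_EK: "F2 p \<in> EK" if p: "p \<in> EF \<times> UNIV" for p
  proof -
    obtain W c where "p = (W, c)" "W \<in> EF" using p by blast
    then show ?thesis using EK_smult[OF val_EK, of W c] by (simp add: F2_def EF_simps)
  qed
  have of_int_EK: "of_int k * r \<in> EK" if "r \<in> EK" for k r
  proof -
    have "of_int k \<in> EK"
    proof (induction k rule: int_induct[where k = 0])
      case base
      show ?case using add_subgroupD(1)[OF EK_sub] by simp
    next
      case (step1 i)
      then show ?case using add_subgroupD(4)[OF EK_sub _ EK_one] by simp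
    next
      case (step2 i)
      then show ?case using add_subgroupD(2)[OF EK_sub _ EK_one] by simp
    qed
    then show ?thesis by (intro EK_mult that)
  qed
  have rho_EK: "T2.\<rho> f \<in> EK" if "f \<in> carrier T2.FP" for f
    unfolding T2.\<rho>_def lin_comb_def
  proof (rule add_subgroup_sum[OF EK_sub])
    fix p assume "p \<in> keys f"
    then show "of_int (lookup f p) * F2 p \<in> EK"
    proof -
      have "p \<in> EF \<times> UNIV"
        using \<open>p \<in> keys f\<close> that unfolding T2.FP_simps(1) by (auto simp: ratfun_alg_simps)
      then show ?thesis by (intro of_int_EK F2_EK)
    qed
  qed
  define g where "g f = ival (T2.\<rho> f)" for f
  have g: "g f \<in> carrier Env" "val (g f) = T2.\<rho> f" if "f \<in> carrier T2.FP" for f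
    unfolding g_def using ival[OF rho_EK[OF that]] by blast+
  have eqI: "W = V" if "W \<in> carrier Env" "V \<in> carrier Env" "val W = val V" for W V
    using val_inj that by blast
  have hom: "\<And>a. a \<in> carrier T2.FP \<Longrightarrow> g a \<in> carrier Env"
    "\<And>a b. a \<in> carrier T2.FP \<Longrightarrow> b \<in> carrier T2.FP \<Longrightarrow> g (a \<otimes>\<^bsub>T2.FP\<^esub> b) = g a \<otimes>\<^bsub>Env\<^esub> g b"
    "\<And>a b. a \<in> carrier T2.FP \<Longrightarrow> b \<in> carrier T2.FP \<Longrightarrow> g (a \<oplus>\<^bsub>T2.FP\<^esub> b) = g a \<oplus>\<^bsub>Env\<^esub> g b"
    "g \<one>\<^bsub>T2.FP\<^esub> = \<one>\<^bsub>Env\<^esub>"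
    "\<And>c a. c \<in> carrier (ratfun_field :: 'k poly fract ring) \<Longrightarrow> a \<in> carrier T2.FP \<Longrightarrow> g (c \<odot>\<^bsub>T2.FP\<^esub> a) = c \<odot>\<^bsub>Env\<^esub> g a"
    "\<And>a b. a \<in> carrier T2.FP \<Longrightarrow> b \<in> carrier T2.FP \<Longrightarrow> g a = g b \<longleftrightarrow> a \<ominus>\<^bsub>T2.FP\<^esub> b \<in> T2.K"
  proof -
    fix a assume a: "a \<in> carrier T2.FP"
    show "g a \<in> carrier Env" by (rule g(1)[OF a])
    show "g (c \<odot>\<^bsub>T2.FP\<^esub> a) = c \<odot>\<^bsub>Env\<^esub> g a" if "c \<in> carrier (ratfun_field :: 'k poly fract ring)" for c
      using g[OF T2.FP_smult(1)[OF that a]] val_hom(5)[OF g(1)[OF a], of c] T2.FP_smult(2)[OF that a] g(2)[OF a]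
      by (intro eqI) simp_all
    fix b assume b: "b \<in> carrier T2.FP"
    show "g (a \<otimes>\<^bsub>T2.FP\<^esub> b) = g a \<otimes>\<^bsub>Env\<^esub> g b"
      using g[OF T2.FP_mult(1)[OF a b]] val_hom(1)[OF g(1)[OF a] g(1)[OF b]] T2.FP_mult(2)[OF a b] g(2)[OF a] g(2)[OF b]
      by (intro eqI) simp_all
    have ab: "a \<oplus>\<^bsub>T2.FP\<^esub> b \<in> carrier T2.FP" by (rule C.a_closed[OF a b])
    show "g (a \<oplus>\<^bsub>T2.FP\<^esub> b) = g a \<oplus>\<^bsub>Env\<^esub> g b"
      using g[OF ab] val_hom(2)[OF g(1)[OF a] g(1)[OF b]] g(2)[OF a] g(2)[OF b]
      by (intro eqI) (simp_all add: T2.FP_simps(2) T2.rho_add)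
    show "g a = g b \<longleftrightarrow> a \<ominus>\<^bsub>T2.FP\<^esub> b \<in> T2.K"
      using val_inj[OF g(1)[OF a] g(1)[OF b]] T2.diff_K_iff[OF a b] g(2)[OF a] g(2)[OF b] by simp
  next
    show "g \<one>\<^bsub>T2.FP\<^esub> = \<one>\<^bsub>Env\<^esub>"
      using g[OF T2.FP_one] val_hom(3) T2.F_one by (intro eqI) (simp_all add: T2.FP_simps(4))
  qed
  have surj: "carrier Env \<subseteq> g ` carrier T2.FP"
  proof
    fix W assume W: "W \<in> carrier Env"
    have "EK \<subseteq> T2.\<rho> ` carrier T2.FP"
    proof (rule scaled_Cp_EK)
      show "add_subgroup (T2.\<rho> ` carrier T2.FP)" by (rule add_subgroup_image[OF T2.FP_sub T2.rho_diff])
      fix k r assume r: "r \<in> Cp"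
      then have "ival r \<in> EF" using ival[OF Cp_EK[OF r]] by (simp add: EF_simps)
      then have "frag_of (ival r, k) \<in> carrier T2.FP"
        by (intro T2.FP_frag_of) (simp_all add: ratfun_alg_simps)
      moreover have "T2.\<rho> (frag_of (ival r, k)) = sc k * r"
        using ival(2)[OF Cp_EK[OF r]] by (simp only: T2.rho_frag_of) (simp add: F2_def)
      ultimately show "sc k * r \<in> T2.\<rho> ` carrier T2.FP" by (metis image_eqI)
    qed
    then obtain f where f: "f \<in> carrier T2.FP" "val W = T2.\<rho> f" using val_EK[OF W] by blast
    then have "W = g f" using eqI[OF W g(1)[OF f(1)]] g(2)[OF f(1)] by simp
    then show "W \<in> g ` carrier T2.FP" using f(1) by blast
  qed
  have iso: "(\<lambda>W. the_elem (g ` W)) \<in> alg_iso ratfun_field (tensor_alg laurent_ring EnvF ratfun_alg) Env"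
    unfolding tensor_alg_def by (rule C.first_isomorphism(1)[OF hom surj])
  have pt: "the_elem (g ` pure_tensor laurent_ring EnvF ratfun_alg r c) = c \<odot>\<^bsub>Env\<^esub> r" if r: "r \<in> EF" for r c
  proof -
    have f: "frag_of (r, c) \<in> carrier T2.FP"
      by (intro T2.FP_frag_of) (simp_all add: r ratfun_alg_simps)
    have "the_elem (g ` pure_tensor laurent_ring EnvF ratfun_alg r c) = g (frag_of (r, c))"
      unfolding pure_tensor_def by (rule C.first_isomorphism(2)[OF hom surj f])
    moreover have rE: "r \<in> carrier Env" using r by (simp add: EF_simps)
    have "val (g (frag_of (r, c))) = sc c * val r"
      unfolding g(2)[OF f] T2.rho_frag_of by (simp add: F2_def)
    then have "g (frag_of (r, c)) = c \<odot>\<^bsub>Env\<^esub> r"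
      using val_hom(5)[OF rE, of c] by (intro eqI g(1)[OF f]) simp_all
    ultimately show ?thesis by simp
  qed
  show ?thesis
    unfolding is_form_def
  proof (intro conjI bexI[OF _ iso] ballI allI pt)
    show "is_subalgebra laurent_ring EF Env" unfolding EF_eq by (rule Cp_subalgebra)
  qed
qed

section \<open>The specialization at \<open>q = 1\<close> and its isomorphism with
  \<open>P(A)\<close>\<close>

abbreviation "hEF \<equiv> q_minus_1_ideal Env EF"
abbreviation "EnvFk \<equiv> restrict_scalars const EnvF"

text \<open>Passing to the quotient and restricting scalars give equal records in either order; with
  the scalars restricted at the start, \<open>alg_congruence\<close> over \<open>k\<close>
  applies.\<close>

lemma specialization_Env: "specialization Env EF = quot_alg EnvFk hEF"
  by (simp add: specialization_def quot_alg_def restrict_scalars_def FactRing_def A_RCOSETS_def RCOSETS_def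
      rcoset_mult_def[abs_def] set_add_def set_mult_def[abs_def] a_r_coset_def r_coset_def)

lemma hEF_iff: assumes "W \<in> carrier Env" shows "W \<in> hEF \<longleftrightarrow> val W \<in> hCp"
proof
  assume "W \<in> hEF"
  then obtain V where V: "V \<in> EF" "W = (qq - 1) \<odot>\<^bsub>Env\<^esub> V" by (auto simp: q_minus_1_ideal_def)
  then have "val W = hh * val V" using val_hom(5)[of V "qq - 1"] by (simp add: EF_simps)
  then show "val W \<in> hCp" using V(1) by (simp add: EF_simps hCp_I)
next
  assume "val W \<in> hCp"
  then obtain r where r: "r \<in> Cp" "val W = hh * r" by (auto simp: hCp_def)
  have V: "ival r \<in> EF" using ival[OF Cp_EK[OF r(1)]] r(1) by (simp add: EF_simps)
  have "val ((qq - 1) \<odot>\<^bsub>Env\<^esub> ival r) = val W"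
    using val_hom(5)[OF ival(1)[OF Cp_EK[OF r(1)]], of "qq - 1"] ival(2)[OF Cp_EK[OF r(1)]] r(2) by simp
  then have "W = (qq - 1) \<odot>\<^bsub>Env\<^esub> ival r"
    using val_inj[OF assms, of "(qq - 1) \<odot>\<^bsub>Env\<^esub> ival r"] val_hom(5)[OF ival(1)[OF Cp_EK[OF r(1)]], of "qq - 1"] by simp
  then show "W \<in> hEF" using V by (simp add: q_minus_1_ideal_def)
qed

lemma EnvFk_simps:
  "carrier EnvFk = EF" "W \<otimes>\<^bsub>EnvFk\<^esub> V = W \<otimes>\<^bsub>Env\<^esub> V" "W \<oplus>\<^bsub>EnvFk\<^esub> V = W \<oplus>\<^bsub>Env\<^esub> V"
  "\<one>\<^bsub>EnvFk\<^esub> = \<one>\<^bsub>Env\<^esub>" "\<zero>\<^bsub>EnvFk\<^esub> = \<zero>\<^bsub>Env\<^esub>" "c \<odot>\<^bsub>EnvFk\<^esub> W = const c \<odot>\<^bsub>Env\<^esub> W"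
  by (simp_all add: restrict_scalars_def)

lemma EnvFk_abelian: "abelian_group EnvFk"
  and EnvFk_minus: "W \<in> EF \<Longrightarrow> V \<in> EF \<Longrightarrow> val (W \<ominus>\<^bsub>EnvFk\<^esub> V) = val W - val V"
proof -
  have img: "- val W \<in> val ` EF" if "W \<in> EF" for W
  proof (rule image_eqI)
    show "\<ominus>\<^bsub>Env\<^esub> W \<in> EF" "- val W = val (\<ominus>\<^bsub>Env\<^esub> W)"
      using that val_uminus[of W] add_subgroupD(3)[OF Cp_sub] by (simp_all add: EF_simps)
  qed
  have *: "inj_on val (carrier EnvFk)" "\<zero>\<^bsub>EnvFk\<^esub> \<in> carrier EnvFk" "val \<zero>\<^bsub>EnvFk\<^esub> = 0"
    "\<And>a b. a \<in> carrier EnvFk \<Longrightarrow> b \<in> carrier EnvFk \<Longrightarrow> a \<oplus>\<^bsub>EnvFk\<^esub> b \<in> carrier EnvFk"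
    "\<And>a b. a \<in> carrier EnvFk \<Longrightarrow> b \<in> carrier EnvFk \<Longrightarrow> val (a \<oplus>\<^bsub>EnvFk\<^esub> b) = val a + val b"
    "\<And>a. a \<in> carrier EnvFk \<Longrightarrow> - val a \<in> val ` carrier EnvFk"
    unfolding EnvFk_simps
    using val_inj val_hom(2,4) EF_closed(2,3) img by (auto simp: inj_on_def EF_simps)
  show "abelian_group EnvFk" by (rule abelian_group_of_inj(1)[OF *])
  show "W \<in> EF \<Longrightarrow> V \<in> EF \<Longrightarrow> val (W \<ominus>\<^bsub>EnvFk\<^esub> V) = val W - val V"
    using abelian_group_of_inj(2)[OF *] by (simp only: EnvFk_simps(1))
qed

lemma EnvFk_minus_closed: "W \<in> EF \<Longrightarrow> V \<in> EF \<Longrightarrow> W \<ominus>\<^bsub>EnvFk\<^esub> V \<in> EF"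
  using abelian_group.minus_closed[OF EnvFk_abelian, of W V] by (simp only: EnvFk_simps(1))

lemma EnvFk_minus_hEF: "W \<in> EF \<Longrightarrow> V \<in> EF \<Longrightarrow> W \<ominus>\<^bsub>EnvFk\<^esub> V \<in> hEF \<longleftrightarrow> val W - val V \<in> hCp"
  using hEF_iff[of "W \<ominus>\<^bsub>EnvFk\<^esub> V"] EnvFk_minus[of W V] EnvFk_minus_closed[of W V] by (simp add: EF_simps)

lemma hEF_EF: "hEF \<subseteq> EF"
  using EF_closed(6)[OF qq_minus_1_laurent] by (auto simp: q_minus_1_ideal_def)

lemma hEF_congruence: "alg_congruence hEF EnvFk base_field"
proof (intro alg_congruence.intro abelian_subgroupI3 additive_subgroup.intro EnvFk_abelian
    alg_congruence_axioms.intro)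
  interpret EFk: abelian_group EnvFk by (rule EnvFk_abelian)
  have e: "W \<in> carrier Env" "val W \<in> Cp" if "W \<in> EF" for W using that by (simp_all add: EF_simps)
  show "subgroup hEF (add_monoid EnvFk)"
  proof (rule EFk.add.subgroupI)
    show "hEF \<subseteq> carrier EnvFk" using hEF_EF by (simp only: EnvFk_simps)
    show "hEF \<noteq> {}" using EF_closed(2) by (auto simp: q_minus_1_ideal_def)
    fix W assume W: "W \<in> hEF"
    then have WE: "W \<in> EF" using hEF_EF by blast
    have "\<ominus>\<^bsub>EnvFk\<^esub> W = \<zero>\<^bsub>EnvFk\<^esub> \<ominus>\<^bsub>EnvFk\<^esub> W"
    proof -
      have "W \<in> carrier EnvFk" using WE by (simp only: EnvFk_simps(1))
      then show ?thesis by (simp only: EFk.minus_eq EFk.l_zero[OF EFk.a_inv_closed])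
    qed
    also have "\<dots> \<in> hEF"
      unfolding EnvFk_simps(5) EnvFk_minus_hEF[OF EF_closed(2) WE]
      using hEF_iff[OF e(1)[OF WE]] W val_hom(4) add_subgroupD(3)[OF hCp_sub] by simp
    finally show "\<ominus>\<^bsub>EnvFk\<^esub> W \<in> hEF" .
    fix V assume V: "V \<in> hEF"
    then have VE: "V \<in> EF" using hEF_EF by blast
    have "W \<oplus>\<^bsub>Env\<^esub> V \<in> carrier Env" "val (W \<oplus>\<^bsub>Env\<^esub> V) = val W + val V"
      using val_hom(2)[OF e(1)[OF WE] e(1)[OF VE]] by blast+
    then show "W \<oplus>\<^bsub>EnvFk\<^esub> V \<in> hEF"
      using hEF_iff[OF e(1)[OF WE]] hEF_iff[OF e(1)[OF VE]] W V
      by (simp add: EnvFk_simps(3) hEF_iff add_subgroupD(4)[OF hCp_sub])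
  qed
  fix W W' V V' assume "W \<in> carrier EnvFk" "W' \<in> carrier EnvFk" "V \<in> carrier EnvFk" "V' \<in> carrier EnvFk"
    and h: "W \<ominus>\<^bsub>EnvFk\<^esub> W' \<in> hEF" "V \<ominus>\<^bsub>EnvFk\<^esub> V' \<in> hEF"
  then have W: "W \<in> EF" "W' \<in> EF" "V \<in> EF" "V' \<in> EF" by (simp_all only: EnvFk_simps(1))
  have hh: "val W - val W' \<in> hCp" "val V - val V' \<in> hCp"
    using h EnvFk_minus_hEF W by blast+
  have "val (W \<otimes>\<^bsub>Env\<^esub> V) - val (W' \<otimes>\<^bsub>Env\<^esub> V') = (val W - val W') * val V + val W' * (val V - val V')"
    using val_hom(1)[OF e(1)[OF W(1)] e(1)[OF W(3)]] val_hom(1)[OF e(1)[OF W(2)] e(1)[OF W(4)]]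
    by (simp add: algebra_simps)
  also have "\<dots> \<in> hCp"
    by (intro add_subgroupD(4)[OF hCp_sub] hCp_left hCp_right hh e(2) W)
  finally show "W \<otimes>\<^bsub>EnvFk\<^esub> V \<ominus>\<^bsub>EnvFk\<^esub> W' \<otimes>\<^bsub>EnvFk\<^esub> V' \<in> hEF"
    unfolding EnvFk_simps(2) using EnvFk_minus_hEF[OF EF_closed(4)[OF W(1,3)] EF_closed(4)[OF W(2,4)]] by blast
next
  fix c :: 'k and W W' assume "W \<in> carrier EnvFk" "W' \<in> carrier EnvFk" and h: "W \<ominus>\<^bsub>EnvFk\<^esub> W' \<in> hEF"
  then have W: "W \<in> EF" "W' \<in> EF" by (simp_all only: EnvFk_simps(1))
  have hh: "val W - val W' \<in> hCp" using h EnvFk_minus_hEF W by blast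
  have "val (const c \<odot>\<^bsub>Env\<^esub> W) - val (const c \<odot>\<^bsub>Env\<^esub> W') = \<kappa> c * (val W - val W')"
    using val_hom(5)[of W "const c"] val_hom(5)[of W' "const c"] W by (simp add: EF_simps right_diff_distrib)
  also have "\<dots> \<in> hCp" by (intro hCp_left Cp_sc const_laurent hh)
  finally show "c \<odot>\<^bsub>EnvFk\<^esub> W \<ominus>\<^bsub>EnvFk\<^esub> c \<odot>\<^bsub>EnvFk\<^esub> W' \<in> hEF"
    unfolding EnvFk_simps(6)
    using EnvFk_minus_hEF[OF EF_closed(6)[OF const_laurent W(1)] EF_closed(6)[OF const_laurent W(2)]] by blast
next
  fix c :: 'k and W assume "W \<in> carrier EnvFk"
  then show "c \<odot>\<^bsub>EnvFk\<^esub> W \<in> carrier EnvFk"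
    unfolding EnvFk_simps(1,6) by (rule EF_closed(6)[OF const_laurent])
qed (simp_all only: EnvFk_simps EF_closed)

lemma FA_congruence: "alg_congruence I FA base_field"
proof (intro alg_congruence.intro abelian_subgroupI3 alg_congruence_axioms.intro)
  interpret FA: ring FA by (rule FA_ring)
  show "abelian_group FA" by unfold_locales
  show "additive_subgroup I FA" using I_ideal by (simp add: ideal_def)
  have m: "f \<ominus>\<^bsub>FA\<^esub> g = f - g" if "f \<in> carrier FA" "g \<in> carrier FA" for f g
  proof (rule abelian_group_of_inj(2)[where v = "\<lambda>f. f", OF _ _ _ _ _ _ that])
    show "- f \<in> (\<lambda>f. f) ` carrier FA" if "f \<in> carrier FA" for f
      using add_subgroupD(3)[OF FA_sub that] by simp
  qed (simp_all add: FA_simps(3,5) add_subgroupD(1,4)[OF FA_sub])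
  show "\<one>\<^bsub>FA\<^esub> \<in> carrier FA" by simp
  show "f \<otimes>\<^bsub>FA\<^esub> g \<in> carrier FA" if "f \<in> carrier FA" "g \<in> carrier FA" for f g
    using that by simp
  show "c \<odot>\<^bsub>FA\<^esub> f \<in> carrier FA" if "f \<in> carrier FA" for c f
    unfolding FA_simps(6) by (intro FA_mult FA_kf that)
  show "f \<otimes>\<^bsub>FA\<^esub> g \<ominus>\<^bsub>FA\<^esub> f' \<otimes>\<^bsub>FA\<^esub> g' \<in> I"
    if f: "f \<in> carrier FA" "f' \<in> carrier FA" "g \<in> carrier FA" "g' \<in> carrier FA"
      "f \<ominus>\<^bsub>FA\<^esub> f' \<in> I" "g \<ominus>\<^bsub>FA\<^esub> g' \<in> I" for f f' g g'
  proof -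
    have "f \<otimes>\<^bsub>FA\<^esub> g \<ominus>\<^bsub>FA\<^esub> f' \<otimes>\<^bsub>FA\<^esub> g' = (f - f') * g + f' * (g - g')"
      using m[OF FA_mult[OF f(1,3)] FA_mult[OF f(2,4)]] by (simp add: FA_simps(2) algebra_simps)
    also have "\<dots> \<in> I"
      using f(5,6) m[OF f(1,2)] m[OF f(3,4)]
      by (intro add_subgroupD(4)[OF I_sub] I_left I_right f(2,3)) simp_all
    finally show ?thesis .
  qed
  show "c \<odot>\<^bsub>FA\<^esub> f \<ominus>\<^bsub>FA\<^esub> c \<odot>\<^bsub>FA\<^esub> f' \<in> I"
    if f: "f \<in> carrier FA" "f' \<in> carrier FA" "f \<ominus>\<^bsub>FA\<^esub> f' \<in> I" for c f f'
    using I_left[OF FA_kf f(3), of c] m[OF f(1,2)] m[OF FA_mult[OF FA_kf f(1)] FA_mult[OF FA_kf f(2)], of c c]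
    by (simp add: FA_simps(6) right_diff_distrib)
qed

abbreviation "PA \<equiv> poisson_env n Sp (semiclassical_bracket A S) (\<lambda>i. spec_image A S (x i))"

text \<open>The isomorphism runs from the specialization to \<open>P(A)\<close>: an element of the
  form goes to the class of any \<open>f\<close> whose image under \<open>Phi\<close> is congruent
  to it modulo \<open>h\<close>. Such \<open>f\<close> exist by \<open>Phi_surj\<close>;
  \<open>Phi_kernel\<close> makes the class independent of the choice and the induced map
  injective.\<close>

lemma specialization_iso: "alg_iso base_field (specialization Env EF) PA \<noteq> {}"
proof -
  interpret C: alg_congruence hEF EnvFk base_field by (rule hEF_congruence)
  interpret D: alg_congruence I FA base_field by (rule FA_congruence)
  have PA: "PA = quot_alg FA I" by (simp add: poisson_env_def I_def)
  have e: "W \<in> carrier Env" "val W \<in> Cp" if "W \<in> EF" for W using that by (simp_all add: EF_simps)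
  define lift where "lift W = (SOME f. f \<in> carrier FA \<and> val W - Phi f \<in> hCp)" for W
  have lift: "lift W \<in> carrier FA" "val W - Phi (lift W) \<in> hCp" if "W \<in> EF" for W
  proof -
    have "\<exists>f. f \<in> carrier FA \<and> val W - Phi f \<in> hCp" using Phi_surj[OF e(2)[OF that]] by blast
    from someI_ex[OF this] show "lift W \<in> carrier FA" "val W - Phi (lift W) \<in> hCp"
      unfolding lift_def by blast+
  qed
  have FA_minus: "f \<ominus>\<^bsub>FA\<^esub> g = f - g" if "f \<in> carrier FA" "g \<in> carrier FA" for f g
  proof (rule abelian_group_of_inj(2)[where v = "\<lambda>f. f", OF _ _ _ _ _ _ that])
    show "- f \<in> (\<lambda>f. f) ` carrier FA" if "f \<in> carrier FA" for f
      using add_subgroupD(3)[OF FA_sub that] by simp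
  qed (simp_all add: FA_simps(3,5) add_subgroupD(1,4)[OF FA_sub])
  have eq: "I +>\<^bsub>FA\<^esub> f = I +>\<^bsub>FA\<^esub> g \<longleftrightarrow> Phi f - Phi g \<in> hCp" if "f \<in> carrier FA" "g \<in> carrier FA" for f g
    using D.coset_eq_iff[OF that] Phi_kernel[OF add_subgroupD(2)[OF FA_sub that]]
    by (simp add: FA_minus[OF that] Phi_diff)
  \<comment> \<open>Any convenient preimage may replace the chosen one; this is how compatibility
    with the operations is checked.\<close>
  have lift_eq: "I +>\<^bsub>FA\<^esub> lift W = I +>\<^bsub>FA\<^esub> f" if "W \<in> EF" "f \<in> carrier FA" "val W - Phi f \<in> hCp" for W f
  proof -
    have "(val W - Phi f) - (val W - Phi (lift W)) \<in> hCp"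
      by (rule add_subgroupD(2)[OF hCp_sub that(3) lift(2)[OF that(1)]])
    then show ?thesis using eq[OF lift(1)[OF that(1)] that(2)] by simp
  qed
  have inPA: "I +>\<^bsub>FA\<^esub> f \<in> carrier PA" if "f \<in> carrier FA" for f
    unfolding PA D.quot_carrier using that by blast
  define g where "g W = I +>\<^bsub>FA\<^esub> lift W" for W
  have hom: "\<And>a. a \<in> carrier EnvFk \<Longrightarrow> g a \<in> carrier PA"
    "\<And>a b. a \<in> carrier EnvFk \<Longrightarrow> b \<in> carrier EnvFk \<Longrightarrow> g (a \<otimes>\<^bsub>EnvFk\<^esub> b) = g a \<otimes>\<^bsub>PA\<^esub> g b"
    "\<And>a b. a \<in> carrier EnvFk \<Longrightarrow> b \<in> carrier EnvFk \<Longrightarrow> g (a \<oplus>\<^bsub>EnvFk\<^esub> b) = g a \<oplus>\<^bsub>PA\<^esub> g b"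
    "g \<one>\<^bsub>EnvFk\<^esub> = \<one>\<^bsub>PA\<^esub>"
    "\<And>c a. c \<in> carrier (base_field :: 'k ring) \<Longrightarrow> a \<in> carrier EnvFk \<Longrightarrow> g (c \<odot>\<^bsub>EnvFk\<^esub> a) = c \<odot>\<^bsub>PA\<^esub> g a"
    "\<And>a b. a \<in> carrier EnvFk \<Longrightarrow> b \<in> carrier EnvFk \<Longrightarrow> g a = g b \<longleftrightarrow> a \<ominus>\<^bsub>EnvFk\<^esub> b \<in> hEF"
  proof -
    fix a assume "a \<in> carrier EnvFk"
    then have a: "a \<in> EF" by (simp only: EnvFk_simps(1))
    show "g a \<in> carrier PA" unfolding g_def by (rule inPA[OF lift(1)[OF a]])
    show "g (c \<odot>\<^bsub>EnvFk\<^esub> a) = c \<odot>\<^bsub>PA\<^esub> g a" if "c \<in> carrier (base_field :: 'k ring)" for c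
    proof -
      have "val (const c \<odot>\<^bsub>Env\<^esub> a) - Phi (kf c * lift a) = \<kappa> c * (val a - Phi (lift a))"
        using val_hom(5)[OF e(1)[OF a], of "const c"] by (simp add: Phi_mult Phi_kf right_diff_distrib)
      also have "\<dots> \<in> hCp" by (intro hCp_left Cp_sc const_laurent lift(2) a)
      finally have "I +>\<^bsub>FA\<^esub> lift (const c \<odot>\<^bsub>Env\<^esub> a) = I +>\<^bsub>FA\<^esub> (kf c * lift a)"
        by (intro lift_eq EF_closed(6)[OF const_laurent a] FA_mult FA_kf lift(1)[OF a])
      then show ?thesis
        unfolding g_def PA EnvFk_simps(6) D.quot_smult[OF that lift(1)[OF a]] FA_simps(6) .
    qed
    fix b assume "b \<in> carrier EnvFk"
    then have b: "b \<in> EF" by (simp only: EnvFk_simps(1))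
    show "g (a \<otimes>\<^bsub>EnvFk\<^esub> b) = g a \<otimes>\<^bsub>PA\<^esub> g b"
    proof -
      have "val (a \<otimes>\<^bsub>Env\<^esub> b) - Phi (lift a * lift b) = (val a - Phi (lift a)) * val b + Phi (lift a) * (val b - Phi (lift b))"
        using val_hom(1)[OF e(1)[OF a] e(1)[OF b]] by (simp add: Phi_mult algebra_simps)
      also have "\<dots> \<in> hCp"
        by (intro add_subgroupD(4)[OF hCp_sub] hCp_left hCp_right lift(2) Phi_FA lift(1) e(2) a b)
      finally have "I +>\<^bsub>FA\<^esub> lift (a \<otimes>\<^bsub>Env\<^esub> b) = I +>\<^bsub>FA\<^esub> (lift a * lift b)"
        by (intro lift_eq EF_closed(4)[OF a b] FA_mult lift(1) a b)
      then show ?thesis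
        unfolding g_def PA EnvFk_simps(2) D.quot_mult[OF lift(1)[OF a] lift(1)[OF b]] FA_simps(2) .
    qed
    show "g (a \<oplus>\<^bsub>EnvFk\<^esub> b) = g a \<oplus>\<^bsub>PA\<^esub> g b"
    proof -
      have "val (a \<oplus>\<^bsub>Env\<^esub> b) - Phi (lift a + lift b) = (val a - Phi (lift a)) + (val b - Phi (lift b))"
        using val_hom(2)[OF e(1)[OF a] e(1)[OF b]] by (simp add: Phi_add)
      also have "\<dots> \<in> hCp"
        by (intro add_subgroupD(4)[OF hCp_sub] lift(2) a b)
      finally have "I +>\<^bsub>FA\<^esub> lift (a \<oplus>\<^bsub>Env\<^esub> b) = I +>\<^bsub>FA\<^esub> (lift a + lift b)"
        by (intro lift_eq EF_closed(3)[OF a b] add_subgroupD(4)[OF FA_sub] lift(1) a b)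
      then show ?thesis
        unfolding g_def PA EnvFk_simps(3) D.quot_add[OF lift(1)[OF a] lift(1)[OF b]] FA_simps(3) .
    qed
    show "g a = g b \<longleftrightarrow> a \<ominus>\<^bsub>EnvFk\<^esub> b \<in> hEF"
    proof -
      have "(Phi (lift a) - Phi (lift b)) - (val a - val b) = (val b - Phi (lift b)) - (val a - Phi (lift a))"
        by simp
      also have "\<dots> \<in> hCp" by (rule add_subgroupD(2)[OF hCp_sub lift(2)[OF b] lift(2)[OF a]])
      finally show ?thesis
        unfolding g_def eq[OF lift(1)[OF a] lift(1)[OF b]] EnvFk_minus_hEF[OF a b]
        by (rule add_subgroup_cancel[OF hCp_sub])
    qed
  next
    have "I +>\<^bsub>FA\<^esub> lift \<one>\<^bsub>Env\<^esub> = I +>\<^bsub>FA\<^esub> 1"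
      by (rule lift_eq[OF EF_closed(1) FA_one]) (simp add: Phi_one val_hom(3) add_subgroupD(1)[OF hCp_sub])
    then show "g \<one>\<^bsub>EnvFk\<^esub> = \<one>\<^bsub>PA\<^esub>"
      unfolding g_def PA EnvFk_simps(4) D.quot_one FA_simps(4) .
  qed
  have surj: "carrier PA \<subseteq> g ` carrier EnvFk"
  proof
    fix U assume "U \<in> carrier PA"
    then obtain f where f: "f \<in> carrier FA" "U = I +>\<^bsub>FA\<^esub> f" unfolding PA D.quot_carrier by blast
    have r: "Phi f \<in> Cp" by (rule Phi_FA[OF f(1)])
    have W: "ival (Phi f) \<in> EF" "val (ival (Phi f)) = Phi f"
      using ival[OF Cp_EK[OF r]] r by (simp_all add: EF_simps)
    then have "g (ival (Phi f)) = U"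
      unfolding g_def f(2) by (intro lift_eq f(1)) (simp_all add: add_subgroupD(1)[OF hCp_sub])
    then show "U \<in> g ` carrier EnvFk" using W(1) unfolding EnvFk_simps(1) by blast
  qed
  show ?thesis
    unfolding specialization_Env using C.first_isomorphism(1)[OF hom surj] by blast
qed

end

theorem theorem14:
  fixes A :: "('k::field_char_0 poly fract, 'a) module"
    and G :: "nat \<Rightarrow> 'a set"
    and S :: "'a set"
    and x :: "nat \<Rightarrow> 'a"
    and n :: nat
  assumes "assoc_algebra ratfun_field A"
    and "is_grading ratfun_field A G"
    and "is_form A S"
    and "has_semiclassical_limit A S"
    and "\<forall>i<n. x i \<in> S"
    and "\<forall>i<n. \<exists>d. x i \<in> G d"
    and "generated_subalgebra ratfun_field A (x ` {..<n}) = carrier A"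
    and "is_polynomial_algebra_on n (specialization A S) (\<lambda>i. spec_image A S (x i))"
    and "is_basis A (exponents n) (ordered_monomial A n x)"
  shows "q_deformation (env_alg A) (env_form A n x)
    (poisson_env n (specialization A S) (semiclassical_bracket A S) (\<lambda>i. spec_image A S (x i)))"
proof -
  have "based_algebra A n x"
    using assms(1,9) by (intro based_algebra.intro based_algebra_axioms.intro)
  then interpret quantization A n x S
    using assms(3,4,5,8)
    by (intro quantization.intro quantization_axioms.intro)
      (simp_all add: is_form_def has_semiclassical_limit_def)
  show ?thesis
    unfolding q_deformation_def using EF_is_form specialization_iso by blast
qed

end
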